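(* Let $h$ be given as the Laplace transform of a positive Borel measure $\mu$ defined on $\mathbb{R}_+$, i.e. $h(t)=\int_{\mathbb{R}_+}e^{-st}\,d\mu(s)$ for $t>0$, and let $\theta$ be an inner function on $\mathbb{C}_+$. Let $K=\mathcal{L}^{-1}K_\theta\subseteq L^2(0,\infty)$ be the inverse Laplace transform of the model space $K_\theta$. Then the truncated Hankel operator $\Gamma_h$ on $K$ given by $$\langle\Gamma_hf,g\rangle=\int_{\mathbb{R}_+}\int_{\mathbb{R}_+}h(t+\tau)f(t)\overline{g(\tau)}\,dt\,d\tau\qquad(f,g\in K)$$ is bounded if and only if there is a constant $c>0$ such that $$\int_0^\infty\frac{w}{|w+s|^2}\,d\mu(s)\le\frac{c}{1-|\theta(w)|}\qquad\text{for all }w\in(0,\infty).\qquad( * )$$ Moreover, in case $0\notin\sigma(\theta)$, it suffices to check $( * )$ only for $w\ge\min\{\operatorname{dist}(0,\sigma(\theta))/2,\,1\}$; and in case $\infty\notin\sigma(\theta)$, it suffices to check $( * )$ only for $w\le 2\sup\{|z|:z\in\sigma(\theta)\}$.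
   Context: $\mathbb{R}_+=(0,\infty)$, $\mathbb{C}_+=\{s\in\mathbb{C}:\operatorname{Re}s>0\}$. The Laplace transform $(\mathcal{L}f)(s)=\int_0^\infty f(t)e^{-st}\,dt$ is an isomorphism of $L^2(0,\infty)$ onto the Hardy space $H^2(\mathbb{C}_+)$. For an inner function $\theta\in H^\infty(\mathbb{C}_+)$, $K_\theta=H^2(\mathbb{C}_+)\ominus\theta H^2(\mathbb{C}_+)$ is the model space. The spectrum of $\theta$ is $\sigma(\theta)=\{\zeta\in\overline{\mathbb{C}_+}\cup\{\infty\}:\liminf_{z\to\zeta,\ z\in\mathbb{C}_+}|\theta(z)|=0\}$. Here $\operatorname{dist}(0,\sigma(\theta))$ is the Euclidean distance to the finite points of $\sigma(\theta)$, equal to $+\infty$ if there are none. The right-hand side of $( * )$ is read as $+\infty$ if $|\theta(w)|=1$.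
   Formalization: The clause for ∞∉σ(θ) excludes σ(θ)={0}, where it is false (θ=e^{-1/s}, dμ=s^{-1/2}ds on (0,1)). The double integral, which need not converge absolutely, is the limit as ε→0+ with kernel h(u+ε)−h(u+1/ε) in place of h(u). *)

theory Defs
  imports "HOL-Complex_Analysis.Complex_Analysis" "HOL-Real_Asymp.Real_Asymp"
begin

section \<open>The Hardy space of the right half-plane and model spaces\<close>

definition Cplus :: "complex set"
  where "Cplus = {s. 0 < Re s}"

text \<open>Functions on \<open>Cplus\<close> are total functions whose values off \<open>Cplus\<close> are ignored throughout;
  likewise for functions on the half-line \<open>{0<..}\<close>.\<close>

definition H2 :: "(complex \<Rightarrow> complex) set"
  where "H2 = {F. F holomorphic_on Cplus \<and>
    (\<exists>C. \<forall>x>0. integrable lborel (\<lambda>y. (cmod (F (Complex x y)))\<^sup>2) \<and>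
              (LBINT y. (cmod (F (Complex x y)))\<^sup>2) \<le> C)}"

text \<open>For \<open>F, G \<in> H2\<close> the limit exists and equals the \<open>L\<^sup>2\<close> inner product of the boundary functions
  on the imaginary axis. With the factor \<open>1 / (2 * pi)\<close> the Laplace transform is unitary.\<close>

definition H2_inner :: "(complex \<Rightarrow> complex) \<Rightarrow> (complex \<Rightarrow> complex) \<Rightarrow> complex"
  where "H2_inner F G =
    Lim (at_right 0) (\<lambda>x. LBINT y. F (Complex x y) * cnj (G (Complex x y))) / of_real (2 * pi)"

definition inner_function :: "(complex \<Rightarrow> complex) \<Rightarrow> bool"
  where "inner_function \<theta> \<longleftrightarrow> \<theta> holomorphic_on Cplus \<and> bounded (\<theta> ` Cplus) \<and>
    (AE y in lborel. \<exists>\<zeta>. ((\<lambda>x. \<theta> (Complex x y)) \<longlongrightarrow> \<zeta>) (at_right 0) \<and> cmod \<zeta> = 1)"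

definition model_space :: "(complex \<Rightarrow> complex) \<Rightarrow> (complex \<Rightarrow> complex) set"
  where "model_space \<theta> = {F \<in> H2. \<forall>G\<in>H2. H2_inner F (\<lambda>s. \<theta> s * G s) = 0}"

text \<open>The spectrum is a subset of the closed half-plane together with the point at infinity;
  its finite part and the membership of \<open>\<infinity>\<close> are given separately. The spectrum \<open>{0}\<close>, e.g. of
  \<open>\<theta> s = exp (- 1 / s)\<close>, is a degenerate case of the restriction \<open>w \<le> 2 * sup {\<bar>z\<bar>}\<close>: no \<open>w > 0\<close> satisfies
  it, although boundedness still depends on the measure.\<close>

definition finite_spectrum :: "(complex \<Rightarrow> complex) \<Rightarrow> complex set"
  where "finite_spectrum \<theta> =
    {\<zeta> \<in> closure Cplus. Liminf (at \<zeta> within Cplus) (\<lambda>z. ereal (cmod (\<theta> z))) = 0}"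

definition infinity_in_spectrum :: "(complex \<Rightarrow> complex) \<Rightarrow> bool"
  where "infinity_in_spectrum \<theta> \<longleftrightarrow>
    Liminf (inf at_infinity (principal Cplus)) (\<lambda>z. ereal (cmod (\<theta> z))) = 0"


section \<open>Square-integrable functions on the half-line\<close>

text \<open>Elements of \<open>L\<^sup>2(0,\<infinity>)\<close> are represented by functions, not by classes modulo null sets.\<close>

definition L2 :: "(real \<Rightarrow> complex) set"
  where "L2 = {f. set_borel_measurable lborel {0<..} f \<and>
                  set_integrable lborel {0<..} (\<lambda>t. (cmod (f t))\<^sup>2)}"

definition L2_inner :: "(real \<Rightarrow> complex) \<Rightarrow> (real \<Rightarrow> complex) \<Rightarrow> complex"
  where "L2_inner f g = (LBINT t:{0<..}. f t * cnj (g t))"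

definition L2_norm :: "(real \<Rightarrow> complex) \<Rightarrow> real"
  where "L2_norm f = sqrt (LBINT t:{0<..}. (cmod (f t))\<^sup>2)"

definition laplace :: "(real \<Rightarrow> complex) \<Rightarrow> complex \<Rightarrow> complex"
  where "laplace f s = (LBINT t:{0<..}. f t * exp (- (s * of_real t)))"

definition inverse_laplace_image :: "(complex \<Rightarrow> complex) set \<Rightarrow> (real \<Rightarrow> complex) set"
  where "inverse_laplace_image M = {f \<in> L2. laplace f \<in> M}"

definition bounded_operator_on ::
    "(real \<Rightarrow> complex) set \<Rightarrow> ((real \<Rightarrow> complex) \<Rightarrow> (real \<Rightarrow> complex)) \<Rightarrow> bool"
  where "bounded_operator_on K \<Gamma> \<longleftrightarrow>
    (\<forall>f\<in>K. \<Gamma> f \<in> K) \<and>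
    (\<forall>f\<in>K. \<forall>g\<in>K. \<forall>a b. AE t in lborel. 0 < t \<longrightarrow>
       \<Gamma> (\<lambda>u. a * f u + b * g u) t = a * \<Gamma> f t + b * \<Gamma> g t) \<and>
    (\<exists>C. \<forall>f\<in>K. L2_norm (\<Gamma> f) \<le> C * L2_norm f)"


section \<open>Truncated Hankel operators\<close>

text \<open>For some \<open>\<theta>\<close>, \<open>h\<close> and \<open>f, g \<in> K\<close> the integrand \<open>h (t + \<tau>) * f t * cnj (g \<tau>)\<close> is not absolutely
  integrable even though the operator is bounded: this happens for \<open>h t = t powr (- 3/2)\<close> and the
  Blaschke product with zeros \<open>2 powr (n/2) + \<i> * 2^n\<close>, \<open>n \<ge> 1\<close>, because elements of \<open>K\<close> may oscillate
  fast near \<open>0\<close>. The double integral is therefore taken as an improper one, the limit for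
  \<open>\<epsilon> \<rightarrow> 0+\<close> of the integrals with kernel \<open>h (u + \<epsilon>) - h (u + 1/\<epsilon>)\<close> in place of \<open>h u\<close>.
  If \<open>h\<close> is the Laplace transform of a positive measure on \<open>{0<..}\<close>, then this kernel increases
  to \<open>h u\<close> as \<open>\<epsilon>\<close> decreases to \<open>0\<close>, and the integral converges absolutely for all \<open>f, g \<in> L2\<close> and
  \<open>0 < \<epsilon> < 1\<close>. By \<open>hankel_form_if_integrable\<close> below, the value is the ordinary
  double integral whenever that one converges absolutely.\<close>

definition regularized_hankel_integral ::
    "real \<Rightarrow> (real \<Rightarrow> real) \<Rightarrow> (real \<Rightarrow> complex) \<Rightarrow> (real \<Rightarrow> complex) \<Rightarrow> complex"
  where "regularized_hankel_integral \<epsilon> h f g =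
    (LBINT \<tau>:{0<..}. LBINT t:{0<..}.
       of_real (h (t + \<tau> + \<epsilon>) - h (t + \<tau> + 1 / \<epsilon>)) * f t * cnj (g \<tau>))"

definition has_hankel_integral ::
    "(real \<Rightarrow> real) \<Rightarrow> (real \<Rightarrow> complex) \<Rightarrow> (real \<Rightarrow> complex) \<Rightarrow> complex \<Rightarrow> bool"
  where "has_hankel_integral h f g v \<longleftrightarrow>
    ((\<lambda>\<epsilon>. regularized_hankel_integral \<epsilon> h f g) \<longlongrightarrow> v) (at_right 0)"

definition truncated_hankel_bounded :: "(real \<Rightarrow> real) \<Rightarrow> (real \<Rightarrow> complex) set \<Rightarrow> bool"
  where "truncated_hankel_bounded h K \<longleftrightarrow>
    (\<exists>\<Gamma>. bounded_operator_on K \<Gamma> \<and>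
         (\<forall>f\<in>K. \<forall>g\<in>K. has_hankel_integral h f g (L2_inner (\<Gamma> f) g)))"

definition is_laplace_of_measure :: "(real \<Rightarrow> real) \<Rightarrow> real measure \<Rightarrow> bool"
  where "is_laplace_of_measure h \<mu> \<longleftrightarrow>
    (\<forall>t>0. has_bochner_integral \<mu> (\<lambda>s. exp (- (s * t))) (h t))"

text \<open>The right-hand side is \<open>\<infinity>\<close> if \<open>cmod (\<theta> (of_real w)) = 1\<close>, as \<open>c / 0 = \<infinity>\<close> in \<open>ennreal\<close>
  for \<open>c > 0\<close>.\<close>

definition test_condition :: "real measure \<Rightarrow> (complex \<Rightarrow> complex) \<Rightarrow> real \<Rightarrow> real \<Rightarrow> bool"
  where "test_condition \<mu> \<theta> c w \<longleftrightarrow>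
    (\<integral>\<^sup>+ s. ennreal (w / \<bar>w + s\<bar>\<^sup>2) \<partial>\<mu>) \<le> ennreal c / ennreal (1 - cmod (\<theta> (of_real w)))"


section \<open>Consistency of the improper double integral\<close>

lemma laplace_of_measure_facts:
  assumes sp: "sets \<mu> = sets (restrict_space borel {0<..})" and h: "is_laplace_of_measure h \<mu>"
  shows "\<And>u v. 0 < u \<Longrightarrow> u \<le> v \<Longrightarrow> h v \<le> h u" and "\<And>u. 0 < u \<Longrightarrow> 0 \<le> h u"
    and "\<And>u. 0 < u \<Longrightarrow> isCont h u" and "(h \<longlongrightarrow> 0) at_top"
proof -
  have space: "space \<mu> = {0<..}"
    using sets_eq_imp_space_eq[OF sp] by (simp add: space_restrict_space)
  have int: "integrable \<mu> (\<lambda>s. exp (- (s * t)))" and eq: "h t = (\<integral>s. exp (- (s * t)) \<partial>\<mu>)" if "0 < t" for t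
    using h that by (auto simp: is_laplace_of_measure_def has_bochner_integral_iff)
  have meas [measurable]: "(\<lambda>s. exp (- (s * t))) \<in> borel_measurable \<mu>" for t :: real
  proof -
    have "(\<lambda>s. exp (- (s * t))) \<in> borel_measurable (restrict_space borel {0<..})"
      by (intro measurable_restrict_space1) measurable
    then show ?thesis
      using measurable_cong_sets[OF sp refl] by blast
  qed
  show "h v \<le> h u" if "0 < u" "u \<le> v" for u v
  proof -
    have "(\<integral>s. exp (- (s * v)) \<partial>\<mu>) \<le> (\<integral>s. exp (- (s * u)) \<partial>\<mu>)"
      using that by (intro integral_mono int) (auto simp: space)
    then show ?thesis
      using eq that by simp
  qed
  show "0 \<le> h u" if "0 < u" for u
    unfolding eq[OF that] by simp
  show "isCont h u" if u: "0 < u" for u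
    unfolding continuous_at_sequentially
  proof (intro allI impI)
    fix X :: "nat \<Rightarrow> real" assume X: "X \<longlonglongrightarrow> u"
    define Y where "Y n = max (X n) (u / 2)" for n
    have Y: "Y \<longlonglongrightarrow> u"
      using tendsto_max[OF X tendsto_const[of "u / 2"]] u by (simp add: Y_def[abs_def] max_absorb1)
    have Ypos: "0 < Y n" for n
      using u by (simp add: Y_def less_max_iff_disj)
    have "(\<lambda>n. \<integral>s. exp (- (s * Y n)) \<partial>\<mu>) \<longlonglongrightarrow> (\<integral>s. exp (- (s * u)) \<partial>\<mu>)"
    proof (rule integral_dominated_convergence[where w = "\<lambda>s. exp (- (s * (u / 2)))"])
      show "integrable \<mu> (\<lambda>s. exp (- (s * (u / 2))))"
        using u by (intro int) simp
      show "AE s in \<mu>. (\<lambda>n. exp (- (s * Y n))) \<longlonglongrightarrow> exp (- (s * u))"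
        by (intro AE_I2 tendsto_intros Y)
      show "AE s in \<mu>. norm (exp (- (s * Y n))) \<le> exp (- (s * (u / 2)))" for n
        by (intro AE_I2) (auto simp: space Y_def intro!: mult_left_mono)
    qed auto
    then have "(\<lambda>n. h (Y n)) \<longlonglongrightarrow> h u"
      using eq[OF u] eq[OF Ypos] by simp
    moreover have "\<forall>\<^sub>F n in sequentially. h (Y n) = h (X n)"
      using order_tendstoD(1)[OF X, of "u / 2"] u
      by (auto elim!: eventually_mono simp: Y_def max_absorb1)
    ultimately show "(h \<circ> X) \<longlonglongrightarrow> h u"
      by (simp add: comp_def tendsto_cong)
  qed
  have "((\<lambda>t. \<integral>s. exp (- (s * t)) \<partial>\<mu>) \<longlongrightarrow> (\<integral>s. 0 \<partial>\<mu>)) at_top"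
  proof (rule integral_dominated_convergence_at_top[where w = "\<lambda>s. exp (- (s * 1))"])
    show "integrable \<mu> (\<lambda>s. exp (- (s * 1)))"
      by (intro int) simp
    show "\<forall>\<^sub>F t in at_top. AE s in \<mu>. norm (exp (- (s * t))) \<le> exp (- (s * 1))"
      using eventually_ge_at_top[of 1]
      by eventually_elim (intro AE_I2, auto simp: space)
    show "AE s in \<mu>. ((\<lambda>t. exp (- (s * t))) \<longlongrightarrow> 0) at_top"
    proof (intro AE_I2)
      fix s assume "s \<in> space \<mu>"
      then have "0 < s" by (simp add: space)
      then show "((\<lambda>t. exp (- (s * t))) \<longlongrightarrow> 0) at_top"
        by real_asymp
    qed
  qed auto
  moreover have "\<forall>\<^sub>F t in at_top. (\<integral>s. exp (- (s * t)) \<partial>\<mu>) = h t"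
    using eventually_gt_at_top[of 0] by eventually_elim (simp add: eq)
  ultimately show "(h \<longlongrightarrow> 0) at_top"
    by (simp add: tendsto_cong)
qed

proposition hankel_form_if_integrable:
  assumes sp: "sets \<mu> = sets (restrict_space borel {0<..})" and h: "is_laplace_of_measure h \<mu>"
    and f: "f \<in> L2" and g: "g \<in> L2"
    and int: "set_integrable (lborel \<Otimes>\<^sub>M lborel) ({0<..} \<times> {0<..})
                (\<lambda>(\<tau>, t). of_real (h (t + \<tau>)) * f t * cnj (g \<tau>))"
  shows "has_hankel_integral h f g
           (LBINT \<tau>:{0<..}. LBINT t:{0<..}. of_real (h (t + \<tau>)) * f t * cnj (g \<tau>))"
proof -
  note facts = laplace_of_measure_facts[OF sp h]
  define F where "F t = indicator {0<..} t *\<^sub>R f t" for t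
  define G where "G t = indicator {0<..} t *\<^sub>R g t" for t
  define H where "H u = indicator {0<..} u *\<^sub>R h u" for u
  have [measurable]: "F \<in> borel_measurable borel" "G \<in> borel_measurable borel"
    using f g by (auto simp: F_def[abs_def] G_def[abs_def] L2_def set_borel_measurable_def)
  have [measurable]: "H \<in> borel_measurable borel"
    unfolding H_def[abs_def]
    by (intro borel_measurable_continuous_on_indicator continuous_at_imp_continuous_on)
       (auto intro: facts(3))
  have F0: "F t = 0" and G0: "G t = 0" and H0: "H t = 0" if "\<not> 0 < t" for t
    using that by (auto simp: F_def G_def H_def)
  have Hh: "H t = h t" if "0 < t" for t
    using that by (auto simp: H_def)
  define \<Phi> where "\<Phi> k p = of_real (k (snd p + fst p)) * F (snd p) * cnj (G (fst p))"
    for k :: "real \<Rightarrow> real" and p :: "real \<times> real"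
  define k where "k r u = H (u + inverse r) - H (u + r)" for r u :: real
  have int': "integrable (lborel \<Otimes>\<^sub>M lborel) (\<Phi> H)"
  proof -
    have "(\<lambda>p. indicator ({0<..} \<times> {0<..}) p *\<^sub>R
              (case p of (\<tau>, t) \<Rightarrow> of_real (h (t + \<tau>)) * f t * cnj (g \<tau>))) = \<Phi> H"
      by (auto simp: fun_eq_iff \<Phi>_def F_def G_def H_def indicator_def)
    then show ?thesis
      using int by (simp add: set_integrable_def)
  qed
  have kbound: "\<bar>k r u\<bar> \<le> H u" if "1 \<le> r" "0 < u" for r u
  proof -
    have "inverse r \<le> r"
      using that by (meson inverse_le_1_iff order_trans)
    then have "h (u + r) \<le> h (u + inverse r)" "h (u + inverse r) \<le> h u" "0 \<le> h (u + r)"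
      using that by (auto intro!: facts(1,2) add_pos_pos)
    then show ?thesis
      using that by (simp add: k_def Hh add_pos_pos)
  qed
  have klim: "((\<lambda>r. k r u) \<longlongrightarrow> H u) at_top" if "0 < u" for u
  proof -
    have "((\<lambda>r. u + inverse r) \<longlongrightarrow> u + 0) at_top"
      by (intro tendsto_intros tendsto_inverse_0_at_top filterlim_ident)
    then have "((\<lambda>r. h (u + inverse r)) \<longlongrightarrow> h u) at_top"
      using isCont_tendsto_compose[OF facts(3)[OF that]] by simp
    moreover have "((\<lambda>r. h (u + r)) \<longlongrightarrow> 0) at_top"
      by (rule filterlim_compose[OF facts(4)])
         (intro filterlim_tendsto_add_at_top[OF tendsto_const] filterlim_ident)
    ultimately have "((\<lambda>r. h (u + inverse r) - h (u + r)) \<longlongrightarrow> h u - 0) at_top"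
      by (rule tendsto_diff)
    moreover have "\<forall>\<^sub>F r in at_top. h (u + inverse r) - h (u + r) = k r u"
      using eventually_gt_at_top[of 0]
      by eventually_elim (use that in \<open>simp add: k_def Hh add_pos_pos\<close>)
    ultimately show ?thesis
      using that by (simp add: Hh tendsto_cong)
  qed
  have \<Phi>bound: "norm (\<Phi> (k r) p) \<le> norm (\<Phi> H p)" if "1 \<le> r" for r p
  proof (cases "0 < fst p \<and> 0 < snd p")
    case True
    then have "\<bar>k r (snd p + fst p)\<bar> \<le> \<bar>H (snd p + fst p)\<bar>"
      using kbound[OF that, of "snd p + fst p"] by linarith
    then show ?thesis
      by (simp add: \<Phi>_def norm_mult mult_right_mono)
  qed (auto simp: \<Phi>_def F0 G0)
  have \<Phi>lim: "((\<lambda>r. \<Phi> (k r) p) \<longlongrightarrow> \<Phi> H p) at_top" for p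
  proof (cases "0 < fst p \<and> 0 < snd p")
    case True
    then show ?thesis
      unfolding \<Phi>_def by (intro tendsto_intros klim) auto
  qed (auto simp: \<Phi>_def F0 G0)
  have [measurable]: "cnj \<in> borel_measurable borel"
    by (intro borel_measurable_continuous_onI continuous_intros)
  have [measurable]: "k r \<in> borel_measurable borel" for r
    unfolding k_def[abs_def] by measurable
  have \<Phi>meas [measurable]: "\<Phi> q \<in> borel_measurable (lborel \<Otimes>\<^sub>M lborel)"
    if [measurable]: "q \<in> borel_measurable borel" for q
    unfolding \<Phi>_def[abs_def] by measurable
  have fubini: "(LBINT \<tau>. LBINT t. \<Phi> q (\<tau>, t)) = integral\<^sup>L (lborel \<Otimes>\<^sub>M lborel) (\<Phi> q)"
    if "integrable (lborel \<Otimes>\<^sub>M lborel) (\<Phi> q)" for q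
    using lborel_pair.integral_fst'[OF that] by simp
  have set_eq: "(LBINT \<tau>:{0<..}. LBINT t:{0<..}. of_real (q (t + \<tau>)) * f t * cnj (g \<tau>)) =
                (LBINT \<tau>. LBINT t. \<Phi> q' (\<tau>, t))"
    if "\<And>u. 0 < u \<Longrightarrow> q u = q' u" for q q'
  proof -
    have "indicator {0<..} \<tau> *\<^sub>R (LBINT t:{0<..}. of_real (q (t + \<tau>)) * f t * cnj (g \<tau>)) =
          (LBINT t. \<Phi> q' (\<tau>, t))" for \<tau>
    proof (cases "0 < \<tau>")
      case True
      then show ?thesis
        unfolding set_lebesgue_integral_def
        by (auto intro!: Bochner_Integration.integral_cong
                 simp: \<Phi>_def F_def G_def indicator_def that add_pos_pos)
    qed (simp add: \<Phi>_def G0)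
    then show ?thesis
      by (simp add: set_lebesgue_integral_def)
  qed
  have "((\<lambda>r. integral\<^sup>L (lborel \<Otimes>\<^sub>M lborel) (\<Phi> (k r))) \<longlongrightarrow>
          integral\<^sup>L (lborel \<Otimes>\<^sub>M lborel) (\<Phi> H)) at_top"
  proof (rule integral_dominated_convergence_at_top[where w = "\<lambda>p. norm (\<Phi> H p)"])
    show "\<forall>\<^sub>F r in at_top. AE p in lborel \<Otimes>\<^sub>M lborel. norm (\<Phi> (k r) p) \<le> norm (\<Phi> H p)"
      using eventually_ge_at_top[of 1] by eventually_elim (intro AE_I2 \<Phi>bound)
  qed (use int' \<Phi>lim in auto)
  moreover have "\<forall>\<^sub>F r in at_top. integral\<^sup>L (lborel \<Otimes>\<^sub>M lborel) (\<Phi> (k r)) =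
      regularized_hankel_integral (inverse r) h f g"
    using eventually_ge_at_top[of 1]
  proof eventually_elim
    fix r :: real assume r: "1 \<le> r"
    have "integrable (lborel \<Otimes>\<^sub>M lborel) (\<Phi> (k r))"
      by (rule Bochner_Integration.integrable_bound[OF int']) (auto intro: \<Phi>bound r)
    note eq = fubini[OF this]
    have inv: "1 / inverse r = r"
      by (simp add: divide_inverse)
    have "regularized_hankel_integral (inverse r) h f g = (LBINT \<tau>. LBINT t. \<Phi> (k r) (\<tau>, t))"
      unfolding regularized_hankel_integral_def
      unfolding inv by (rule set_eq) (use r in \<open>simp add: k_def Hh add_pos_pos\<close>)
    then show "integral\<^sup>L (lborel \<Otimes>\<^sub>M lborel) (\<Phi> (k r)) =
        regularized_hankel_integral (inverse r) h f g"
      by (simp add: eq)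
  qed
  moreover have "(LBINT \<tau>:{0<..}. LBINT t:{0<..}. of_real (h (t + \<tau>)) * f t * cnj (g \<tau>)) =
      integral\<^sup>L (lborel \<Otimes>\<^sub>M lborel) (\<Phi> H)"
    by (subst set_eq[where q' = H]) (auto simp: Hh fubini[OF int'])
  ultimately show ?thesis
    unfolding has_hankel_integral_def filterlim_at_right_to_top
    by (simp add: tendsto_cong)
qed

end

theory Submission
  imports Defs "HOL-Probability.Levy" "HOL-Probability.Sinc_Integral"
begin

text \<open>Write \<open>L f\<close> for the Laplace transform of \<open>f\<close>. Since \<open>h (t + \<tau>)\<close> is the integral of \<open>exp (- s t) * exp (- s \<tau>)\<close>
  with respect to \<open>\<mu>\<close>, Fubini's theorem turns the Hankel form into the integral of \<open>L f * cnj (L g)\<close> over the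
  half-line with respect to \<open>\<mu>\<close> (\<open>regularized_hankel_eq\<close>; the improper double integral contributes a factor that
  increases to \<open>1\<close>). As \<open>\<mu>\<close> is positive, the choice \<open>g = f\<close> shows that a bounded operator makes \<open>f \<mapsto> L f\<close>
  a bounded map from \<open>K\<close> to \<open>L\<^sup>2(\<mu>)\<close>, and the Riesz theorem gives the converse. The theorem is thus one about
  Carleson measures on the half-line for a model space.

  The space \<open>K\<close> has reproducing kernels: for \<open>w > 0\<close> it contains a function \<open>k\<^sub>w\<close> with
  \<open>L k\<^sub>w s = (1 - cnj (\<theta> w) * \<theta> s) / (s + w)\<close> that represents \<open>f \<mapsto> L f w\<close> (\<open>reproducing_kernel\<close>). Testing the
  embedding on \<open>k\<^sub>w\<close> shows that the integral condition is necessary (\<open>poisson_test_if_embeds\<close>).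

  For sufficiency, compose the embedding with its adjoint. The result is the integral operator on \<open>L\<^sup>2(\<mu>)\<close> with
  kernel \<open>(1 - cnj (\<theta> t) * \<theta> s) / (s + t)\<close>, and the Schur test with the weight \<open>sqrt (E s / s)\<close>,
  \<open>E s = 1 - \<bar>\<theta> s\<bar>\<^sup>2\<close>, bounds it (\<open>schur_row\<close>). All that is used about \<open>\<theta>\<close> is the Pick inequality, the Cauchy-Schwarz
  inequality for two reproducing kernels. It implies that \<open>s * E s\<close> increases and \<open>E s / s\<close> decreases, and that
  \<open>\<theta>\<close> varies little as long as \<open>s * E s\<close> at most doubles. The integral condition bounds the mass of \<open>\<mu>\<close> near
  \<open>0\<close> and the integral of \<open>s\<^sup>-\<^sup>2\<close> over a tail. A row of the Schur test is then a sum over the scales at which \<open>s * E s\<close>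
  doubles, and this sum is dominated by a geometric series; the inversion \<open>s \<mapsto> 1 / s\<close> reduces the part of a row
  beyond the diagonal to the part before it.

  If \<open>0\<close> is not in the spectrum then \<open>1 - \<bar>\<theta> w\<bar> = O(w)\<close> at \<open>0\<close>, and if \<open>\<infinity>\<close> is not in the spectrum then
  \<open>1 - \<bar>\<theta> w\<bar> = O(1 / w)\<close> at \<open>\<infinity>\<close>. Near such a point the right-hand side of the condition is at least of the
  size to which the Poisson integral grows when its argument moves there from a fixed \<open>v\<close>, so that the condition at \<open>v\<close>
  implies the one at all these arguments. The estimates for \<open>\<theta>\<close> compare \<open>log (1 / \<bar>\<theta>\<bar>)\<close> with an explicit harmonic
  function. Boundary values exist only almost everywhere, so the maximum principle takes the form of Cauchy's
  formula for the powers \<open>g\<^sup>n\<close> of a holomorphic function: bounds for \<open>\<bar>g w\<bar>\<^sup>n\<close> that do not depend on \<open>n\<close> imply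
  \<open>\<bar>g w\<bar> \<le> 1\<close> (\<open>inner_defect_linear_at_zero\<close>, \<open>inner_defect_at_infinity\<close>). An empty spectrum forces \<open>\<bar>\<theta>\<bar> = 1\<close>, and
  then the condition holds trivially.

  The Hilbert space theory of \<open>L\<^sup>2(0,\<infinity>)\<close> and the Hardy space is developed for functions instead of classes. The
  Paley-Wiener theorem follows from Cauchy's formula on vertical lines, the Riesz theorem and the inequality
  \<open>\<parallel>L f\<parallel> \<le> sqrt (2 * pi) * \<parallel>f\<parallel>\<close> on these lines.\<close>

section \<open>Square-integrable functions on a measure space\<close>

text \<open>Functions are not identified when they agree almost everywhere, so \<open>nrm\<close> below is only a seminorm.\<close>

definition L2_on :: "'a measure \<Rightarrow> ('a \<Rightarrow> complex) set"
  where "L2_on M = {f \<in> borel_measurable M. integrable M (\<lambda>x. (cmod (f x))\<^sup>2)}"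

definition ip :: "'a measure \<Rightarrow> ('a \<Rightarrow> complex) \<Rightarrow> ('a \<Rightarrow> complex) \<Rightarrow> complex"
  where "ip M f g = (\<integral>x. f x * cnj (g x) \<partial>M)"

definition nrm :: "'a measure \<Rightarrow> ('a \<Rightarrow> complex) \<Rightarrow> real"
  where "nrm M f = sqrt (\<integral>x. (cmod (f x))\<^sup>2 \<partial>M)"

lemma measurable_cnj [measurable]: "cnj \<in> borel_measurable borel"
  by (intro borel_measurable_continuous_onI continuous_intros)

lemma L2_onD: "f \<in> L2_on M \<Longrightarrow> f \<in> borel_measurable M"
  "f \<in> L2_on M \<Longrightarrow> integrable M (\<lambda>x. (cmod (f x))\<^sup>2)"
  by (auto simp: L2_on_def)

lemma nrm_nonneg [simp]: "0 \<le> nrm M f"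
  by (simp add: nrm_def)

lemma nrm_square: "(nrm M f)\<^sup>2 = (\<integral>x. (cmod (f x))\<^sup>2 \<partial>M)"
  by (simp add: nrm_def)

lemma ip_self: "ip M f f = of_real ((nrm M f)\<^sup>2)"
  unfolding ip_def nrm_square by (simp add: complex_norm_square[symmetric] flip: integral_complex_of_real)

lemma integrable_cmod_mult:
  assumes "f \<in> L2_on M" "g \<in> L2_on M"
  shows "integrable M (\<lambda>x. cmod (f x) * cmod (g x))"
proof -
  note [measurable] = L2_onD(1)[OF assms(1)] L2_onD(1)[OF assms(2)]
  show ?thesis
proof (rule Bochner_Integration.integrable_bound)
  show "integrable M (\<lambda>x. (cmod (f x))\<^sup>2 + (cmod (g x))\<^sup>2)"
    using assms by (auto simp: L2_on_def)
  show "(\<lambda>x. cmod (f x) * cmod (g x)) \<in> borel_measurable M"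
    by measurable
  have "a * b \<le> a\<^sup>2 + b\<^sup>2" if "0 \<le> a" "0 \<le> b" for a b :: real
    using that sum_squares_bound[of a b] mult_nonneg_nonneg[of a b] by linarith
  then show "AE x in M. norm (cmod (f x) * cmod (g x)) \<le> norm ((cmod (f x))\<^sup>2 + (cmod (g x))\<^sup>2)"
    by (intro AE_I2) simp
qed
qed

lemma integrable_ip:
  assumes "f \<in> L2_on M" "g \<in> L2_on M"
  shows "integrable M (\<lambda>x. f x * cnj (g x))"
proof -
  note [measurable] = L2_onD(1)[OF assms(1)] L2_onD(1)[OF assms(2)]
  show ?thesis
proof (rule Bochner_Integration.integrable_bound[OF integrable_cmod_mult[OF assms]])
  show "(\<lambda>x. f x * cnj (g x)) \<in> borel_measurable M"
    by measurable
qed (auto simp: norm_mult)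
qed

lemma L2_on_scale [intro]: "f \<in> L2_on M \<Longrightarrow> (\<lambda>x. c * f x) \<in> L2_on M"
  by (auto simp: L2_on_def norm_mult power_mult_distrib)

lemma L2_on_zero [simp, intro]: "(\<lambda>x. 0) \<in> L2_on M"
  by (auto simp: L2_on_def)

lemma L2_on_add [intro]:
  assumes "f \<in> L2_on M" "g \<in> L2_on M"
  shows "(\<lambda>x. f x + g x) \<in> L2_on M"
proof -
  note [measurable] = L2_onD(1)[OF assms(1)] L2_onD(1)[OF assms(2)]
  have "integrable M (\<lambda>x. (cmod (f x + g x))\<^sup>2)"
  proof (rule Bochner_Integration.integrable_bound)
    show "integrable M (\<lambda>x. 2 * (cmod (f x))\<^sup>2 + 2 * (cmod (g x))\<^sup>2)"
      using assms by (auto simp: L2_on_def)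
    show "(\<lambda>x. (cmod (f x + g x))\<^sup>2) \<in> borel_measurable M"
      by measurable
    have "(cmod (a + b))\<^sup>2 \<le> 2 * (cmod a)\<^sup>2 + 2 * (cmod b)\<^sup>2" for a b
    proof -
      have "(cmod (a + b))\<^sup>2 \<le> (cmod a + cmod b)\<^sup>2"
        by (intro power_mono norm_triangle_ineq) simp
      also have "\<dots> \<le> 2 * (cmod a)\<^sup>2 + 2 * (cmod b)\<^sup>2"
        using sum_squares_bound[of "cmod a" "cmod b"] by (simp add: power2_sum)
      finally show ?thesis .
    qed
    then show "AE x in M. norm ((cmod (f x + g x))\<^sup>2) \<le> norm (2 * (cmod (f x))\<^sup>2 + 2 * (cmod (g x))\<^sup>2)"
      by (intro AE_I2) simp
  qed
  then show ?thesis
    by (simp add: L2_on_def)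
qed

lemma L2_on_diff [intro]: "f \<in> L2_on M \<Longrightarrow> g \<in> L2_on M \<Longrightarrow> (\<lambda>x. f x - g x) \<in> L2_on M"
  using L2_on_add[of f M "\<lambda>x. (-1) * g x"] L2_on_scale[of g M "-1"] by simp

lemma ip_add_left: "f \<in> L2_on M \<Longrightarrow> f' \<in> L2_on M \<Longrightarrow> g \<in> L2_on M \<Longrightarrow>
    ip M (\<lambda>x. f x + f' x) g = ip M f g + ip M f' g"
  unfolding ip_def by (subst Bochner_Integration.integral_add[symmetric])
    (auto simp: integrable_ip algebra_simps)

lemma ip_diff_left: "f \<in> L2_on M \<Longrightarrow> f' \<in> L2_on M \<Longrightarrow> g \<in> L2_on M \<Longrightarrow>
    ip M (\<lambda>x. f x - f' x) g = ip M f g - ip M f' g"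
  unfolding ip_def by (subst Bochner_Integration.integral_diff[symmetric])
    (auto simp: integrable_ip algebra_simps)

lemma ip_scale_left: "ip M (\<lambda>x. c * f x) g = c * ip M f g"
  unfolding ip_def by (simp add: mult.assoc)

lemma ip_cnj: "ip M g f = cnj (ip M f g)"
proof -
  have "(\<integral>x. cnj (f x * cnj (g x)) \<partial>M) = cnj (\<integral>x. f x * cnj (g x) \<partial>M)"
    by (rule Bochner_Integration.integral_cnj)
  then show ?thesis
    by (simp add: ip_def mult.commute)
qed

lemma nrm_scale: "nrm M (\<lambda>x. c * f x) = cmod c * nrm M f"
  by (simp add: nrm_def norm_mult power_mult_distrib real_sqrt_mult)

lemma nrm_eq_0_iff: "f \<in> L2_on M \<Longrightarrow> nrm M f = 0 \<longleftrightarrow> (AE x in M. f x = 0)"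
  unfolding nrm_def by (simp add: integral_nonneg_eq_0_iff_AE L2_onD)

lemma integral_cmod_mult_le:
  assumes f: "f \<in> L2_on M" and g: "g \<in> L2_on M"
  shows "(\<integral>x. cmod (f x) * cmod (g x) \<partial>M) \<le> nrm M f * nrm M g"
proof (cases "nrm M f = 0 \<or> nrm M g = 0")
  case True
  then have "AE x in M. cmod (f x) * cmod (g x) = 0"
  proof
    assume "nrm M f = 0"
    then have "AE x in M. f x = 0" using nrm_eq_0_iff[OF f] by simp
    then show ?thesis by eventually_elim simp
  next
    assume "nrm M g = 0"
    then have "AE x in M. g x = 0" using nrm_eq_0_iff[OF g] by simp
    then show ?thesis by eventually_elim simp
  qed
  then have "(\<integral>x. cmod (f x) * cmod (g x) \<partial>M) = 0"
    by (rule integral_eq_zero_AE)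
  then show ?thesis by simp
next
  case False
  define a b where "a = nrm M f" and "b = nrm M g"
  have ab: "a > 0" "b > 0"
    using False by (auto simp: a_def b_def less_le)
  have *: "u * v \<le> (b / (2 * a)) * u\<^sup>2 + (a / (2 * b)) * v\<^sup>2" for u v :: real
  proof -
    have "0 \<le> (b * u - a * v)\<^sup>2" by simp
    then have "2 * a * b * (u * v) \<le> b\<^sup>2 * u\<^sup>2 + a\<^sup>2 * v\<^sup>2"
      by (simp add: power2_diff power_mult_distrib algebra_simps)
    then show ?thesis
      using ab by (simp add: field_simps power2_eq_square)
  qed
  have "(\<integral>x. cmod (f x) * cmod (g x) \<partial>M) \<le>
        (\<integral>x. (b / (2 * a)) * (cmod (f x))\<^sup>2 + (a / (2 * b)) * (cmod (g x))\<^sup>2 \<partial>M)"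
    using f g by (intro integral_mono integrable_cmod_mult *) (auto simp: L2_on_def)
  also have "\<dots> = (b / (2 * a)) * a\<^sup>2 + (a / (2 * b)) * b\<^sup>2"
    using f g by (simp add: L2_onD a_def b_def nrm_square)
  also have "\<dots> = a * b"
    using ab by (simp add: field_simps power2_eq_square)
  finally show ?thesis by (simp add: a_def b_def)
qed

lemma cmod_ip_le:
  assumes f: "f \<in> L2_on M" and g: "g \<in> L2_on M"
  shows "cmod (ip M f g) \<le> nrm M f * nrm M g"
proof -
  have "cmod (ip M f g) \<le> (\<integral>x. cmod (f x * cnj (g x)) \<partial>M)"
    unfolding ip_def by (rule integral_norm_bound)
  also have "\<dots> \<le> nrm M f * nrm M g"
    using integral_cmod_mult_le[OF assms] by (simp add: norm_mult)
  finally show ?thesis .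
qed

lemma nrm_add_square:
  assumes f: "f \<in> L2_on M" and g: "g \<in> L2_on M"
  shows "(nrm M (\<lambda>x. f x + g x))\<^sup>2 = (nrm M f)\<^sup>2 + 2 * Re (ip M f g) + (nrm M g)\<^sup>2"
proof -
  have "(cmod (a + b))\<^sup>2 = (cmod a)\<^sup>2 + 2 * Re (a * cnj b) + (cmod b)\<^sup>2" for a b
    by (simp only: cmod_power2) (simp add: power2_eq_square algebra_simps)
  then have "(nrm M (\<lambda>x. f x + g x))\<^sup>2 =
      (\<integral>x. (cmod (f x))\<^sup>2 + 2 * Re (f x * cnj (g x)) + (cmod (g x))\<^sup>2 \<partial>M)"
    unfolding nrm_square by simp
  also have "\<dots> = (nrm M f)\<^sup>2 + 2 * Re (ip M f g) + (nrm M g)\<^sup>2"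
  proof -
    have *: "integrable M (\<lambda>x. Re (f x * cnj (g x)))"
      using integrable_ip[OF f g] by (rule integrable_Re)
    have "(\<integral>x. (cmod (f x))\<^sup>2 + 2 * Re (f x * cnj (g x)) + (cmod (g x))\<^sup>2 \<partial>M) =
        (\<integral>x. (cmod (f x))\<^sup>2 \<partial>M) + 2 * (\<integral>x. Re (f x * cnj (g x)) \<partial>M) + (\<integral>x. (cmod (g x))\<^sup>2 \<partial>M)"
      using * L2_onD(2)[OF f] L2_onD(2)[OF g] by (simp del: times_complex.sel cnj.sel)
    also have "(\<integral>x. Re (f x * cnj (g x)) \<partial>M) = Re (ip M f g)"
      unfolding ip_def using integrable_ip[OF f g] by (rule integral_Re)
    finally show ?thesis by (simp add: nrm_square)
  qed
  finally show ?thesis .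
qed

lemma nn_integral_L2:
  "f \<in> L2_on M \<Longrightarrow> (\<integral>\<^sup>+x. ennreal ((cmod (f x))\<^sup>2) \<partial>M) = ennreal ((nrm M f)\<^sup>2)"
  unfolding nrm_square by (intro nn_integral_eq_integral) (auto simp: L2_onD)

lemma L2_on_if_nn_integral_le:
  assumes [measurable]: "f \<in> borel_measurable M"
    and le: "(\<integral>\<^sup>+x. ennreal ((cmod (f x))\<^sup>2) \<partial>M) \<le> ennreal c" and c: "0 \<le> c"
  shows "f \<in> L2_on M" "(nrm M f)\<^sup>2 \<le> c"
proof -
  have "integrable M (\<lambda>x. (cmod (f x))\<^sup>2)"
    using le by (intro integrableI_bounded) (auto simp: le_less_trans)
  then show f: "f \<in> L2_on M"
    by (simp add: L2_on_def)
  show "(nrm M f)\<^sup>2 \<le> c"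
    using le nn_integral_L2[OF f] c by simp
qed

lemma L2_fatou:
  assumes [measurable]: "\<And>k. f k \<in> borel_measurable M" "g \<in> borel_measurable M"
    and lim: "AE x in M. (\<lambda>k. f k x) \<longlonglongrightarrow> g x"
    and le: "\<And>k. k \<ge> k0 \<Longrightarrow> (\<integral>\<^sup>+x. ennreal ((cmod (f k x))\<^sup>2) \<partial>M) \<le> C"
  shows "(\<integral>\<^sup>+x. ennreal ((cmod (g x))\<^sup>2) \<partial>M) \<le> C"
proof -
  have "(\<integral>\<^sup>+x. ennreal ((cmod (g x))\<^sup>2) \<partial>M) =
        (\<integral>\<^sup>+x. liminf (\<lambda>k. ennreal ((cmod (f k x))\<^sup>2)) \<partial>M)"
  proof (rule nn_integral_cong_AE)
    show "AE x in M. ennreal ((cmod (g x))\<^sup>2) = liminf (\<lambda>k. ennreal ((cmod (f k x))\<^sup>2))"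
      using lim
    proof eventually_elim
      fix x assume "(\<lambda>k. f k x) \<longlonglongrightarrow> g x"
      then have "(\<lambda>k. ennreal ((cmod (f k x))\<^sup>2)) \<longlonglongrightarrow> ennreal ((cmod (g x))\<^sup>2)"
        by (intro tendsto_intros)
      then show "ennreal ((cmod (g x))\<^sup>2) = liminf (\<lambda>k. ennreal ((cmod (f k x))\<^sup>2))"
        using lim_imp_Liminf[OF sequentially_bot] by metis
    qed
  qed
  also have "\<dots> \<le> liminf (\<lambda>k. \<integral>\<^sup>+x. ennreal ((cmod (f k x))\<^sup>2) \<partial>M)"
    by (rule nn_integral_liminf) measurable
  also have "\<dots> \<le> C"
  proof -
    have "\<forall>\<^sub>F k in sequentially. (\<integral>\<^sup>+x. ennreal ((cmod (f k x))\<^sup>2) \<partial>M) \<le> C"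
      using eventually_ge_at_top[of k0] by eventually_elim (rule le)
    then have "limsup (\<lambda>k. \<integral>\<^sup>+x. ennreal ((cmod (f k x))\<^sup>2) \<partial>M) \<le> C"
      by (rule Limsup_bounded)
    then show ?thesis
      using Liminf_le_Limsup[OF sequentially_bot] order_trans by blast
  qed
  finally show ?thesis .
qed

text \<open>Along a subsequence whose consecutive distances are below \<open>2\<^sup>-\<^sup>k\<close> the weighted sum of the squared
  increments has finite integral, so the increments decay geometrically almost everywhere; Fatou's
  lemma turns the pointwise limit into a limit in norm.\<close>

theorem L2_complete:
  assumes f: "\<And>n. f n \<in> L2_on M"
    and Cauchy: "\<And>e. e > 0 \<Longrightarrow> \<exists>N. \<forall>m\<ge>N. \<forall>n\<ge>N. nrm M (\<lambda>x. f m x - f n x) < e"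
  shows "\<exists>g\<in>L2_on M. (\<lambda>n. nrm M (\<lambda>x. f n x - g x)) \<longlonglongrightarrow> 0"
proof -
  have "\<forall>k. \<exists>N. \<forall>m\<ge>N. \<forall>n\<ge>N. nrm M (\<lambda>x. f m x - f n x) < (1/2)^k"
    using Cauchy by simp
  then obtain N where N: "\<And>k m n. m \<ge> N k \<Longrightarrow> n \<ge> N k \<Longrightarrow> nrm M (\<lambda>x. f m x - f n x) < (1/2::real)^k"
    by metis
  define r where "r k = k + sum N {..k}" for k
  have rN: "r k \<ge> N k" for k
    unfolding r_def by (simp add: trans_le_add2 member_le_sum)
  have rSuc: "r (Suc k) \<ge> r k" and rk: "r k \<ge> k" for k
    by (auto simp: r_def)
  define u where "u k x = f (r (Suc k)) x - f (r k) x" for k x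
  have uL: "u k \<in> L2_on M" for k
    unfolding u_def by (intro L2_on_diff f)
  have u_le: "(nrm M (u k))\<^sup>2 \<le> ((1/2)^k)\<^sup>2" for k
    unfolding u_def by (intro power_mono less_imp_le N rN order_trans[OF rN rSuc] nrm_nonneg)
  have [measurable]: "u k \<in> borel_measurable M" "f k \<in> borel_measurable M" for k
    using uL f by (auto simp: L2_on_def)
  have "(\<integral>\<^sup>+x. (\<Sum>k. ennreal (2^k * (cmod (u k x))\<^sup>2)) \<partial>M) = (\<Sum>k. \<integral>\<^sup>+x. ennreal (2^k * (cmod (u k x))\<^sup>2) \<partial>M)"
    by (rule nn_integral_suminf) measurable
  also have "\<dots> = (\<Sum>k. ennreal (2^k * (nrm M (u k))\<^sup>2))"
    by (intro suminf_cong) (simp add: ennreal_mult' nn_integral_cmult nn_integral_L2[OF uL])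
  also have "\<dots> \<le> (\<Sum>k. ennreal ((1/2)^k))"
  proof (intro suminf_le ennreal_leI summableI)
    fix k
    have "2^k * (nrm M (u k))\<^sup>2 \<le> 2^k * ((1/2)^k)\<^sup>2"
      by (intro mult_left_mono u_le) simp
    then show "2^k * (nrm M (u k))\<^sup>2 \<le> (1/2)^k"
      by (simp add: power2_eq_square power_divide)
  qed
  also have "\<dots> = ennreal (\<Sum>k. (1/2)^k)"
    by (rule suminf_ennreal2) (auto intro: summable_geometric)
  also have "\<dots> < \<infinity>" by simp
  finally have "AE x in M. (\<Sum>k. ennreal (2^k * (cmod (u k x))\<^sup>2)) \<noteq> \<infinity>"
    by (intro nn_integral_PInf_AE) auto
  then have conv: "AE x in M. convergent (\<lambda>k. f (r k) x)"
  proof eventually_elim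
    fix x assume "(\<Sum>k. ennreal (2^k * (cmod (u k x))\<^sup>2)) \<noteq> \<infinity>"
    then have "summable (\<lambda>k. 2^k * (cmod (u k x))\<^sup>2)"
      by (intro summable_suminf_not_top) auto
    then have "Bseq (\<lambda>k. 2^k * (cmod (u k x))\<^sup>2)"
      using summable_LIMSEQ_zero convergentI convergent_imp_Bseq by blast
    then obtain B where B: "B > 0" "\<And>k. 2^k * (cmod (u k x))\<^sup>2 \<le> B"
      by (auto elim!: BseqE simp: abs_le_iff)
    have "cmod (u k x) \<le> sqrt B * (sqrt (1/2))^k" for k
    proof -
      have "(cmod (u k x))\<^sup>2 \<le> B * (1/2)^k"
        using B(2)[of k] by (simp add: field_simps)
      then have "sqrt ((cmod (u k x))\<^sup>2) \<le> sqrt (B * (1/2)^k)"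
        by (rule real_sqrt_le_mono)
      then show ?thesis
        by (simp add: real_sqrt_mult real_sqrt_power)
    qed
    moreover have "summable (\<lambda>k. sqrt B * (sqrt (1/2))^k)"
      by (intro summable_mult summable_geometric) (simp add: real_sqrt_divide)
    ultimately have "summable (\<lambda>k. u k x)"
      by (intro summable_comparison_test[of "\<lambda>k. u k x" "\<lambda>k. sqrt B * (sqrt (1/2))^k"]) auto
    then have "convergent (\<lambda>n. \<Sum>k<n. u k x)"
      by (simp add: summable_iff_convergent)
    then have "convergent (\<lambda>n. (\<Sum>k<n. u k x) + f (r 0) x)"
      by (intro convergent_add convergent_const)
    moreover have "(\<Sum>k<n. u k x) + f (r 0) x = f (r n) x" for n
      unfolding u_def by (subst sum_lessThan_telescope) simp
    ultimately show "convergent (\<lambda>k. f (r k) x)"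
      by simp
  qed
  define g where "g x = lim (\<lambda>k. f (r k) x)" for x
  have [measurable]: "g \<in> borel_measurable M"
    unfolding g_def by measurable
  have close: "(\<lambda>x. f n x - g x) \<in> L2_on M \<and> nrm M (\<lambda>x. f n x - g x) \<le> (1/2)^k" if "n \<ge> N k" for n k
  proof -
    have "(\<integral>\<^sup>+x. ennreal ((cmod (f n x - g x))\<^sup>2) \<partial>M) \<le> ennreal (((1/2)^k)\<^sup>2)"
    proof (rule L2_fatou[where f = "\<lambda>j x. f n x - f (r j) x" and ?k0.0 = "N k"])
      show "AE x in M. (\<lambda>j. f n x - f (r j) x) \<longlonglongrightarrow> f n x - g x"
        using conv by eventually_elim (auto intro!: tendsto_intros simp: g_def convergent_LIMSEQ_iff)
      fix j assume "j \<ge> N k"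
      then have "r j \<ge> N k" using rk order_trans by blast
      then have "nrm M (\<lambda>x. f n x - f (r j) x) \<le> (1/2)^k"
        using N that less_imp_le by blast
      then show "(\<integral>\<^sup>+x. ennreal ((cmod (f n x - f (r j) x))\<^sup>2) \<partial>M) \<le> ennreal (((1/2)^k)\<^sup>2)"
        by (subst nn_integral_L2) (auto intro!: L2_on_diff f ennreal_leI power_mono)
    qed auto
    from L2_on_if_nn_integral_le[OF _ this]
    show ?thesis
      using power2_le_imp_le by (auto simp del: power_one_over)
  qed
  have "(\<lambda>x. f (N 0) x - g x) \<in> L2_on M"
    using close[where n = "N 0" and k = 0] by blast
  from L2_on_diff[OF f[of "N 0"] this] have gL: "g \<in> L2_on M" by simp
  have "(\<lambda>n. nrm M (\<lambda>x. f n x - g x)) \<longlonglongrightarrow> 0"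
  proof (rule LIMSEQ_I)
    fix e :: real assume "0 < e"
    then obtain k where k: "(1/2)^k < e"
      using real_arch_pow_inv[of e "1/2"] by auto
    have "\<forall>n\<ge>N k. norm (nrm M (\<lambda>x. f n x - g x) - 0) < e"
      using close k by fastforce
    then show "\<exists>n0. \<forall>n\<ge>n0. norm (nrm M (\<lambda>x. f n x - g x) - 0) < e" ..
  qed
  with gL show ?thesis by blast
qed

definition closed_subspace :: "'a measure \<Rightarrow> ('a \<Rightarrow> complex) set \<Rightarrow> bool"
  where "closed_subspace M V \<longleftrightarrow> V \<subseteq> L2_on M \<and> (\<lambda>x. 0) \<in> V \<and>
    (\<forall>f\<in>V. \<forall>g\<in>V. \<forall>a b. (\<lambda>x. a * f x + b * g x) \<in> V) \<and>
    (\<forall>f g. (\<forall>n::nat. f n \<in> V) \<longrightarrow> g \<in> L2_on M \<longrightarrow> (\<lambda>n. nrm M (\<lambda>x. f n x - g x)) \<longlonglongrightarrow> 0 \<longrightarrow> g \<in> V)"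

lemma closed_subspace_L2_on: "closed_subspace M (L2_on M)"
  by (auto simp: closed_subspace_def)

lemma tendsto_ip_left:
  assumes f: "\<And>n. f n \<in> L2_on M" and g: "g \<in> L2_on M" and h: "h \<in> L2_on M"
    and lim: "(\<lambda>n. nrm M (\<lambda>x. f n x - g x)) \<longlonglongrightarrow> 0"
  shows "(\<lambda>n. ip M (f n) h) \<longlonglongrightarrow> ip M g h"
proof (rule LIM_zero_cancel, rule tendsto_0_le[where K = "nrm M h"])
  have "norm (ip M (f n) h - ip M g h) \<le> norm (nrm M (\<lambda>x. f n x - g x)) * nrm M h" for n
    using cmod_ip_le[OF L2_on_diff[OF f[of n] g] h] by (simp add: ip_diff_left[OF f g h])
  then show "\<forall>\<^sub>F n in sequentially. norm (ip M (f n) h - ip M g h) \<le> norm (nrm M (\<lambda>x. f n x - g x)) * nrm M h"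
    by simp
qed (rule lim)

text \<open>The representing vector minimises \<open>\<parallel>f\<parallel>\<^sup>2 - 2 * Re (\<Lambda> f)\<close>: by the parallelogram law a minimising
  sequence is Cauchy.\<close>

theorem riesz_representation:
  assumes V: "closed_subspace M V"
    and lin: "\<And>f g a b. f \<in> V \<Longrightarrow> g \<in> V \<Longrightarrow> \<Lambda> (\<lambda>x. a * f x + b * g x) = a * \<Lambda> f + b * (\<Lambda> g :: complex)"
    and bound: "\<And>f. f \<in> V \<Longrightarrow> cmod (\<Lambda> f) \<le> C * nrm M f"
  shows "\<exists>g\<in>V. \<forall>f\<in>V. \<Lambda> f = ip M f g"
proof -
  have VL: "f \<in> L2_on M" if "f \<in> V" for f
    using V that by (auto simp: closed_subspace_def)
  have Vlin: "(\<lambda>x. a * f x + b * g x) \<in> V" if "f \<in> V" "g \<in> V" for f g a b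
    using V that by (auto simp: closed_subspace_def)
  have V0: "(\<lambda>x. 0) \<in> V" using V by (auto simp: closed_subspace_def)
  define J where "J f = (nrm M f)\<^sup>2 - 2 * Re (\<Lambda> f)" for f
  have J_expand: "J (\<lambda>x. 1 * f x + of_real t * g x) =
      J f + t\<^sup>2 * (nrm M g)\<^sup>2 + 2 * t * (Re (ip M g f) - Re (\<Lambda> g))" if "f \<in> V" "g \<in> V" for f g and t :: real
  proof -
    have "(nrm M (\<lambda>x. f x + of_real t * g x))\<^sup>2 =
        (nrm M f)\<^sup>2 + 2 * Re (ip M f (\<lambda>x. of_real t * g x)) + (nrm M (\<lambda>x. of_real t * g x))\<^sup>2"
      using that by (intro nrm_add_square L2_on_scale VL)
    moreover have "Re (ip M f (\<lambda>x. of_real t * g x)) = t * Re (ip M g f)"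
      by (subst ip_cnj) (simp add: ip_scale_left)
    ultimately show ?thesis
      unfolding J_def lin[OF that] by (simp add: nrm_scale power_mult_distrib algebra_simps)
  qed
  have J_lower: "- C\<^sup>2 \<le> J f" if "f \<in> V" for f
  proof -
    have "Re (\<Lambda> f) \<le> C * nrm M f"
      using bound[OF that] complex_Re_le_cmod order_trans by blast
    moreover have "0 \<le> (nrm M f - C)\<^sup>2" by simp
    ultimately show ?thesis unfolding J_def power2_diff by (simp add: mult.commute[of C] mult.assoc)
  qed
  define d where "d = (INF f\<in>V. J f)"
  have bdd: "bdd_below (J ` V)"
    using J_lower by (auto intro: bdd_belowI[of _ "- C\<^sup>2"])
  have d_le: "d \<le> J f" if "f \<in> V" for f
    unfolding d_def using bdd that by (rule cINF_lower)
  have "\<forall>n. \<exists>f\<in>V. J f < d + 1 / real (Suc n)"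
  proof
    fix n
    have "d < d + 1 / real (Suc n)" by simp
    then show "\<exists>f\<in>V. J f < d + 1 / real (Suc n)"
      unfolding d_def using cINF_less_iff[OF _ bdd] V0 by blast
  qed
  then obtain f where f: "\<And>n. f n \<in> V" and Jf: "\<And>n. J (f n) < d + 1 / real (Suc n)"
    by metis
  have par: "(nrm M (\<lambda>x. f m x - f n x))\<^sup>2 \<le> 2 / real (Suc m) + 2 / real (Suc n)" for m n
  proof -
    define D where "D x = f m x - f n x" for x
    have D: "D \<in> V" using Vlin[OF f[of m] f[of n], of 1 "-1"] by (simp add: D_def[abs_def])
    have "f m = (\<lambda>x. 1 * f n x + of_real 1 * D x)" by (simp add: D_def)
    then have "J (f m) = J (f n) + (nrm M D)\<^sup>2 + 2 * (Re (ip M D (f n)) - Re (\<Lambda> D))"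
      using J_expand[OF f[of n] D, of 1] by simp
    moreover have "d \<le> J (f n) + (1/4) * (nrm M D)\<^sup>2 + (Re (ip M D (f n)) - Re (\<Lambda> D))"
      using d_le[OF Vlin[OF f[of n] D, of 1 "of_real (1/2)"]] J_expand[OF f[of n] D, of "1/2"]
      by (simp add: power2_eq_square)
    moreover have "q \<le> 2 * (a - d) + 2 * (b - d)" if "a = b + q + 2 * c" "d \<le> b + 1 / 4 * q + c" for a b c q :: real
      using that by argo
    ultimately have "(nrm M D)\<^sup>2 \<le> 2 * (J (f m) - d) + 2 * (J (f n) - d)"
      by blast
    then show ?thesis
      using Jf[of m] Jf[of n] by (simp add: D_def[abs_def])
  qed
  have "\<exists>N. \<forall>m\<ge>N. \<forall>n\<ge>N. nrm M (\<lambda>x. f m x - f n x) < e" if "e > 0" for e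
  proof -
    obtain N where N: "4 / e\<^sup>2 < real N"
      using reals_Archimedean2 by blast
    have "nrm M (\<lambda>x. f m x - f n x) < e" if "m \<ge> N" "n \<ge> N" for m n
    proof (rule power_less_imp_less_base[of _ 2])
      have Npos: "0 < real N"
        by (rule le_less_trans[OF _ N]) simp
      have "2 / real (Suc m) \<le> 2 / real N" "2 / real (Suc n) \<le> 2 / real N"
        using that Npos by (auto intro!: divide_left_mono)
      then have "(nrm M (\<lambda>x. f m x - f n x))\<^sup>2 \<le> 4 / real N"
        using par[of m n] by linarith
      also have "\<dots> < e\<^sup>2"
        using N \<open>e > 0\<close> Npos by (simp add: field_simps)
      finally show "(nrm M (\<lambda>x. f m x - f n x))\<^sup>2 < e\<^sup>2" .
    qed (use \<open>e > 0\<close> in simp)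
    then show ?thesis by blast
  qed
  from L2_complete[OF VL[OF f] this]
  obtain g where g: "g \<in> L2_on M" and lim: "(\<lambda>n. nrm M (\<lambda>x. f n x - g x)) \<longlonglongrightarrow> 0"
    by blast
  have gV: "g \<in> V"
    using V f g lim unfolding closed_subspace_def by blast
  have Re_eq: "Re (\<Lambda> h) = Re (ip M g h)" if h: "h \<in> V" for h
  proof -
    have var: "0 \<le> t\<^sup>2 * (nrm M h)\<^sup>2 + 2 * t * (Re (ip M g h) - Re (\<Lambda> h))" for t :: real
    proof (rule LIMSEQ_le)
      show "(\<lambda>n. - (1 / real (Suc n))) \<longlonglongrightarrow> 0"
        using tendsto_minus[OF LIMSEQ_inverse_real_of_nat] by (simp add: inverse_eq_divide)
      have "(\<lambda>n. Re (ip M (f n) h)) \<longlonglongrightarrow> Re (ip M g h)"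
        by (intro tendsto_intros tendsto_ip_left VL f g h lim)
      then have lim_Re: "(\<lambda>n. Re (ip M (f n) h)) \<longlonglongrightarrow> Re (ip M g h)" .
      show "(\<lambda>n. t\<^sup>2 * (nrm M h)\<^sup>2 + 2 * t * (Re (ip M (f n) h) - Re (\<Lambda> h))) \<longlonglongrightarrow>
          t\<^sup>2 * (nrm M h)\<^sup>2 + 2 * t * (Re (ip M g h) - Re (\<Lambda> h))"
        by (intro tendsto_add tendsto_mult tendsto_diff tendsto_const lim_Re)
      have "- (1 / real (Suc n)) \<le> t\<^sup>2 * (nrm M h)\<^sup>2 + 2 * t * (Re (ip M (f n) h) - Re (\<Lambda> h))" for n
      proof -
        have "Re (ip M h (f n)) = Re (ip M (f n) h)" by (subst ip_cnj) simp
        then show ?thesis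
          using d_le[OF Vlin[OF f[of n] h, of 1 "of_real t"]] J_expand[OF f[of n] h, of t] Jf[of n]
          by simp
      qed
      then show "\<exists>N. \<forall>n\<ge>N. - (1 / real (Suc n)) \<le>
          t\<^sup>2 * (nrm M h)\<^sup>2 + 2 * t * (Re (ip M (f n) h) - Re (\<Lambda> h))" by blast
    qed
    define c where "c = Re (ip M g h) - Re (\<Lambda> h)"
    define q where "q = (nrm M h)\<^sup>2 + 1"
    have q: "q > 0" by (simp add: q_def add_nonneg_pos)
    have "0 \<le> (- c / q)\<^sup>2 * (nrm M h)\<^sup>2 + 2 * (- c / q) * c"
      unfolding c_def by (rule var)
    also have "\<dots> \<le> (- c / q)\<^sup>2 * q + 2 * (- c / q) * c"
      by (intro add_right_mono mult_left_mono) (auto simp: q_def)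
    also have "\<dots> = - (c\<^sup>2 / q)"
      using q by (simp add: field_simps power2_eq_square)
    finally have "c\<^sup>2 \<le> 0"
      using q by (simp add: divide_le_0_iff zero_le_divide_iff)
    then show ?thesis by (simp add: c_def)
  qed
  have "\<Lambda> h = ip M h g" if h: "h \<in> V" for h
  proof -
    have ih: "(\<lambda>x. \<i> * h x) \<in> V" using Vlin[OF h V0, of \<i> 0] by simp
    have "\<Lambda> (\<lambda>x. \<i> * h x) = \<i> * \<Lambda> h"
      using lin[OF h V0, of \<i> 0] by simp
    moreover have "ip M g (\<lambda>x. \<i> * h x) = - \<i> * ip M g h"
      by (subst ip_cnj, subst ip_scale_left, subst ip_cnj[of M g h]) simp
    ultimately have "Im (\<Lambda> h) = - Im (ip M g h)"
      using Re_eq[OF ih] by simp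
    then show ?thesis
      using Re_eq[OF h] by (subst ip_cnj) (simp add: complex_eq_iff)
  qed
  with gV show ?thesis by blast
qed

section \<open>The Laplace transform on the half-line\<close>

definition halfline :: "real measure"
  where "halfline = restrict_space lborel {0<..}"

definition expo :: "complex \<Rightarrow> real \<Rightarrow> complex"
  where "expo w t = exp (- (w * of_real t))"

lemma space_halfline [simp]: "space halfline = {0<..}"
  by (simp add: halfline_def space_restrict_space)

lemma sigma_finite_halfline: "sigma_finite_measure halfline"
  unfolding halfline_def by (intro sigma_finite_measure_restrict_space) (auto intro: lborel.sigma_finite_measure_axioms)

lemma integrable_halfline_iff:
  fixes f :: "real \<Rightarrow> 'a :: {banach, second_countable_topology}"
  shows "integrable halfline f \<longleftrightarrow> set_integrable lborel {0<..} f"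
  unfolding halfline_def set_integrable_def by (rule integrable_restrict_space) simp

lemma integral_halfline:
  fixes f :: "real \<Rightarrow> 'a :: {banach, second_countable_topology}"
  shows "integral\<^sup>L halfline f = (LBINT t:{0<..}. f t)"
  unfolding halfline_def set_lebesgue_integral_def by (rule integral_restrict_space) simp

lemma measurable_halflineI [intro]: "f \<in> borel_measurable borel \<Longrightarrow> f \<in> borel_measurable halfline"
  unfolding halfline_def by (intro measurable_restrict_space1) simp

lemma AE_halfline_iff: "(AE t in halfline. P t) \<longleftrightarrow> (AE t in lborel. 0 < t \<longrightarrow> P t)"
  unfolding halfline_def by (subst AE_restrict_space_iff) auto

lemma L2_eq_L2_on: "L2 = L2_on halfline"
proof -
  have "set_borel_measurable lborel {0<..} f \<longleftrightarrow> f \<in> borel_measurable halfline" for f :: "real \<Rightarrow> complex"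
    unfolding halfline_def set_borel_measurable_def by (subst borel_measurable_restrict_space_iff) auto
  then show ?thesis
    by (auto simp: L2_def L2_on_def integrable_halfline_iff)
qed

lemma L2_inner_eq_ip: "L2_inner f g = ip halfline f g"
  by (simp add: L2_inner_def ip_def integral_halfline)

lemma L2_norm_eq_nrm: "L2_norm f = nrm halfline f"
  by (simp add: L2_norm_def nrm_def integral_halfline)

lemma measurable_expo [measurable]: "expo w \<in> borel_measurable borel"
  unfolding expo_def[abs_def] by measurable

lemma measurable_expo_halfline [measurable]: "expo w \<in> borel_measurable halfline"
  by (intro measurable_halflineI measurable_expo)

lemma cmod_expo: "cmod (expo w t) = exp (- (Re w * t))"
  by (simp add: expo_def)

lemma cnj_expo: "cnj (expo w t) = expo (cnj w) t"
  by (simp add: expo_def exp_cnj)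

lemma expo_add: "expo (v + w) t = expo v t * expo w t"
  by (simp add: expo_def exp_add[symmetric] algebra_simps)

lemma laplace_eq: "laplace f s = (\<integral>t. f t * expo s t \<partial>halfline)"
  by (simp add: laplace_def integral_halfline expo_def)

lemma laplace_eq_ip: "laplace f s = ip halfline f (expo (cnj s))"
  by (simp add: laplace_eq ip_def cnj_expo)

lemma has_bochner_integral_exp_halfline:
  assumes "0 < a"
  shows "has_bochner_integral halfline (\<lambda>t. exp (- (a * t))) (1 / a)"
proof -
  have "(\<integral>\<^sup>+t. ennreal (exp (- (a * t))) * indicator {0..} t \<partial>lborel) = ennreal (0 - (- exp (- (a * 0)) / a))"
  proof (rule nn_integral_FTC_atLeast)
    show "((\<lambda>t. - exp (- (a * t)) / a) has_real_derivative exp (- (a * t))) (at t)" for t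
      using assms by (auto intro!: derivative_eq_intros)
    show "((\<lambda>t. - exp (- (a * t)) / a) \<longlongrightarrow> 0) at_top"
      using assms by real_asymp
  qed auto
  also have "(\<integral>\<^sup>+t. ennreal (exp (- (a * t))) * indicator {0..} t \<partial>lborel) =
      (\<integral>\<^sup>+t. ennreal (exp (- (a * t))) * indicator {0<..} t \<partial>lborel)"
    by (intro nn_integral_cong_AE eventually_mono[OF AE_lborel_singleton[of 0]]) (auto simp: indicator_def)
  also have "\<dots> = (\<integral>\<^sup>+t. ennreal (exp (- (a * t))) \<partial>halfline)"
    unfolding halfline_def by (subst nn_integral_restrict_space) auto
  finally show ?thesis
    using assms by (intro has_bochner_integral_nn_integral) auto
qed

lemma L2_on_expo [intro]: "0 < Re w \<Longrightarrow> expo w \<in> L2_on halfline"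
  and nrm_expo: "0 < Re w \<Longrightarrow> (nrm halfline (expo w))\<^sup>2 = 1 / (2 * Re w)"
proof -
  have eq: "(cmod (expo w t))\<^sup>2 = exp (- ((2 * Re w) * t))" for t
    by (simp add: cmod_expo algebra_simps flip: exp_double)
  assume "0 < Re w"
  then have "has_bochner_integral halfline (\<lambda>t. (cmod (expo w t))\<^sup>2) (1 / (2 * Re w))"
    unfolding eq by (intro has_bochner_integral_exp_halfline) simp
  then show "expo w \<in> L2_on halfline" "(nrm halfline (expo w))\<^sup>2 = 1 / (2 * Re w)"
    by (auto simp: L2_on_def nrm_square has_bochner_integral_iff)
qed

lemma integrable_laplace: "f \<in> L2_on halfline \<Longrightarrow> 0 < Re s \<Longrightarrow> integrable halfline (\<lambda>t. f t * expo s t)"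
  using integrable_ip[of f halfline "expo (cnj s)"] L2_on_expo[of "cnj s"] by (simp add: cnj_expo)

lemma cmod_laplace_le:
  assumes "f \<in> L2_on halfline" "0 < Re s"
  shows "(cmod (laplace f s))\<^sup>2 \<le> (nrm halfline f)\<^sup>2 / (2 * Re s)"
proof -
  have "(cmod (laplace f s))\<^sup>2 \<le> (nrm halfline f * nrm halfline (expo (cnj s)))\<^sup>2"
    unfolding laplace_eq_ip using assms by (intro power_mono cmod_ip_le L2_on_expo) auto
  then show ?thesis
    using assms by (simp add: power_mult_distrib nrm_expo)
qed

lemma laplace_expo:
  assumes "0 < Re (s + w)"
  shows "laplace (expo w) s = 1 / (s + w)"
proof -
  define z where "z = s + w"
  have z: "0 < Re z" using assms by (simp add: z_def)
  then have z0: "z \<noteq> 0" by auto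
  have "(LBINT t=ereal 0..\<infinity>. expo z t) = 0 - (- 1 / z)"
  proof (rule interval_integral_FTC_integrable[where F = "\<lambda>t. - expo z t / z"])
    show "((\<lambda>t. - expo z t / z) has_vector_derivative expo z t) (at t)" for t
      unfolding expo_def[abs_def] using z0
      by (auto intro!: derivative_eq_intros has_vector_derivative_real_field)
    show "isCont (expo z) t" for t
      unfolding expo_def[abs_def] by (intro continuous_intros)
    have "integrable halfline (\<lambda>t. expo z t)"
    proof (rule Bochner_Integration.integrable_bound)
      show "integrable halfline (\<lambda>t. exp (- (Re z * t)))"
        using has_bochner_integral_exp_halfline[OF z] by (simp add: has_bochner_integral_iff)
    qed (auto simp: cmod_expo)
    then show "set_integrable lborel (einterval (ereal 0) \<infinity>) (expo z)"
      by (simp add: integrable_halfline_iff einterval_eq_Ici einterval_def greaterThan_def)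
    have "((\<lambda>t. - expo z t / z) \<longlongrightarrow> - 1 / z) (at_right 0)"
    proof -
      have "isCont (\<lambda>t. - expo z t / z) 0"
        unfolding expo_def[abs_def] using z0 by (intro continuous_intros) auto
      then show ?thesis
        by (auto simp: expo_def isCont_def intro: tendsto_mono[OF at_le])
    qed
    then show "(((\<lambda>t. - expo z t / z) \<circ> real_of_ereal) \<longlongrightarrow> - 1 / z) (at_right (ereal 0))"
      by (simp only: ereal_tendsto_simps)
    have "((\<lambda>t. expo z t) \<longlongrightarrow> 0) at_top"
    proof (rule tendsto_norm_zero_cancel)
      show "((\<lambda>t. cmod (expo z t)) \<longlongrightarrow> 0) at_top"
        unfolding cmod_expo using z by real_asymp
    qed
    then have "((\<lambda>t. - expo z t / z) \<longlongrightarrow> 0) at_top"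
      using z0 by (auto intro!: tendsto_eq_intros)
    then show "(((\<lambda>t. - expo z t / z) \<circ> real_of_ereal) \<longlongrightarrow> 0) (at_left \<infinity>)"
      by (simp only: ereal_tendsto_simps)
  qed simp
  moreover have "(LBINT t=ereal 0..\<infinity>. expo z t) = (LBINT t:{0<..}. expo z t)"
    by (simp add: interval_lebesgue_integral_def einterval_def greaterThan_def)
  ultimately show ?thesis
    by (simp add: laplace_eq expo_add[symmetric] integral_halfline z_def add.commute)
qed

lemma laplace_scaled_add:
  assumes "f \<in> L2_on halfline" "g \<in> L2_on halfline" "0 < Re s"
  shows "laplace (\<lambda>t. a * f t + b * g t) s = a * laplace f s + b * laplace g s"
  using assms by (simp add: laplace_eq_ip ip_add_left L2_on_scale L2_on_expo ip_scale_left)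

text \<open>Expand \<open>exp (- w t)\<close> in powers of \<open>w - z\<close>. For \<open>\<bar>w - z\<bar> < Re z / 2\<close> the partial sums, multiplied by
  \<open>exp (- z t)\<close>, are dominated by \<open>exp (- t * Re z / 2)\<close>, so that integration and summation commute.\<close>

lemma laplace_holomorphic:
  assumes f: "f \<in> L2_on halfline"
  shows "laplace f holomorphic_on Cplus"
proof -
  have [measurable]: "f \<in> borel_measurable halfline"
    using f by (rule L2_onD)
  have "laplace f holomorphic_on ball z (Re z / 2)" if z: "0 < Re z" for z
  proof (rule power_series_holomorphic)
    define r where "r = Re z / 2"
    define a where "a n = (\<integral>t. f t * expo z t * ((- of_real t) ^ n / fact n) \<partial>halfline)" for n :: nat
    fix w assume "w \<in> ball z (Re z / 2)"
    then have w: "cmod (w - z) < r"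
      by (simp add: dist_norm norm_minus_commute r_def)
    define u where "u n t = f t * expo z t * ((- of_real t) ^ n / fact n) * (w - z) ^ n" for n :: nat and t
    define v where "v t = cmod (f t) * cmod (expo (of_real r) t)" for t
    have [measurable]: "u n \<in> borel_measurable halfline" for n
      unfolding u_def[abs_def] by (intro borel_measurable_times borel_measurable_divide) (auto intro!: measurable_halflineI)
    have v: "integrable halfline v"
      unfolding v_def using z by (intro integrable_cmod_mult f L2_on_expo) (simp add: r_def)
    have part: "(\<Sum>n<N. cmod (u n t)) \<le> v t" if "0 < t" for N t
    proof -
      have "(\<Sum>n<N. cmod (u n t)) = cmod (f t * expo z t) * (\<Sum>n<N. (t * cmod (w - z)) ^ n / fact n)"
        using that by (simp add: u_def norm_mult norm_divide norm_power sum_distrib_left power_mult_distrib mult_ac)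
      also have "\<dots> \<le> cmod (f t * expo z t) * exp (t * r)"
      proof (rule mult_left_mono)
        have "(\<Sum>n<N. (t * cmod (w - z)) ^ n / fact n) \<le> exp (t * cmod (w - z))"
          using sum_le_suminf[OF summable_exp[of "t * cmod (w - z)"], of "{..<N}"] that
          by (simp add: exp_def divide_inverse mult.commute scaleR_conv_of_real)
        also have "\<dots> \<le> exp (t * r)"
          using that w by simp
        finally show "(\<Sum>n<N. (t * cmod (w - z)) ^ n / fact n) \<le> exp (t * r)" .
      qed simp
      also have "\<dots> = v t"
        by (simp add: v_def norm_mult cmod_expo r_def mult.assoc field_simps flip: exp_add)
      finally show ?thesis .
    qed
    have int: "integrable halfline (u n)" for n
    proof (rule Bochner_Integration.integrable_bound[OF v])
      show "AE t in halfline. norm (u n t) \<le> norm (v t)"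
      proof (rule AE_I2)
        fix t assume "t \<in> space halfline"
        then have "cmod (u n t) \<le> v t"
          using part[of t "Suc n"] sum_nonneg[of "{..<n}" "\<lambda>n. cmod (u n t)"] by simp
        then show "norm (u n t) \<le> norm (v t)"
          by (simp add: v_def)
      qed
    qed measurable
    have sm: "summable (\<lambda>n. cmod (u n t))" if "0 < t" for t
      using part[OF that] by (intro summableI_nonneg_bounded[where x = "v t"]) auto
    have "(\<lambda>n. integral\<^sup>L halfline (u n)) sums (\<integral>t. (\<Sum>n. u n t) \<partial>halfline)"
    proof (rule sums_integral[OF int])
      show "AE t in halfline. summable (\<lambda>n. norm (u n t))"
        by (intro AE_I2) (simp add: sm)
      show "summable (\<lambda>n. \<integral>t. norm (u n t) \<partial>halfline)"
      proof (rule summableI_nonneg_bounded[where x = "integral\<^sup>L halfline v"])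
        fix N
        have "(\<Sum>n<N. \<integral>t. norm (u n t) \<partial>halfline) = (\<integral>t. (\<Sum>n<N. norm (u n t)) \<partial>halfline)"
          by (rule Bochner_Integration.integral_sum[symmetric]) (simp add: int)
        also have "\<dots> \<le> integral\<^sup>L halfline v"
          by (intro integral_mono_AE v Bochner_Integration.integrable_sum integrable_norm int AE_I2)
             (simp add: part)
        finally show "(\<Sum>n<N. \<integral>t. norm (u n t) \<partial>halfline) \<le> integral\<^sup>L halfline v" .
      qed simp
    qed
    moreover have "(\<Sum>n. u n t) = f t * expo w t" if "0 < t" for t
    proof -
      have "(\<lambda>n. (- of_real t * (w - z)) ^ n /\<^sub>R fact n) sums exp (- of_real t * (w - z))"
        by (rule exp_converges)
      then have "(\<lambda>n. f t * expo z t * ((- of_real t * (w - z)) ^ n /\<^sub>R fact n)) sums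
          (f t * expo z t * exp (- of_real t * (w - z)))"
        by (rule sums_mult)
      moreover have "f t * expo z t * ((- of_real t * (w - z)) ^ n /\<^sub>R fact n) = u n t" for n
        unfolding u_def power_mult_distrib by (simp add: scaleR_conv_of_real divide_inverse mult_ac)
      moreover have "f t * expo z t * exp (- of_real t * (w - z)) = f t * expo w t"
        by (simp add: expo_def mult.assoc flip: exp_add) (simp add: algebra_simps)
      ultimately show ?thesis by (simp add: sums_iff)
    qed
    then have "(\<integral>t. (\<Sum>n. u n t) \<partial>halfline) = laplace f w"
      unfolding laplace_eq by (intro Bochner_Integration.integral_cong) auto
    moreover have "integral\<^sup>L halfline (u n) = a n * (w - z) ^ n" for n
      unfolding u_def a_def by (rule Bochner_Integration.integral_mult_left_zero)
    ultimately show "(\<lambda>n. a n * (w - z) ^ n) sums laplace f w"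
      by simp
  qed
  then have "laplace f field_differentiable at z" if "z \<in> Cplus" for z
    using that by (intro holomorphic_on_imp_differentiable_at[of _ "ball z (Re z / 2)"]) (auto simp: Cplus_def)
  then show ?thesis
    by (simp add: holomorphic_on_def field_differentiable_at_within)
qed

text \<open>The positive and the negative part have the same mass, by the hypothesis at frequency \<open>0\<close>. If it is positive,
  they are up to normalisation densities with the same characteristic function and agree by Levy's uniqueness theorem.\<close>

lemma zero_if_fourier_zero:
  fixes u :: "real \<Rightarrow> real"
  assumes u: "integrable lborel u" and zero: "\<And>y. (LBINT t. iexp (y * t) * of_real (u t)) = 0"
  shows "AE t in lborel. u t = 0"
proof -
  define p n where "p t = max (u t) 0" and "n t = max (- u t) 0" for t
  have [measurable]: "u \<in> borel_measurable borel" using u by auto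
  have [measurable]: "p \<in> borel_measurable borel" "n \<in> borel_measurable borel"
    by (auto simp: p_def[abs_def] n_def[abs_def])
  have pn: "integrable lborel p" "integrable lborel n" and nonneg: "p t \<ge> 0" "n t \<ge> 0" and upn: "u t = p t - n t" for t
    using u by (auto simp: p_def[abs_def] n_def[abs_def] intro!: integrable_max)
  have int: "integrable lborel (\<lambda>t. iexp (y * t) * of_real (v t))" if "integrable lborel v" for y and v :: "real \<Rightarrow> real"
  proof (rule Bochner_Integration.integrable_bound[OF that])
    show "(\<lambda>t. iexp (y * t) * of_real (v t)) \<in> borel_measurable lborel"
      using borel_measurable_integrable[OF that] by simp
  qed (auto simp: norm_mult)
  have eq: "(LBINT t. iexp (y * t) * of_real (p t)) = (LBINT t. iexp (y * t) * of_real (n t))" for y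
    using zero[of y] Bochner_Integration.integral_diff[OF int[OF pn(1)] int[OF pn(2)], of y y]
    by (simp add: upn right_diff_distrib)
  define c where "c = integral\<^sup>L lborel p"
  have c: "c = integral\<^sup>L lborel n"
    using eq[of 0] by (simp add: c_def)
  show ?thesis
  proof (cases "c = 0")
    case True
    then have "AE t in lborel. p t = 0" "AE t in lborel. n t = 0"
      using integral_nonneg_eq_0_iff_AE[OF pn(1)] integral_nonneg_eq_0_iff_AE[OF pn(2)] nonneg c
      by (auto simp: c_def)
    then show ?thesis by eventually_elim (simp add: upn)
  next
    case False
    then have c_pos: "c > 0" using nonneg by (auto simp: c_def less_le)
    define D where "D v = density lborel (\<lambda>t. ennreal (v t / c))" for v :: "real \<Rightarrow> real"
    have D: "real_distribution (D v)" "char (D v) y = (LBINT t. iexp (y * t) * of_real (v t)) / of_real c"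
      "A \<in> sets borel \<Longrightarrow> emeasure (D v) A = ennreal (LBINT t:A. v t / c)"
      if v: "integrable lborel v" "\<And>t. v t \<ge> 0" "integral\<^sup>L lborel v = c" for v y A
    proof -
      have [measurable]: "v \<in> borel_measurable borel" using v by auto
      show em: "emeasure (D v) A = ennreal (LBINT t:A. v t / c)" if "A \<in> sets borel" for A
      proof -
        have "emeasure (D v) A = (\<integral>\<^sup>+t. ennreal (indicator A t *\<^sub>R (v t / c)) \<partial>lborel)"
          unfolding D_def using that
          by (subst emeasure_density) (auto intro!: nn_integral_cong simp: indicator_def)
        also have "\<dots> = ennreal (LBINT t:A. v t / c)"
          unfolding set_lebesgue_integral_def using that v c_pos
          by (intro nn_integral_eq_integral integrable_mult_indicator) auto
        finally show ?thesis .
      qed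
      have "emeasure (D v) (space (D v)) = 1"
        using em[of UNIV] v c_pos by (simp add: D_def set_lebesgue_integral_def)
      then have "prob_space (D v)" by (rule prob_spaceI)
      then show "real_distribution (D v)"
        by (auto simp: real_distribution_def real_distribution_axioms_def D_def)
      have "char (D v) y = (LBINT t. (v t / c) *\<^sub>R iexp (y * t))"
        unfolding char_def D_def using v c_pos by (subst integral_density) auto
      also have "\<dots> = (LBINT t. iexp (y * t) * of_real (v t) / of_real c)"
        by (simp add: scaleR_conv_of_real mult_ac)
      finally show "char (D v) y = (LBINT t. iexp (y * t) * of_real (v t)) / of_real c"
        by simp
    qed
    have "D p = D n"
      using D pn nonneg c eq by (intro Levy_uniqueness) (auto simp: fun_eq_iff c_def)
    have "AE t in lborel. p t / c = n t / c"
    proof (rule density_unique_real)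
      fix A :: "real set" assume "A \<in> sets lborel"
      then have "ennreal (LBINT t:A. p t / c) = ennreal (LBINT t:A. n t / c)"
        using D(3)[OF pn(1), of A] D(3)[OF pn(2), of A] nonneg c \<open>D p = D n\<close> by (simp add: c_def)
      moreover have "(LBINT t:A. p t / c) \<ge> 0" "(LBINT t:A. n t / c) \<ge> 0"
        unfolding set_lebesgue_integral_def using nonneg c_pos
        by (auto intro!: Bochner_Integration.integral_nonneg)
      ultimately show "(LBINT t:A. p t / c) = (LBINT t:A. n t / c)" by simp
    qed (use pn in auto)
    then show ?thesis
      by eventually_elim (use c_pos in \<open>simp add: upn\<close>)
  qed
qed

text \<open>On the line \<open>Re s = 1\<close> the Laplace transform is the Fourier transform of \<open>f t * exp (- t)\<close>. Real and imaginary part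
  are treated separately, as the Fourier transform of the conjugate also vanishes.\<close>

theorem laplace_injective:
  assumes f: "f \<in> L2_on halfline" and zero: "\<And>s. 0 < Re s \<Longrightarrow> laplace f s = 0"
  shows "AE t in halfline. f t = 0"
proof -
  define g where "g t = indicator {0<..} t *\<^sub>R (f t * expo 1 t)" for t
  have g: "integrable lborel g"
    using integrable_laplace[OF f, of 1] by (simp add: integrable_halfline_iff set_integrable_def g_def[abs_def])
  have int: "integrable lborel (\<lambda>t. iexp (y * t) * g t)" for y
  proof (rule Bochner_Integration.integrable_bound[OF g])
    show "(\<lambda>t. iexp (y * t) * g t) \<in> borel_measurable lborel"
      using borel_measurable_integrable[OF g] by simp
  qed (auto simp: norm_mult)
  have Lg: "(LBINT t. iexp (y * t) * g t) = 0" for y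
  proof -
    have "(LBINT t. iexp (y * t) * g t) = (LBINT t:{0<..}. f t * expo (Complex 1 (-y)) t)"
      unfolding set_lebesgue_integral_def g_def
      by (intro Bochner_Integration.integral_cong refl)
         (auto simp: expo_def indicator_def Complex_eq algebra_simps simp flip: exp_add)
    also have "\<dots> = 0"
      using zero[of "Complex 1 (-y)"] by (simp add: laplace_eq integral_halfline)
    finally show ?thesis .
  qed
  have Lgc: "(LBINT t. iexp (y * t) * cnj (g t)) = 0" for y
  proof -
    have "(LBINT t. iexp (y * t) * cnj (g t)) = (LBINT t. cnj (iexp ((- y) * t) * g t))"
      by (simp add: exp_cnj)
    also have "\<dots> = cnj (LBINT t. iexp ((- y) * t) * g t)"
      by (rule Bochner_Integration.integral_cnj)
    finally show ?thesis using Lg[of "- y"] by simp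
  qed
  have intc: "integrable lborel (\<lambda>t. iexp (y * t) * cnj (g t))" for y
  proof (rule Bochner_Integration.integrable_bound[OF g])
    show "(\<lambda>t. iexp (y * t) * cnj (g t)) \<in> borel_measurable lborel"
      using borel_measurable_integrable[OF g] by simp
  qed (auto simp: norm_mult)
  have Re0: "AE t in lborel. Re (g t) = 0"
  proof (rule zero_if_fourier_zero)
    fix y
    have "(LBINT t. iexp (y * t) * of_real (Re (g t))) =
        (LBINT t. (iexp (y * t) * g t + iexp (y * t) * cnj (g t)) / 2)"
      by (intro Bochner_Integration.integral_cong refl)
         (simp add: complex_add_cnj flip: distrib_left)
    also have "\<dots> = 0" using int intc Lg Lgc by simp
    finally show "(LBINT t. iexp (y * t) * of_real (Re (g t))) = 0" .
  qed (use g in auto)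
  have aux: "e * of_real (Im z) = (e * z - e * cnj z) / (2 * \<i>)" for e z
    by (simp add: complex_diff_cnj flip: right_diff_distrib) (simp add: complex_eq_iff)
  have "AE t in lborel. Im (g t) = 0"
  proof (rule zero_if_fourier_zero)
    fix y
    have "(LBINT t. iexp (y * t) * of_real (Im (g t))) =
        (LBINT t. (iexp (y * t) * g t - iexp (y * t) * cnj (g t)) / (2 * \<i>))"
      by (intro Bochner_Integration.integral_cong refl aux)
    also have "\<dots> = 0" using int intc Lg Lgc by simp
    finally show "(LBINT t. iexp (y * t) * of_real (Im (g t))) = 0" .
  qed (use g in auto)
  with Re0 show ?thesis
    unfolding AE_halfline_iff
  proof eventually_elim
    fix t assume "Re (g t) = 0" "Im (g t) = 0"
    then have "g t = 0" by (simp add: complex_eq_iff)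
    then show "0 < t \<longrightarrow> f t = 0" by (auto simp: g_def expo_def)
  qed
qed

section \<open>Cauchy's formula on lines\<close>

text \<open>Integrals along the edges of rectangles, in the real parameter: a contour integral along a vertical edge is
  \<open>\<i>\<close> times \<open>vedge\<close>.\<close>

definition hedge :: "(complex \<Rightarrow> complex) \<Rightarrow> real \<Rightarrow> real \<Rightarrow> real \<Rightarrow> complex"
  where "hedge g a b y = (LBINT x:{a..b}. g (Complex x y))"

definition vedge :: "(complex \<Rightarrow> complex) \<Rightarrow> real \<Rightarrow> real \<Rightarrow> real \<Rightarrow> complex"
  where "vedge g x c d = (LBINT y:{c..d}. g (Complex x y))"

lemma continuous_Complex_left [continuous_intros]: "continuous_on A (\<lambda>x. Complex x y)"
  and continuous_Complex_right [continuous_intros]: "continuous_on B (\<lambda>y. Complex x y)"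
  unfolding Complex_eq by (intro continuous_intros)+

lemma contour_integral_hline:
  assumes ab: "a < b" and g: "continuous_on ((\<lambda>x. Complex x y) ` {a..b}) g"
  shows "(g has_contour_integral hedge g a b y) (linepath (Complex a y) (Complex b y))"
proof -
  have c: "continuous_on {a..b} (\<lambda>x. g (Complex x y))"
    by (rule continuous_on_compose2[OF g]) (auto intro!: continuous_intros)
  have "set_integrable lborel {a..b} (\<lambda>x. g (Complex x y))"
    using c by (rule borel_integrable_atLeastAtMost')
  then have "((\<lambda>x. g (Complex x y)) has_integral hedge g a b y) {a..b}"
    unfolding hedge_def by (simp add: has_integral_set_lebesgue set_borel_integral_eq_integral has_integral_iff)
  then have "((\<lambda>x. g (Complex ((b - a) * x + a) y)) has_integral hedge g a b y /\<^sub>R (b - a)) {0..1}"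
    using has_integral_affinity'[of "\<lambda>x. g (Complex x y)" "hedge g a b y" a b "b - a" a] ab by simp
  then have "((\<lambda>x. g (Complex ((b - a) * x + a) y) * of_real (b - a)) has_integral
      (hedge g a b y /\<^sub>R (b - a)) * of_real (b - a)) {0..1}"
    by (rule has_integral_mult_left)
  moreover have "(hedge g a b y /\<^sub>R (b - a)) * of_real (b - a) = hedge g a b y"
    using ab by (simp add: scaleR_conv_of_real)
  moreover have "g (Complex ((b - a) * x + a) y) * of_real (b - a) =
      g (linepath (Complex a y) (Complex b y) x) * (Complex b y - Complex a y)" for x
  proof -
    have "linepath (Complex a y) (Complex b y) x = Complex ((b - a) * x + a) y"
      by (simp add: linepath_def complex_eq_iff algebra_simps)
    moreover have "Complex b y - Complex a y = of_real (b - a)"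
      by (simp add: complex_eq_iff)
    ultimately show ?thesis by simp
  qed
  ultimately show ?thesis
    by (simp add: has_contour_integral_linepath)
qed

lemma contour_integral_vline:
  assumes cd: "c < d" and g: "continuous_on ((\<lambda>y. Complex x y) ` {c..d}) g"
  shows "(g has_contour_integral \<i> * vedge g x c d) (linepath (Complex x c) (Complex x d))"
proof -
  have ct: "continuous_on {c..d} (\<lambda>y. g (Complex x y))"
    by (rule continuous_on_compose2[OF g]) (auto intro!: continuous_intros)
  have "set_integrable lborel {c..d} (\<lambda>y. g (Complex x y))"
    using ct by (rule borel_integrable_atLeastAtMost')
  then have "((\<lambda>y. g (Complex x y)) has_integral vedge g x c d) {c..d}"
    unfolding vedge_def by (simp add: set_borel_integral_eq_integral has_integral_iff)
  then show ?thesis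
    using cd by (subst has_contour_integral_linepath_same_Re_iff[of _ x _ c d]) (auto simp flip: mult.assoc)
qed

lemma rectpath_edges:
  assumes ab: "a < b" and cd: "c < d"
    and I: "(g has_contour_integral I) (rectpath (Complex a c) (Complex b d))"
    and g: "continuous_on (path_image (rectpath (Complex a c) (Complex b d))) g"
  shows "hedge g a b c + \<i> * vedge g b c d - hedge g a b d - \<i> * vedge g a c d = I"
proof -
  have im: "path_image (rectpath (Complex a c) (Complex b d)) =
      {z. Re z \<in> {a, b} \<and> Im z \<in> {c..d} \<or> Re z \<in> {a..b} \<and> Im z \<in> {c, d}}"
    using ab cd by (subst path_image_rectpath) auto
  have e1: "(g has_contour_integral hedge g a b c) (linepath (Complex a c) (Complex b c))"
    using ab cd by (intro contour_integral_hline continuous_on_subset[OF g]) (auto simp: im)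
  have e2: "(g has_contour_integral \<i> * vedge g b c d) (linepath (Complex b c) (Complex b d))"
    using ab cd by (intro contour_integral_vline continuous_on_subset[OF g]) (auto simp: im)
  have "(g has_contour_integral hedge g a b d) (linepath (Complex a d) (Complex b d))"
    using ab cd by (intro contour_integral_hline continuous_on_subset[OF g]) (auto simp: im)
  then have e3: "(g has_contour_integral - hedge g a b d) (linepath (Complex b d) (Complex a d))"
    by (metis has_contour_integral_reversepath reversepath_linepath valid_path_linepath)
  have "(g has_contour_integral \<i> * vedge g a c d) (linepath (Complex a c) (Complex a d))"
    using ab cd by (intro contour_integral_vline continuous_on_subset[OF g]) (auto simp: im)
  then have e4: "(g has_contour_integral - (\<i> * vedge g a c d)) (linepath (Complex a d) (Complex a c))"
    by (metis has_contour_integral_reversepath reversepath_linepath valid_path_linepath)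
  have "(g has_contour_integral (hedge g a b c + (\<i> * vedge g b c d + (- hedge g a b d + - (\<i> * vedge g a c d)))))
      (rectpath (Complex a c) (Complex b d))"
    unfolding rectpath_def Let_def
    by (intro has_contour_integral_join e1 e2 e3 e4[simplified] valid_path_join valid_path_linepath)
       (use e1 e2 e3 e4 in \<open>auto intro!: has_contour_integral_join valid_path_join\<close>)
  then have "I = hedge g a b c + (\<i> * vedge g b c d + (- hedge g a b d + - (\<i> * vedge g a c d)))"
    by (rule has_contour_integral_unique[OF I])
  then show ?thesis by simp
qed

lemma rectangle_cauchy_formula:
  assumes f: "f holomorphic_on {z. Re z \<in> {a..b} \<and> Im z \<in> {c..d}}"
    and w: "Re w \<in> {a<..<b}" "Im w \<in> {c<..<d}"
  defines "g \<equiv> (\<lambda>z. f z / (z - w))"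
  shows "hedge g a b c + \<i> * vedge g b c d - hedge g a b d - \<i> * vedge g a c d = 2 * pi * \<i> * f w"
proof -
  have S: "{z. Re z \<in> {a..b} \<and> Im z \<in> {c..d}} = cbox (Complex a c) (Complex b d)"
    by (auto simp: in_cbox_complex_iff)
  have f': "f holomorphic_on cbox (Complex a c) (Complex b d)"
    using f by (simp only: S)
  have im: "path_image (rectpath (Complex a c) (Complex b d)) \<subseteq> cbox (Complex a c) (Complex b d) - {w}"
    using w path_image_rectpath_cbox_minus_box[of "Complex a c" "Complex b d"]
    by (auto simp: in_box_complex_iff)
  have "(g has_contour_integral (2 * pi * \<i> * winding_number (rectpath (Complex a c) (Complex b d)) w * f w))
      (rectpath (Complex a c) (Complex b d))"
    unfolding g_def using f' w im
    by (intro Cauchy_integral_formula_convex_simple[where S = "cbox (Complex a c) (Complex b d)"])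
       (auto simp: in_box_complex_iff)
  moreover have "winding_number (rectpath (Complex a c) (Complex b d)) w = 1"
    using w by (intro winding_number_rectpath) (auto simp: in_box_complex_iff)
  moreover have "continuous_on (path_image (rectpath (Complex a c) (Complex b d))) g"
    unfolding g_def using im f unfolding S
    by (intro continuous_intros continuous_on_subset[OF holomorphic_on_imp_continuous_on[OF f']]) auto
  ultimately show ?thesis
    using w by (intro rectpath_edges) auto
qed

lemma rectangle_cauchy_theorem:
  assumes f: "f holomorphic_on {z. Re z \<in> {a..b} \<and> Im z \<in> {c..d}}" and ab: "a < b" and cd: "c < d"
  shows "hedge f a b c + \<i> * vedge f b c d - hedge f a b d - \<i> * vedge f a c d = 0"
proof -
  have S: "{z. Re z \<in> {a..b} \<and> Im z \<in> {c..d}} = cbox (Complex a c) (Complex b d)"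
    by (auto simp: in_cbox_complex_iff)
  have f': "f holomorphic_on cbox (Complex a c) (Complex b d)"
    using f by (simp only: S)
  have im: "path_image (rectpath (Complex a c) (Complex b d)) \<subseteq> cbox (Complex a c) (Complex b d)"
    using ab cd by (intro path_image_rectpath_subset_cbox) auto
  have "(f has_contour_integral 0) (rectpath (Complex a c) (Complex b d))"
    using f' im by (intro Cauchy_theorem_convex_simple[where S = "cbox (Complex a c) (Complex b d)"]) auto
  moreover have "continuous_on (path_image (rectpath (Complex a c) (Complex b d))) f"
    using im f unfolding S by (intro continuous_on_subset[OF holomorphic_on_imp_continuous_on])
  ultimately show ?thesis
    using ab cd by (intro rectpath_edges) auto
qed

lemma open_Cplus: "open Cplus"
  unfolding Cplus_def by (rule open_halfspace_Re_gt)

lemma in_Cplus_iff [simp]: "s \<in> Cplus \<longleftrightarrow> 0 < Re s"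
  by (simp add: Cplus_def)

lemma H2D: "F \<in> H2 \<Longrightarrow> F holomorphic_on Cplus"
  by (simp add: H2_def)

definition on_line :: "(complex \<Rightarrow> complex) \<Rightarrow> real \<Rightarrow> real \<Rightarrow> complex"
  where "on_line F x y = F (Complex x y)"

lemma continuous_on_line:
  assumes "F holomorphic_on Cplus" "0 < x"
  shows "continuous_on A (on_line F x)"
  unfolding on_line_def
  by (rule continuous_on_compose2[OF holomorphic_on_imp_continuous_on[OF assms(1)]])
     (auto intro!: continuous_intros simp: assms(2))

lemma measurable_on_line:
  "F holomorphic_on Cplus \<Longrightarrow> 0 < x \<Longrightarrow> on_line F x \<in> borel_measurable borel"
  by (intro borel_measurable_continuous_onI continuous_on_line)

lemma H2_iff: "F \<in> H2 \<longleftrightarrow> F holomorphic_on Cplus \<and>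
    (\<exists>C\<ge>0. \<forall>x>0. on_line F x \<in> L2_on lborel \<and> nrm lborel (on_line F x) \<le> C)" (is "_ \<longleftrightarrow> ?r")
proof
  assume F: "F \<in> H2"
  then obtain C where C: "\<And>x. 0 < x \<Longrightarrow> integrable lborel (\<lambda>y. (cmod (F (Complex x y)))\<^sup>2)"
    "\<And>x. 0 < x \<Longrightarrow> (LBINT y. (cmod (F (Complex x y)))\<^sup>2) \<le> C"
    by (auto simp: H2_def)
  have "on_line F x \<in> L2_on lborel" "nrm lborel (on_line F x) \<le> sqrt \<bar>C\<bar>" if "0 < x" for x
    using C[OF that] measurable_on_line[OF H2D[OF F] that]
    by (auto simp: L2_on_def nrm_def on_line_def intro: order_trans)
  then show ?r
    using H2D[OF F] by (auto intro!: exI[of _ "sqrt \<bar>C\<bar>"])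
next
  assume ?r
  then obtain C where F: "F holomorphic_on Cplus" and C: "0 \<le> C"
    "\<And>x. 0 < x \<Longrightarrow> on_line F x \<in> L2_on lborel" "\<And>x. 0 < x \<Longrightarrow> nrm lborel (on_line F x) \<le> C"
    by blast
  have "(LBINT y. (cmod (F (Complex x y)))\<^sup>2) \<le> C\<^sup>2" if "0 < x" for x
    using power_mono[OF C(3)[OF that], of 2] by (simp add: nrm_square on_line_def)
  then show "F \<in> H2"
    unfolding H2_def using F C(2) by (auto simp: L2_on_def on_line_def intro!: exI[of _ "C\<^sup>2"])
qed

lemma L2_on_pole:
  assumes "Re w \<noteq> x"
  shows "on_line (\<lambda>z. 1 / (z - w)) x \<in> L2_on lborel"
    and "(nrm lborel (on_line (\<lambda>z. 1 / (z - w)) x))\<^sup>2 = pi / \<bar>x - Re w\<bar>"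
proof -
  define a where "a = x - Re w"
  have a: "a \<noteq> 0" using assms by (simp add: a_def)
  have [measurable]: "on_line (\<lambda>z. 1 / (z - w)) x \<in> borel_measurable borel"
    unfolding on_line_def[abs_def] Complex_eq by measurable
  have eq: "(cmod (on_line (\<lambda>z. 1 / (z - w)) x (Im w + a * y)))\<^sup>2 = inverse (1 + y\<^sup>2) / a\<^sup>2" for y
  proof -
    have "Complex x (Im w + a * y) - w = Complex a (a * y)"
      by (simp add: complex_eq_iff a_def)
    then have "(cmod (on_line (\<lambda>z. 1 / (z - w)) x (Im w + a * y)))\<^sup>2 = 1 / (a\<^sup>2 + (a * y)\<^sup>2)"
      by (simp add: on_line_def norm_divide power_divide cmod_power2)
    also have "a\<^sup>2 + (a * y)\<^sup>2 = a\<^sup>2 * (1 + y\<^sup>2)"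
      by (simp add: algebra_simps power_mult_distrib)
    finally show ?thesis by (simp add: divide_inverse)
  qed
  have I1: "has_bochner_integral lborel (\<lambda>y. inverse (1 + y\<^sup>2)) pi"
    using integrable_inverse_1_plus_square LBINT_inverse_1_plus_square
    by (simp add: has_bochner_integral_iff interval_lebesgue_integral_def set_integrable_def
        set_lebesgue_integral_def einterval_def)
  then have "has_bochner_integral lborel (\<lambda>y. (cmod (on_line (\<lambda>z. 1 / (z - w)) x (Im w + a * y)))\<^sup>2) (pi / a\<^sup>2)"
    unfolding eq by (rule has_bochner_integral_divide_zero)
  note scaled = this
  have "has_bochner_integral lborel (\<lambda>y. (cmod (on_line (\<lambda>z. 1 / (z - w)) x y))\<^sup>2) (\<bar>a\<bar> *\<^sub>R (pi / a\<^sup>2))"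
  proof -
    have "(\<bar>a\<bar> *\<^sub>R (pi / a\<^sup>2)) /\<^sub>R \<bar>a\<bar> = pi / a\<^sup>2" using a by (simp add: field_simps)
    with scaled show ?thesis
      by (subst lborel_has_bochner_integral_real_affine_iff[OF a, of _ _ "Im w"]) (simp only:)
  qed
  note I = this
  show "on_line (\<lambda>z. 1 / (z - w)) x \<in> L2_on lborel"
      "(nrm lborel (on_line (\<lambda>z. 1 / (z - w)) x))\<^sup>2 = pi / \<bar>x - Re w\<bar>"
  proof -
    have "\<bar>a\<bar> *\<^sub>R (pi / a\<^sup>2) = pi / \<bar>x - Re w\<bar>"
      using a by (cases "0 < a") (auto simp: a_def[symmetric] power2_eq_square)
    with I show "on_line (\<lambda>z. 1 / (z - w)) x \<in> L2_on lborel"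
      "(nrm lborel (on_line (\<lambda>z. 1 / (z - w)) x))\<^sup>2 = pi / \<bar>x - Re w\<bar>"
      by (auto simp: L2_on_def nrm_square has_bochner_integral_iff)
  qed
qed

text \<open>Square-integrability over the strip makes the \<open>L\<^sup>2\<close> norm over horizontal cross sections at most \<open>1\<close>
  at arbitrarily large heights, simultaneously above and below.\<close>

lemma H2_small_cross_sections:
  assumes F: "F \<in> H2" and x: "0 < x"
  shows "\<exists>R>N. (LBINT u:{x..X}. (cmod (F (Complex u R)))\<^sup>2) \<le> 1 \<and>
               (LBINT u:{x..X}. (cmod (F (Complex u (-R))))\<^sup>2) \<le> 1"
proof (rule ccontr)
  assume neg: "\<not> ?thesis"
  have hol: "F holomorphic_on Cplus" using F by (rule H2D)
  obtain C where C: "0 \<le> C" "\<And>u. 0 < u \<Longrightarrow> on_line F u \<in> L2_on lborel"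
      "\<And>u. 0 < u \<Longrightarrow> nrm lborel (on_line F u) \<le> C"
    using F by (auto simp: H2_iff)
  define G where "G z = indicator Cplus z *\<^sub>R F z" for z
  have [measurable]: "G \<in> borel_measurable borel"
    unfolding G_def[abs_def] using hol open_Cplus
    by (intro borel_measurable_continuous_on_indicator holomorphic_on_imp_continuous_on) auto
  have GF: "G (Complex u y) = F (Complex u y)" if "0 < u" for u y
    using that by (simp add: G_def)
  have cm [measurable]: "(\<lambda>p. Complex (fst p) (snd p)) \<in> borel_measurable (borel \<Otimes>\<^sub>M borel)"
    unfolding Complex_eq by measurable
  define k where "k u y = ennreal ((cmod (G (Complex u y)))\<^sup>2) * indicator {x..X} u" for u y
  have [measurable]: "(\<lambda>p. k (fst p) (snd p)) \<in> borel_measurable (borel \<Otimes>\<^sub>M borel)"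
    unfolding k_def by measurable
  have kpair [measurable]: "(\<lambda>(u, y). k u y) \<in> borel_measurable (borel \<Otimes>\<^sub>M borel)"
    "(\<lambda>(y, u). k u y) \<in> borel_measurable (borel \<Otimes>\<^sub>M borel)"
    unfolding k_def Complex_eq by measurable
  define q where "q y = (\<integral>\<^sup>+u. k u y \<partial>lborel)" for y
  have [measurable]: "q \<in> borel_measurable borel"
    unfolding q_def by measurable
  have "(\<integral>\<^sup>+y. q y \<partial>lborel) = (\<integral>\<^sup>+u. \<integral>\<^sup>+y. k u y \<partial>lborel \<partial>lborel)"
    unfolding q_def by (rule lborel_pair.Fubini') simp
  also have "\<dots> \<le> (\<integral>\<^sup>+u. ennreal (C\<^sup>2) * indicator {x..X} u \<partial>lborel)"
  proof (rule nn_integral_mono)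
    fix u
    show "(\<integral>\<^sup>+y. k u y \<partial>lborel) \<le> ennreal (C\<^sup>2) * indicator {x..X} u"
    proof (cases "u \<in> {x..X}")
      case True
      then have u: "0 < u" using x by simp
      have "(\<integral>\<^sup>+y. k u y \<partial>lborel) = (\<integral>\<^sup>+y. ennreal ((cmod (on_line F u y))\<^sup>2) \<partial>lborel)"
        using True u by (simp add: k_def GF on_line_def)
      also have "\<dots> = ennreal ((nrm lborel (on_line F u))\<^sup>2)"
        by (rule nn_integral_L2) (rule C(2)[OF u])
      also have "\<dots> \<le> ennreal (C\<^sup>2)"
        by (intro ennreal_leI power_mono C(3) u) simp
      finally show ?thesis using True by simp
    qed (simp add: k_def)
  qed
  also have "\<dots> < \<infinity>"
    by (simp add: nn_integral_cmult ennreal_mult_less_top emeasure_lborel_Icc_eq)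
  finally have fin: "(\<integral>\<^sup>+y. q y \<partial>lborel) < \<infinity>" .
  have "(\<integral>\<^sup>+y. q (- y) \<partial>lborel) = (\<integral>\<^sup>+y. q y \<partial>lborel)"
    using nn_integral_real_affine[of q "-1" 0] by simp
  with fin have "(\<integral>\<^sup>+y. q y + q (- y) \<partial>lborel) < \<infinity>"
    by (subst nn_integral_add) auto
  moreover have "(\<integral>\<^sup>+y. q y + q (- y) \<partial>lborel) = \<infinity>"
  proof -
    have q_eq: "ennreal (LBINT u:{x..X}. (cmod (F (Complex u y)))\<^sup>2) = q y" for y
    proof -
      have "continuous_on {x..X} (\<lambda>u. (cmod (F (Complex u y)))\<^sup>2)"
        by (intro continuous_intros continuous_on_compose2[OF holomorphic_on_imp_continuous_on[OF hol]])
           (use x in auto)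
      then have si: "set_integrable lborel {x..X} (\<lambda>u. (cmod (F (Complex u y)))\<^sup>2)"
        by (rule borel_integrable_atLeastAtMost')
      have "q y = (\<integral>\<^sup>+u. ennreal (indicator {x..X} u *\<^sub>R (cmod (F (Complex u y)))\<^sup>2) \<partial>lborel)"
        unfolding q_def k_def using x by (intro nn_integral_cong) (auto simp: GF indicator_def)
      also have "\<dots> = ennreal (LBINT u:{x..X}. (cmod (F (Complex u y)))\<^sup>2)"
        using si unfolding set_lebesgue_integral_def set_integrable_def
        by (intro nn_integral_eq_integral) auto
      finally show ?thesis by simp
    qed
    have "1 \<le> q y + q (- y)" if "y > N" for y
    proof -
      have "1 < (LBINT u:{x..X}. (cmod (F (Complex u y)))\<^sup>2) \<or> 1 < (LBINT u:{x..X}. (cmod (F (Complex u (-y))))\<^sup>2)"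
        using neg that by (auto simp: not_le)
      then have "1 \<le> q y \<or> 1 \<le> q (- y)"
        unfolding q_eq[symmetric] by (auto intro: less_imp_le)
      then show ?thesis
        by (meson le_iff_add order_trans add_increasing add_increasing2 zero_le)
    qed
    then have "(\<integral>\<^sup>+y. indicator {N<..} y \<partial>lborel) \<le> (\<integral>\<^sup>+y. q y + q (- y) \<partial>lborel)"
      by (intro nn_integral_mono) (auto simp: indicator_def)
    moreover have "(\<integral>\<^sup>+y. indicator {N<..} y \<partial>lborel) = \<infinity>"
    proof -
      have "of_nat n \<le> emeasure lborel {N<..}" for n :: nat
      proof -
        have "emeasure lborel {N<..N + real n} \<le> emeasure lborel {N<..}"
          by (rule emeasure_mono) auto
        then show ?thesis by (simp add: ennreal_of_nat_eq_real_of_nat)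
      qed
      then have "emeasure lborel {N<..} = \<infinity>"
        using ennreal_Ex_less_of_nat[of "emeasure lborel {N<..}"] by (metis infinity_ennreal_def leD top.not_eq_extremum)
      then show ?thesis by simp
    qed
    ultimately show ?thesis by (simp add: top_unique)
  qed
  ultimately show False by simp
qed

lemma hedge_pole_le:
  assumes F: "F holomorphic_on Cplus" and x: "0 < x" and y: "y \<noteq> Im w"
    and small: "(LBINT u:{x..X}. (cmod (F (Complex u y)))\<^sup>2) \<le> 1"
  shows "cmod (hedge (\<lambda>z. F z / (z - w)) x X y) \<le> (\<bar>X - x\<bar> + 1) / \<bar>y - Im w\<bar>"
proof -
  have cont: "continuous_on {x..X} (\<lambda>u. F (Complex u y))"
    by (intro continuous_intros continuous_on_compose2[OF holomorphic_on_imp_continuous_on[OF F]])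
       (use x in auto)
  have ne: "Complex u y \<noteq> w" for u using y by auto
  have i1: "set_integrable lborel {x..X} (\<lambda>u. F (Complex u y) / (Complex u y - w))"
    by (intro borel_integrable_atLeastAtMost' continuous_intros cont) (use ne in auto)
  have i2: "set_integrable lborel {x..X} (\<lambda>u. (1 + (cmod (F (Complex u y)))\<^sup>2) / \<bar>y - Im w\<bar>)"
    by (intro borel_integrable_atLeastAtMost' continuous_intros cont) (use y in auto)
  have i3: "set_integrable lborel {x..X} (\<lambda>u. (cmod (F (Complex u y)))\<^sup>2)"
    by (intro borel_integrable_atLeastAtMost' continuous_intros cont)
  have i4: "set_integrable lborel {x..X} (\<lambda>u. 1::real)"
    by (intro borel_integrable_atLeastAtMost' continuous_intros)
  have "cmod (hedge (\<lambda>z. F z / (z - w)) x X y) \<le> (LBINT u:{x..X}. cmod (F (Complex u y) / (Complex u y - w)))"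
    unfolding hedge_def by (rule set_integral_norm_bound[OF i1])
  also have "\<dots> \<le> (LBINT u:{x..X}. (1 + (cmod (F (Complex u y)))\<^sup>2) / \<bar>y - Im w\<bar>)"
  proof (rule set_integral_mono[OF _ i2])
    show "set_integrable lborel {x..X} (\<lambda>u. cmod (F (Complex u y) / (Complex u y - w)))"
      by (rule set_integrable_norm[OF i1])
    fix u
    \<comment> \<open>turns the bound on the square integral into one on the integral of \<open>\<bar>F\<bar>\<close>\<close>
    have a: "cmod v \<le> 1 + (cmod v)\<^sup>2" for v
      using sum_squares_bound[of 1 "cmod v"] norm_ge_zero[of v] unfolding one_power2 by linarith
    have "\<bar>y - Im w\<bar> \<le> cmod (Complex u y - w)"
      using abs_Im_le_cmod[of "Complex u y - w"] by simp
    then show "cmod (F (Complex u y) / (Complex u y - w)) \<le> (1 + (cmod (F (Complex u y)))\<^sup>2) / \<bar>y - Im w\<bar>"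
      unfolding norm_divide using y by (intro frac_le a) auto
  qed
  also have "\<dots> = ((LBINT u:{x..X}. 1) + (LBINT u:{x..X}. (cmod (F (Complex u y)))\<^sup>2)) / \<bar>y - Im w\<bar>"
    using i3 i4 by simp
  also have "\<dots> \<le> (\<bar>X - x\<bar> + 1) / \<bar>y - Im w\<bar>"
    using small by (intro divide_right_mono add_mono) (auto simp: set_lebesgue_integral_def measure_def emeasure_lborel_Icc_eq)
  finally show ?thesis .
qed

text \<open>Close the line by a rectangle. Its horizontal sides are negligible along suitable heights, and its
  right side contributes \<open>O(X powr (- 1/2))\<close>.\<close>

theorem H2_cauchy_formula:
  fixes F :: "complex \<Rightarrow> complex"
  assumes F: "F \<in> H2" and x: "0 < x" and w: "x < Re w"
  shows "(LBINT y. F (Complex x y) / (w - Complex x y)) = 2 * pi * F w"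
proof -
  have hol: "F holomorphic_on Cplus" using F by (rule H2D)
  obtain C where C: "0 \<le> C" "\<And>u. 0 < u \<Longrightarrow> on_line F u \<in> L2_on lborel"
      "\<And>u. 0 < u \<Longrightarrow> nrm lborel (on_line F u) \<le> C"
    using F by (auto simp: H2_iff)
  define g where "g z = F z / (z - w)" for z
  define V where "V u = (LBINT y. g (Complex u y))" for u
  have V_ip: "V u = ip lborel (on_line F u) (\<lambda>y. cnj (on_line (\<lambda>z. 1 / (z - w)) u y))" for u
    by (simp add: V_def ip_def g_def on_line_def)
  have cL: "(\<lambda>y. cnj (f y)) \<in> L2_on lborel" "nrm lborel (\<lambda>y. cnj (f y)) = nrm lborel f"
    if "f \<in> L2_on lborel" for f
    using that by (auto simp: L2_on_def nrm_def intro: measurable_compose[OF _ measurable_cnj])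
  have g_int: "integrable lborel (\<lambda>y. g (Complex u y))" if "0 < u" "u \<noteq> Re w" for u
    using integrable_ip[OF C(2)[OF that(1)] cL(1)[OF L2_on_pole(1)[of w u]]] that
    by (simp add: g_def on_line_def)
  \<comment> \<open>rectangles of growing height between the lines \<open>Re z = x\<close> and \<open>Re z = X\<close>\<close>
  have V_diff: "V X - V x = 2 * pi * F w" if X: "Re w < X" for X
  proof -
    have "\<forall>n::nat. \<exists>R>real n + \<bar>Im w\<bar>. (LBINT u:{x..X}. (cmod (F (Complex u R)))\<^sup>2) \<le> 1 \<and>
               (LBINT u:{x..X}. (cmod (F (Complex u (-R))))\<^sup>2) \<le> 1"
      using H2_small_cross_sections[OF F x] by blast
    then obtain R where R: "\<And>n. R n > real n + \<bar>Im w\<bar>"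
        "\<And>n. (LBINT u:{x..X}. (cmod (F (Complex u (R n))))\<^sup>2) \<le> 1"
        "\<And>n. (LBINT u:{x..X}. (cmod (F (Complex u (- R n))))\<^sup>2) \<le> 1"
      by metis
    have rect: "hedge g x X (- R n) + \<i> * vedge g X (- R n) (R n) - hedge g x X (R n) - \<i> * vedge g x (- R n) (R n)
        = 2 * pi * \<i> * F w" for n
      unfolding g_def using R(1)[of n] X w x
      by (intro rectangle_cauchy_formula holomorphic_on_subset[OF hol]) auto
    have V_lim: "(\<lambda>n. vedge g u (- R n) (R n)) \<longlonglongrightarrow> V u" if "0 < u" "u \<noteq> Re w" for u
      unfolding vedge_def V_def set_lebesgue_integral_def
    proof (rule integral_dominated_convergence[where w = "\<lambda>y. norm (g (Complex u y))"])
      show "(\<lambda>y. g (Complex u y)) \<in> borel_measurable lborel"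
        using g_int[OF that] by auto
      then show "(\<lambda>y. indicator {- R n..R n} y *\<^sub>R g (Complex u y)) \<in> borel_measurable lborel" for n
        by (intro borel_measurable_scaleR) auto
      show "integrable lborel (\<lambda>y. norm (g (Complex u y)))"
        using g_int[OF that] by auto
      show "AE y in lborel. (\<lambda>n. indicator {- R n..R n} y *\<^sub>R g (Complex u y)) \<longlonglongrightarrow> g (Complex u y)"
      proof (rule AE_I2)
        fix y :: real
        obtain n0 :: nat where "\<bar>y\<bar> < real n0" using reals_Archimedean2 by blast
        have "\<forall>\<^sub>F n in sequentially. indicator {- R n..R n} y *\<^sub>R g (Complex u y) = g (Complex u y)"
          using eventually_ge_at_top[of n0]
        proof eventually_elim
          case (elim n)
          then have "\<bar>y\<bar> < R n" using R(1)[of n] \<open>\<bar>y\<bar> < real n0\<close> by linarith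
          then show ?case by (auto simp: indicator_def)
        qed
        then show "(\<lambda>n. indicator {- R n..R n} y *\<^sub>R g (Complex u y)) \<longlonglongrightarrow> g (Complex u y)"
          by (rule tendsto_eventually)
      qed
    qed (auto simp: indicator_def)
    have H_lim: "(\<lambda>n. hedge g x X (s * R n)) \<longlonglongrightarrow> 0" if s: "s = 1 \<or> s = -1" for s :: real
    proof (rule Lim_null_comparison)
      show "(\<lambda>n. (\<bar>X - x\<bar> + 1) * inverse (real n)) \<longlonglongrightarrow> 0"
        by (intro tendsto_mult_right_zero lim_inverse_n)
      show "\<forall>\<^sub>F n in sequentially. norm (hedge g x X (s * R n)) \<le> (\<bar>X - x\<bar> + 1) * inverse (real n)"
        using eventually_gt_at_top[of 0]
      proof eventually_elim
        fix n :: nat assume n: "0 < n"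
        have b: "real n \<le> \<bar>s * R n - Im w\<bar>" using s R(1)[of n] by auto
        have "norm (hedge g x X (s * R n)) \<le> (\<bar>X - x\<bar> + 1) / \<bar>s * R n - Im w\<bar>"
          unfolding g_def by (rule hedge_pole_le[OF hol x]) (use b n s R(2,3)[of n] in auto)
        also have "\<dots> \<le> (\<bar>X - x\<bar> + 1) / real n"
          using b n by (intro divide_left_mono) auto
        finally show "norm (hedge g x X (s * R n)) \<le> (\<bar>X - x\<bar> + 1) * inverse (real n)"
          by (simp add: divide_inverse)
      qed
    qed
    have "(\<lambda>n. hedge g x X (- R n) + \<i> * vedge g X (- R n) (R n) - hedge g x X (R n) - \<i> * vedge g x (- R n) (R n))
        \<longlonglongrightarrow> 0 + \<i> * V X - 0 - \<i> * V x"
      using H_lim[of 1] H_lim[of "-1"] w x X by (intro tendsto_intros V_lim) auto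
    then have "2 * pi * \<i> * F w = \<i> * V X - \<i> * V x"
      unfolding rect by (simp add: LIMSEQ_const_iff)
    then have "\<i> * (V X - V x) = \<i> * (2 * pi * F w)" by (simp add: algebra_simps)
    then show ?thesis by simp
  qed
  have "((\<lambda>X. V X) \<longlongrightarrow> 0) at_top"
  proof (rule Lim_null_comparison)
    show "\<forall>\<^sub>F X in at_top. norm (V X) \<le> C * sqrt (pi / \<bar>X - Re w\<bar>)"
      using eventually_gt_at_top[of "Re w"]
    proof eventually_elim
      fix X assume X: "Re w < X"
      then have X0: "0 < X" "Re w \<noteq> X" using w x by auto
      have "norm (V X) \<le> nrm lborel (on_line F X) * nrm lborel (on_line (\<lambda>z. 1 / (z - w)) X)"
        unfolding V_ip using cmod_ip_le[OF C(2)[OF X0(1)] cL(1)[OF L2_on_pole(1)[OF X0(2)]]]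
        by (simp add: cL L2_on_pole(1)[OF X0(2)])
      also have "\<dots> \<le> C * sqrt (pi / \<bar>X - Re w\<bar>)"
        using L2_on_pole(2)[OF X0(2)] C X0 by (intro mult_mono) (auto intro: real_le_rsqrt)
      finally show "norm (V X) \<le> C * sqrt (pi / \<bar>X - Re w\<bar>)" .
    qed
    show "((\<lambda>X. C * sqrt (pi / \<bar>X - Re w\<bar>)) \<longlongrightarrow> 0) at_top"
    proof -
      have "((\<lambda>X. sqrt (pi / \<bar>X - Re w\<bar>)) \<longlongrightarrow> 0) at_top" by real_asymp
      then show ?thesis by (rule tendsto_mult_right_zero)
    qed
  qed
  moreover have "\<forall>\<^sub>F X in at_top. V X = V x + 2 * pi * F w"
    using eventually_gt_at_top[of "Re w"] by eventually_elim (use V_diff in \<open>simp add: algebra_simps\<close>)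
  ultimately have "((\<lambda>X::real. V x + 2 * pi * F w) \<longlongrightarrow> 0) at_top"
    by (rule Lim_transform_eventually)
  then have "V x + 2 * pi * F w = 0"
    by (simp add: tendsto_const_iff)
  moreover have "(LBINT y. F (Complex x y) / (w - Complex x y)) = - V x"
    unfolding V_def g_def by (subst Bochner_Integration.integral_minus[symmetric])
      (auto intro!: Bochner_Integration.integral_cong simp: minus_divide_right)
  ultimately show ?thesis by (simp add: add_eq_0_iff)
qed

section \<open>The Paley-Wiener and Plancherel theorems\<close>

lemma integral_swap_bounded_kernel:
  fixes a :: "'a \<Rightarrow> complex" and G :: "'b \<Rightarrow> complex" and k :: "'a \<Rightarrow> 'b \<Rightarrow> complex"
  assumes M: "sigma_finite_measure M" and N: "sigma_finite_measure N"
    and a: "integrable M a" and G: "integrable N G"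
    and k [measurable]: "(\<lambda>(x, y). k x y) \<in> borel_measurable (M \<Otimes>\<^sub>M N)"
    and k_le: "\<And>x y. x \<in> space M \<Longrightarrow> y \<in> space N \<Longrightarrow> cmod (k x y) \<le> 1"
  shows "(\<integral>y. G y * (\<integral>x. a x * k x y \<partial>M) \<partial>N) = (\<integral>x. a x * (\<integral>y. G y * k x y \<partial>N) \<partial>M)"
proof -
  interpret pair_sigma_finite M N
    using M N by (simp add: pair_sigma_finite_def)
  have [measurable]: "a \<in> borel_measurable M" "G \<in> borel_measurable N"
    using a G by auto
  have sec: "integrable N (\<lambda>y. a x * G y * k x y)" if "x \<in> space M" for x
  proof (rule Bochner_Integration.integrable_bound)
    show "integrable N (\<lambda>y. a x * G y)" using G by simp
    have [measurable]: "k x \<in> borel_measurable N"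
      using measurable_Pair2[OF k that] by simp
    show "(\<lambda>y. a x * G y * k x y) \<in> borel_measurable N"
      by measurable
    show "AE y in N. norm (a x * G y * k x y) \<le> norm (a x * G y)"
      using k_le[OF that] by (intro AE_I2) (simp add: norm_mult mult_left_le)
  qed
  have "integrable (M \<Otimes>\<^sub>M N) (case_prod (\<lambda>x y. a x * G y * k x y))"
  proof (rule Fubini_integrable)
    show "case_prod (\<lambda>x y. a x * G y * k x y) \<in> borel_measurable (M \<Otimes>\<^sub>M N)"
      by measurable
    show "AE x in M. integrable N (\<lambda>y. case (x, y) of (x, y) \<Rightarrow> a x * G y * k x y)"
      by (intro AE_I2) (simp add: sec)
    show "integrable M (\<lambda>x. \<integral>y. norm (case (x, y) of (x, y) \<Rightarrow> a x * G y * k x y) \<partial>N)"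
    proof (rule Bochner_Integration.integrable_bound)
      show "integrable M (\<lambda>x. norm (a x) * (\<integral>y. norm (G y) \<partial>N))"
        using a by simp
      show "AE x in M. norm (\<integral>y. norm (case (x, y) of (x, y) \<Rightarrow> a x * G y * k x y) \<partial>N)
          \<le> norm (norm (a x) * (\<integral>y. norm (G y) \<partial>N))"
      proof (rule AE_I2)
        fix x assume x: "x \<in> space M"
        have "(\<integral>y. norm (a x * G y * k x y) \<partial>N) \<le> (\<integral>y. norm (a x) * norm (G y) \<partial>N)"
          using sec[OF x] G k_le[OF x]
          by (intro integral_mono integrable_norm) (auto simp: norm_mult mult_left_le)
        then show "norm (\<integral>y. norm (case (x, y) of (x, y) \<Rightarrow> a x * G y * k x y) \<partial>N)
          \<le> norm (norm (a x) * (\<integral>y. norm (G y) \<partial>N))"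
          by (simp add: integral_nonneg)
      qed
    qed measurable
  qed
  from Fubini_integral[OF this]
  have "(\<integral>y. (\<integral>x. a x * G y * k x y \<partial>M) \<partial>N) = (\<integral>x. (\<integral>y. a x * G y * k x y \<partial>N) \<partial>M)"
    by simp
  moreover have "(\<integral>x. a x * G y * k x y \<partial>M) = G y * (\<integral>x. a x * k x y \<partial>M)" for y
    by (subst integral_mult_right_zero[symmetric]) (simp add: mult_ac)
  moreover have "(\<integral>y. a x * G y * k x y \<partial>N) = a x * (\<integral>y. G y * k x y \<partial>N)" for x
    by (subst integral_mult_right_zero[symmetric]) (simp add: mult_ac)
  ultimately show ?thesis by simp
qed

lemma gaussian_fourier:
  assumes d: "0 < d"
  shows "(LBINT y. of_real (exp (- ((d * y)\<^sup>2 / 2))) * iexp (v * y)) = of_real (2 * pi * normal_density 0 d v)"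
    and "integrable lborel (\<lambda>y. exp (- ((d * y)\<^sup>2 / 2)))"
proof -
  have w: "exp (- ((d * y)\<^sup>2 / 2)) = sqrt (2 * pi) * std_normal_density (0 + d * y)" for y
    by (simp add: std_normal_density_def)
  have "integrable lborel (\<lambda>y. std_normal_density (0 + d * y))"
    using d by (intro lborel_integrable_real_affine) auto
  then show "integrable lborel (\<lambda>y. exp (- ((d * y)\<^sup>2 / 2)))"
    unfolding w by simp
  have "(LBINT y. of_real (exp (- ((d * y)\<^sup>2 / 2))) * iexp (v * y)) =
      (LBINT y. of_real (sqrt (2 * pi)) * (of_real (std_normal_density (0 + d * y)) * iexp (v / d * (0 + d * y))))"
    unfolding w using d by (intro Bochner_Integration.integral_cong refl) (simp add: mult.assoc)
  also have "\<dots> = of_real (sqrt (2 * pi)) * (LBINT y. of_real (std_normal_density (0 + d * y)) * iexp (v / d * (0 + d * y)))"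
    by (rule integral_mult_right_zero)
  also have "(LBINT y. of_real (std_normal_density (0 + d * y)) * iexp (v / d * (0 + d * y))) =
      (LBINT y. of_real (std_normal_density y) * iexp (v / d * y)) /\<^sub>R \<bar>d\<bar>"
    using d lborel_integral_real_affine[of d "\<lambda>y. of_real (std_normal_density y) * iexp (v / d * y)" 0] by simp
  also have "(LBINT y. of_real (std_normal_density y) * iexp (v / d * y)) = char std_normal_distribution (v / d)"
    unfolding char_def by (subst integral_density) (auto simp: scaleR_conv_of_real)
  also have "\<dots> = of_real (exp (- (v / d)\<^sup>2 / 2))"
    by (simp add: char_std_normal_distribution)
  also have "of_real (sqrt (2 * pi)) * (of_real (exp (- (v / d)\<^sup>2 / 2)) /\<^sub>R \<bar>d\<bar>) =
      complex_of_real (sqrt (2 * pi) * (exp (- (v / d)\<^sup>2 / 2) / d))"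
    by (simp only: scaleR_conv_of_real abs_of_pos[OF d] of_real_mult of_real_divide of_real_inverse divide_inverse mult_ac)
  also have "sqrt (2 * pi) * (exp (- (v / d)\<^sup>2 / 2) / d) = 2 * pi * normal_density 0 d v"
  proof -
    define c where "c = sqrt (2 * pi)"
    have c: "c > 0" "2 * pi = c * c" by (auto simp: c_def)
    have "sqrt (2 * pi * d\<^sup>2) = c * d"
      unfolding c_def real_sqrt_mult using d by simp
    then have "2 * pi / sqrt (2 * pi * d\<^sup>2) = (c * c) / (c * d)"
      by (simp only: c(2))
    then have "2 * pi / sqrt (2 * pi * d\<^sup>2) = sqrt (2 * pi) / d"
      using c(1) by (simp add: c_def[symmetric])
    moreover have "2 * pi * normal_density 0 d v = (2 * pi / sqrt (2 * pi * d\<^sup>2)) * exp (- (v / d)\<^sup>2 / 2)"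
      by (simp add: normal_density_def power_divide mult.commute)
    ultimately show ?thesis by simp
  qed
  finally show "(LBINT y. of_real (exp (- ((d * y)\<^sup>2 / 2))) * iexp (v * y)) = of_real (2 * pi * normal_density 0 d v)" .
qed

lemma nn_integral_normal_density_le:
  assumes "0 < d"
  shows "(\<integral>\<^sup>+u. ennreal (normal_density 0 d (t - u)) \<partial>halfline) \<le> 1"
    and "(\<integral>\<^sup>+u. ennreal (normal_density 0 d (u - t)) \<partial>halfline) \<le> 1"
proof -
  have sym: "normal_density 0 d (t - u) = normal_density t d u" "normal_density 0 d (u - t) = normal_density t d u" for u
    by (simp_all add: normal_density_def power2_commute[of t u])
  have "(\<integral>\<^sup>+u. ennreal (normal_density t d u) \<partial>halfline) \<le> (\<integral>\<^sup>+u. ennreal (normal_density t d u) \<partial>lborel)"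
    unfolding halfline_def
    by (subst nn_integral_restrict_space) (auto intro!: nn_integral_mono simp: indicator_def)
  also have "\<dots> = 1"
    using assms by (subst nn_integral_eq_integral) auto
  finally show "(\<integral>\<^sup>+u. ennreal (normal_density 0 d (t - u)) \<partial>halfline) \<le> 1"
      "(\<integral>\<^sup>+u. ennreal (normal_density 0 d (u - t)) \<partial>halfline) \<le> 1"
    unfolding sym by auto
qed

text \<open>A Gaussian weight on the line makes Fubini's theorem applicable. Its Fourier transform is \<open>2 * pi\<close> times
  a probability density, and convolution with a probability density does not increase the norm.\<close>

lemma gaussian_weighted_plancherel_le:
  assumes f: "f \<in> L2_on halfline" and x: "0 < x" and d: "0 < d"
  shows "(\<integral>\<^sup>+y. ennreal (exp (- ((d * y)\<^sup>2 / 2)) * (cmod (laplace f (Complex x y)))\<^sup>2) \<partial>lborel)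
      \<le> ennreal (2 * pi * (nrm halfline f)\<^sup>2)"
proof -
  interpret hh: pair_sigma_finite halfline halfline
    by (simp add: pair_sigma_finite_def sigma_finite_halfline)
  define a where "a t = f t * expo (of_real x) t" for t
  define w where "w y = exp (- ((d * y)\<^sup>2 / 2))" for y
  define L where "L y = laplace f (Complex x y)" for y
  have w_int: "integrable lborel w"
    unfolding w_def using gaussian_fourier(2)[OF d] .
  have [measurable]: "f \<in> borel_measurable halfline" using f by (rule L2_onD)
  have a: "integrable halfline a"
    unfolding a_def using integrable_laplace[OF f, of "of_real x"] x by simp
  have ac: "integrable halfline (\<lambda>t. cnj (a t))" using a by simp
  have [measurable]: "a \<in> borel_measurable halfline" using a by auto
  have a_le: "cmod (a t) \<le> cmod (f t)" if "0 < t" for t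
    using x that by (simp add: a_def norm_mult cmod_expo mult_left_le)
  have L_eq: "L y = (\<integral>t. a t * iexp (- (y * t)) \<partial>halfline)" for y
    unfolding L_def laplace_eq a_def
    by (intro Bochner_Integration.integral_cong refl)
       (simp add: expo_def Complex_eq algebra_simps flip: exp_add)
  have Lc_eq: "cnj (L y) = (\<integral>t. cnj (a t) * iexp (y * t) \<partial>halfline)" for y
    unfolding L_eq by (subst Bochner_Integration.integral_cnj[symmetric]) (simp add: exp_cnj)
  define B where "B = (\<integral>t. cmod (a t) \<partial>halfline)"
  have L_le: "cmod (L y) \<le> B" for y
  proof -
    have "cmod (L y) \<le> (\<integral>t. cmod (a t * iexp (- (y * t))) \<partial>halfline)"
      unfolding L_eq by (rule integral_norm_bound)
    then show ?thesis by (simp add: B_def norm_mult)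
  qed
  have [measurable]: "L \<in> borel_measurable borel"
    using measurable_on_line[OF laplace_holomorphic[OF f] x] by (simp add: L_def[abs_def] on_line_def[abs_def])
  have [measurable]: "w \<in> borel_measurable borel" using w_int by auto
  have wL_int: "integrable lborel (\<lambda>y. of_real (w y) * cnj (L y))"
  proof (rule Bochner_Integration.integrable_bound)
    show "integrable lborel (\<lambda>y. w y * B)" using w_int by simp
    show "AE y in lborel. norm (of_real (w y) * cnj (L y)) \<le> norm (w y * B)"
      using L_le by (intro AE_I2) (auto simp: norm_mult abs_mult w_def intro: order_trans[OF _ abs_ge_self])
  qed measurable
  have w_exp_int: "integrable lborel (\<lambda>y. complex_of_real (w y) * iexp (- (y * t)))" for t
  proof (rule Bochner_Integration.integrable_bound[OF w_int])
  qed (auto simp: norm_mult)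
  have halfline_lborel [measurable]: "(\<lambda>(t, y). iexp (c * (y * t))) \<in> borel_measurable (halfline \<Otimes>\<^sub>M lborel)" for c
  proof -
    have "(\<lambda>t. t) \<in> borel_measurable halfline" by auto
    then have "(\<lambda>p. (\<lambda>t. t) (fst p)) \<in> borel_measurable (halfline \<Otimes>\<^sub>M lborel)"
      by (rule measurable_compose[OF measurable_fst])
    then have [measurable]: "fst \<in> borel_measurable (halfline \<Otimes>\<^sub>M lborel)" by simp
    have [measurable]: "snd \<in> borel_measurable (halfline \<Otimes>\<^sub>M lborel)"
      using measurable_snd[of halfline lborel] by simp
    show ?thesis unfolding split_beta by measurable
  qed
  define N where "N u t = normal_density 0 d (u - t)" for u t
  have N_nonneg: "0 \<le> N u t" for u t by (simp add: N_def normal_density_nonneg)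
  have [measurable]: "(\<lambda>(t, u). N u t) \<in> borel_measurable (halfline \<Otimes>\<^sub>M halfline)"
      "(\<lambda>u. N u t) \<in> borel_measurable halfline" "(\<lambda>t. N u t) \<in> borel_measurable halfline" for t u
  proof -
    have "(\<lambda>t. t) \<in> borel_measurable halfline" by auto
    then have "(\<lambda>p. (\<lambda>t. t) (fst p)) \<in> borel_measurable (halfline \<Otimes>\<^sub>M halfline)"
        "(\<lambda>p. (\<lambda>t. t) (snd p)) \<in> borel_measurable (halfline \<Otimes>\<^sub>M halfline)"
      by (auto intro: measurable_compose[OF measurable_fst] measurable_compose[OF measurable_snd])
    then have [measurable]: "fst \<in> borel_measurable (halfline \<Otimes>\<^sub>M halfline)" "snd \<in> borel_measurable (halfline \<Otimes>\<^sub>M halfline)"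
      by simp_all
    show "(\<lambda>(t, u). N u t) \<in> borel_measurable (halfline \<Otimes>\<^sub>M halfline)"
      unfolding N_def split_beta by measurable
    show "(\<lambda>u. N u t) \<in> borel_measurable halfline" "(\<lambda>t. N u t) \<in> borel_measurable halfline"
      unfolding N_def by (intro measurable_halflineI; measurable)+
  qed
  have inner: "(LBINT y. (of_real (w y) * cnj (L y)) * iexp (- (y * t))) =
      (\<integral>u. cnj (a u) * of_real (2 * pi * N u t) \<partial>halfline)" for t
  proof -
    have wy: "(LBINT y. (of_real (w y) * iexp (- (y * t))) * iexp (y * u)) = of_real (2 * pi * N u t)" for u
    proof -
      have "(LBINT y. (of_real (w y) * iexp (- (y * t))) * iexp (y * u)) = (LBINT y. of_real (w y) * iexp ((u - t) * y))"
        by (intro Bochner_Integration.integral_cong refl) (simp add: mult.assoc algebra_simps flip: exp_add)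
      then show ?thesis
        using gaussian_fourier(1)[OF d, of "u - t"] by (simp add: w_def N_def)
    qed
    have "(LBINT y. (of_real (w y) * cnj (L y)) * iexp (- (y * t))) =
        (LBINT y. (of_real (w y) * iexp (- (y * t))) * (\<integral>u. cnj (a u) * iexp (y * u) \<partial>halfline))"
      by (intro Bochner_Integration.integral_cong refl) (simp add: Lc_eq mult_ac)
    also have "\<dots> = (\<integral>u. cnj (a u) * (LBINT y. (of_real (w y) * iexp (- (y * t))) * iexp (y * u)) \<partial>halfline)"
      using halfline_lborel[of 1]
      by (intro integral_swap_bounded_kernel sigma_finite_halfline lborel.sigma_finite_measure_axioms ac w_exp_int) auto
    finally show ?thesis unfolding wy .
  qed
  define J where "J = (\<integral>t. a t * (\<integral>u. cnj (a u) * of_real (2 * pi * N u t) \<partial>halfline) \<partial>halfline)"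
  \<comment> \<open>the weighted integral as a quadratic form in \<open>a\<close> with the Gaussian kernel \<open>N\<close>\<close>
  have I_eq: "complex_of_real (LBINT y. w y * (cmod (L y))\<^sup>2) = J"
  proof -
    have "complex_of_real (LBINT y. w y * (cmod (L y))\<^sup>2) = (LBINT y. of_real (w y * (cmod (L y))\<^sup>2))"
      by (rule integral_complex_of_real[symmetric])
    also have "\<dots> = (LBINT y. (of_real (w y) * cnj (L y)) * L y)"
      by (intro Bochner_Integration.integral_cong refl) (simp add: complex_norm_square mult_ac del: of_real_power)
    also have "\<dots> = (LBINT y. (of_real (w y) * cnj (L y)) * (\<integral>t. a t * iexp (- (y * t)) \<partial>halfline))"
      unfolding L_eq[symmetric] ..
    also have "\<dots> = (\<integral>t. a t * (LBINT y. (of_real (w y) * cnj (L y)) * iexp (- (y * t))) \<partial>halfline)"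
      using halfline_lborel[of "-1"]
      by (intro integral_swap_bounded_kernel sigma_finite_halfline lborel.sigma_finite_measure_axioms a wL_int) auto
    finally show ?thesis unfolding inner J_def .
  qed
  have norm_le: "ennreal (cmod (integral\<^sup>L M g)) \<le> (\<integral>\<^sup>+x. ennreal (cmod (g x)) \<partial>M)" for M :: "real measure" and g
    by (cases "integrable M g") (auto simp: integral_norm_bound_ennreal not_integrable_integral_eq)
  have amgm: "ennreal (cmod p * cmod q) \<le> ennreal (1/2) * (ennreal ((cmod p)\<^sup>2) + ennreal ((cmod q)\<^sup>2))" for p q
  proof -
    have "cmod p * cmod q \<le> (1/2) * ((cmod p)\<^sup>2 + (cmod q)\<^sup>2)"
      using sum_squares_bound[of "cmod p" "cmod q"] by simp
    then have "ennreal (cmod p * cmod q) \<le> ennreal ((1/2) * ((cmod p)\<^sup>2 + (cmod q)\<^sup>2))"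
      by (rule ennreal_leI)
    also have "\<dots> = ennreal (1/2) * ennreal ((cmod p)\<^sup>2 + (cmod q)\<^sup>2)"
      by (rule ennreal_mult) auto
    also have "ennreal ((cmod p)\<^sup>2 + (cmod q)\<^sup>2) = ennreal ((cmod p)\<^sup>2) + ennreal ((cmod q)\<^sup>2)"
      by (rule ennreal_plus) auto
    finally show ?thesis .
  qed
  define S where "S = (\<integral>\<^sup>+t. ennreal ((cmod (a t))\<^sup>2) \<partial>halfline)"
  have "ennreal (cmod J) \<le> (\<integral>\<^sup>+t. \<integral>\<^sup>+u. ennreal (cmod (a t) * cmod (a u)) * (ennreal (2 * pi) * ennreal (N u t)) \<partial>halfline \<partial>halfline)"
  proof -
    have "ennreal (cmod J) \<le> (\<integral>\<^sup>+t. ennreal (cmod (a t * (\<integral>u. cnj (a u) * of_real (2 * pi * N u t) \<partial>halfline))) \<partial>halfline)"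
      unfolding J_def by (rule norm_le)
    also have "\<dots> \<le> (\<integral>\<^sup>+t. \<integral>\<^sup>+u. ennreal (cmod (a t) * cmod (a u)) * (ennreal (2 * pi) * ennreal (N u t)) \<partial>halfline \<partial>halfline)"
    proof (rule nn_integral_mono)
      fix t
      have "ennreal (cmod (a t * (\<integral>u. cnj (a u) * of_real (2 * pi * N u t) \<partial>halfline)))
          \<le> ennreal (cmod (a t)) * (\<integral>\<^sup>+u. ennreal (cmod (cnj (a u) * of_real (2 * pi * N u t))) \<partial>halfline)"
        unfolding norm_mult[of "a t"] ennreal_mult[OF norm_ge_zero norm_ge_zero]
        by (rule mult_left_mono[OF norm_le]) simp
      also have "\<dots> = (\<integral>\<^sup>+u. ennreal (cmod (a t)) * ennreal (cmod (cnj (a u) * of_real (2 * pi * N u t))) \<partial>halfline)"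
        by (rule nn_integral_cmult[symmetric]) measurable
      also have "\<dots> = (\<integral>\<^sup>+u. ennreal (cmod (a t) * cmod (a u)) * (ennreal (2 * pi) * ennreal (N u t)) \<partial>halfline)"
        by (intro nn_integral_cong) (simp add: norm_mult abs_mult N_nonneg ennreal_mult mult.assoc)
      finally show "ennreal (cmod (a t * (\<integral>u. cnj (a u) * of_real (2 * pi * N u t) \<partial>halfline)))
          \<le> (\<integral>\<^sup>+u. ennreal (cmod (a t) * cmod (a u)) * (ennreal (2 * pi) * ennreal (N u t)) \<partial>halfline)" .
    qed
    finally show ?thesis .
  qed
  also have "\<dots> \<le> (\<integral>\<^sup>+t. \<integral>\<^sup>+u. ennreal pi * (ennreal ((cmod (a t))\<^sup>2) * ennreal (N u t)) +
      ennreal pi * (ennreal ((cmod (a u))\<^sup>2) * ennreal (N u t)) \<partial>halfline \<partial>halfline)"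
  proof (intro nn_integral_mono)
    fix t u
    have "ennreal (cmod (a t) * cmod (a u)) * (ennreal (2 * pi) * ennreal (N u t)) \<le>
        (ennreal (1/2) * (ennreal ((cmod (a t))\<^sup>2) + ennreal ((cmod (a u))\<^sup>2))) * (ennreal (2 * pi) * ennreal (N u t))"
      by (intro mult_right_mono amgm) simp
    also have "\<dots> = (ennreal (1/2) * ennreal (2 * pi)) * ((ennreal ((cmod (a t))\<^sup>2) + ennreal ((cmod (a u))\<^sup>2)) * ennreal (N u t))"
      by (simp add: mult_ac)
    also have "ennreal (1/2) * ennreal (2 * pi) = ennreal pi"
      by (subst ennreal_mult[symmetric]) auto
    finally show "ennreal (cmod (a t) * cmod (a u)) * (ennreal (2 * pi) * ennreal (N u t)) \<le>
        ennreal pi * (ennreal ((cmod (a t))\<^sup>2) * ennreal (N u t)) + ennreal pi * (ennreal ((cmod (a u))\<^sup>2) * ennreal (N u t))"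
      by (simp add: distrib_left distrib_right)
  qed
  also have "\<dots> = (\<integral>\<^sup>+t. \<integral>\<^sup>+u. ennreal pi * (ennreal ((cmod (a t))\<^sup>2) * ennreal (N u t)) \<partial>halfline \<partial>halfline) +
      (\<integral>\<^sup>+t. \<integral>\<^sup>+u. ennreal pi * (ennreal ((cmod (a u))\<^sup>2) * ennreal (N u t)) \<partial>halfline \<partial>halfline)"
    by (subst nn_integral_add[symmetric]) (auto intro!: nn_integral_cong nn_integral_add)
  also have "\<dots> \<le> ennreal pi * S + ennreal pi * S"
  proof (rule add_mono)
    have "(\<integral>\<^sup>+t. \<integral>\<^sup>+u. ennreal pi * (ennreal ((cmod (a t))\<^sup>2) * ennreal (N u t)) \<partial>halfline \<partial>halfline) =
        (\<integral>\<^sup>+t. ennreal pi * (ennreal ((cmod (a t))\<^sup>2) * (\<integral>\<^sup>+u. ennreal (N u t) \<partial>halfline)) \<partial>halfline)"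
      by (intro nn_integral_cong) (simp add: nn_integral_cmult)
    also have "\<dots> \<le> (\<integral>\<^sup>+t. ennreal pi * (ennreal ((cmod (a t))\<^sup>2) * 1) \<partial>halfline)"
      unfolding N_def by (intro nn_integral_mono mult_left_mono nn_integral_normal_density_le d) auto
    also have "\<dots> = ennreal pi * S"
      by (simp add: S_def nn_integral_cmult)
    finally show "(\<integral>\<^sup>+t. \<integral>\<^sup>+u. ennreal pi * (ennreal ((cmod (a t))\<^sup>2) * ennreal (N u t)) \<partial>halfline \<partial>halfline) \<le> ennreal pi * S" .
    have "(\<integral>\<^sup>+t. \<integral>\<^sup>+u. ennreal pi * (ennreal ((cmod (a u))\<^sup>2) * ennreal (N u t)) \<partial>halfline \<partial>halfline) =
        (\<integral>\<^sup>+u. \<integral>\<^sup>+t. ennreal pi * (ennreal ((cmod (a u))\<^sup>2) * ennreal (N u t)) \<partial>halfline \<partial>halfline)"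
      by (rule hh.Fubini'[symmetric]) measurable
    also have "\<dots> = (\<integral>\<^sup>+u. ennreal pi * (ennreal ((cmod (a u))\<^sup>2) * (\<integral>\<^sup>+t. ennreal (N u t) \<partial>halfline)) \<partial>halfline)"
      by (intro nn_integral_cong) (simp add: nn_integral_cmult)
    also have "\<dots> \<le> (\<integral>\<^sup>+u. ennreal pi * (ennreal ((cmod (a u))\<^sup>2) * 1) \<partial>halfline)"
      unfolding N_def by (intro nn_integral_mono mult_left_mono nn_integral_normal_density_le d) auto
    also have "\<dots> = ennreal pi * S"
      by (simp add: S_def nn_integral_cmult)
    finally show "(\<integral>\<^sup>+t. \<integral>\<^sup>+u. ennreal pi * (ennreal ((cmod (a u))\<^sup>2) * ennreal (N u t)) \<partial>halfline \<partial>halfline) \<le> ennreal pi * S" .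
  qed
  also have "\<dots> = ennreal (2 * pi) * S"
    by (simp add: distrib_right[symmetric] flip: ennreal_plus)
  also have "\<dots> \<le> ennreal (2 * pi) * ennreal ((nrm halfline f)\<^sup>2)"
  proof (rule mult_left_mono)
    show "S \<le> ennreal ((nrm halfline f)\<^sup>2)"
      unfolding S_def nn_integral_L2[OF f, symmetric]
      by (intro nn_integral_mono ennreal_leI power_mono a_le) auto
  qed simp
  finally have J_le: "ennreal (cmod J) \<le> ennreal (2 * pi * (nrm halfline f)\<^sup>2)"
    by (simp add: ennreal_mult)
  have "integrable lborel (\<lambda>y. w y * (cmod (L y))\<^sup>2)"
  proof (rule Bochner_Integration.integrable_bound)
    show "integrable lborel (\<lambda>y. w y * B\<^sup>2)" using w_int by simp
    show "AE y in lborel. norm (w y * (cmod (L y))\<^sup>2) \<le> norm (w y * B\<^sup>2)"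
      using L_le by (intro AE_I2) (auto simp: w_def intro!: power_mono)
  qed measurable
  then have "(\<integral>\<^sup>+y. ennreal (w y * (cmod (L y))\<^sup>2) \<partial>lborel) = ennreal (LBINT y. w y * (cmod (L y))\<^sup>2)"
    by (intro nn_integral_eq_integral) (auto simp: w_def)
  also have "\<dots> \<le> ennreal (cmod J)"
    unfolding I_eq[symmetric] by (intro ennreal_leI) simp
  also note J_le
  finally show ?thesis
    by (simp only: w_def L_def)
qed

text \<open>Fatou's lemma removes the Gaussian weight, as it widens to the constant \<open>1\<close>.\<close>

theorem nrm_laplace_line_le:
  assumes f: "f \<in> L2_on halfline" and x: "0 < x"
  shows "on_line (laplace f) x \<in> L2_on lborel"
    and "nrm lborel (on_line (laplace f) x) \<le> sqrt (2 * pi) * nrm halfline f"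
proof -
  have [measurable]: "on_line (laplace f) x \<in> borel_measurable borel"
    using measurable_on_line[OF laplace_holomorphic[OF f] x] .
  have le: "(\<integral>\<^sup>+y. ennreal ((cmod (on_line (laplace f) x y))\<^sup>2) \<partial>lborel) \<le> ennreal (2 * pi * (nrm halfline f)\<^sup>2)"
  proof (rule L2_fatou)
    fix k :: nat
    define d where "d = inverse (real (Suc k))"
    show "(\<lambda>y. of_real (exp (- ((inverse (real (Suc k)) * y)\<^sup>2 / 4))) * on_line (laplace f) x y) \<in> borel_measurable lborel"
      by measurable
    have "(cmod (of_real (exp (- ((d * y)\<^sup>2 / 4))) * on_line (laplace f) x y))\<^sup>2 =
        exp (- ((d * y)\<^sup>2 / 2)) * (cmod (laplace f (Complex x y)))\<^sup>2" for y
      by (simp add: on_line_def norm_mult power_mult_distrib flip: exp_double)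
    then show "(\<integral>\<^sup>+y. ennreal ((cmod (of_real (exp (- ((inverse (real (Suc k)) * y)\<^sup>2 / 4))) * on_line (laplace f) x y))\<^sup>2) \<partial>lborel)
        \<le> ennreal (2 * pi * (nrm halfline f)\<^sup>2)"
      using gaussian_weighted_plancherel_le[OF f x, of d] by (simp add: d_def)
  next
    have "(\<lambda>k. of_real (exp (- ((inverse (real (Suc k)) * y)\<^sup>2 / 4))) * on_line (laplace f) x y) \<longlonglongrightarrow>
        of_real (exp (- ((0 * y)\<^sup>2 / 4))) * on_line (laplace f) x y" for y
      by (intro tendsto_intros LIMSEQ_inverse_real_of_nat) simp
    then show "AE y in lborel. (\<lambda>k. of_real (exp (- ((inverse (real (Suc k)) * y)\<^sup>2 / 4))) * on_line (laplace f) x y)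
        \<longlonglongrightarrow> on_line (laplace f) x y"
      by simp
  qed auto
  show "on_line (laplace f) x \<in> L2_on lborel"
    by (rule L2_on_if_nn_integral_le(1)[OF _ le]) auto
  have "(nrm lborel (on_line (laplace f) x))\<^sup>2 \<le> 2 * pi * (nrm halfline f)\<^sup>2"
    by (rule L2_on_if_nn_integral_le(2)[OF _ le]) auto
  then have "nrm lborel (on_line (laplace f) x) \<le> sqrt (2 * pi * (nrm halfline f)\<^sup>2)"
    by (rule real_le_rsqrt)
  then show "nrm lborel (on_line (laplace f) x) \<le> sqrt (2 * pi) * nrm halfline f"
    by (simp add: real_sqrt_mult)
qed

lemma H2_cong: "F \<in> H2 \<Longrightarrow> (\<And>s. 0 < Re s \<Longrightarrow> G s = F s) \<Longrightarrow> G \<in> H2"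
proof -
  assume F: "F \<in> H2" and eq: "\<And>s. 0 < Re s \<Longrightarrow> G s = F s"
  have "G holomorphic_on Cplus"
    using H2D[OF F] by (rule holomorphic_transform) (simp add: eq)
  moreover have "on_line G x = on_line F x" if "0 < x" for x
    using that by (auto simp: on_line_def eq)
  ultimately show "G \<in> H2"
    using F by (auto simp: H2_iff)
qed

lemma laplace_in_H2: "f \<in> L2_on halfline \<Longrightarrow> laplace f \<in> H2"
  unfolding H2_iff
  by (auto intro!: exI[of _ "sqrt (2 * pi) * nrm halfline f"] laplace_holomorphic nrm_laplace_line_le)

lemma on_line_laplace_expo:
  "0 < x \<Longrightarrow> 0 < Re w \<Longrightarrow> on_line (laplace (expo w)) x = on_line (\<lambda>s. 1 / (s + w)) x"
  by (auto simp: on_line_def laplace_expo)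

lemma resolvent_in_H2: "0 < Re w \<Longrightarrow> (\<lambda>s. 1 / (s + w)) \<in> H2"
  by (rule H2_cong[OF laplace_in_H2[OF L2_on_expo]]) (auto simp: laplace_expo)

lemma H2_line_L2: "F \<in> H2 \<Longrightarrow> 0 < x \<Longrightarrow> on_line F x \<in> L2_on lborel"
  by (auto simp: H2_iff)

text \<open>On the line \<open>Re z = x\<close> the conjugate of \<open>z\<close> is \<open>2 x - z\<close>, so the conjugate of \<open>1 / (z + w)\<close> is a Cauchy kernel with its
  pole at \<open>2 x + cnj w\<close>.\<close>

lemma ip_line_resolvent:
  fixes F :: "complex \<Rightarrow> complex"
  assumes F: "F \<in> H2" and x: "0 < x" and w: "0 < Re w"
  shows "ip lborel (on_line F x) (on_line (\<lambda>s. 1 / (s + w)) x) = 2 * pi * F (2 * of_real x + cnj w)"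
proof -
  have "ip lborel (on_line F x) (on_line (\<lambda>s. 1 / (s + w)) x) =
      (LBINT y. F (Complex x y) / (2 * of_real x + cnj w - Complex x y))"
    unfolding ip_def on_line_def
  proof (intro Bochner_Integration.integral_cong refl)
    fix y
    have "cnj (Complex x y + w) = 2 * of_real x + cnj w - Complex x y"
      by (simp add: complex_eq_iff)
    then show "F (Complex x y) * cnj (1 / (Complex x y + w)) = F (Complex x y) / (2 * of_real x + cnj w - Complex x y)"
      by (simp add: divide_inverse flip: complex_cnj_add)
  qed
  also have "\<dots> = 2 * pi * F (2 * of_real x + cnj w)"
    using x w by (intro H2_cauchy_formula F) auto
  finally show ?thesis .
qed

text \<open>Testing the representing vector of \<open>f \<mapsto> \<langle>laplace f, F\<rangle>\<close> on a vertical line against exponentials turns Cauchy's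
  formula for \<open>F\<close> into the value of its Laplace transform.\<close>

lemma line_functional_representer:
  fixes F :: "complex \<Rightarrow> complex"
  assumes F: "F \<in> H2" and x: "0 < x"
  shows "\<exists>g\<in>L2_on halfline.
    (\<forall>f\<in>L2_on halfline. ip lborel (on_line (laplace f) x) (on_line F x) = 2 * pi * ip halfline f g) \<and>
    (\<forall>s. 0 < Re s \<longrightarrow> laplace g s = F (2 * of_real x + s)) \<and>
    nrm halfline g \<le> nrm lborel (on_line F x)"
proof -
  define \<Lambda> where "\<Lambda> f = ip lborel (on_line (laplace f) x) (on_line F x) / (2 * pi)" for f
  \<comment> \<open>the bound \<open>b\<close> is \<open>1 / sqrt (2 * pi)\<close> times the norm of \<open>F\<close> on the line\<close>
  define b where "b = sqrt (2 * pi) * nrm lborel (on_line F x) / (2 * pi)"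
  have FL: "on_line F x \<in> L2_on lborel" by (rule H2_line_L2[OF F x])
  have lap: "on_line (laplace (\<lambda>t. c * f t + d * g t)) x = (\<lambda>y. c * on_line (laplace f) x y + d * on_line (laplace g) x y)"
    if "f \<in> L2_on halfline" "g \<in> L2_on halfline" for c d f g
    using laplace_scaled_add[OF that] x by (auto simp: on_line_def)
  have bound: "cmod (\<Lambda> f) \<le> b * nrm halfline f" if f: "f \<in> L2_on halfline" for f
  proof -
    have "cmod (ip lborel (on_line (laplace f) x) (on_line F x)) \<le>
        (sqrt (2 * pi) * nrm halfline f) * nrm lborel (on_line F x)"
      using cmod_ip_le[OF nrm_laplace_line_le(1)[OF f x] FL] nrm_laplace_line_le(2)[OF f x]
      by (meson mult_right_mono nrm_nonneg order_trans)
    then show ?thesis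
      by (simp add: \<Lambda>_def b_def norm_divide norm_mult divide_right_mono mult_ac)
  qed
  have "\<exists>g\<in>L2_on halfline. \<forall>f\<in>L2_on halfline. \<Lambda> f = ip halfline f g"
  proof (rule riesz_representation[OF closed_subspace_L2_on _ bound])
    fix f g a c assume fg: "f \<in> L2_on halfline" "g \<in> L2_on halfline"
    show "\<Lambda> (\<lambda>t. a * f t + c * g t) = a * \<Lambda> f + c * \<Lambda> g"
      unfolding \<Lambda>_def lap[OF fg]
      by (subst ip_add_left)
         (auto intro!: L2_on_scale nrm_laplace_line_le fg x FL simp: ip_scale_left add_divide_distrib)
  qed
  then obtain g where g: "g \<in> L2_on halfline" and rep: "\<And>f. f \<in> L2_on halfline \<Longrightarrow> \<Lambda> f = ip halfline f g"
    by blast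
  have "laplace g s = F (2 * of_real x + s)" if s: "0 < Re s" for s
  proof -
    have "laplace g s = cnj (\<Lambda> (expo (cnj s)))"
      using s by (subst rep) (auto simp: laplace_eq_ip intro: ip_cnj)
    also have "\<dots> = ip lborel (on_line F x) (on_line (\<lambda>z. 1 / (z + cnj s)) x) / (2 * pi)"
      unfolding \<Lambda>_def using s x by (simp add: on_line_laplace_expo ip_cnj[of lborel "on_line F x"])
    also have "\<dots> = F (2 * of_real x + s)"
      using s by (subst ip_line_resolvent[OF F x]) auto
    finally show ?thesis .
  qed
  moreover have "nrm halfline g \<le> nrm lborel (on_line F x)"
  proof (cases "nrm halfline g = 0")
    case False
    then have pos: "0 < nrm halfline g" by (simp add: less_le)
    have "(nrm halfline g)\<^sup>2 \<le> b * nrm halfline g"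
      using bound[OF g] unfolding rep[OF g] ip_self by (simp add: norm_power)
    then have "nrm halfline g \<le> b"
      using pos by (simp add: power2_eq_square)
    also have "b \<le> nrm lborel (on_line F x)"
    proof -
      have "1 \<le> 2 * pi" using pi_gt3 by linarith
      then have "sqrt (2 * pi) \<le> sqrt ((2 * pi)\<^sup>2)"
        unfolding real_sqrt_le_iff power2_eq_square
        using mult_left_mono[of 1 "2 * pi" "2 * pi"] by linarith
      also have "sqrt ((2 * pi)\<^sup>2) = 2 * pi"
        by (simp only: real_sqrt_abs abs_of_nonneg pi_ge_zero mult_nonneg_nonneg zero_le_numeral)
      finally have "sqrt (2 * pi) / (2 * pi) \<le> 1"
        by (simp only: divide_le_eq_1_pos[OF mult_pos_pos[OF zero_less_numeral pi_gt_zero]])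
      then show ?thesis
        unfolding b_def using mult_left_le[of "sqrt (2 * pi) / (2 * pi)" "nrm lborel (on_line F x)"]
        by (simp add: mult.commute)
    qed
    finally show ?thesis .
  qed simp
  moreover have "ip lborel (on_line (laplace f) x) (on_line F x) = 2 * pi * ip halfline f g" if "f \<in> L2_on halfline" for f
    using rep[OF that] by (simp add: \<Lambda>_def field_simps)
  ultimately show ?thesis using g by blast
qed

lemma laplace_unique:
  assumes "f \<in> L2_on halfline" "g \<in> L2_on halfline" "\<And>s. 0 < Re s \<Longrightarrow> laplace f s = laplace g s"
  shows "AE t in halfline. f t = g t"
proof -
  have "AE t in halfline. f t - g t = 0"
  proof (rule laplace_injective)
    show "laplace (\<lambda>t. f t - g t) s = 0" if "0 < Re s" for s
      using laplace_scaled_add[OF assms(1,2) that, of 1 "-1"] assms(3)[OF that] by simp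
  qed (use assms in auto)
  then show ?thesis by simp
qed

lemma laplace_cong_AE:
  assumes "f \<in> borel_measurable halfline" "g \<in> borel_measurable halfline" "AE t in halfline. f t = g t"
  shows "laplace f s = laplace g s"
proof -
  have "AE t in halfline. f t * expo s t = g t * expo s t"
    using assms(3) by eventually_elim simp
  then show ?thesis
    unfolding laplace_eq using assms(1,2)
    by (intro integral_cong_AE borel_measurable_times measurable_expo_halfline)
qed

lemma ip_cong_AE:
  assumes "g \<in> borel_measurable M" "g' \<in> borel_measurable M" "f \<in> borel_measurable M" "AE t in M. g t = g' t"
  shows "ip M f g = ip M f g'"
proof -
  have "AE t in M. f t * cnj (g t) = f t * cnj (g' t)"
    using assms(4) by eventually_elim simp
  then show ?thesis
    unfolding ip_def using assms(1-3)
    by (intro integral_cong_AE borel_measurable_times measurable_compose[OF _ measurable_cnj])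
qed

lemma laplace_shift: "laplace (\<lambda>t. expo v t * g t) s = laplace g (v + s)"
  by (simp add: laplace_eq expo_add mult_ac)

lemma L2_on_expo_mult:
  assumes g: "g \<in> L2_on halfline" and c: "0 \<le> c"
  shows "(\<lambda>t. expo (of_real c) t * g t) \<in> L2_on halfline"
proof -
  have [measurable]: "g \<in> borel_measurable halfline" using g by (rule L2_onD)
  have "integrable halfline (\<lambda>t. (cmod (expo (of_real c) t * g t))\<^sup>2)"
  proof (rule Bochner_Integration.integrable_bound)
    show "integrable halfline (\<lambda>t. (cmod (g t))\<^sup>2)" using g by (rule L2_onD)
    show "AE t in halfline. norm ((cmod (expo (of_real c) t * g t))\<^sup>2) \<le> norm ((cmod (g t))\<^sup>2)"
      using c by (intro AE_I2) (auto simp: norm_mult cmod_expo intro!: power_mono mult_left_le_one_le)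
  qed measurable
  then show ?thesis by (simp add: L2_on_def)
qed

text \<open>The vectors \<open>G x\<close> representing \<open>F\<close> on the lines \<open>Re s = x\<close> have the Laplace transforms \<open>F (2 x + s)\<close> and bounded
  norms. By injectivity they are \<open>exp (- 2 x t) * g t\<close> for one function \<open>g\<close>; letting \<open>x\<close> tend to \<open>0\<close>, Fatou's lemma shows
  that \<open>g\<close> is square-integrable.\<close>

theorem paley_wiener:
  assumes F: "F \<in> H2"
  shows "\<exists>g\<in>L2_on halfline. \<forall>s. 0 < Re s \<longrightarrow> laplace g s = F s"
proof -
  obtain C where C: "0 \<le> C" "\<And>u. 0 < u \<Longrightarrow> nrm lborel (on_line F u) \<le> C"
    using F by (auto simp: H2_iff)
  have "\<forall>x\<in>{0<..}. \<exists>g\<in>L2_on halfline. (\<forall>s. 0 < Re s \<longrightarrow> laplace g s = F (2 * of_real x + s)) \<and> nrm halfline g \<le> C"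
    using line_functional_representer[OF F] C(2) by (meson greaterThan_iff order_trans)
  then obtain G where G: "\<And>x. 0 < x \<Longrightarrow> G x \<in> L2_on halfline"
      "\<And>x s. 0 < x \<Longrightarrow> 0 < Re s \<Longrightarrow> laplace (G x) s = F (2 * of_real x + s)"
      "\<And>x. 0 < x \<Longrightarrow> nrm halfline (G x) \<le> C"
    unfolding bchoice_iff by (metis greaterThan_iff)
  \<comment> \<open>\<open>G (1/2)\<close> has the transform \<open>F (1 + s)\<close>, and the factor \<open>exp t\<close> undoes the shift by \<open>1\<close>\<close>
  define g where "g t = expo (-1) t * G (1/2) t" for t
  have Gm [measurable]: "G x \<in> borel_measurable halfline" if "0 < x" for x
    using G(1)[OF that] by (rule L2_onD)
  have [measurable]: "g \<in> borel_measurable halfline"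
    unfolding g_def[abs_def] using Gm[of "1/2"] by measurable
  have AE_G: "AE t in halfline. G x t = expo (of_real (2 * x)) t * g t" if x: "0 < x" "x < 1/2" for x
  proof -
    have "AE t in halfline. expo (of_real (1 - 2 * x)) t * G x t = G (1/2) t"
    proof (rule laplace_unique)
      show "(\<lambda>t. expo (of_real (1 - 2 * x)) t * G x t) \<in> L2_on halfline"
        using x by (intro L2_on_expo_mult G(1)) auto
      fix s assume s: "0 < Re s"
      show "laplace (\<lambda>t. expo (of_real (1 - 2 * x)) t * G x t) s = laplace (G (1/2)) s"
        unfolding laplace_shift using x s by (subst (1 2) G(2)) auto
    qed (simp add: G(1))
    then show ?thesis
    proof eventually_elim
      fix t assume eq: "expo (of_real (1 - 2 * x)) t * G x t = G (1/2) t"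
      have "expo (of_real (2 * x)) t * g t = (expo (of_real (2 * x)) t * expo (-1) t * expo (of_real (1 - 2 * x)) t) * G x t"
        by (simp add: g_def eq[symmetric])
      also have "expo (of_real (2 * x)) t * expo (-1) t * expo (of_real (1 - 2 * x)) t = 1"
        by (simp add: expo_add[symmetric]) (simp add: expo_def)
      finally show "G x t = expo (of_real (2 * x)) t * g t" by simp
    qed
  qed
  have "(\<integral>\<^sup>+t. ennreal ((cmod (g t))\<^sup>2) \<partial>halfline) \<le> ennreal (C\<^sup>2)"
  proof (rule L2_fatou)
    fix k :: nat
    define x where "x = inverse (real (Suc k)) / 4"
    have x: "0 < x" "x < 1/2"
      using inverse_le_1_iff[of "real (Suc k)"] by (auto simp: x_def)
    have "(\<integral>\<^sup>+t. ennreal ((cmod (expo (of_real (2 * x)) t * g t))\<^sup>2) \<partial>halfline) =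
        (\<integral>\<^sup>+t. ennreal ((cmod (G x t))\<^sup>2) \<partial>halfline)"
      by (intro nn_integral_cong_AE eventually_mono[OF AE_G[OF x]]) simp
    also have "\<dots> \<le> ennreal (C\<^sup>2)"
      unfolding nn_integral_L2[OF G(1)[OF x(1)]] using G(3)[OF x(1)] by (intro ennreal_leI power_mono) auto
    finally show "(\<integral>\<^sup>+t. ennreal ((cmod (expo (of_real (2 * (inverse (real (Suc k)) / 4))) t * g t))\<^sup>2) \<partial>halfline)
        \<le> ennreal (C\<^sup>2)" by (simp add: x_def)
    show "(\<lambda>t. expo (of_real (2 * (inverse (real (Suc k)) / 4))) t * g t) \<in> borel_measurable halfline"
      by measurable
  next
    have "(\<lambda>k. expo (of_real (2 * (inverse (real (Suc k)) / 4))) t * g t) \<longlonglongrightarrow> expo (of_real (2 * (0 / 4))) t * g t" for t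
      unfolding expo_def by (intro tendsto_intros LIMSEQ_inverse_real_of_nat) auto
    then show "AE t in halfline. (\<lambda>k. expo (of_real (2 * (inverse (real (Suc k)) / 4))) t * g t) \<longlonglongrightarrow> g t"
      by (simp add: expo_def)
  qed measurable
  then have gL: "g \<in> L2_on halfline"
    by (intro L2_on_if_nn_integral_le(1)) auto
  have "laplace g s = F s" if s: "0 < Re s" for s
  proof -
    define x where "x = min (1/4) (Re s / 4)"
    have x: "0 < x" "x < 1/2" "2 * x < Re s" using s by (auto simp: x_def)
    have "laplace g s = laplace (\<lambda>t. expo (of_real (2 * x)) t * g t) (s - of_real (2 * x))"
      unfolding laplace_shift by simp
    also have "\<dots> = laplace (G x) (s - of_real (2 * x))"
      using AE_G[OF x(1,2)] x Gm[OF x(1)] by (intro laplace_cong_AE) (auto simp: eq_commute)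
    also have "\<dots> = F s"
      using x by (subst G(2)) auto
    finally show ?thesis .
  qed
  with gL show ?thesis by blast
qed

text \<open>The vector representing \<open>laplace g\<close> on the line \<open>Re s = x\<close> has the Laplace transform \<open>laplace g (2 x + s)\<close>, hence is
  \<open>exp (- 2 x t) * g t\<close>.\<close>

theorem plancherel_line:
  assumes f: "f \<in> L2_on halfline" and g: "g \<in> L2_on halfline" and x: "0 < x"
  shows "ip lborel (on_line (laplace f) x) (on_line (laplace g) x) =
    2 * pi * ip halfline f (\<lambda>t. expo (of_real (2 * x)) t * g t)"
proof -
  from line_functional_representer[OF laplace_in_H2[OF g] x]
  obtain g' where g': "g' \<in> L2_on halfline"
    "\<And>f. f \<in> L2_on halfline \<Longrightarrow> ip lborel (on_line (laplace f) x) (on_line (laplace g) x) = 2 * pi * ip halfline f g'"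
    "\<And>s. 0 < Re s \<Longrightarrow> laplace g' s = laplace g (2 * of_real x + s)"
    by blast
  have eL: "(\<lambda>t. expo (of_real (2 * x)) t * g t) \<in> L2_on halfline"
    using x by (intro L2_on_expo_mult g) auto
  have "AE t in halfline. g' t = expo (of_real (2 * x)) t * g t"
    using g' eL by (intro laplace_unique) (auto simp: laplace_shift)
  then have "ip halfline f g' = ip halfline f (\<lambda>t. expo (of_real (2 * x)) t * g t)"
    using g' eL f by (intro ip_cong_AE L2_onD)
  then show ?thesis using g'(2)[OF f] by simp
qed

lemma tendsto_ip_line:
  assumes f: "f \<in> L2_on halfline" and g: "g \<in> L2_on halfline"
  shows "((\<lambda>x. ip lborel (on_line (laplace f) x) (on_line (laplace g) x)) \<longlongrightarrow> 2 * pi * ip halfline f g) (at_right 0)"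
proof (rule tendsto_at_right_sequentially)
  fix S :: "nat \<Rightarrow> real" assume S: "\<And>n. 0 < S n" "\<And>n. S n < 1" "S \<longlonglongrightarrow> 0"
  have [measurable]: "f \<in> borel_measurable halfline" "g \<in> borel_measurable halfline"
    using f g by (auto intro: L2_onD)
  have "(\<lambda>n. ip halfline f (\<lambda>t. expo (of_real (2 * S n)) t * g t)) \<longlonglongrightarrow> ip halfline f g"
    unfolding ip_def
  proof (rule integral_dominated_convergence[where w = "\<lambda>t. cmod (f t) * cmod (g t)"])
    show "AE t in halfline. (\<lambda>n. f t * cnj (expo (of_real (2 * S n)) t * g t)) \<longlonglongrightarrow> f t * cnj (g t)"
    proof (rule AE_I2)
      fix t
      have "(\<lambda>n. f t * cnj (expo (of_real (2 * S n)) t * g t)) \<longlonglongrightarrow> f t * cnj (expo (of_real (2 * 0)) t * g t)"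
        unfolding expo_def by (intro tendsto_intros S(3))
      then show "(\<lambda>n. f t * cnj (expo (of_real (2 * S n)) t * g t)) \<longlonglongrightarrow> f t * cnj (g t)"
        by (simp add: expo_def)
    qed
    show "AE t in halfline. norm (f t * cnj (expo (of_real (2 * S n)) t * g t)) \<le> cmod (f t) * cmod (g t)" for n
      using S(1)[of n] by (intro AE_I2) (auto simp: norm_mult cmod_expo intro!: mult_left_mono mult_left_le_one_le)
  qed (use integrable_cmod_mult[OF f g] in \<open>auto intro!: measurable_compose[OF _ measurable_cnj]\<close>)
  then show "(\<lambda>n. ip lborel (on_line (laplace f) (S n)) (on_line (laplace g) (S n))) \<longlonglongrightarrow> 2 * pi * ip halfline f g"
    unfolding plancherel_line[OF f g S(1)] by (intro tendsto_intros)
qed auto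

text \<open>With this lemma the model space can be studied in \<open>L\<^sup>2(0,\<infinity>)\<close>, without boundary functions.\<close>

lemma H2_inner_laplace:
  assumes f: "f \<in> L2_on halfline" and g: "g \<in> L2_on halfline"
    and F: "\<And>s. 0 < Re s \<Longrightarrow> F s = laplace f s" and G: "\<And>s. 0 < Re s \<Longrightarrow> G s = laplace g s"
  shows "H2_inner F G = ip halfline f g"
proof -
  have "((\<lambda>x. LBINT y. F (Complex x y) * cnj (G (Complex x y))) \<longlongrightarrow> 2 * pi * ip halfline f g) (at_right 0)"
  proof (rule Lim_transform_eventually[OF tendsto_ip_line[OF f g]])
    show "\<forall>\<^sub>F x in at_right 0. ip lborel (on_line (laplace f) x) (on_line (laplace g) x) =
        (LBINT y. F (Complex x y) * cnj (G (Complex x y)))"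
      using eventually_at_right_less[of 0] by eventually_elim (simp add: ip_def on_line_def F G)
  qed
  then show ?thesis
    unfolding H2_inner_def by (subst tendsto_Lim[where l = "2 * pi * ip halfline f g"]) auto
qed

section \<open>Inner functions and model spaces\<close>

text \<open>The last step of each maximum principle below: Cauchy's formula for \<open>n\<close>-th powers loses a constant factor that
  does not depend on \<open>n\<close>.\<close>

lemma le_one_if_powers_bounded:
  fixes r :: real
  assumes "\<And>n. r ^ n \<le> B"
  shows "r \<le> 1"
proof (rule ccontr)
  assume "\<not> r \<le> 1"
  then obtain n where "B < r ^ n"
    using real_arch_pow[of r B] by auto
  with assms[of n] show False by simp
qed

lemma cmod_mono: "\<bar>Re a\<bar> \<le> \<bar>Re b\<bar> \<Longrightarrow> \<bar>Im a\<bar> \<le> \<bar>Im b\<bar> \<Longrightarrow> cmod a \<le> cmod b"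
  unfolding cmod_def by (intro real_sqrt_le_mono add_mono) (auto simp: abs_le_square_iff)

lemma H2_mult_bounded:
  assumes \<phi>: "\<phi> holomorphic_on Cplus" and le: "\<And>s. 0 < Re s \<Longrightarrow> cmod (\<phi> s) \<le> B" and F: "F \<in> H2"
  shows "(\<lambda>s. \<phi> s * F s) \<in> H2"
proof -
  obtain C where C: "0 \<le> C" "\<And>u. 0 < u \<Longrightarrow> on_line F u \<in> L2_on lborel" "\<And>u. 0 < u \<Longrightarrow> nrm lborel (on_line F u) \<le> C"
    using F by (auto simp: H2_iff)
  have B: "0 \<le> B" by (rule order_trans[OF norm_ge_zero le[of 1]]) simp
  have hol: "(\<lambda>s. \<phi> s * F s) holomorphic_on Cplus"
    by (intro holomorphic_on_mult \<phi> H2D F)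
  have "on_line (\<lambda>s. \<phi> s * F s) x \<in> L2_on lborel \<and> nrm lborel (on_line (\<lambda>s. \<phi> s * F s) x) \<le> B * C" if x: "0 < x" for x
  proof -
    have [measurable]: "on_line (\<lambda>s. \<phi> s * F s) x \<in> borel_measurable borel"
      by (rule measurable_on_line[OF hol x])
    have "(\<integral>\<^sup>+y. ennreal ((cmod (on_line (\<lambda>s. \<phi> s * F s) x y))\<^sup>2) \<partial>lborel) \<le>
        (\<integral>\<^sup>+y. ennreal ((cmod (of_real B * on_line F x y))\<^sup>2) \<partial>lborel)"
      using le x B
      by (intro nn_integral_mono ennreal_leI power_mono) (auto simp: on_line_def norm_mult intro!: mult_right_mono)
    also have "\<dots> = ennreal ((nrm lborel (\<lambda>y. of_real B * on_line F x y))\<^sup>2)"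
      by (intro nn_integral_L2 L2_on_scale C x)
    also have "\<dots> \<le> ennreal ((B * C)\<^sup>2)"
      unfolding nrm_scale using B C(3)[OF x] by (intro ennreal_leI power_mono mult_mono) auto
    finally have le2: "(\<integral>\<^sup>+y. ennreal ((cmod (on_line (\<lambda>s. \<phi> s * F s) x y))\<^sup>2) \<partial>lborel) \<le> ennreal ((B * C)\<^sup>2)" .
    have "on_line (\<lambda>s. \<phi> s * F s) x \<in> L2_on lborel" "(nrm lborel (on_line (\<lambda>s. \<phi> s * F s) x))\<^sup>2 \<le> (B * C)\<^sup>2"
      by (rule L2_on_if_nn_integral_le[OF _ le2], simp_all)+
    then show ?thesis
      using B C(1) power2_le_imp_le by auto
  qed
  then show ?thesis
    using hol B C(1) by (auto simp: H2_iff intro!: exI[of _ "B * C"])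
qed

lemma inner_functionD:
  assumes "inner_function \<theta>"
  shows "\<theta> holomorphic_on Cplus"
    and "\<exists>B. \<forall>s. 0 < Re s \<longrightarrow> cmod (\<theta> s) \<le> B"
    and "AE y in lborel. ((\<lambda>x. cmod (\<theta> (Complex x y))) \<longlongrightarrow> 1) (at_right 0)"
proof -
  show "\<theta> holomorphic_on Cplus"
    using assms by (simp add: inner_function_def)
  obtain B where "\<forall>z\<in>\<theta> ` Cplus. cmod z \<le> B"
    using assms by (auto simp: inner_function_def bounded_iff)
  then show "\<exists>B. \<forall>s. 0 < Re s \<longrightarrow> cmod (\<theta> s) \<le> B"
    by (intro exI[of _ B]) auto
  have "AE y in lborel. \<exists>\<zeta>. ((\<lambda>x. \<theta> (Complex x y)) \<longlongrightarrow> \<zeta>) (at_right 0) \<and> cmod \<zeta> = 1"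
    using assms by (simp add: inner_function_def)
  then show "AE y in lborel. ((\<lambda>x. cmod (\<theta> (Complex x y))) \<longlongrightarrow> 1) (at_right 0)"
    by eventually_elim (metis tendsto_norm)
qed

lemma inner_function_seq_tendsto:
  assumes "inner_function \<theta>" and S: "\<And>n. 0 < S n" "S \<longlonglongrightarrow> 0"
  shows "AE y in lborel. (\<lambda>n. cmod (\<theta> (Complex (S n) y))) \<longlonglongrightarrow> 1"
  using inner_functionD(3)[OF assms(1)]
proof eventually_elim
  fix y assume lim: "((\<lambda>x. cmod (\<theta> (Complex x y))) \<longlongrightarrow> 1) (at_right 0)"
  have "filterlim S (at_right 0) sequentially"
    using S by (simp add: filterlim_at less_imp_neq[symmetric])
  with lim show "(\<lambda>n. cmod (\<theta> (Complex (S n) y))) \<longlonglongrightarrow> 1"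
    by (rule filterlim_compose)
qed

text \<open>Cauchy's formula for the \<open>n\<close>-th power, moved to the boundary where the modulus is \<open>1\<close>, bounds
  \<open>\<bar>\<theta> w\<bar>\<^sup>n\<close> independently of \<open>n\<close>.\<close>

lemma inner_function_le_one:
  assumes \<theta>: "inner_function \<theta>" and w: "0 < Re w"
  shows "cmod (\<theta> w) \<le> 1"
proof -
  obtain B where B: "\<And>s. 0 < Re s \<Longrightarrow> cmod (\<theta> s) \<le> B"
    using inner_functionD(2)[OF \<theta>] by blast
  have hol: "\<theta> holomorphic_on Cplus" by (rule inner_functionD(1)[OF \<theta>])
  \<comment> \<open>The lines \<open>Re z = S k\<close> do not pass \<open>w'\<close>, so that \<open>d\<close> dominates the Cauchy kernel of \<open>w\<close> times
    \<open>1 / (z + 1)\<close> on all of them. The factor \<open>1 / (z + 1)\<close> makes the powers of \<open>\<theta>\<close> square-integrable.\<close>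
  define w' where "w' = Complex (Re w / 2) (Im w)"
  define d where "d y = cmod (on_line (\<lambda>z. 1 / (z - (-1))) 0 y) * cmod (on_line (\<lambda>z. 1 / (z - w')) 0 y)" for y
  define D where "D = integral\<^sup>L lborel d"
  have d_int: "integrable lborel d"
    unfolding d_def using w by (intro integrable_cmod_mult L2_on_pole) (auto simp: w'_def)
  have d_nonneg: "0 \<le> d y" for y by (simp add: d_def)
  define S where "S n = (Re w / 2) * inverse (real (Suc n))" for n
  have S: "0 < S n" "S n \<le> Re w / 2" for n
    using w by (auto simp: S_def intro!: mult_left_le simp: inverse_le_1_iff)
  have "S \<longlonglongrightarrow> (Re w / 2) * 0"
    unfolding S_def by (intro tendsto_intros LIMSEQ_inverse_real_of_nat)
  then have S0: "S \<longlonglongrightarrow> 0" by simp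
  have "cmod (\<theta> w) ^ n \<le> cmod (w + 1) * D / (2 * pi)" for n
  proof -
    have "(\<lambda>s. \<theta> s ^ n * (1 / (s + 1))) \<in> H2"
      using B by (intro H2_mult_bounded[where B = "B ^ n"] holomorphic_on_power hol resolvent_in_H2)
        (auto simp: norm_power intro!: power_mono)
    note cauchy = H2_cauchy_formula[OF this]
    have le: "2 * pi * cmod (\<theta> w) ^ n / cmod (w + 1) \<le> (LBINT y. cmod (\<theta> (Complex (S k) y)) ^ n * d y)" for k
    proof -
      have "2 * pi * cmod (\<theta> w) ^ n / cmod (w + 1) = cmod (2 * pi * (\<theta> w ^ n * (1 / (w + 1))))"
        by (simp add: norm_mult norm_divide norm_power)
      also have "2 * pi * (\<theta> w ^ n * (1 / (w + 1))) =
          (LBINT y. \<theta> (Complex (S k) y) ^ n * (1 / (Complex (S k) y + 1)) / (w - Complex (S k) y))"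
        using S[of k] w by (subst cauchy) auto
      also have "cmod \<dots> \<le> (LBINT y. cmod (\<theta> (Complex (S k) y) ^ n * (1 / (Complex (S k) y + 1)) / (w - Complex (S k) y)))"
        by (rule integral_norm_bound)
      also have "\<dots> \<le> (LBINT y. cmod (\<theta> (Complex (S k) y)) ^ n * d y)"
      proof (rule Bochner_Integration.integral_mono')
        show "integrable lborel (\<lambda>y. cmod (\<theta> (Complex (S k) y)) ^ n * d y)"
        proof (rule Bochner_Integration.integrable_bound)
          show "integrable lborel (\<lambda>y. B ^ n * d y)" using d_int by simp
          have "(\<lambda>y. \<theta> (Complex (S k) y)) \<in> borel_measurable borel"
            using measurable_on_line[OF hol S(1)[of k]] by (simp add: on_line_def[abs_def])
          then show "(\<lambda>y. cmod (\<theta> (Complex (S k) y)) ^ n * d y) \<in> borel_measurable lborel"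
            using d_int by (auto intro!: borel_measurable_times borel_measurable_power measurable_compose[OF _ borel_measurable_norm])
          show "AE y in lborel. norm (cmod (\<theta> (Complex (S k) y)) ^ n * d y) \<le> norm (B ^ n * d y)"
            using B S(1)[of k] d_nonneg
            by (intro AE_I2) (auto simp: abs_mult intro!: mult_right_mono power_mono intro: order_trans[OF _ abs_ge_self])
        qed
        fix y
        have "cmod (Complex 1 y) \<le> cmod (Complex (S k) y + 1)"
          using S(1)[of k] by (intro cmod_mono) auto
        moreover have "cmod (w' - Complex 0 y) \<le> cmod (w - Complex (S k) y)"
          using S[of k] w by (intro cmod_mono) (auto simp: w'_def)
        moreover have "0 < cmod (Complex 1 y)" "0 < cmod (w' - Complex 0 y)"
          using w by (auto simp: w'_def complex_eq_iff)
        ultimately have "1 / (cmod (Complex (S k) y + 1) * cmod (w - Complex (S k) y)) \<le>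
            1 / (cmod (Complex 1 y) * cmod (w' - Complex 0 y))"
          by (intro divide_left_mono mult_mono mult_pos_pos) auto
        also have "\<dots> = d y"
          by (simp add: d_def on_line_def norm_divide norm_minus_commute[of _ w'] Complex_eq add.commute)
        finally have le: "1 / (cmod (Complex (S k) y + 1) * cmod (w - Complex (S k) y)) \<le> d y" .
        show "cmod (\<theta> (Complex (S k) y) ^ n * (1 / (Complex (S k) y + 1)) / (w - Complex (S k) y)) \<le>
            cmod (\<theta> (Complex (S k) y)) ^ n * d y"
        proof -
          have "cmod (\<theta> (Complex (S k) y) ^ n * (1 / (Complex (S k) y + 1)) / (w - Complex (S k) y)) =
              cmod (\<theta> (Complex (S k) y)) ^ n * (1 / (cmod (Complex (S k) y + 1) * cmod (w - Complex (S k) y)))"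
            by (simp add: norm_mult norm_divide norm_power)
          also have "\<dots> \<le> cmod (\<theta> (Complex (S k) y)) ^ n * d y"
            by (rule mult_left_mono[OF le]) simp
          finally show ?thesis .
        qed
      qed (auto simp: d_nonneg)
      finally show ?thesis .
    qed
    have "(\<lambda>k. LBINT y. cmod (\<theta> (Complex (S k) y)) ^ n * d y) \<longlonglongrightarrow> D"
      unfolding D_def
    proof (rule integral_dominated_convergence[where w = "\<lambda>y. B ^ n * d y"])
      show "AE y in lborel. (\<lambda>k. cmod (\<theta> (Complex (S k) y)) ^ n * d y) \<longlonglongrightarrow> d y"
        using inner_function_seq_tendsto[OF \<theta> S(1) S0]
      proof eventually_elim
        fix y assume "(\<lambda>k. cmod (\<theta> (Complex (S k) y))) \<longlonglongrightarrow> 1"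
        then have "(\<lambda>k. cmod (\<theta> (Complex (S k) y)) ^ n * d y) \<longlonglongrightarrow> 1 ^ n * d y"
          by (intro tendsto_intros)
        then show "(\<lambda>k. cmod (\<theta> (Complex (S k) y)) ^ n * d y) \<longlonglongrightarrow> d y" by simp
      qed
      fix k
      have "(\<lambda>y. \<theta> (Complex (S k) y)) \<in> borel_measurable borel"
        using measurable_on_line[OF hol S(1)[of k]] by (simp add: on_line_def[abs_def])
      then show "(\<lambda>y. cmod (\<theta> (Complex (S k) y)) ^ n * d y) \<in> borel_measurable lborel"
        using d_int by (auto intro!: borel_measurable_times borel_measurable_power measurable_compose[OF _ borel_measurable_norm])
      show "AE y in lborel. norm (cmod (\<theta> (Complex (S k) y)) ^ n * d y) \<le> B ^ n * d y"
        using B S(1)[of k] d_nonneg by (intro AE_I2) (auto simp: abs_mult intro!: mult_right_mono power_mono)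
    qed (use d_int in auto)
    then have "2 * pi * cmod (\<theta> w) ^ n / cmod (w + 1) \<le> D"
      by (rule LIMSEQ_le_const) (use le in blast)
    moreover have "0 < cmod (w + 1)" using w by (auto simp: complex_eq_iff)
    ultimately show ?thesis by (simp add: field_simps)
  qed
  then show ?thesis by (rule le_one_if_powers_bounded)
qed

lemma inner_times_H2: "inner_function \<theta> \<Longrightarrow> G \<in> H2 \<Longrightarrow> (\<lambda>s. \<theta> s * G s) \<in> H2"
  by (rule H2_mult_bounded[where B = 1]) (auto simp: inner_functionD inner_function_le_one)

text \<open>The preimage of \<open>\<theta> H\<^sup>2\<close> under the Laplace transform; \<open>model_L2\<close> is its orthogonal complement in \<open>L\<^sup>2(0,\<infinity>)\<close>.\<close>

definition inner_range :: "(complex \<Rightarrow> complex) \<Rightarrow> (real \<Rightarrow> complex) set"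
  where "inner_range \<theta> = {v \<in> L2_on halfline. \<exists>G\<in>H2. \<forall>s. 0 < Re s \<longrightarrow> laplace v s = \<theta> s * G s}"

definition model_L2 :: "(complex \<Rightarrow> complex) \<Rightarrow> (real \<Rightarrow> complex) set"
  where "model_L2 \<theta> = {f \<in> L2_on halfline. \<forall>v\<in>inner_range \<theta>. ip halfline f v = 0}"

lemma inverse_laplace_image_model_space:
  assumes \<theta>: "inner_function \<theta>"
  shows "inverse_laplace_image (model_space \<theta>) = model_L2 \<theta>"
proof (intro equalityI subsetI)
  fix f assume "f \<in> inverse_laplace_image (model_space \<theta>)"
  then have f: "f \<in> L2_on halfline" and orth: "\<And>G. G \<in> H2 \<Longrightarrow> H2_inner (laplace f) (\<lambda>s. \<theta> s * G s) = 0"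
    by (auto simp: inverse_laplace_image_def model_space_def L2_eq_L2_on)
  have "ip halfline f v = 0" if "v \<in> inner_range \<theta>" for v
  proof -
    obtain G where v: "v \<in> L2_on halfline" and G: "G \<in> H2" "\<And>s. 0 < Re s \<Longrightarrow> laplace v s = \<theta> s * G s"
      using \<open>v \<in> inner_range \<theta>\<close> by (auto simp: inner_range_def)
    have "H2_inner (laplace f) (\<lambda>s. \<theta> s * G s) = ip halfline f v"
      by (rule H2_inner_laplace[OF f v]) (auto simp: G)
    then show ?thesis using orth[OF G(1)] by simp
  qed
  with f show "f \<in> model_L2 \<theta>" by (simp add: model_L2_def)
next
  fix f assume "f \<in> model_L2 \<theta>"
  then have f: "f \<in> L2_on halfline" and orth: "\<And>v. v \<in> inner_range \<theta> \<Longrightarrow> ip halfline f v = 0"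
    by (auto simp: model_L2_def)
  have "H2_inner (laplace f) (\<lambda>s. \<theta> s * G s) = 0" if G: "G \<in> H2" for G
  proof -
    obtain v where v: "v \<in> L2_on halfline" "\<And>s. 0 < Re s \<Longrightarrow> laplace v s = \<theta> s * G s"
      using paley_wiener[OF inner_times_H2[OF \<theta> G]] by blast
    have "H2_inner (laplace f) (\<lambda>s. \<theta> s * G s) = ip halfline f v"
      by (rule H2_inner_laplace[OF f v(1)]) (auto simp: v)
    also have "\<dots> = 0"
      using v G by (intro orth) (auto simp: inner_range_def)
    finally show ?thesis .
  qed
  then show "f \<in> inverse_laplace_image (model_space \<theta>)"
    using f laplace_in_H2[OF f] by (auto simp: inverse_laplace_image_def model_space_def L2_eq_L2_on)
qed

lemma model_L2_subset: "f \<in> model_L2 \<theta> \<Longrightarrow> f \<in> L2_on halfline"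
  by (simp add: model_L2_def)

lemma closed_subspace_model_L2: "closed_subspace halfline (model_L2 \<theta>)"
proof -
  have lin: "(\<lambda>x. a * f x + b * g x) \<in> model_L2 \<theta>" if "f \<in> model_L2 \<theta>" "g \<in> model_L2 \<theta>" for f g a b
    using that by (auto simp: model_L2_def inner_range_def ip_add_left L2_on_scale ip_scale_left)
  have closed: "g \<in> model_L2 \<theta>" if f: "\<And>n::nat. f n \<in> model_L2 \<theta>" and g: "g \<in> L2_on halfline"
    and lim: "(\<lambda>n. nrm halfline (\<lambda>x. f n x - g x)) \<longlonglongrightarrow> 0" for f g
  proof -
    have "ip halfline g v = 0" if v: "v \<in> inner_range \<theta>" for v
    proof -
      have "(\<lambda>n. ip halfline (f n) v) \<longlonglongrightarrow> ip halfline g v"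
        using f v by (intro tendsto_ip_left g lim) (auto simp: model_L2_def inner_range_def)
      moreover have "ip halfline (f n) v = 0" for n
        using f[of n] v by (simp add: model_L2_def)
      ultimately show ?thesis by (simp add: LIMSEQ_const_iff)
    qed
    with g show ?thesis by (simp add: model_L2_def)
  qed
  have zero: "(\<lambda>x. 0) \<in> model_L2 \<theta>"
    by (auto simp: model_L2_def ip_def)
  show ?thesis
    unfolding closed_subspace_def
  proof (intro conjI)
    show "model_L2 \<theta> \<subseteq> L2_on halfline" by (auto intro: model_L2_subset)
    show "(\<lambda>x. 0) \<in> model_L2 \<theta>" by (rule zero)
  qed (use lin closed in blast)+
qed

text \<open>Multiplication by an inner function preserves inner products because \<open>1 - \<bar>\<theta>\<bar>\<^sup>2\<close> tends to \<open>0\<close> at almost every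
  boundary point. Here one factor is the Cauchy kernel \<open>1 / (s + w)\<close>, for which dominated convergence gives the limit
  in norm and the inner product is a point evaluation.\<close>

lemma ip_inner_multiples:
  assumes \<theta>: "inner_function \<theta>" and w: "0 < Re w"
    and b: "b \<in> L2_on halfline" "\<And>s. 0 < Re s \<Longrightarrow> laplace b s = \<theta> s * (1 / (s + w))"
    and v: "v \<in> L2_on halfline" "\<And>s. 0 < Re s \<Longrightarrow> laplace v s = \<theta> s * G s" and G: "G \<in> H2"
  shows "ip halfline b v = cnj (G (cnj w))"
proof -
  have hol: "\<theta> holomorphic_on Cplus" by (rule inner_functionD(1)[OF \<theta>])
  obtain C where C: "0 \<le> C" "\<And>u. 0 < u \<Longrightarrow> on_line G u \<in> L2_on lborel" "\<And>u. 0 < u \<Longrightarrow> nrm lborel (on_line G u) \<le> C"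
    using G by (auto simp: H2_iff)
  define S where "S n = inverse (real (Suc n))" for n
  have S: "0 < S n" "S \<longlonglongrightarrow> 0" for n
    unfolding S_def by (simp, rule LIMSEQ_inverse_real_of_nat)
  have at: "filterlim S (at_right 0) sequentially"
    using S by (simp add: filterlim_at less_imp_neq[symmetric])
  define r where "r = (\<lambda>s. 1 / (s + w))"
  define D where "D n y = of_real (1 - (cmod (\<theta> (Complex (S n) y)))\<^sup>2) * on_line r (S n) y" for n y
  have rL: "on_line r (S n) \<in> L2_on lborel" for n
    unfolding r_def by (rule H2_line_L2[OF resolvent_in_H2[OF w] S(1)])
  have \<theta>m [measurable]: "(\<lambda>y. \<theta> (Complex (S n) y)) \<in> borel_measurable borel" for n
    using measurable_on_line[OF hol S(1)[of n]] by (simp add: on_line_def[abs_def])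
  have rm [measurable]: "on_line r (S n) \<in> borel_measurable borel" for n
    using rL[of n] by (auto simp: L2_on_def)
  have Dm [measurable]: "D n \<in> borel_measurable borel" for n
    unfolding D_def by measurable
  have pole: "on_line (\<lambda>z. 1 / (z - (- w))) 0 \<in> L2_on lborel"
    using w by (intro L2_on_pole) auto
  have fac: "0 \<le> 1 - (cmod (\<theta> (Complex (S n) y)))\<^sup>2" "1 - (cmod (\<theta> (Complex (S n) y)))\<^sup>2 \<le> 1" for n y
    using inner_function_le_one[OF \<theta>, of "Complex (S n) y"] S(1)[of n] by (auto simp: power_le_one)
  have D_le: "(cmod (D n y))\<^sup>2 \<le> (cmod (on_line (\<lambda>z. 1 / (z - (- w))) 0 y))\<^sup>2" for n y
  proof -
    have "cmod (D n y) \<le> cmod (on_line r (S n) y)"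
      unfolding D_def norm_mult norm_of_real using fac by (intro mult_left_le_one_le) auto
    also have "\<dots> \<le> cmod (on_line (\<lambda>z. 1 / (z - (- w))) 0 y)"
    proof -
      have "cmod (Complex 0 y + w) \<le> cmod (Complex (S n) y + w)"
        using S(1)[of n] w by (intro cmod_mono) auto
      moreover have "0 < cmod (Complex 0 y + w)" using w by (auto simp: complex_eq_iff)
      ultimately show ?thesis
        by (simp add: r_def on_line_def norm_divide frac_le)
    qed
    finally show ?thesis by (intro power_mono) auto
  qed
  have DL: "D n \<in> L2_on lborel" for n
  proof -
    have "integrable lborel (\<lambda>y. (cmod (D n y))\<^sup>2)"
    proof (rule Bochner_Integration.integrable_bound[OF L2_onD(2)[OF pole]])
      show "AE y in lborel. norm ((cmod (D n y))\<^sup>2) \<le> norm ((cmod (on_line (\<lambda>z. 1 / (z - (- w))) 0 y))\<^sup>2)"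
        using D_le by (intro AE_I2) simp
    qed measurable
    then show ?thesis by (simp add: L2_on_def)
  qed
  have nrm_D: "(\<lambda>n. nrm lborel (D n)) \<longlonglongrightarrow> 0"
  proof -
    have "(\<lambda>n. LBINT y. (cmod (D n y))\<^sup>2) \<longlonglongrightarrow> (LBINT y::real. 0)"
    proof (rule integral_dominated_convergence[where w = "\<lambda>y. (cmod (on_line (\<lambda>z. 1 / (z - (- w))) 0 y))\<^sup>2"])
      show "AE y in lborel. (\<lambda>n. (cmod (D n y))\<^sup>2) \<longlonglongrightarrow> 0"
        using inner_function_seq_tendsto[OF \<theta> S]
      proof eventually_elim
        fix y assume lim: "(\<lambda>n. cmod (\<theta> (Complex (S n) y))) \<longlonglongrightarrow> 1"
        have "(\<lambda>n. on_line r (S n) y) \<longlonglongrightarrow> 1 / (Complex 0 y + w)"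
          unfolding r_def on_line_def Complex_eq using w
          by (intro tendsto_intros S(2)) (auto simp: complex_eq_iff)
        then have "(\<lambda>n. (cmod (D n y))\<^sup>2) \<longlonglongrightarrow> (cmod (of_real (1 - 1\<^sup>2) * (1 / (Complex 0 y + w))))\<^sup>2"
          unfolding D_def using lim by (intro tendsto_intros)
        then show "(\<lambda>n. (cmod (D n y))\<^sup>2) \<longlonglongrightarrow> 0" by simp
      qed
      show "AE y in lborel. norm ((cmod (D n y))\<^sup>2) \<le> (cmod (on_line (\<lambda>z. 1 / (z - (- w))) 0 y))\<^sup>2" for n
        using D_le by (intro AE_I2) simp
    qed (use L2_onD(2)[OF pole] in auto)
    then have "(\<lambda>n. sqrt (LBINT y. (cmod (D n y))\<^sup>2)) \<longlonglongrightarrow> sqrt 0"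
      by (intro tendsto_intros) simp
    then show ?thesis by (simp add: nrm_def)
  qed
  have split: "ip lborel (on_line (laplace b) (S n)) (on_line (laplace v) (S n)) =
      cnj (2 * pi * G (2 * of_real (S n) + cnj w)) - ip lborel (D n) (on_line G (S n))" for n
  proof -
    have "ip lborel (on_line (laplace b) (S n)) (on_line (laplace v) (S n)) =
        ip lborel (\<lambda>y. on_line r (S n) y - D n y) (on_line G (S n))"
      unfolding ip_def
    proof (intro Bochner_Integration.integral_cong refl)
      fix y
      define z where "z = Complex (S n) y"
      have z: "0 < Re z" using S(1) by (simp add: z_def)
      have "\<theta> z * cnj (\<theta> z) = of_real ((cmod (\<theta> z))\<^sup>2)"
        by (rule complex_norm_square[symmetric])
      then have "(\<theta> z * (1 / (z + w))) * cnj (\<theta> z * G z) = of_real ((cmod (\<theta> z))\<^sup>2) * (1 / (z + w)) * cnj (G z)"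
        by (simp add: mult_ac)
      also have "\<dots> = (1 / (z + w) - of_real (1 - (cmod (\<theta> z))\<^sup>2) * (1 / (z + w))) * cnj (G z)"
        by (simp add: algebra_simps)
      finally show "on_line (laplace b) (S n) y * cnj (on_line (laplace v) (S n) y) =
          (on_line r (S n) y - D n y) * cnj (on_line G (S n) y)"
        unfolding on_line_def D_def r_def z_def[symmetric] b(2)[OF z] v(2)[OF z] .
    qed
    also have "\<dots> = ip lborel (on_line r (S n)) (on_line G (S n)) - ip lborel (D n) (on_line G (S n))"
      by (rule ip_diff_left[OF rL DL C(2)[OF S(1)]])
    also have "ip lborel (on_line r (S n)) (on_line G (S n)) = cnj (2 * pi * G (2 * of_real (S n) + cnj w))"
      using ip_line_resolvent[OF G S(1)[of n] w] by (subst ip_cnj) (simp add: r_def)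
    finally show ?thesis .
  qed
  have "(\<lambda>n. ip lborel (D n) (on_line G (S n))) \<longlonglongrightarrow> 0"
  proof (rule Lim_null_comparison)
    show "\<forall>\<^sub>F n in sequentially. norm (ip lborel (D n) (on_line G (S n))) \<le> nrm lborel (D n) * C"
      using cmod_ip_le[OF DL C(2)[OF S(1)]] C(3)[OF S(1)]
      by (intro always_eventually allI) (meson mult_left_mono nrm_nonneg order_trans)
    show "(\<lambda>n. nrm lborel (D n) * C) \<longlonglongrightarrow> 0"
      using nrm_D by (rule tendsto_mult_left_zero)
  qed
  moreover have "(\<lambda>n. G (2 * of_real (S n) + cnj w)) \<longlonglongrightarrow> G (2 * of_real 0 + cnj w)"
  proof (rule isCont_tendsto_compose[where g = G])
    show "isCont G (2 * of_real 0 + cnj w)"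
      using holomorphic_on_imp_continuous_on[OF H2D[OF G]] open_Cplus w
      by (simp add: continuous_on_eq_continuous_at)
  qed (intro tendsto_intros S(2))
  ultimately have "(\<lambda>n. ip lborel (on_line (laplace b) (S n)) (on_line (laplace v) (S n))) \<longlonglongrightarrow>
      cnj (2 * pi * G (2 * of_real 0 + cnj w)) - 0"
    unfolding split by (intro tendsto_intros)
  moreover have "(\<lambda>n. ip lborel (on_line (laplace b) (S n)) (on_line (laplace v) (S n))) \<longlonglongrightarrow> 2 * pi * ip halfline b v"
    using filterlim_compose[OF tendsto_ip_line[OF b(1) v(1)] at] .
  ultimately have "2 * pi * ip halfline b v = cnj (2 * pi * G (2 * of_real 0 + cnj w)) - 0"
    by (rule LIMSEQ_unique[rotated])
  then show ?thesis by simp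
qed

text \<open>Since \<open>f \<mapsto> laplace f w\<close> is represented by \<open>exp (- w t)\<close> on all of \<open>L\<^sup>2(0,\<infinity>)\<close>, the kernel of \<open>model_L2\<close> is the
  orthogonal projection of this exponential, and \<open>b\<close> with the transform \<open>\<theta> s / (s + w)\<close> gives the component to remove.\<close>

theorem reproducing_kernel:
  assumes \<theta>: "inner_function \<theta>" and w: "0 < w"
  shows "\<exists>\<kappa>\<in>model_L2 \<theta>.
    (\<forall>s. 0 < Re s \<longrightarrow> laplace \<kappa> s = (1 - cnj (\<theta> (of_real w)) * \<theta> s) / (s + of_real w)) \<and>
    (\<forall>f\<in>model_L2 \<theta>. ip halfline f \<kappa> = laplace f (of_real w))"
proof -
  define W where "W = complex_of_real w"
  have W: "0 < Re W" "cnj W = W" using w by (auto simp: W_def)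
  obtain b where b: "b \<in> L2_on halfline" "\<And>s. 0 < Re s \<Longrightarrow> laplace b s = \<theta> s * (1 / (s + W))"
    using paley_wiener[OF inner_times_H2[OF \<theta> resolvent_in_H2[OF W(1)]]] by blast
  have bN: "b \<in> inner_range \<theta>"
    unfolding inner_range_def mem_Collect_eq using b resolvent_in_H2[OF W(1)]
    by (intro conjI bexI[of _ "\<lambda>s. 1 / (s + W)"]) auto
  have eL: "expo W \<in> L2_on halfline" using W by auto
  define c where "c = cnj (\<theta> W)"
  define \<kappa> where "\<kappa> t = expo W t - c * b t" for t
  have cb: "(\<lambda>t. c * b t) \<in> L2_on halfline" by (intro L2_on_scale b)
  have \<kappa>L: "\<kappa> \<in> L2_on halfline"
    unfolding \<kappa>_def by (intro L2_on_diff eL cb)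
  have ip_expo: "ip halfline f (expo W) = laplace f W" for f
    by (simp add: laplace_eq_ip W)
  have "ip halfline \<kappa> v = 0" if v: "v \<in> inner_range \<theta>" for v
  proof -
    obtain G where vL: "v \<in> L2_on halfline" and G: "G \<in> H2" "\<And>s. 0 < Re s \<Longrightarrow> laplace v s = \<theta> s * G s"
      using v by (auto simp: inner_range_def)
    have "ip halfline \<kappa> v = ip halfline (expo W) v - c * ip halfline b v"
      unfolding \<kappa>_def by (subst ip_diff_left[OF eL cb vL]) (simp add: ip_scale_left)
    also have "ip halfline (expo W) v = cnj (\<theta> W * G W)"
      by (subst ip_cnj) (simp add: ip_expo G(2) W)
    also have "ip halfline b v = cnj (G (cnj W))"
      by (rule ip_inner_multiples[OF \<theta> W(1) b vL G(2) G(1)])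
    finally show ?thesis by (simp add: c_def W)
  qed
  then have \<kappa>K: "\<kappa> \<in> model_L2 \<theta>" using \<kappa>L by (simp add: model_L2_def)
  have "laplace \<kappa> s = (1 - c * \<theta> s) / (s + W)" if s: "0 < Re s" for s
  proof -
    have "laplace \<kappa> s = laplace (expo W) s - c * laplace b s"
      using laplace_scaled_add[OF eL b(1) s, of 1 "- c"] by (simp add: \<kappa>_def[abs_def])
    then show ?thesis
      using s W by (simp add: laplace_expo b(2) diff_divide_distrib)
  qed
  moreover have "ip halfline f \<kappa> = laplace f W" if f: "f \<in> model_L2 \<theta>" for f
  proof -
    have fL: "f \<in> L2_on halfline" using f by (rule model_L2_subset)
    have "ip halfline \<kappa> f = ip halfline (expo W) f - c * ip halfline b f"
      unfolding \<kappa>_def by (subst ip_diff_left[OF eL cb fL]) (simp add: ip_scale_left)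
    moreover have "ip halfline b f = 0"
      using f bN by (subst ip_cnj) (simp add: model_L2_def)
    ultimately have "ip halfline \<kappa> f = ip halfline (expo W) f" by simp
    then have "cnj (ip halfline f \<kappa>) = cnj (ip halfline f (expo W))"
      by (simp only: ip_cnj[symmetric])
    then show ?thesis by (simp add: ip_expo)
  qed
  ultimately show ?thesis using \<kappa>K by (auto simp: c_def W_def)
qed

section \<open>A Schur test on the half-line\<close>

text \<open>A function on the half-line with values in the unit disc that satisfies the two-point Pick inequality for the right
  half-plane. Up to the factor \<open>(s + t) / (2 * sqrt (s t))\<close> it bounds the numerator \<open>d\<close> of the kernel by the
  geometric mean of its diagonal values \<open>E\<close>.\<close>

locale pick_function =
  fixes u :: "real \<Rightarrow> complex"
  assumes u_measurable [measurable]: "u \<in> borel_measurable borel"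
    and u_cont: "continuous_on {0<..} u"
    and u_less: "\<And>s. 0 < s \<Longrightarrow> cmod (u s) < 1"
    and pick: "\<And>s t. 0 < s \<Longrightarrow> 0 < t \<Longrightarrow>
      4 * s * t * (cmod (1 - cnj (u t) * u s))\<^sup>2 \<le> (s + t)\<^sup>2 * ((1 - (cmod (u s))\<^sup>2) * (1 - (cmod (u t))\<^sup>2))"
begin

definition E :: "real \<Rightarrow> real" where "E s = 1 - (cmod (u s))\<^sup>2"
definition \<phi> :: "real \<Rightarrow> real" where "\<phi> s = E s / s"
definition \<psi> :: "real \<Rightarrow> real" where "\<psi> s = s * E s"
definition d :: "real \<Rightarrow> real \<Rightarrow> real" where "d t s = cmod (1 - cnj (u t) * u s)"

lemma measurable_E [measurable]: "E \<in> borel_measurable borel"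
  unfolding E_def[abs_def] by measurable

lemma measurable_\<phi> [measurable]: "\<phi> \<in> borel_measurable borel"
  unfolding \<phi>_def[abs_def] by measurable

lemma measurable_\<psi> [measurable]: "\<psi> \<in> borel_measurable borel"
  unfolding \<psi>_def[abs_def] by measurable

lemma measurable_d [measurable]: "(\<lambda>(s, t). d s t) \<in> borel_measurable (borel \<Otimes>\<^sub>M borel)"
  unfolding d_def by measurable

lemma measurable_d_section [measurable]: "(\<lambda>t. d t s) \<in> borel_measurable borel"
  unfolding d_def by measurable

lemma E_pos: "0 < s \<Longrightarrow> 0 < E s"
  using u_less[of s] by (simp add: E_def power_less_one_iff abs_square_less_1)

lemma \<phi>_pos: "0 < s \<Longrightarrow> 0 < \<phi> s" and \<psi>_pos: "0 < s \<Longrightarrow> 0 < \<psi> s"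
  by (auto simp: \<phi>_def \<psi>_def E_pos)

lemma sqrt_\<psi>: "0 < s \<Longrightarrow> sqrt (\<psi> s) = s * sqrt (\<phi> s)"
proof -
  assume s: "0 < s"
  then have "\<psi> s = s\<^sup>2 * \<phi> s" by (simp add: \<psi>_def \<phi>_def power2_eq_square)
  with s show ?thesis by (simp add: real_sqrt_mult)
qed

lemma d_nonneg [simp]: "0 \<le> d t s"
  by (simp add: d_def)

lemma d_commute: "d s t = d t s"
proof -
  have "1 - cnj (u s) * u t = cnj (1 - cnj (u t) * u s)" by (simp add: mult.commute)
  then show ?thesis unfolding d_def by (metis complex_mod_cnj)
qed

lemma pick_d: "0 < s \<Longrightarrow> 0 < t \<Longrightarrow> 4 * s * t * (d t s)\<^sup>2 \<le> (s + t)\<^sup>2 * (E s * E t)"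
  using pick[of s t] by (simp add: d_def E_def)

lemma E_mean_le_d: "E s + E t \<le> 2 * d t s"
proof -
  have "1 - cmod (u t) * cmod (u s) \<le> d t s"
    unfolding d_def using norm_triangle_ineq2[of 1 "cnj (u t) * u s"] by (simp add: norm_mult)
  moreover have "2 * (cmod (u t) * cmod (u s)) \<le> (cmod (u t))\<^sup>2 + (cmod (u s))\<^sup>2"
    using sum_squares_bound[of "cmod (u t)" "cmod (u s)"] by simp
  ultimately show ?thesis by (simp add: E_def)
qed

text \<open>The Pick inequality and \<open>E s + E t \<le> 2 * d t s\<close>. The first factor compares \<open>\<psi> s\<close> with \<open>\<psi> t\<close>, the second one
  \<open>\<phi> s\<close> with \<open>\<phi> t\<close>: if one of the monotonicity statements that follow failed, both factors would have the same
  strict sign.\<close>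

lemma pick_product:
  assumes "0 < s" "0 < t"
  shows "(s * E s - t * E t) * (t * E s - s * E t) \<le> 0"
proof -
  have "(E s + E t)\<^sup>2 \<le> (2 * d t s)\<^sup>2"
    using E_mean_le_d[of s t] E_pos assms by (intro power_mono) (auto intro: add_nonneg_nonneg less_imp_le)
  then have "s * t * (E s + E t)\<^sup>2 \<le> s * t * (4 * (d t s)\<^sup>2)"
    using assms by (intro mult_left_mono) (auto simp: power_mult_distrib)
  also have "\<dots> = 4 * s * t * (d t s)\<^sup>2" by simp
  also have "\<dots> \<le> (s + t)\<^sup>2 * (E s * E t)"
    using assms by (rule pick_d)
  finally show ?thesis by (simp add: power2_eq_square algebra_simps)
qed

lemma \<psi>_mono: "0 < s \<Longrightarrow> s \<le> t \<Longrightarrow> \<psi> s \<le> \<psi> t"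
proof (rule ccontr)
  assume st: "0 < s" "s \<le> t" and "\<not> \<psi> s \<le> \<psi> t"
  then have 1: "0 < s * E s - t * E t" by (simp add: \<psi>_def)
  have "s * E s \<le> t * E s" "s * E t \<le> t * E t"
    using st E_pos[of s] E_pos[of t] by (auto intro!: mult_right_mono)
  with 1 have "0 < t * E s - s * E t" by linarith
  from mult_pos_pos[OF 1 this] show False
    using pick_product[of s t] st by simp
qed

lemma \<phi>_antimono: "0 < s \<Longrightarrow> s \<le> t \<Longrightarrow> \<phi> t \<le> \<phi> s"
proof (rule ccontr)
  assume st: "0 < s" "s \<le> t" and "\<not> \<phi> t \<le> \<phi> s"
  then have 1: "0 < s * E t - t * E s" by (simp add: \<phi>_def field_simps)
  have "s * E s \<le> t * E s" "s * E t \<le> t * E t"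
    using st E_pos[of s] E_pos[of t] by (auto intro!: mult_right_mono)
  with 1 have "0 < t * E t - s * E s" by linarith
  from mult_pos_pos[OF this 1] show False
    using pick_product[of s t] st by (simp add: algebra_simps)
qed

text \<open>The identity \<open>\<bar>u s - u t\<bar>\<^sup>2 = (d t s)\<^sup>2 - E s * E t\<close> and the Pick inequality give
  \<open>4 s t * \<bar>u s - u t\<bar>\<^sup>2 \<le> (s - t)\<^sup>2 * (E s * E t)\<close>. Within one doubling of \<open>\<psi>\<close> the function \<open>u\<close> moves by at most \<open>E t\<close>.\<close>

lemma u_increment:
  assumes t: "0 < t" and ts: "t \<le> s" and le: "\<psi> s \<le> 2 * \<psi> t"
  shows "cmod (u s - u t) \<le> \<psi> t / t"
proof -
  have s: "0 < s" using t ts by simp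
  have id: "(cmod (u s - u t))\<^sup>2 = (d t s)\<^sup>2 - E s * E t"
    unfolding d_def E_def cmod_power2 by (simp add: power2_eq_square algebra_simps)
  have "4 * s * t * (cmod (u s - u t))\<^sup>2 = 4 * s * t * (d t s)\<^sup>2 - 4 * s * t * (E s * E t)"
    unfolding id by (simp add: right_diff_distrib)
  also have "\<dots> \<le> (s + t)\<^sup>2 * (E s * E t) - 4 * s * t * (E s * E t)"
    using pick_d[OF s t] by simp
  also have "\<dots> = (s - t)\<^sup>2 * (E s * E t)"
    by (simp add: power2_eq_square algebra_simps)
  also have "\<dots> \<le> s\<^sup>2 * (E s * E t)"
    using t ts s E_pos by (intro mult_right_mono power_mono) (auto intro: less_imp_le)
  also have "\<dots> = s * E t * \<psi> s"
    by (simp add: \<psi>_def power2_eq_square)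
  also have "\<dots> \<le> s * E t * (2 * \<psi> t)"
    using le s E_pos[OF t] by (intro mult_left_mono) auto
  also have "\<dots> = 2 * s * t * (\<psi> t / t)\<^sup>2"
    using t by (simp add: \<psi>_def power2_eq_square)
  finally have "(4 * s * t) * (cmod (u s - u t))\<^sup>2 \<le> (4 * s * t) * ((\<psi> t / t)\<^sup>2 / 2)"
    by simp
  then have "(cmod (u s - u t))\<^sup>2 \<le> (\<psi> t / t)\<^sup>2 / 2"
    using s t by (subst (asm) mult_le_cancel_left_pos) auto
  also have "\<dots> \<le> (\<psi> t / t)\<^sup>2" by simp
  finally show ?thesis
    using \<psi>_pos[OF t] t by (intro power2_le_imp_le[of "cmod (u s - u t)"]) auto
qed

lemma d_near:
  assumes t: "0 < t" and ts: "t \<le> s" and le: "\<psi> s \<le> 2 * \<psi> t"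
  shows "d t s \<le> 2 * \<psi> t / t"
proof -
  have "1 - cnj (u t) * u s = of_real (E t) + cnj (u t) * (u t - u s)"
    unfolding E_def by (simp add: algebra_simps complex_norm_square del: of_real_power)
  then have "d t s \<le> cmod (of_real (E t)) + cmod (cnj (u t) * (u t - u s))"
    unfolding d_def by (metis norm_triangle_ineq)
  also have "\<dots> \<le> E t + cmod (u s - u t)"
    using E_pos[OF t] u_less[OF t] by (auto simp: norm_mult norm_minus_commute intro!: mult_left_le_one_le)
  also have "\<dots> \<le> 2 * \<psi> t / t"
    using u_increment[OF assms] t by (simp add: \<psi>_def)
  finally show ?thesis .
qed

lemma d_triangle:
  assumes t: "0 < t"
  shows "d t s \<le> d t r + cmod (u s - u r)"
proof -
  have "1 - cnj (u t) * u s = (1 - cnj (u t) * u r) + cnj (u t) * (u r - u s)"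
    by (simp add: algebra_simps)
  then have "d t s \<le> d t r + cmod (cnj (u t) * (u r - u s))"
    unfolding d_def by (metis norm_triangle_ineq)
  also have "cmod (cnj (u t) * (u r - u s)) \<le> cmod (u s - u r)"
    using u_less[OF t] by (auto simp: norm_mult norm_minus_commute intro!: mult_left_le_one_le)
  finally show ?thesis by simp
qed

lemma continuous_E: "continuous_on {0<..} E"
  unfolding E_def[abs_def] by (intro continuous_intros u_cont)

end

text \<open>Going down from \<open>s\<close> to points where \<open>\<psi>\<close> halves, the increments of \<open>N\<close> form a geometric series with ratio
  \<open>2 powr (- 1/2)\<close>, whose sum is below \<open>4\<close>.\<close>

lemma halving_bound:
  fixes \<psi> :: "real \<Rightarrow> real" and N :: "real \<Rightarrow> ennreal"
  assumes cont: "continuous_on {a..} \<psi>" and pos: "\<And>s. a \<le> s \<Longrightarrow> 0 < \<psi> s"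
    and mono: "\<And>r s. a \<le> r \<Longrightarrow> r \<le> s \<Longrightarrow> \<psi> r \<le> \<psi> s"
    and N0: "N a = 0" and K: "0 \<le> K"
    and step: "\<And>r s. a \<le> r \<Longrightarrow> r \<le> s \<Longrightarrow> \<psi> s \<le> 2 * \<psi> r \<Longrightarrow> N s \<le> N r + ennreal (K * sqrt (\<psi> s))"
    and s: "a \<le> s"
  shows "N s \<le> ennreal (4 * K * sqrt (\<psi> s))"
proof -
  have near: "N s \<le> ennreal (4 * K * sqrt (\<psi> s))" if "a \<le> s" "\<psi> s \<le> 2 * \<psi> a" for s
  proof -
    have "N s \<le> ennreal (K * sqrt (\<psi> s))"
      using step[of a s] that by (simp add: N0)
    also have "\<dots> \<le> ennreal (4 * K * sqrt (\<psi> s))"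
      using K pos[OF that(1)] by (intro ennreal_leI mult_right_mono) auto
    finally show ?thesis .
  qed
  have "a \<le> s \<Longrightarrow> \<psi> s \<le> 2 ^ n * \<psi> a \<Longrightarrow> N s \<le> ennreal (4 * K * sqrt (\<psi> s))" for n s
  proof (induction n arbitrary: s)
    case 0
    then show ?case using pos[of a] by (intro near) auto
  next
    case (Suc n)
    show ?case
    proof (cases "\<psi> s \<le> 2 * \<psi> a")
      case True
      with Suc.prems(1) show ?thesis by (rule near)
    next
      case False
      have "\<exists>r\<ge>a. r \<le> s \<and> \<psi> r = \<psi> s / 2"
        using Suc.prems(1) False pos[OF Suc.prems(1)]
        by (intro IVT' continuous_on_subset[OF cont]) auto
      then obtain r where r: "a \<le> r" "r \<le> s" "\<psi> r = \<psi> s / 2" by blast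
      have "N r \<le> ennreal (4 * K * sqrt (\<psi> r))"
        using r Suc.prems by (intro Suc.IH) auto
      note IH = this
      have "N s \<le> N r + ennreal (K * sqrt (\<psi> s))"
        using step[of r s] r by simp
      also have "\<dots> \<le> ennreal (4 * K * sqrt (\<psi> r)) + ennreal (K * sqrt (\<psi> s))"
        using IH by (rule add_right_mono)
      also have "\<dots> = ennreal (4 * K * sqrt (\<psi> r) + K * sqrt (\<psi> s))"
        using K pos[of s] pos[of r] r Suc.prems by (subst ennreal_plus) auto
      also have "\<dots> \<le> ennreal (4 * K * sqrt (\<psi> s))"
      proof (rule ennreal_leI)
        \<comment> \<open>\<open>4 * 3/4 + 1 = 4\<close>, and \<open>1/2 \<le> (3/4)\<^sup>2\<close>\<close>
        have "sqrt (\<psi> r) \<le> sqrt ((3/4)\<^sup>2 * \<psi> s)"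
          using r pos[OF Suc.prems(1)] by (intro real_sqrt_le_mono) (simp add: power2_eq_square)
        also have "\<dots> = 3/4 * sqrt (\<psi> s)"
          by (simp add: real_sqrt_mult)
        finally have "K * sqrt (\<psi> r) \<le> K * (3/4 * sqrt (\<psi> s))"
          using K by (rule mult_left_mono)
        then show "4 * K * sqrt (\<psi> r) + K * sqrt (\<psi> s) \<le> 4 * K * sqrt (\<psi> s)" by simp
      qed
      finally show ?thesis .
    qed
  qed
  moreover obtain n where "\<psi> s / \<psi> a < 2 ^ n"
    using real_arch_pow[of 2 "\<psi> s / \<psi> a"] by auto
  then have "\<psi> s \<le> 2 ^ n * \<psi> a"
    using pos[of a] by (simp add: field_simps)
  ultimately show ?thesis using s by blast
qed

text \<open>The support is bounded away from \<open>0\<close> to start the halving argument at the point \<open>a\<close>; no constant depends on \<open>a\<close>.\<close>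

locale pick_measure = pick_function +
  fixes m :: "real measure" and a c :: real
  assumes sets_m [measurable_cong]: "sets m = sets borel"
    and a_pos: "0 < a" and support: "AE s in m. a < s" and c_nonneg: "0 \<le> c"
    and poisson: "\<And>w. 0 < w \<Longrightarrow> (\<integral>\<^sup>+s. ennreal (w / (w + s)\<^sup>2) \<partial>m) \<le> ennreal (c / E w)"
begin

text \<open>The Poisson kernel \<open>w / (w + s)\<^sup>2\<close> is at least \<open>1 / (4 w)\<close> for \<open>s \<le> w\<close>, and at least \<open>w / (4 s\<^sup>2)\<close> for \<open>s > w\<close> in
  the lemma after this one.\<close>

lemma emeasure_le:
  assumes w: "0 < w"
  shows "emeasure m {0<..w} \<le> ennreal (4 * c / \<phi> w)"
proof -
  have "ennreal (1 / (4 * w)) * emeasure m {0<..w} = (\<integral>\<^sup>+s. ennreal (1 / (4 * w)) * indicator {0<..w} s \<partial>m)"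
    by (simp add: nn_integral_cmult_indicator)
  also have "\<dots> \<le> (\<integral>\<^sup>+s. ennreal (w / (w + s)\<^sup>2) \<partial>m)"
  proof (rule nn_integral_mono)
    fix s
    show "ennreal (1 / (4 * w)) * indicator {0<..w} s \<le> ennreal (w / (w + s)\<^sup>2)"
    proof (cases "s \<in> {0<..w}")
      case True
      then have "(w + s)\<^sup>2 \<le> (2 * w)\<^sup>2" by (intro power_mono) auto
      moreover have "0 < (w + s)\<^sup>2" using True w by (intro zero_less_power) auto
      ultimately have "w / (2 * w)\<^sup>2 \<le> w / (w + s)\<^sup>2"
        using w True by (intro divide_left_mono mult_pos_pos zero_less_power) auto
      also have "w / (2 * w)\<^sup>2 = 1 / (4 * w)" using w by (simp add: power2_eq_square)
      finally show ?thesis using True by (simp add: ennreal_leI)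
    qed simp
  qed
  also have "\<dots> \<le> ennreal (c / E w)" by (rule poisson[OF w])
  finally have "ennreal (4 * w) * (ennreal (1 / (4 * w)) * emeasure m {0<..w}) \<le> ennreal (4 * w) * ennreal (c / E w)"
    by (intro mult_left_mono) auto
  moreover have "ennreal (4 * w) * ennreal (1 / (4 * w)) = 1"
    using w by (simp flip: ennreal_mult)
  moreover have "ennreal (4 * w) * ennreal (c / E w) = ennreal (4 * c / \<phi> w)"
    using w c_nonneg E_pos[OF w] by (simp add: \<phi>_def mult_ac flip: ennreal_mult)
  ultimately show ?thesis by (simp add: mult.assoc[symmetric])
qed

lemma tail_le:
  assumes w: "0 < w"
  shows "(\<integral>\<^sup>+s. ennreal (1 / s\<^sup>2) * indicator {w<..} s \<partial>m) \<le> ennreal (4 * c / \<psi> w)"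
proof -
  have "ennreal (w / 4) * (\<integral>\<^sup>+s. ennreal (1 / s\<^sup>2) * indicator {w<..} s \<partial>m) =
      (\<integral>\<^sup>+s. ennreal (w / 4) * (ennreal (1 / s\<^sup>2) * indicator {w<..} s) \<partial>m)"
    by (rule nn_integral_cmult[symmetric]) measurable
  also have "\<dots> \<le> (\<integral>\<^sup>+s. ennreal (w / (w + s)\<^sup>2) \<partial>m)"
  proof (rule nn_integral_mono)
    fix s
    show "ennreal (w / 4) * (ennreal (1 / s\<^sup>2) * indicator {w<..} s) \<le> ennreal (w / (w + s)\<^sup>2)"
    proof (cases "w < s")
      case True
      then have "(w + s)\<^sup>2 \<le> (2 * s)\<^sup>2" using w by (intro power_mono) auto
      moreover have "0 < (w + s)\<^sup>2" using True w by (intro zero_less_power) auto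
      ultimately have "w / (2 * s)\<^sup>2 \<le> w / (w + s)\<^sup>2"
        using w True by (intro divide_left_mono mult_pos_pos zero_less_power) auto
      moreover have "w / (2 * s)\<^sup>2 = (w / 4) * (1 / s\<^sup>2)" by (simp add: power2_eq_square)
      ultimately show ?thesis using True w by (simp add: ennreal_leI flip: ennreal_mult)
    qed simp
  qed
  also have "\<dots> \<le> ennreal (c / E w)" by (rule poisson[OF w])
  finally have "ennreal (4 / w) * (ennreal (w / 4) * (\<integral>\<^sup>+s. ennreal (1 / s\<^sup>2) * indicator {w<..} s \<partial>m))
      \<le> ennreal (4 / w) * ennreal (c / E w)"
    by (intro mult_left_mono) auto
  moreover have "ennreal (4 / w) * ennreal (w / 4) = 1"
    using w by (simp flip: ennreal_mult)
  moreover have "ennreal (4 / w) * ennreal (c / E w) = ennreal (4 * c / \<psi> w)"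
    using w c_nonneg E_pos[OF w] by (simp add: \<psi>_def flip: ennreal_mult)
  ultimately show ?thesis by (simp add: mult.assoc[symmetric])
qed

text \<open>\<open>N\<close> is the part of a row of the Schur test before the diagonal, with the denominator \<open>s + t\<close> omitted. When \<open>s\<close>
  changes, the change of \<open>d t s\<close> is bounded independently of \<open>t\<close>, and \<open>A\<close> is the factor left over.\<close>

definition A :: "real \<Rightarrow> ennreal"
  where "A s = (\<integral>\<^sup>+t. ennreal (sqrt (\<phi> t)) * indicator {0<..s} t \<partial>m)"

definition N :: "real \<Rightarrow> ennreal"
  where "N s = (\<integral>\<^sup>+t. ennreal (d t s * sqrt (\<phi> t)) * indicator {0<..s} t \<partial>m)"

lemma null_below:
  "s \<le> a \<Longrightarrow> (\<integral>\<^sup>+t. f t * indicator {0<..s} t \<partial>m) = 0"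
proof -
  assume s: "s \<le> a"
  have "(\<integral>\<^sup>+t. f t * indicator {0<..s} t \<partial>m) = (\<integral>\<^sup>+t. 0 \<partial>m)"
    by (intro nn_integral_cong_AE eventually_mono[OF support]) (use s in auto)
  then show ?thesis by simp
qed

lemma split_interval:
  assumes "r \<le> s" "0 < r" and [measurable]: "f \<in> borel_measurable borel"
  shows "(\<integral>\<^sup>+t. f t * indicator {0<..s} t \<partial>m) =
    (\<integral>\<^sup>+t. f t * indicator {0<..r} t \<partial>m) + (\<integral>\<^sup>+t. f t * indicator {r<..s} t \<partial>m)"
  using assms(1,2) by (subst nn_integral_add[symmetric]) (auto intro!: nn_integral_cong simp: indicator_def)

text \<open>Halving with \<open>1 / \<phi>\<close>: on each scale \<open>\<phi>\<close> is essentially constant and \<open>emeasure_le\<close> bounds the mass.\<close>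

lemma A_le:
  assumes s: "a \<le> s"
  shows "A s \<le> ennreal (32 * c / sqrt (\<phi> s))"
proof -
  have "A s \<le> ennreal (4 * (8 * c) * sqrt (1 / \<phi> s))"
  proof (rule halving_bound[where \<psi> = "\<lambda>s. 1 / \<phi> s"])
    show "continuous_on {a..} (\<lambda>s. 1 / \<phi> s)"
    proof -
      have ne: "E s \<noteq> 0" if "a \<le> s" for s
        using E_pos[of s] a_pos that by simp
      show ?thesis
        unfolding \<phi>_def[abs_def]
        by (intro continuous_intros continuous_on_subset[OF continuous_E]) (use a_pos ne in auto)
    qed
    show "0 < 1 / \<phi> s" if "a \<le> s" for s
      using a_pos that \<phi>_pos[of s] by simp
    show "1 / \<phi> r \<le> 1 / \<phi> s" if "a \<le> r" "r \<le> s" for r s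
      using a_pos that \<phi>_antimono[of r s] \<phi>_pos[of r] \<phi>_pos[of s] by (intro divide_left_mono) auto
    show "A a = 0" by (simp add: A_def null_below)
    show "A s \<le> A r + ennreal (8 * c * sqrt (1 / \<phi> s))" if rs: "a \<le> r" "r \<le> s" "1 / \<phi> s \<le> 2 * (1 / \<phi> r)" for r s
    proof -
      have pos: "0 < r" "0 < s" using rs a_pos by auto
      have \<phi>r: "\<phi> r \<le> 4 * \<phi> s" using rs(3) \<phi>_pos[OF pos(1)] \<phi>_pos[OF pos(2)] by (simp add: field_simps)
      have "A s = A r + (\<integral>\<^sup>+t. ennreal (sqrt (\<phi> t)) * indicator {r<..s} t \<partial>m)"
        unfolding A_def by (rule split_interval) (use rs pos in auto)
      also have "(\<integral>\<^sup>+t. ennreal (sqrt (\<phi> t)) * indicator {r<..s} t \<partial>m) \<le>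
          (\<integral>\<^sup>+t. ennreal (2 * sqrt (\<phi> s)) * indicator {0<..s} t \<partial>m)"
      proof (intro nn_integral_mono)
        fix t
        show "ennreal (sqrt (\<phi> t)) * indicator {r<..s} t \<le> ennreal (2 * sqrt (\<phi> s)) * indicator {0<..s} t"
        proof (cases "t \<in> {r<..s}")
          case True
          then have "\<phi> t \<le> 4 * \<phi> s" using \<phi>_antimono[of r t] \<phi>r pos by auto
          then have "sqrt (\<phi> t) \<le> sqrt (4 * \<phi> s)" by (rule real_sqrt_le_mono)
          also have "\<dots> = 2 * sqrt (\<phi> s)" by (simp add: real_sqrt_mult)
          finally show ?thesis using True pos by (simp add: ennreal_leI)
        qed simp
      qed
      also have "\<dots> = ennreal (2 * sqrt (\<phi> s)) * emeasure m {0<..s}"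
        by (simp add: nn_integral_cmult_indicator)
      also have "\<dots> \<le> ennreal (2 * sqrt (\<phi> s)) * ennreal (4 * c / \<phi> s)"
        by (intro mult_left_mono emeasure_le pos) simp
      also have "\<dots> = ennreal (8 * c * sqrt (1 / \<phi> s))"
      proof -
        define q where "q = sqrt (\<phi> s)"
        have q: "0 < q" "\<phi> s = q * q" using \<phi>_pos[OF pos(2)] by (auto simp: q_def)
        have "2 * sqrt (\<phi> s) * (4 * c / \<phi> s) = 8 * c * sqrt (1 / \<phi> s)"
          using q by (simp add: real_sqrt_divide)
        then show ?thesis
          using q c_nonneg by (simp flip: ennreal_mult)
      qed
      finally show ?thesis by (simp add: add_left_mono)
    qed
  qed (use s c_nonneg in auto)
  then show ?thesis by (simp add: real_sqrt_divide)
qed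

text \<open>Halving with \<open>\<psi>\<close>. From \<open>r\<close> to \<open>s\<close>, the old part of the integral changes by \<open>\<bar>u s - u r\<bar> * A r\<close>, and on the new part
  \<open>d_near\<close> and \<open>tail_le\<close> apply.\<close>

lemma N_le:
  assumes s: "0 < s"
  shows "N s \<le> ennreal (192 * c * sqrt (\<psi> s))"
proof (cases "s \<le> a")
  case True
  then show ?thesis by (simp add: N_def null_below)
next
  case False
  have "N s \<le> ennreal (4 * (48 * c) * sqrt (\<psi> s))"
  proof (rule halving_bound[where \<psi> = \<psi>])
    show "continuous_on {a..} \<psi>"
      unfolding \<psi>_def[abs_def]
      by (intro continuous_intros continuous_on_subset[OF continuous_E]) (use a_pos in auto)
    show "0 < \<psi> s" if "a \<le> s" for s
      using a_pos that \<psi>_pos[of s] by simp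
    show "\<psi> r \<le> \<psi> s" if "a \<le> r" "r \<le> s" for r s
      using a_pos that \<psi>_mono[of r s] by simp
    show "N a = 0" by (simp add: N_def null_below)
    show "N s \<le> N r + ennreal (48 * c * sqrt (\<psi> s))" if rs: "a \<le> r" "r \<le> s" "\<psi> s \<le> 2 * \<psi> r" for r s
    proof -
      have pos: "0 < r" "0 < s" using rs a_pos by auto
      have \<psi>rs: "\<psi> r \<le> \<psi> s" "0 < \<psi> r" "0 < \<psi> s" using \<psi>_mono rs pos \<psi>_pos by auto
      have "N s = (\<integral>\<^sup>+t. ennreal (d t s * sqrt (\<phi> t)) * indicator {0<..r} t \<partial>m) +
          (\<integral>\<^sup>+t. ennreal (d t s * sqrt (\<phi> t)) * indicator {r<..s} t \<partial>m)"
        unfolding N_def by (rule split_interval) (use rs pos in auto)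
      also have "\<dots> \<le> (N r + ennreal (32 * c * sqrt (\<psi> s))) + ennreal (16 * c * sqrt (\<psi> s))"
      proof (rule add_mono)
        have "(\<integral>\<^sup>+t. ennreal (d t s * sqrt (\<phi> t)) * indicator {0<..r} t \<partial>m) \<le>
            (\<integral>\<^sup>+t. ennreal (d t r * sqrt (\<phi> t)) * indicator {0<..r} t +
              ennreal (\<psi> r / r) * (ennreal (sqrt (\<phi> t)) * indicator {0<..r} t) \<partial>m)"
        proof (intro nn_integral_mono)
          fix t
          show "ennreal (d t s * sqrt (\<phi> t)) * indicator {0<..r} t \<le>
            ennreal (d t r * sqrt (\<phi> t)) * indicator {0<..r} t +
              ennreal (\<psi> r / r) * (ennreal (sqrt (\<phi> t)) * indicator {0<..r} t)"
          proof (cases "t \<in> {0<..r}")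
            case True
            have "d t s \<le> d t r + \<psi> r / r"
              using d_triangle[of t s r] u_increment[OF pos(1) rs(2,3)] True by simp
            then have "d t s * sqrt (\<phi> t) \<le> (d t r + \<psi> r / r) * sqrt (\<phi> t)"
              using \<phi>_pos[of t] True by (intro mult_right_mono) auto
            then have "ennreal (d t s * sqrt (\<phi> t)) \<le> ennreal (d t r * sqrt (\<phi> t) + \<psi> r / r * sqrt (\<phi> t))"
              by (simp add: ennreal_leI distrib_right)
            also have "\<dots> = ennreal (d t r * sqrt (\<phi> t)) + ennreal (\<psi> r / r * sqrt (\<phi> t))"
              using \<phi>_pos[of t] True \<psi>rs pos by (intro ennreal_plus mult_nonneg_nonneg) auto
            also have "ennreal (\<psi> r / r * sqrt (\<phi> t)) = ennreal (\<psi> r / r) * ennreal (sqrt (\<phi> t))"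
              using \<phi>_pos[of t] True \<psi>rs pos by (intro ennreal_mult) auto
            finally show ?thesis using True by simp
          qed simp
        qed
        also have "\<dots> = N r + ennreal (\<psi> r / r) * A r"
          unfolding N_def A_def by (subst nn_integral_add) (auto simp: nn_integral_cmult)
        also have "\<dots> \<le> N r + ennreal (\<psi> r / r) * ennreal (32 * c / sqrt (\<phi> r))"
          by (intro add_left_mono mult_left_mono A_le rs) simp
        also have "ennreal (\<psi> r / r) * ennreal (32 * c / sqrt (\<phi> r)) = ennreal (32 * c * sqrt (\<psi> r))"
        proof -
          define q where "q = sqrt (\<phi> r)"
          have q: "0 < q" "\<psi> r = (r * q) * (r * q)" "sqrt (\<psi> r) = r * q"
            using \<phi>_pos[OF pos(1)] sqrt_\<psi>[OF pos(1)] \<psi>rs by (auto simp: q_def) (metis real_sqrt_mult_self abs_of_pos)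
          have "\<psi> r / r * (32 * c / q) = 32 * c * sqrt (\<psi> r)"
            unfolding q(3) unfolding q(2) using q(1) pos by simp
          then show ?thesis
            using q \<psi>rs pos c_nonneg by (simp add: q_def flip: ennreal_mult)
        qed
        also have "\<dots> \<le> ennreal (32 * c * sqrt (\<psi> s))"
          using c_nonneg \<psi>rs by (intro ennreal_leI mult_left_mono) auto
        finally show "(\<integral>\<^sup>+t. ennreal (d t s * sqrt (\<phi> t)) * indicator {0<..r} t \<partial>m) \<le> N r + ennreal (32 * c * sqrt (\<psi> s))"
          by (simp add: add_left_mono)
        define q where "q = sqrt (\<psi> s)"
        have q: "0 < q" "\<psi> s = q * q" using \<psi>rs by (auto simp: q_def)
        have "(\<integral>\<^sup>+t. ennreal (d t s * sqrt (\<phi> t)) * indicator {r<..s} t \<partial>m) \<le>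
            (\<integral>\<^sup>+t. ennreal (2 * \<psi> s * q) * (ennreal (1 / t\<^sup>2) * indicator {r<..} t) \<partial>m)"
        proof (intro nn_integral_mono)
          fix t
          show "ennreal (d t s * sqrt (\<phi> t)) * indicator {r<..s} t \<le> ennreal (2 * \<psi> s * q) * (ennreal (1 / t\<^sup>2) * indicator {r<..} t)"
          proof (cases "t \<in> {r<..s}")
            case True
            then have t: "0 < t" "t \<le> s" "r \<le> t" using pos by auto
            have "\<psi> r \<le> \<psi> t" "\<psi> t \<le> \<psi> s" using t pos by (auto intro: \<psi>_mono)
            then have "d t s \<le> 2 * \<psi> t / t" using rs by (intro d_near t) auto
            also have "\<dots> \<le> 2 * \<psi> s / t" using \<open>\<psi> t \<le> \<psi> s\<close> t by (intro divide_right_mono) auto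
            finally have 1: "d t s \<le> 2 * \<psi> s / t" .
            have "sqrt (\<phi> t) = sqrt (\<psi> t) / t" using t sqrt_\<psi>[OF t(1)] by simp
            also have "\<dots> \<le> q / t" unfolding q_def using \<open>\<psi> t \<le> \<psi> s\<close> t by (intro divide_right_mono) auto
            finally have "d t s * sqrt (\<phi> t) \<le> (2 * \<psi> s / t) * (q / t)"
              using 1 \<psi>rs t \<phi>_pos[of t] by (intro mult_mono) auto
            also have "\<dots> = (2 * \<psi> s * q) * (1 / t\<^sup>2)" by (simp add: power2_eq_square)
            finally show ?thesis
              using True t \<psi>rs q by (simp add: ennreal_leI flip: ennreal_mult)
          qed simp
        qed
        also have "\<dots> = ennreal (2 * \<psi> s * q) * (\<integral>\<^sup>+t. ennreal (1 / t\<^sup>2) * indicator {r<..} t \<partial>m)"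
          by (rule nn_integral_cmult) measurable
        also have "\<dots> \<le> ennreal (2 * \<psi> s * q) * ennreal (4 * c / \<psi> r)"
          by (intro mult_left_mono tail_le pos) simp
        also have "\<dots> \<le> ennreal (16 * c * sqrt (\<psi> s))"
        proof -
          have "\<psi> s / \<psi> r \<le> 2" using rs(3) \<psi>rs by (simp add: field_simps)
          then have "(8 * c * q) * (\<psi> s / \<psi> r) \<le> (8 * c * q) * 2"
            using c_nonneg q by (intro mult_left_mono) auto
          then have "2 * \<psi> s * q * (4 * c / \<psi> r) \<le> 16 * c * sqrt (\<psi> s)"
            by (simp add: q_def mult_ac)
          then show ?thesis
            using q \<psi>rs c_nonneg by (simp add: ennreal_leI flip: ennreal_mult)
        qed
        finally show "(\<integral>\<^sup>+t. ennreal (d t s * sqrt (\<phi> t)) * indicator {r<..s} t \<partial>m) \<le> ennreal (16 * c * sqrt (\<psi> s))" .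
      qed
      also have "\<dots> = N r + ennreal (48 * c * sqrt (\<psi> s))"
        using c_nonneg \<psi>rs by (simp add: add.assoc flip: ennreal_plus)
      finally show ?thesis .
    qed
  qed (use False c_nonneg in auto)
  then show ?thesis by simp
qed

end

text \<open>The substitution \<open>s \<mapsto> 1 / s\<close> exchanges \<open>\<phi>\<close> and \<open>\<psi>\<close> and preserves the Poisson bound for the measure
  \<open>s\<^sup>-\<^sup>2 d\<mu>\<close>, so that the bound below the diagonal also gives the one above it.\<close>

lemma (in pick_measure) N_le_above:
  assumes b: "0 < b" "AE s in m. s < b" and \<sigma>: "0 < \<sigma>"
  shows "(\<integral>\<^sup>+t. ennreal (d t \<sigma> * (sqrt (\<phi> t) / t)) * indicator {\<sigma>..} t \<partial>m) \<le> ennreal (192 * c * sqrt (\<phi> \<sigma>))"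
proof -
  define v where "v s = u (1 / s)" for s
  \<comment> \<open>the support of \<open>m\<close> lies below \<open>b\<close>, that of its image above \<open>1 / b\<close>\<close>
  define m' where "m' = distr (density m (\<lambda>s. ennreal (1 / s\<^sup>2))) borel (\<lambda>s. 1 / s)"
  interpret inv: pick_function v
  proof
    show "v \<in> borel_measurable borel" unfolding v_def[abs_def] by measurable
    show "continuous_on {0<..} v"
      unfolding v_def[abs_def]
      by (rule continuous_on_compose2[OF u_cont]) (auto intro!: continuous_intros)
    show "cmod (v s) < 1" if "0 < s" for s
      using u_less[of "1 / s"] that by (simp add: v_def)
    show "4 * s * t * (cmod (1 - cnj (v t) * v s))\<^sup>2 \<le> (s + t)\<^sup>2 * ((1 - (cmod (v s))\<^sup>2) * (1 - (cmod (v t))\<^sup>2))"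
      if st: "0 < s" "0 < t" for s t
    proof -
      have "(s * t)\<^sup>2 * (4 * (1 / s) * (1 / t) * (cmod (1 - cnj (v t) * v s))\<^sup>2) \<le>
          (s * t)\<^sup>2 * ((1 / s + 1 / t)\<^sup>2 * ((1 - (cmod (v s))\<^sup>2) * (1 - (cmod (v t))\<^sup>2)))"
        using pick[of "1 / s" "1 / t"] st unfolding v_def by (intro mult_left_mono) auto
      moreover have "(s * t)\<^sup>2 * (4 * (1 / s) * (1 / t) * X) = 4 * s * t * X" for X
        using st by (simp add: power2_eq_square)
      moreover have "(s * t)\<^sup>2 * ((1 / s + 1 / t)\<^sup>2 * X) = (s + t)\<^sup>2 * X" for X
      proof -
        have "s * t * (1 / s + 1 / t) = s + t" using st by (simp add: distrib_left)
        then show ?thesis by (metis mult.assoc power_mult_distrib)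
      qed
      ultimately show ?thesis by simp
    qed
  qed
  have invE: "inv.E s = E (1 / s)" for s by (simp add: inv.E_def E_def v_def)
  have invd: "inv.d t s = d (1 / t) (1 / s)" for s t by (simp add: inv.d_def d_def v_def)
  have nn: "(\<integral>\<^sup>+s. f s \<partial>m') = (\<integral>\<^sup>+t. ennreal (1 / t\<^sup>2) * f (1 / t) \<partial>m)"
    if [measurable]: "f \<in> borel_measurable borel" for f
    unfolding m'_def by (simp add: nn_integral_distr nn_integral_density)
  interpret inv: pick_measure v m' "1 / b" c
  proof
    show "sets m' = sets borel" by (simp add: m'_def)
    show "0 < 1 / b" using b by simp
    show "0 \<le> c" by (rule c_nonneg)
    show "AE s in m'. 1 / b < s"
      unfolding m'_def
    proof (subst AE_distr_iff)
      show "AE x in density m (\<lambda>s. ennreal (1 / s\<^sup>2)). 1 / b < 1 / x"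
      proof (subst AE_density)
        show "AE x in m. 0 < ennreal (1 / x\<^sup>2) \<longrightarrow> 1 / b < 1 / x"
          using b(2) support by eventually_elim (use a_pos b in \<open>auto simp: frac_less2\<close>)
      qed measurable
    qed measurable
    show "(\<integral>\<^sup>+s. ennreal (w / (w + s)\<^sup>2) \<partial>m') \<le> ennreal (c / inv.E w)" if w: "0 < w" for w
    proof -
      have "(\<integral>\<^sup>+s. ennreal (w / (w + s)\<^sup>2) \<partial>m') = (\<integral>\<^sup>+t. ennreal (1 / t\<^sup>2) * ennreal (w / (w + 1 / t)\<^sup>2) \<partial>m)"
        by (rule nn) measurable
      also have "\<dots> = (\<integral>\<^sup>+t. ennreal ((1 / w) / (1 / w + t)\<^sup>2) \<partial>m)"
      proof (intro nn_integral_cong_AE eventually_mono[OF support])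
        fix t assume "a < t"
        then have t: "0 < t" using a_pos by simp
        have "t * (w + 1 / t) = w * (1 / w + t)" using t w by (simp add: field_simps)
        then have "t\<^sup>2 * (w + 1 / t)\<^sup>2 = w\<^sup>2 * (1 / w + t)\<^sup>2" by (metis power_mult_distrib)
        then have "w / (t\<^sup>2 * (w + 1 / t)\<^sup>2) = w / (w\<^sup>2 * (1 / w + t)\<^sup>2)" by simp
        also have "\<dots> = (1 / w) / (1 / w + t)\<^sup>2" using w by (simp add: power2_eq_square)
        finally show "ennreal (1 / t\<^sup>2) * ennreal (w / (w + 1 / t)\<^sup>2) = ennreal ((1 / w) / (1 / w + t)\<^sup>2)"
          using t w by (simp flip: ennreal_mult)
      qed
      also have "\<dots> \<le> ennreal (c / E (1 / w))" using w by (intro poisson) simp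
      finally show ?thesis by (simp add: invE)
    qed
  qed
  have "(\<integral>\<^sup>+t. ennreal (d t \<sigma> * (sqrt (\<phi> t) / t)) * indicator {\<sigma>..} t \<partial>m) = inv.N (1 / \<sigma>)"
    unfolding inv.N_def
  proof (subst nn)
    show "(\<integral>\<^sup>+t. ennreal (d t \<sigma> * (sqrt (\<phi> t) / t)) * indicator {\<sigma>..} t \<partial>m) =
        (\<integral>\<^sup>+t. ennreal (1 / t\<^sup>2) * (ennreal (inv.d (1 / t) (1 / \<sigma>) * sqrt (inv.\<phi> (1 / t))) * indicator {0<..1 / \<sigma>} (1 / t)) \<partial>m)"
    proof (intro nn_integral_cong_AE eventually_mono[OF support])
      fix t assume "a < t"
      then have t: "0 < t" using a_pos by simp
      have "inv.\<phi> (1 / t) = t\<^sup>2 * \<phi> t" using t by (simp add: inv.\<phi>_def \<phi>_def invE power2_eq_square)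
      then have "sqrt (inv.\<phi> (1 / t)) = t * sqrt (\<phi> t)" using t by (simp add: real_sqrt_mult)
      then have "(1 / t\<^sup>2) * (inv.d (1 / t) (1 / \<sigma>) * sqrt (inv.\<phi> (1 / t))) = d t \<sigma> * (sqrt (\<phi> t) / t)"
        using t by (simp add: invd power2_eq_square)
      moreover have "indicator {0<..1 / \<sigma>} (1 / t) = (indicator {\<sigma>..} t :: ennreal)"
        using t \<sigma> by (auto simp: indicator_def field_simps)
      moreover have "0 \<le> sqrt (inv.\<phi> (1 / t))"
        using inv.\<phi>_pos[of "1 / t"] t by simp
      ultimately show "ennreal (d t \<sigma> * (sqrt (\<phi> t) / t)) * indicator {\<sigma>..} t =
          ennreal (1 / t\<^sup>2) * (ennreal (inv.d (1 / t) (1 / \<sigma>) * sqrt (inv.\<phi> (1 / t))) * indicator {0<..1 / \<sigma>} (1 / t))"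
        by (simp add: mult.assoc[symmetric] flip: ennreal_mult)
    qed
  qed measurable
  also have "\<dots> \<le> ennreal (192 * c * sqrt (inv.\<psi> (1 / \<sigma>)))"
    using \<sigma> by (intro inv.N_le) simp
  also have "inv.\<psi> (1 / \<sigma>) = \<phi> \<sigma>" by (simp add: inv.\<psi>_def \<phi>_def invE)
  finally show ?thesis .
qed

text \<open>Replace \<open>s + t\<close> by the larger of the two, and use \<open>N_le\<close> for \<open>t \<le> s\<close> and \<open>N_le_above\<close> for \<open>t \<ge> s\<close>.\<close>

lemma (in pick_measure) schur_row:
  assumes b: "0 < b" "AE s in m. s < b" and s: "0 < s"
  shows "(\<integral>\<^sup>+t. ennreal (d t s / (s + t) * sqrt (\<phi> t)) \<partial>m) \<le> ennreal (384 * c * sqrt (\<phi> s))"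
proof -
  have "(\<integral>\<^sup>+t. ennreal (d t s / (s + t) * sqrt (\<phi> t)) \<partial>m) \<le>
      (\<integral>\<^sup>+t. ennreal (1 / s) * (ennreal (d t s * sqrt (\<phi> t)) * indicator {0<..s} t) +
        ennreal (d t s * (sqrt (\<phi> t) / t)) * indicator {s..} t \<partial>m)"
  proof (intro nn_integral_mono_AE eventually_mono[OF support])
    fix t assume "a < t"
    then have t: "0 < t" using a_pos by simp
    have nonneg: "0 \<le> d t s * sqrt (\<phi> t)" using \<phi>_pos[OF t] by simp
    show "ennreal (d t s / (s + t) * sqrt (\<phi> t)) \<le>
      ennreal (1 / s) * (ennreal (d t s * sqrt (\<phi> t)) * indicator {0<..s} t) +
        ennreal (d t s * (sqrt (\<phi> t) / t)) * indicator {s..} t"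
    proof (cases "t \<le> s")
      case True
      have "d t s / (s + t) * sqrt (\<phi> t) = (d t s * sqrt (\<phi> t)) / (s + t)" by simp
      also have "\<dots> \<le> (d t s * sqrt (\<phi> t)) / s"
        using nonneg s t by (intro divide_left_mono) auto
      finally have "ennreal (d t s / (s + t) * sqrt (\<phi> t)) \<le> ennreal (1 / s * (d t s * sqrt (\<phi> t)))"
        by (intro ennreal_leI) simp
      also have "\<dots> = ennreal (1 / s) * ennreal (d t s * sqrt (\<phi> t))"
        using s nonneg by (intro ennreal_mult) auto
      finally show ?thesis using True t by (simp add: add_increasing2)
    next
      case False
      have "d t s / (s + t) * sqrt (\<phi> t) = (d t s * sqrt (\<phi> t)) / (s + t)" by simp
      also have "\<dots> \<le> (d t s * sqrt (\<phi> t)) / t"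
        using nonneg s t by (intro divide_left_mono) auto
      finally show ?thesis using False by (simp add: ennreal_leI)
    qed
  qed
  also have "\<dots> = ennreal (1 / s) * N s + (\<integral>\<^sup>+t. ennreal (d t s * (sqrt (\<phi> t) / t)) * indicator {s..} t \<partial>m)"
    unfolding N_def by (subst nn_integral_add) (auto simp: nn_integral_cmult)
  also have "\<dots> \<le> ennreal (1 / s) * ennreal (192 * c * sqrt (\<psi> s)) + ennreal (192 * c * sqrt (\<phi> s))"
    by (intro add_mono mult_left_mono N_le N_le_above[OF b] s) simp
  also have "ennreal (1 / s) * ennreal (192 * c * sqrt (\<psi> s)) = ennreal (192 * c * sqrt (\<phi> s))"
    using s c_nonneg \<phi>_pos[OF s] by (simp add: sqrt_\<psi> flip: ennreal_mult)
  also have "ennreal (192 * c * sqrt (\<phi> s)) + ennreal (192 * c * sqrt (\<phi> s)) = ennreal (384 * c * sqrt (\<phi> s))"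
    using c_nonneg \<phi>_pos[OF s] by (simp flip: ennreal_plus)
  finally show ?thesis .
qed

text \<open>By the inequality of arithmetic and geometric means,
  \<open>2 * F s * F t \<le> (F s)\<^sup>2 * p t / p s + (F t)\<^sup>2 * p s / p t\<close>; integrate against the symmetric kernel and use the row bound.\<close>

lemma schur_test:
  fixes k :: "real \<Rightarrow> real \<Rightarrow> real" and p F :: "real \<Rightarrow> real"
  assumes m: "sigma_finite_measure m" and [measurable_cong]: "sets m = sets borel"
    and [measurable]: "(\<lambda>(s, t). k s t) \<in> borel_measurable (borel \<Otimes>\<^sub>M borel)" "p \<in> borel_measurable borel" "F \<in> borel_measurable borel"
    and pos: "AE s in m. 0 < p s" and k_nonneg: "AE s in m. AE t in m. 0 \<le> k s t" and sym: "\<And>s t. k s t = k t s"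
    and F: "\<And>s. 0 \<le> F s" and C: "0 \<le> C"
    and row: "AE s in m. (\<integral>\<^sup>+t. ennreal (k s t * p t) \<partial>m) \<le> ennreal (C * p s)"
  shows "(\<integral>\<^sup>+s. \<integral>\<^sup>+t. ennreal (F s * F t * k s t) \<partial>m \<partial>m) \<le> ennreal C * (\<integral>\<^sup>+s. ennreal ((F s)\<^sup>2) \<partial>m)"
proof -
  interpret mm: pair_sigma_finite m m using m by (simp add: pair_sigma_finite_def)
  define X where "X s t = ennreal (1/2 * (F s)\<^sup>2 / p s) * ennreal (k s t * p t)" for s t
  have [measurable]: "(\<lambda>(s, t). X s t) \<in> borel_measurable (m \<Otimes>\<^sub>M m)"
    unfolding X_def by measurable
  have half: "(\<integral>\<^sup>+s. \<integral>\<^sup>+t. X s t \<partial>m \<partial>m) \<le> ennreal (C/2) * (\<integral>\<^sup>+s. ennreal ((F s)\<^sup>2) \<partial>m)"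
  proof -
    have "(\<integral>\<^sup>+s. \<integral>\<^sup>+t. X s t \<partial>m \<partial>m) = (\<integral>\<^sup>+s. ennreal (1/2 * (F s)\<^sup>2 / p s) * (\<integral>\<^sup>+t. ennreal (k s t * p t) \<partial>m) \<partial>m)"
      unfolding X_def by (intro nn_integral_cong nn_integral_cmult) measurable
    also have "\<dots> \<le> (\<integral>\<^sup>+s. ennreal (C/2) * ennreal ((F s)\<^sup>2) \<partial>m)"
    proof (intro nn_integral_mono_AE)
      show "AE s in m. ennreal (1/2 * (F s)\<^sup>2 / p s) * (\<integral>\<^sup>+t. ennreal (k s t * p t) \<partial>m) \<le> ennreal (C/2) * ennreal ((F s)\<^sup>2)"
        using row pos
      proof eventually_elim
        fix s assume r: "(\<integral>\<^sup>+t. ennreal (k s t * p t) \<partial>m) \<le> ennreal (C * p s)" and p: "0 < p s"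
        have "ennreal (1/2 * (F s)\<^sup>2 / p s) * (\<integral>\<^sup>+t. ennreal (k s t * p t) \<partial>m) \<le>
            ennreal (1/2 * (F s)\<^sup>2 / p s) * ennreal (C * p s)"
          by (intro mult_left_mono r) simp
        also have "\<dots> = ennreal ((1/2 * (F s)\<^sup>2 / p s) * (C * p s))"
          using p C by (intro ennreal_mult[symmetric]) auto
        also have "(1/2 * (F s)\<^sup>2 / p s) * (C * p s) = (C/2) * (F s)\<^sup>2"
          using p by simp
        also have "ennreal \<dots> = ennreal (C/2) * ennreal ((F s)\<^sup>2)"
          using C by (intro ennreal_mult) auto
        finally show "ennreal (1/2 * (F s)\<^sup>2 / p s) * (\<integral>\<^sup>+t. ennreal (k s t * p t) \<partial>m) \<le> ennreal (C/2) * ennreal ((F s)\<^sup>2)" .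
      qed
    qed
    also have "\<dots> = ennreal (C/2) * (\<integral>\<^sup>+s. ennreal ((F s)\<^sup>2) \<partial>m)"
      by (rule nn_integral_cmult) measurable
    finally show ?thesis .
  qed
  have "(\<integral>\<^sup>+s. \<integral>\<^sup>+t. ennreal (F s * F t * k s t) \<partial>m \<partial>m) \<le> (\<integral>\<^sup>+s. \<integral>\<^sup>+t. X s t + X t s \<partial>m \<partial>m)"
  proof (intro nn_integral_mono_AE)
    show "AE s in m. (\<integral>\<^sup>+t. ennreal (F s * F t * k s t) \<partial>m) \<le> (\<integral>\<^sup>+t. X s t + X t s \<partial>m)"
      using pos k_nonneg
    proof eventually_elim
      fix s assume ps: "0 < p s" and ks: "AE t in m. 0 \<le> k s t"
      show "(\<integral>\<^sup>+t. ennreal (F s * F t * k s t) \<partial>m) \<le> (\<integral>\<^sup>+t. X s t + X t s \<partial>m)"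
      proof (intro nn_integral_mono_AE)
        show "AE t in m. ennreal (F s * F t * k s t) \<le> X s t + X t s"
          using pos ks
        proof eventually_elim
          fix t assume pt: "0 < p t" and k: "0 \<le> k s t"
          have "0 \<le> (p t * F s - p s * F t)\<^sup>2" by simp
          then have "2 * (p s * p t) * (F s * F t) \<le> (p t * F s)\<^sup>2 + (p s * F t)\<^sup>2"
            by (simp add: power2_diff mult_ac)
          then have "F s * F t \<le> ((p t * F s)\<^sup>2 + (p s * F t)\<^sup>2) / (2 * (p s * p t))"
            using ps pt by (simp add: pos_le_divide_eq mult_ac)
          also have "\<dots> = 1/2 * (F s)\<^sup>2 / p s * p t + 1/2 * (F t)\<^sup>2 / p t * p s"
            using ps pt by (simp add: add_divide_distrib power_mult_distrib power2_eq_square mult_ac)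
          finally have "F s * F t * k s t \<le> (1/2 * (F s)\<^sup>2 / p s * p t + 1/2 * (F t)\<^sup>2 / p t * p s) * k s t"
            using k by (rule mult_right_mono)
          also have "\<dots> = (1/2 * (F s)\<^sup>2 / p s) * (k s t * p t) + (1/2 * (F t)\<^sup>2 / p t) * (k t s * p s)"
          proof -
            have "(x * p t + y * p s) * k s t = x * (k s t * p t) + y * (k s t * p s)" for x y
              by (simp add: algebra_simps)
            then show ?thesis unfolding sym[of t s] .
          qed
          finally have "ennreal (F s * F t * k s t) \<le>
              ennreal ((1/2 * (F s)\<^sup>2 / p s) * (k s t * p t) + (1/2 * (F t)\<^sup>2 / p t) * (k t s * p s))"
            by (rule ennreal_leI)
          also have "\<dots> = X s t + X t s"
          proof -
            have nn: "0 \<le> 1/2 * (F s)\<^sup>2 / p s" "0 \<le> k s t * p t" "0 \<le> 1/2 * (F t)\<^sup>2 / p t" "0 \<le> k t s * p s"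
              using ps pt k sym[of t s] by auto
            show ?thesis
              by (simp only: X_def ennreal_mult[OF nn(1,2)] ennreal_mult[OF nn(3,4)]
                  ennreal_plus[OF mult_nonneg_nonneg[OF nn(1,2)] mult_nonneg_nonneg[OF nn(3,4)]])
          qed
          finally show "ennreal (F s * F t * k s t) \<le> X s t + X t s" .
        qed
      qed
    qed
  qed
  also have "\<dots> = (\<integral>\<^sup>+s. \<integral>\<^sup>+t. X s t \<partial>m \<partial>m) + (\<integral>\<^sup>+s. \<integral>\<^sup>+t. X t s \<partial>m \<partial>m)"
    by (subst nn_integral_add[symmetric]) (auto intro!: nn_integral_cong nn_integral_add)
  also have "(\<integral>\<^sup>+s. \<integral>\<^sup>+t. X t s \<partial>m \<partial>m) = (\<integral>\<^sup>+s. \<integral>\<^sup>+t. X s t \<partial>m \<partial>m)"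
    by (rule mm.Fubini') measurable
  also have "(\<integral>\<^sup>+s. \<integral>\<^sup>+t. X s t \<partial>m \<partial>m) + (\<integral>\<^sup>+s. \<integral>\<^sup>+t. X s t \<partial>m \<partial>m) \<le>
      ennreal (C/2) * (\<integral>\<^sup>+s. ennreal ((F s)\<^sup>2) \<partial>m) + ennreal (C/2) * (\<integral>\<^sup>+s. ennreal ((F s)\<^sup>2) \<partial>m)"
    by (intro add_mono half)
  also have "\<dots> = ennreal C * (\<integral>\<^sup>+s. ennreal ((F s)\<^sup>2) \<partial>m)"
    using C by (simp add: distrib_right[symmetric] flip: ennreal_plus)
  finally show ?thesis .
qed

section \<open>The Hankel form as an integral of Laplace transforms\<close>

text \<open>The measure of the theorem lives on \<open>{0<..}\<close>; here it is carried over to the Borel sets of the real line.\<close>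

locale laplace_measure =
  fixes m :: "real measure" and h :: "real \<Rightarrow> real"
  assumes sets_m [measurable_cong]: "sets m = sets borel" and pos: "AE s in m. 0 < s"
    and h: "\<And>t. 0 < t \<Longrightarrow> has_bochner_integral m (\<lambda>s. exp (- (s * t))) (h t)"
begin

lemma emeasure_atMost_finite: "emeasure m {..r} < \<infinity>"
proof -
  have int: "integrable m (\<lambda>s. exp (- s))" using h[of 1] by (simp add: has_bochner_integral_iff)
  have "ennreal (exp (- r)) * emeasure m {..r} = (\<integral>\<^sup>+s. ennreal (exp (- r)) * indicator {..r} s \<partial>m)"
    by (simp add: nn_integral_cmult_indicator)
  also have "\<dots> \<le> (\<integral>\<^sup>+s. ennreal (exp (- s)) \<partial>m)"
    by (intro nn_integral_mono) (auto simp: indicator_def intro!: ennreal_leI)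
  also have "\<dots> < \<infinity>"
    using nn_integral_eq_integral[OF int] by simp
  finally have "ennreal (exp (- r)) * emeasure m {..r} < \<infinity>" .
  then show ?thesis
    by (auto simp: ennreal_mult_less_top less_top)
qed

lemma sigma_finite_m: "sigma_finite_measure m"
proof
  show "\<exists>A. countable A \<and> A \<subseteq> sets m \<and> \<Union> A = space m \<and> (\<forall>a\<in>A. emeasure m a \<noteq> \<infinity>)"
  proof (intro exI[of _ "range (\<lambda>n::nat. {..real n})"] conjI ballI)
    have "space m = UNIV" using sets_eq_imp_space_eq[OF sets_m] by simp
    moreover have "\<exists>n::nat. x \<le> real n" for x :: real by (rule real_arch_simple)
    ultimately show "\<Union> (range (\<lambda>n::nat. {..real n})) = space m" by auto
    show "emeasure m A \<noteq> \<infinity>" if "A \<in> range (\<lambda>n::nat. {..real n})" for A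
      using that emeasure_atMost_finite by (auto simp: less_le)
  qed auto
qed

text \<open>Extended by zero to a Borel function on the line.\<close>

definition real_laplace :: "(real \<Rightarrow> complex) \<Rightarrow> real \<Rightarrow> complex"
  where "real_laplace f s = indicator {0<..} s *\<^sub>R laplace f (of_real s)"

lemma measurable_real_laplace [measurable]:
  assumes "f \<in> L2_on halfline"
  shows "real_laplace f \<in> borel_measurable borel"
  unfolding real_laplace_def[abs_def]
proof (rule borel_measurable_continuous_on_indicator)
  show "continuous_on {0<..} (\<lambda>s. laplace f (of_real s))"
    by (rule continuous_on_compose2[OF holomorphic_on_imp_continuous_on[OF laplace_holomorphic[OF assms]]])
       (auto intro!: continuous_intros)
qed simp

lemma real_laplace_pos: "0 < s \<Longrightarrow> real_laplace f s = laplace f (of_real s)"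
  by (simp add: real_laplace_def)

lemma cmod_real_laplace_le:
  assumes f: "f \<in> L2_on halfline" and s: "0 < s"
  shows "cmod (real_laplace f s) \<le> nrm halfline f / sqrt s"
proof -
  have "(cmod (laplace f (of_real s)))\<^sup>2 \<le> (nrm halfline f)\<^sup>2 / (2 * s)"
    using cmod_laplace_le[OF f, of "of_real s"] s by simp
  also have "\<dots> \<le> (nrm halfline f)\<^sup>2 / s"
    using s by (intro divide_left_mono) auto
  also have "\<dots> = (nrm halfline f / sqrt s)\<^sup>2"
    using s by (simp add: power_divide)
  finally show ?thesis
    using s by (intro power2_le_imp_le[of "cmod (real_laplace f s)"]) (auto simp: real_laplace_pos)
qed

lemma real_laplace_linear:
  "f \<in> L2_on halfline \<Longrightarrow> g \<in> L2_on halfline \<Longrightarrow>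
    real_laplace (\<lambda>t. a * f t + b * g t) s = a * real_laplace f s + b * real_laplace g s"
  by (auto simp: real_laplace_def laplace_scaled_add indicator_def)

text \<open>The order of integration may be changed because \<open>exp (- s t)\<close> has norm at most \<open>1 / sqrt s\<close> in \<open>L\<^sup>2(0,\<infinity>)\<close>.\<close>

lemma laplace_swap:
  assumes f: "f \<in> L2_on halfline" and [measurable]: "w \<in> borel_measurable borel"
    and w: "integrable m (\<lambda>s. cmod (w s) / sqrt s)"
  shows "integrable m (\<lambda>s. w s * real_laplace f s)"
    and "(\<integral>t. f t * (\<integral>s. w s * expo (of_real s) t \<partial>m) \<partial>halfline) = (\<integral>s. w s * real_laplace f s \<partial>m)"
proof -
  interpret pair_sigma_finite m halfline
    by (simp add: pair_sigma_finite_def sigma_finite_m sigma_finite_halfline)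
  have [measurable]: "f \<in> borel_measurable halfline" using f by (rule L2_onD)
  have "(\<lambda>t. t) \<in> borel_measurable halfline" by auto
  then have "(\<lambda>p. (\<lambda>t. t) (snd p)) \<in> borel_measurable (m \<Otimes>\<^sub>M halfline)"
    by (rule measurable_compose[OF measurable_snd])
  then have [measurable]: "snd \<in> borel_measurable (m \<Otimes>\<^sub>M halfline)" by simp
  define \<Phi> where "\<Phi> p = w (fst p) * (f (snd p) * expo (of_real (fst p)) (snd p))" for p
  have [measurable]: "(\<lambda>p. f (snd p)) \<in> borel_measurable (m \<Otimes>\<^sub>M halfline)"
    by (rule measurable_compose[OF measurable_snd]) measurable
  have \<Phi>_meas [measurable]: "\<Phi> \<in> borel_measurable (m \<Otimes>\<^sub>M halfline)"
    unfolding \<Phi>_def expo_def by measurable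
  have int: "integrable (m \<Otimes>\<^sub>M halfline) \<Phi>"
  proof (rule Fubini_integrable)
    show "AE s in m. integrable halfline (\<lambda>t. \<Phi> (s, t))"
      using pos by eventually_elim (simp add: \<Phi>_def integrable_laplace[OF f])
    show "integrable m (\<lambda>s. \<integral>t. norm (\<Phi> (s, t)) \<partial>halfline)"
    proof (rule Bochner_Integration.integrable_bound)
      show "integrable m (\<lambda>s. cmod (w s) / sqrt s * nrm halfline f)" using w by (intro integrable_mult_left)
      show "AE s in m. norm (\<integral>t. norm (\<Phi> (s, t)) \<partial>halfline) \<le> norm (cmod (w s) / sqrt s * nrm halfline f)"
        using pos
      proof eventually_elim
        fix s :: real assume s: "0 < s"
        have eL: "expo (of_real s) \<in> L2_on halfline" using s by auto
        have "(nrm halfline (expo (of_real s)))\<^sup>2 \<le> (1 / sqrt s)\<^sup>2"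
          using s nrm_expo[of "of_real s"] by (simp add: power_divide frac_le)
        then have ne: "nrm halfline (expo (of_real s)) \<le> 1 / sqrt s"
          using s by (intro power2_le_imp_le[of "nrm halfline (expo (of_real s))"]) auto
        have "(\<integral>t. norm (\<Phi> (s, t)) \<partial>halfline) = cmod (w s) * (\<integral>t. cmod (f t) * cmod (expo (of_real s) t) \<partial>halfline)"
          by (simp add: \<Phi>_def norm_mult)
        also have "\<dots> \<le> cmod (w s) * (nrm halfline f * nrm halfline (expo (of_real s)))"
          by (intro mult_left_mono integral_cmod_mult_le f eL) simp
        also have "\<dots> \<le> cmod (w s) * (nrm halfline f * (1 / sqrt s))"
          by (intro mult_left_mono ne) auto
        finally show "norm (\<integral>t. norm (\<Phi> (s, t)) \<partial>halfline) \<le> norm (cmod (w s) / sqrt s * nrm halfline f)"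
          using s by (simp add: integral_nonneg abs_mult mult.commute)
      qed
    qed measurable
  qed measurable
  have in_s: "AE s in m. (\<integral>t. \<Phi> (s, t) \<partial>halfline) = w s * real_laplace f s"
    using pos by eventually_elim (simp add: \<Phi>_def laplace_eq real_laplace_pos)
  have [measurable]: "real_laplace f \<in> borel_measurable borel" using f by measurable
  have "integrable m (\<lambda>s. \<integral>t. \<Phi> (s, t) \<partial>halfline)"
    using integrable_fst'[OF int] .
  then show "integrable m (\<lambda>s. w s * real_laplace f s)"
    by (rule integrable_cong_AE_imp) (use in_s in \<open>auto simp: eq_commute\<close>)
  have in_t: "(\<integral>s. \<Phi> (s, t) \<partial>m) = f t * (\<integral>s. w s * expo (of_real s) t \<partial>m)" for t
    by (subst integral_mult_right_zero[symmetric]) (simp add: \<Phi>_def mult_ac)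
  have "(\<integral>t. \<integral>s. \<Phi> (s, t) \<partial>m \<partial>halfline) = (\<integral>s. \<integral>t. \<Phi> (s, t) \<partial>halfline \<partial>m)"
    using Fubini_integral[of "\<lambda>s t. \<Phi> (s, t)"] int by simp
  also have "\<dots> = (\<integral>s. w s * real_laplace f s \<partial>m)"
    by (rule integral_cong_AE) (use in_s in measurable)
  finally show "(\<integral>t. f t * (\<integral>s. w s * expo (of_real s) t \<partial>m) \<partial>halfline) = (\<integral>s. w s * real_laplace f s \<partial>m)"
    unfolding in_t .
qed

text \<open>The factor by which the kernel \<open>h (u + \<epsilon>) - h (u + 1/\<epsilon>)\<close> of the regularized form differs from \<open>h u\<close> in the
  representation by the measure.\<close>

definition cutoff :: "real \<Rightarrow> real \<Rightarrow> real"
  where "cutoff \<epsilon> s = exp (- (s * \<epsilon>)) - exp (- (s * (1 / \<epsilon>)))"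

lemma measurable_cutoff [measurable]: "cutoff \<epsilon> \<in> borel_measurable borel"
  unfolding cutoff_def[abs_def] by measurable

lemma cutoff_bounds:
  assumes \<epsilon>: "0 < \<epsilon>" "\<epsilon> < 1" and s: "0 < s"
  shows "0 \<le> cutoff \<epsilon> s" "cutoff \<epsilon> s \<le> 1" "cutoff \<epsilon> s \<le> exp (- (s * \<epsilon>))" "cutoff \<epsilon> s / s \<le> exp (- (s * \<epsilon>)) / \<epsilon>"
proof -
  have "\<epsilon> \<le> 1 / \<epsilon>" using \<epsilon> by (simp add: pos_le_divide_eq mult_le_one)
  then have le: "s * \<epsilon> \<le> s * (1 / \<epsilon>)" using s by (intro mult_left_mono) auto
  then show "0 \<le> cutoff \<epsilon> s" by (simp add: cutoff_def)
  show 1: "cutoff \<epsilon> s \<le> exp (- (s * \<epsilon>))" by (simp add: cutoff_def)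
  also have "\<dots> \<le> 1" using s \<epsilon> by simp
  finally show "cutoff \<epsilon> s \<le> 1" .
  have "cutoff \<epsilon> s = exp (- (s * \<epsilon>)) * (1 - exp (- (s * (1 / \<epsilon>) - s * \<epsilon>)))"
    by (simp add: cutoff_def right_diff_distrib flip: exp_add)
  also have "\<dots> \<le> exp (- (s * \<epsilon>)) * (s * (1 / \<epsilon>))"
  proof (rule mult_left_mono)
    have "1 - exp (- (s * (1 / \<epsilon>) - s * \<epsilon>)) \<le> s * (1 / \<epsilon>) - s * \<epsilon>"
      using exp_ge_add_one_self[of "- (s * (1 / \<epsilon>) - s * \<epsilon>)"] by linarith
    also have "\<dots> \<le> s * (1 / \<epsilon>)" using s \<epsilon> by simp
    finally show "1 - exp (- (s * (1 / \<epsilon>) - s * \<epsilon>)) \<le> s * (1 / \<epsilon>)" .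
  qed simp
  finally show "cutoff \<epsilon> s / s \<le> exp (- (s * \<epsilon>)) / \<epsilon>"
    using s by (simp add: field_simps)
qed

text \<open>Fubini's theorem for each of the two variables. The cutoff decays exponentially at \<open>\<infinity>\<close>, where \<open>m\<close> may have infinite
  mass, and it vanishes to first order at \<open>0\<close>, where the product of the two Laplace transforms is only bounded by a multiple of \<open>1 / s\<close>.\<close>

lemma regularized_hankel_eq:
  assumes f: "f \<in> L2_on halfline" and g: "g \<in> L2_on halfline" and \<epsilon>: "0 < \<epsilon>" "\<epsilon> < 1"
  shows "integrable m (\<lambda>s. of_real (cutoff \<epsilon> s) * (real_laplace f s * cnj (real_laplace g s)))"
    and "regularized_hankel_integral \<epsilon> h f g =
      (\<integral>s. of_real (cutoff \<epsilon> s) * (real_laplace f s * cnj (real_laplace g s)) \<partial>m)"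
proof -
  have [measurable]: "real_laplace f \<in> borel_measurable borel" "real_laplace g \<in> borel_measurable borel"
    using f g by measurable
  have exp_int: "integrable m (\<lambda>s. exp (- (s * \<epsilon>)))"
    using h[OF \<epsilon>(1)] by (simp add: has_bochner_integral_iff)
  have h_diff: "complex_of_real (h (t + \<tau> + \<epsilon>) - h (t + \<tau> + 1 / \<epsilon>)) =
      (\<integral>s. (of_real (cutoff \<epsilon> s) * expo (of_real s) \<tau>) * expo (of_real s) t \<partial>m)" if "0 < t" "0 < \<tau>" for t \<tau>
  proof -
    have "has_bochner_integral m (\<lambda>s. exp (- (s * (t + \<tau> + \<epsilon>))) - exp (- (s * (t + \<tau> + 1 / \<epsilon>))))
        (h (t + \<tau> + \<epsilon>) - h (t + \<tau> + 1 / \<epsilon>))"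
      using that \<epsilon> by (intro has_bochner_integral_diff h) (auto intro!: add_pos_pos)
    then have "complex_of_real (h (t + \<tau> + \<epsilon>) - h (t + \<tau> + 1 / \<epsilon>)) =
        (\<integral>s. of_real (exp (- (s * (t + \<tau> + \<epsilon>))) - exp (- (s * (t + \<tau> + 1 / \<epsilon>)))) \<partial>m)"
      by (simp add: has_bochner_integral_iff integral_complex_of_real del: of_real_diff)
    also have "\<dots> = (\<integral>s. (of_real (cutoff \<epsilon> s) * expo (of_real s) \<tau>) * expo (of_real s) t \<partial>m)"
    proof (intro Bochner_Integration.integral_cong refl)
      fix s
      have "exp (- (s * (t + \<tau> + \<epsilon>))) - exp (- (s * (t + \<tau> + 1 / \<epsilon>))) = (cutoff \<epsilon> s * exp (- (s * \<tau>))) * exp (- (s * t))"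
        by (simp add: cutoff_def left_diff_distrib flip: exp_add) (simp add: algebra_simps)
      then show "complex_of_real (exp (- (s * (t + \<tau> + \<epsilon>))) - exp (- (s * (t + \<tau> + 1 / \<epsilon>)))) =
          (of_real (cutoff \<epsilon> s) * expo (of_real s) \<tau>) * expo (of_real s) t"
        by (simp add: expo_def exp_of_real flip: of_real_mult of_real_minus)
    qed
    finally show ?thesis .
  qed
  have inner: "(\<integral>t. of_real (h (t + \<tau> + \<epsilon>) - h (t + \<tau> + 1 / \<epsilon>)) * f t * cnj (g \<tau>) \<partial>halfline) =
      cnj (g \<tau>) * (\<integral>s. (of_real (cutoff \<epsilon> s) * real_laplace f s) * expo (of_real s) \<tau> \<partial>m)" if \<tau>: "0 < \<tau>" for \<tau>
  proof -
    have "(\<integral>t. of_real (h (t + \<tau> + \<epsilon>) - h (t + \<tau> + 1 / \<epsilon>)) * f t * cnj (g \<tau>) \<partial>halfline) =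
        (\<integral>t. cnj (g \<tau>) * (f t * (\<integral>s. (of_real (cutoff \<epsilon> s) * expo (of_real s) \<tau>) * expo (of_real s) t \<partial>m)) \<partial>halfline)"
    proof (intro Bochner_Integration.integral_cong refl)
      fix t assume "t \<in> space halfline"
      then show "of_real (h (t + \<tau> + \<epsilon>) - h (t + \<tau> + 1 / \<epsilon>)) * f t * cnj (g \<tau>) =
          cnj (g \<tau>) * (f t * (\<integral>s. (of_real (cutoff \<epsilon> s) * expo (of_real s) \<tau>) * expo (of_real s) t \<partial>m))"
        using \<tau> by (subst h_diff) (auto simp only: mult_ac space_halfline greaterThan_iff)
    qed
    also have "\<dots> = cnj (g \<tau>) * (\<integral>t. f t * (\<integral>s. (of_real (cutoff \<epsilon> s) * expo (of_real s) \<tau>) * expo (of_real s) t \<partial>m) \<partial>halfline)"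
      by (rule integral_mult_right_zero)
    also have "(\<integral>t. f t * (\<integral>s. (of_real (cutoff \<epsilon> s) * expo (of_real s) \<tau>) * expo (of_real s) t \<partial>m) \<partial>halfline) =
        (\<integral>s. (of_real (cutoff \<epsilon> s) * expo (of_real s) \<tau>) * real_laplace f s \<partial>m)"
    proof (rule laplace_swap(2)[OF f])
      show "integrable m (\<lambda>s. cmod (of_real (cutoff \<epsilon> s) * expo (of_real s) \<tau>) / sqrt s)"
      proof (rule Bochner_Integration.integrable_bound)
        show "integrable m (\<lambda>s. exp (- (s * \<epsilon>)) * (1 + 1 / \<epsilon>))" using exp_int by simp
        show "AE s in m. norm (cmod (of_real (cutoff \<epsilon> s) * expo (of_real s) \<tau>) / sqrt s) \<le> norm (exp (- (s * \<epsilon>)) * (1 + 1 / \<epsilon>))"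
          using pos
        proof eventually_elim
          fix s :: real assume s: "0 < s"
          have "1 / sqrt s \<le> 1 + 1 / s"
          proof (cases "1 \<le> s")
            case True
            then have "1 / sqrt s \<le> 1" by simp
            then show ?thesis using s by (simp add: add_increasing2)
          next
            case False
            then have "s \<le> sqrt s" using s by (intro real_le_rsqrt) (simp add: power2_eq_square mult_left_le)
            then have "1 / sqrt s \<le> 1 / s" using s by (intro divide_left_mono) auto
            then show ?thesis by simp
          qed
          then have "cutoff \<epsilon> s * (1 / sqrt s) \<le> cutoff \<epsilon> s * (1 + 1 / s)"
            using cutoff_bounds[OF \<epsilon> s] by (intro mult_left_mono) auto
          also have "\<dots> = cutoff \<epsilon> s + cutoff \<epsilon> s / s" by (simp add: distrib_left)
          also have "\<dots> \<le> exp (- (s * \<epsilon>)) + exp (- (s * \<epsilon>)) / \<epsilon>"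
            using cutoff_bounds[OF \<epsilon> s] by (intro add_mono) auto
          finally have "cutoff \<epsilon> s / sqrt s \<le> exp (- (s * \<epsilon>)) * (1 + 1 / \<epsilon>)"
            by (simp add: distrib_left)
          moreover have "exp (- (s * \<tau>)) * (cutoff \<epsilon> s / sqrt s) \<le> cutoff \<epsilon> s / sqrt s"
            using cutoff_bounds[OF \<epsilon> s] s \<tau> by (intro mult_left_le_one_le) auto
          ultimately show "norm (cmod (of_real (cutoff \<epsilon> s) * expo (of_real s) \<tau>) / sqrt s) \<le> norm (exp (- (s * \<epsilon>)) * (1 + 1 / \<epsilon>))"
            using cutoff_bounds[OF \<epsilon> s] s \<epsilon> by (simp add: norm_mult cmod_expo abs_mult mult_ac)
        qed
      qed (unfold expo_def, measurable)
    qed (unfold expo_def, measurable)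
    also have "\<dots> = (\<integral>s. (of_real (cutoff \<epsilon> s) * real_laplace f s) * expo (of_real s) \<tau> \<partial>m)"
      by (simp add: mult_ac)
    finally show ?thesis .
  qed
  have gc: "(\<lambda>t. cnj (g t)) \<in> L2_on halfline"
    using g by (auto simp: L2_on_def intro: measurable_compose[OF _ measurable_cnj])
  have lc: "real_laplace (\<lambda>t. cnj (g t)) s = cnj (real_laplace g s)" for s
  proof -
    have "laplace (\<lambda>t. cnj (g t)) (of_real s) = (\<integral>t. cnj (g t * expo (of_real s) t) \<partial>halfline)"
      by (simp add: laplace_eq cnj_expo)
    also have "\<dots> = cnj (laplace g (of_real s))"
      unfolding laplace_eq by (rule Bochner_Integration.integral_cnj)
    finally show ?thesis by (simp add: real_laplace_def)
  qed
  have w2: "integrable m (\<lambda>s. cmod (of_real (cutoff \<epsilon> s) * real_laplace f s) / sqrt s)"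
  proof (rule Bochner_Integration.integrable_bound)
    show "integrable m (\<lambda>s. exp (- (s * \<epsilon>)) / \<epsilon> * nrm halfline f)" using exp_int by simp
    show "AE s in m. norm (cmod (of_real (cutoff \<epsilon> s) * real_laplace f s) / sqrt s) \<le> norm (exp (- (s * \<epsilon>)) / \<epsilon> * nrm halfline f)"
      using pos
    proof eventually_elim
      fix s :: real assume s: "0 < s"
      have "cmod (of_real (cutoff \<epsilon> s) * real_laplace f s) / sqrt s = cutoff \<epsilon> s * cmod (real_laplace f s) / sqrt s"
        using cutoff_bounds[OF \<epsilon> s] by (simp add: norm_mult)
      also have "\<dots> \<le> cutoff \<epsilon> s * (nrm halfline f / sqrt s) / sqrt s"
        using cutoff_bounds[OF \<epsilon> s] s by (intro divide_right_mono mult_left_mono cmod_real_laplace_le f) auto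
      also have "\<dots> = cutoff \<epsilon> s / s * nrm halfline f"
        using s by simp
      also have "\<dots> \<le> exp (- (s * \<epsilon>)) / \<epsilon> * nrm halfline f"
        using cutoff_bounds[OF \<epsilon> s] by (intro mult_right_mono) auto
      finally show "norm (cmod (of_real (cutoff \<epsilon> s) * real_laplace f s) / sqrt s) \<le> norm (exp (- (s * \<epsilon>)) / \<epsilon> * nrm halfline f)"
        using s \<epsilon> by (simp add: abs_mult)
    qed
  qed measurable
  show "integrable m (\<lambda>s. of_real (cutoff \<epsilon> s) * (real_laplace f s * cnj (real_laplace g s)))"
    using laplace_swap(1)[OF gc _ w2] by (simp add: lc mult.assoc)
  have "regularized_hankel_integral \<epsilon> h f g =
      (\<integral>\<tau>. (\<integral>t. of_real (h (t + \<tau> + \<epsilon>) - h (t + \<tau> + 1 / \<epsilon>)) * f t * cnj (g \<tau>) \<partial>halfline) \<partial>halfline)"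
    by (simp add: regularized_hankel_integral_def integral_halfline)
  also have "\<dots> = (\<integral>\<tau>. cnj (g \<tau>) * (\<integral>s. (of_real (cutoff \<epsilon> s) * real_laplace f s) * expo (of_real s) \<tau> \<partial>m) \<partial>halfline)"
    by (intro Bochner_Integration.integral_cong refl inner) simp
  also have "\<dots> = (\<integral>s. (of_real (cutoff \<epsilon> s) * real_laplace f s) * real_laplace (\<lambda>t. cnj (g t)) s \<partial>m)"
    by (rule laplace_swap(2)[OF gc _ w2]) measurable
  finally show "regularized_hankel_integral \<epsilon> h f g =
      (\<integral>s. of_real (cutoff \<epsilon> s) * (real_laplace f s * cnj (real_laplace g s)) \<partial>m)"
    by (simp add: lc mult.assoc)
qed

end

section \<open>Bounded Hankel operators and Carleson embeddings\<close>

lemma reproducing_kernel_family: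
  assumes \<theta>: "inner_function \<theta>"
  obtains k where "\<And>w. 0 < w \<Longrightarrow> k w \<in> model_L2 \<theta>"
    and "\<And>w s. 0 < w \<Longrightarrow> 0 < Re s \<Longrightarrow> laplace (k w) s = (1 - cnj (\<theta> (of_real w)) * \<theta> s) / (s + of_real w)"
    and "\<And>w f. 0 < w \<Longrightarrow> f \<in> model_L2 \<theta> \<Longrightarrow> ip halfline f (k w) = laplace f (of_real w)"
    and "\<And>w. 0 < w \<Longrightarrow> (nrm halfline (k w))\<^sup>2 = (1 - (cmod (\<theta> (of_real w)))\<^sup>2) / (2 * w)"
proof -
  have "\<forall>w\<in>{0<..}. \<exists>\<kappa>\<in>model_L2 \<theta>.
    (\<forall>s. 0 < Re s \<longrightarrow> laplace \<kappa> s = (1 - cnj (\<theta> (of_real w)) * \<theta> s) / (s + of_real w)) \<and>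
    (\<forall>f\<in>model_L2 \<theta>. ip halfline f \<kappa> = laplace f (of_real w))"
    using reproducing_kernel[OF \<theta>] by simp
  then obtain k where k: "\<And>w. 0 < w \<Longrightarrow> k w \<in> model_L2 \<theta>"
    "\<And>w s. 0 < w \<Longrightarrow> 0 < Re s \<Longrightarrow> laplace (k w) s = (1 - cnj (\<theta> (of_real w)) * \<theta> s) / (s + of_real w)"
    "\<And>w f. 0 < w \<Longrightarrow> f \<in> model_L2 \<theta> \<Longrightarrow> ip halfline f (k w) = laplace f (of_real w)"
    unfolding bchoice_iff by (metis greaterThan_iff)
  have "(nrm halfline (k w))\<^sup>2 = (1 - (cmod (\<theta> (of_real w)))\<^sup>2) / (2 * w)" if w: "0 < w" for w
  proof -
    have "cnj (\<theta> (of_real w)) * \<theta> (of_real w) = of_real ((cmod (\<theta> (of_real w)))\<^sup>2)"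
      unfolding complex_norm_square by (rule mult.commute)
    then have "of_real ((nrm halfline (k w))\<^sup>2) =
        (1 - of_real ((cmod (\<theta> (of_real w)))\<^sup>2)) / (of_real w + complex_of_real w)"
      unfolding ip_self[symmetric] using k w by simp
    also have "\<dots> = of_real ((1 - (cmod (\<theta> (of_real w)))\<^sup>2) / (2 * w))"
      by (simp only: of_real_divide of_real_diff of_real_1 of_real_mult of_real_numeral mult_2 of_real_add)
    finally show ?thesis by (simp only: of_real_eq_iff)
  qed
  with k that show ?thesis by blast
qed

text \<open>The degenerate case of a unimodular constant: the kernel at \<open>t\<close> has norm \<open>0\<close>, and so its Laplace transform
  \<open>(1 - cnj (\<theta> t) * \<theta> s) / (s + t)\<close> vanishes.\<close>

lemma reproducing_kernels_vanish:
  assumes \<theta>: "inner_function \<theta>" and t: "0 < t" "cmod (\<theta> (of_real t)) = 1" and s: "0 < s"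
  shows "cmod (\<theta> (of_real s)) = 1" and "f \<in> model_L2 \<theta> \<Longrightarrow> laplace f (of_real s) = 0"
proof -
  obtain k where k: "\<And>w. 0 < w \<Longrightarrow> k w \<in> model_L2 \<theta>"
      "\<And>w s. 0 < w \<Longrightarrow> 0 < Re s \<Longrightarrow> laplace (k w) s = (1 - cnj (\<theta> (of_real w)) * \<theta> s) / (s + of_real w)"
      "\<And>w f. 0 < w \<Longrightarrow> f \<in> model_L2 \<theta> \<Longrightarrow> ip halfline f (k w) = laplace f (of_real w)"
      "\<And>w. 0 < w \<Longrightarrow> (nrm halfline (k w))\<^sup>2 = (1 - (cmod (\<theta> (of_real w)))\<^sup>2) / (2 * w)"
    using reproducing_kernel_family[OF \<theta>] by metis
  have kt0: "nrm halfline (k t) = 0" using k(4)[OF t(1)] t(2) by simp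
  have "cmod (ip halfline (k t) (k s)) \<le> nrm halfline (k t) * nrm halfline (k s)"
    by (intro cmod_ip_le model_L2_subset[OF k(1)] t s)
  then have "laplace (k t) (of_real s) = 0"
    using kt0 k(3)[OF s k(1)[OF t(1)]] by simp
  moreover have "of_real s + of_real t \<noteq> (0::complex)"
    unfolding of_real_add[symmetric] of_real_eq_0_iff using s t by simp
  ultimately have "cnj (\<theta> (of_real t)) * \<theta> (of_real s) = 1"
    using s t by (simp add: k(2))
  then have "cmod (cnj (\<theta> (of_real t)) * \<theta> (of_real s)) = 1" by simp
  then show s1: "cmod (\<theta> (of_real s)) = 1" using t(2) by (simp add: norm_mult)
  then have ks0: "nrm halfline (k s) = 0" using k(4)[OF s] by simp
  assume f: "f \<in> model_L2 \<theta>"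
  have "cmod (ip halfline f (k s)) \<le> nrm halfline f * nrm halfline (k s)"
    by (intro cmod_ip_le model_L2_subset[OF f] model_L2_subset[OF k(1)] s)
  with ks0 show "laplace f (of_real s) = 0" using k(3)[OF s f] by simp
qed

context laplace_measure
begin

definition embeds :: "(real \<Rightarrow> complex) set \<Rightarrow> real \<Rightarrow> bool"
  where "embeds K C \<longleftrightarrow> 0 \<le> C \<and>
    (\<forall>f\<in>K. (\<integral>\<^sup>+s. ennreal ((cmod (real_laplace f s))\<^sup>2) \<partial>m) \<le> ennreal (C * (nrm halfline f)\<^sup>2))"

lemma tendsto_cutoff:
  assumes s: "0 < s" and S: "\<And>n. 0 < S n" "S \<longlonglongrightarrow> 0"
  shows "(\<lambda>n. cutoff (S n) s) \<longlonglongrightarrow> 1"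
proof -
  have at: "filterlim S (at_right 0) sequentially"
    using S by (simp add: filterlim_at less_imp_neq[symmetric])
  have "((\<lambda>e. cutoff e s) \<longlongrightarrow> 1) (at_right 0)"
    unfolding cutoff_def using s by real_asymp
  then show ?thesis using at by (rule filterlim_compose)
qed

text \<open>Take \<open>g = f\<close>: the regularized forms are integrals of nonnegative functions that converge to \<open>\<bar>laplace f\<bar>\<^sup>2\<close>, so Fatou's
  lemma applies.\<close>

lemma embeds_if_truncated_hankel_bounded:
  assumes K: "K \<subseteq> L2_on halfline" and bd: "truncated_hankel_bounded h K"
  shows "\<exists>C. embeds K C"
proof -
  obtain \<Gamma> where \<Gamma>: "bounded_operator_on K \<Gamma>"
      and rep: "\<And>f g. f \<in> K \<Longrightarrow> g \<in> K \<Longrightarrow> has_hankel_integral h f g (L2_inner (\<Gamma> f) g)"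
    using bd by (auto simp: truncated_hankel_bounded_def)
  obtain C where C: "\<And>f. f \<in> K \<Longrightarrow> nrm halfline (\<Gamma> f) \<le> C * nrm halfline f" and \<Gamma>K: "\<And>f. f \<in> K \<Longrightarrow> \<Gamma> f \<in> K"
    using \<Gamma> unfolding bounded_operator_on_def L2_norm_eq_nrm by blast
  have "(\<integral>\<^sup>+s. ennreal ((cmod (real_laplace f s))\<^sup>2) \<partial>m) \<le> ennreal (\<bar>C\<bar> * (nrm halfline f)\<^sup>2)" if fK: "f \<in> K" for f
  proof -
    have f: "f \<in> L2_on halfline" and \<Gamma>f: "\<Gamma> f \<in> L2_on halfline" using K fK \<Gamma>K by auto
    have [measurable]: "real_laplace f \<in> borel_measurable borel" using f by measurable
    define S where "S n = inverse (real (Suc (Suc n)))" for n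
    have S: "0 < S n" "S n < 1" "S \<longlonglongrightarrow> 0" for n
      unfolding S_def using LIMSEQ_Suc[OF LIMSEQ_inverse_real_of_nat] by (auto simp: inverse_less_1_iff)
    have at: "filterlim S (at_right 0) sequentially"
      using S by (simp add: filterlim_at less_imp_neq[symmetric])
    define v where "v = ip halfline (\<Gamma> f) f"
    have lim: "(\<lambda>n. regularized_hankel_integral (S n) h f f) \<longlonglongrightarrow> v"
      using filterlim_compose[OF rep[OF fK fK, unfolded has_hankel_integral_def] at]
      by (simp add: v_def L2_inner_eq_ip)
    define I where "I n = (\<integral>s. cutoff (S n) s * (cmod (real_laplace f s))\<^sup>2 \<partial>m)" for n
    have sq: "complex_of_real (cutoff (S n) s) * (real_laplace f s * cnj (real_laplace f s)) =
        of_real (cutoff (S n) s * (cmod (real_laplace f s))\<^sup>2)" for n s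
      by (simp only: complex_norm_square of_real_mult)
    have I_int: "integrable m (\<lambda>s. cutoff (S n) s * (cmod (real_laplace f s))\<^sup>2)" for n
      using regularized_hankel_eq(1)[OF f f S(1,2)[of n]] unfolding sq complex_of_real_integrable_eq .
    have I_eq: "regularized_hankel_integral (S n) h f f = of_real (I n)" for n
      using regularized_hankel_eq(2)[OF f f S(1,2)[of n]] unfolding sq I_def integral_complex_of_real .
    have limI: "I \<longlonglongrightarrow> Re v"
      using tendsto_Re[OF lim] by (simp add: I_eq)
    have "(\<integral>\<^sup>+s. ennreal ((cmod (real_laplace f s))\<^sup>2) \<partial>m) =
        (\<integral>\<^sup>+s. liminf (\<lambda>n. ennreal (cutoff (S n) s * (cmod (real_laplace f s))\<^sup>2)) \<partial>m)"
    proof (intro nn_integral_cong_AE eventually_mono[OF pos])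
      fix s :: real assume "0 < s"
      from tendsto_cutoff[OF this S(1,3)]
      have "(\<lambda>n. ennreal (cutoff (S n) s * (cmod (real_laplace f s))\<^sup>2)) \<longlonglongrightarrow> ennreal (1 * (cmod (real_laplace f s))\<^sup>2)"
        by (intro tendsto_intros)
      from lim_imp_Liminf[OF sequentially_bot this]
      show "ennreal ((cmod (real_laplace f s))\<^sup>2) = liminf (\<lambda>n. ennreal (cutoff (S n) s * (cmod (real_laplace f s))\<^sup>2))"
        by simp
    qed
    also have "\<dots> \<le> liminf (\<lambda>n. \<integral>\<^sup>+s. ennreal (cutoff (S n) s * (cmod (real_laplace f s))\<^sup>2) \<partial>m)"
      by (rule nn_integral_liminf) measurable
    also have "\<dots> = liminf (\<lambda>n. ennreal (I n))"
      unfolding I_def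
      by (intro arg_cong[where f = liminf] ext nn_integral_eq_integral I_int eventually_mono[OF pos])
         (simp add: cutoff_bounds S)
    also have "liminf (\<lambda>n. ennreal (I n)) = ennreal (Re v)"
      by (intro lim_imp_Liminf sequentially_bot tendsto_ennrealI limI)
    also have "\<dots> \<le> ennreal (\<bar>C\<bar> * (nrm halfline f)\<^sup>2)"
    proof (rule ennreal_leI)
      have "Re v \<le> nrm halfline (\<Gamma> f) * nrm halfline f"
        unfolding v_def using complex_Re_le_cmod cmod_ip_le[OF \<Gamma>f f] order_trans by blast
      also have "\<dots> \<le> (\<bar>C\<bar> * nrm halfline f) * nrm halfline f"
      proof (rule mult_right_mono)
        have "C * nrm halfline f \<le> \<bar>C\<bar> * nrm halfline f" by (intro mult_right_mono) auto
        with C[OF fK] show "nrm halfline (\<Gamma> f) \<le> \<bar>C\<bar> * nrm halfline f" by linarith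
      qed simp
      finally show "Re v \<le> \<bar>C\<bar> * (nrm halfline f)\<^sup>2" by (simp add: power2_eq_square mult.assoc)
    qed
    finally show ?thesis .
  qed
  then show ?thesis by (auto simp: embeds_def intro!: exI[of _ "\<bar>C\<bar>"])
qed

text \<open>The operator is obtained from the Riesz theorem for the bounded form \<open>B\<close>. The representing vectors are unique only up
  to null sets, hence linearity holds almost everywhere: the defect \<open>k\<close> of linearity is orthogonal to itself.\<close>

lemma truncated_hankel_bounded_if_embeds:
  assumes V: "closed_subspace halfline K" and emb: "embeds K C"
  shows "truncated_hankel_bounded h K"
proof -
  have K: "f \<in> L2_on halfline" if "f \<in> K" for f
    using V that by (auto simp: closed_subspace_def)
  have Klin: "(\<lambda>x. a * f x + b * g x) \<in> K" if "f \<in> K" "g \<in> K" for f g a b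
    using V that by (auto simp: closed_subspace_def)
  have C: "0 \<le> C" using emb by (simp add: embeds_def)
  have RL: "real_laplace f \<in> L2_on m" and Rle: "nrm m (real_laplace f) \<le> sqrt C * nrm halfline f" if f: "f \<in> K" for f
  proof -
    have [measurable]: "real_laplace f \<in> borel_measurable borel" using K[OF f] by measurable
    have le: "(\<integral>\<^sup>+s. ennreal ((cmod (real_laplace f s))\<^sup>2) \<partial>m) \<le> ennreal (C * (nrm halfline f)\<^sup>2)"
      using emb f by (simp add: embeds_def)
    show "real_laplace f \<in> L2_on m"
      by (rule L2_on_if_nn_integral_le(1)[OF _ le]) (use C in auto)
    have "(nrm m (real_laplace f))\<^sup>2 \<le> C * (nrm halfline f)\<^sup>2"
      by (rule L2_on_if_nn_integral_le(2)[OF _ le]) (use C in auto)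
    then have "nrm m (real_laplace f) \<le> sqrt (C * (nrm halfline f)\<^sup>2)" by (rule real_le_rsqrt)
    then show "nrm m (real_laplace f) \<le> sqrt C * nrm halfline f" by (simp add: real_sqrt_mult)
  qed
  define B where "B f g = ip m (real_laplace f) (real_laplace g)" for f g
  have B_le: "cmod (B f g) \<le> (C * nrm halfline g) * nrm halfline f" if "f \<in> K" "g \<in> K" for f g
  proof -
    have "cmod (B f g) \<le> nrm m (real_laplace f) * nrm m (real_laplace g)"
      unfolding B_def by (intro cmod_ip_le RL that)
    also have "\<dots> \<le> (sqrt C * nrm halfline f) * (sqrt C * nrm halfline g)"
      by (intro mult_mono Rle that) (use C in auto)
    also have "\<dots> = (C * nrm halfline g) * nrm halfline f"
    proof -
      have "(x * y) * (x * z) = ((x * x) * z) * y" for x y z :: real by (simp add: mult_ac)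
      then show ?thesis using C by (metis real_sqrt_mult_self abs_of_nonneg)
    qed
    finally show ?thesis .
  qed
  have B_lin: "B (\<lambda>x. a * f x + b * g x) k = a * B f k + b * B g k" if "f \<in> K" "g \<in> K" "k \<in> K" for f g k a b
  proof -
    have "real_laplace (\<lambda>x. a * f x + b * g x) = (\<lambda>s. a * real_laplace f s + b * real_laplace g s)"
      using that K by (auto simp: real_laplace_linear)
    then show ?thesis
      unfolding B_def using RL that by (simp add: ip_add_left L2_on_scale ip_scale_left)
  qed
  have "\<forall>f\<in>K. \<exists>v\<in>K. \<forall>g\<in>K. B g f = ip halfline g v"
  proof
    fix f assume f: "f \<in> K"
    show "\<exists>v\<in>K. \<forall>g\<in>K. B g f = ip halfline g v"
      by (rule riesz_representation[OF V _ B_le]) (use f B_lin in auto)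
  qed
  then obtain \<Gamma> where \<Gamma>K: "\<And>f. f \<in> K \<Longrightarrow> \<Gamma> f \<in> K" and \<Gamma>: "\<And>f g. f \<in> K \<Longrightarrow> g \<in> K \<Longrightarrow> B g f = ip halfline g (\<Gamma> f)"
    by metis
  have bound: "nrm halfline (\<Gamma> f) \<le> C * nrm halfline f" if f: "f \<in> K" for f
  proof (cases "nrm halfline (\<Gamma> f) = 0")
    case False
    then have p: "0 < nrm halfline (\<Gamma> f)" by (simp add: less_le)
    have "(nrm halfline (\<Gamma> f))\<^sup>2 = cmod (B (\<Gamma> f) f)"
      unfolding \<Gamma>[OF f \<Gamma>K[OF f]] ip_self by (simp add: norm_power)
    also have "\<dots> \<le> (C * nrm halfline f) * nrm halfline (\<Gamma> f)"
      by (intro B_le \<Gamma>K f)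
    finally show ?thesis using p by (simp add: power2_eq_square)
  qed (use C in simp)
  have lin: "AE t in lborel. 0 < t \<longrightarrow> \<Gamma> (\<lambda>u. a * f u + b * g u) t = a * \<Gamma> f t + b * \<Gamma> g t"
    if f: "f \<in> K" and g: "g \<in> K" for f g a b
  proof -
    define k where "k t = 1 * \<Gamma> (\<lambda>u. a * f u + b * g u) t + (-1) * (a * \<Gamma> f t + b * \<Gamma> g t)" for t
    have cK: "(\<lambda>u. a * f u + b * g u) \<in> K" by (rule Klin[OF f g])
    have sK: "(\<lambda>t. a * \<Gamma> f t + b * \<Gamma> g t) \<in> K" by (intro Klin \<Gamma>K f g)
    have kK: "k \<in> K" unfolding k_def by (intro Klin \<Gamma>K cK sK)
    have 1: "ip halfline (\<Gamma> (\<lambda>u. a * f u + b * g u)) k = a * cnj (B k f) + b * cnj (B k g)"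
    proof -
      have sym: "cnj (B k q) = B q k" for q unfolding B_def by (rule ip_cnj[symmetric])
      have "ip halfline (\<Gamma> (\<lambda>u. a * f u + b * g u)) k = cnj (B k (\<lambda>u. a * f u + b * g u))"
        unfolding \<Gamma>[OF cK kK] by (rule ip_cnj)
      then show ?thesis
        unfolding sym B_lin[OF f g kK] .
    qed
    have 2: "ip halfline (\<lambda>t. a * \<Gamma> f t + b * \<Gamma> g t) k = a * cnj (B k f) + b * cnj (B k g)"
      using \<Gamma>[OF f kK] \<Gamma>[OF g kK] K \<Gamma>K f g kK
      by (subst ip_add_left) (auto simp: ip_scale_left ip_cnj[of halfline k] L2_on_scale)
    have "ip halfline k k = 0"
    proof -
      have "ip halfline k k = ip halfline (\<lambda>t. 1 * \<Gamma> (\<lambda>u. a * f u + b * g u) t + (-1) * (a * \<Gamma> f t + b * \<Gamma> g t)) k"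
        by (simp add: k_def[abs_def])
      also have "\<dots> = 1 * ip halfline (\<Gamma> (\<lambda>u. a * f u + b * g u)) k + (-1) * ip halfline (\<lambda>t. a * \<Gamma> f t + b * \<Gamma> g t) k"
        using K[OF \<Gamma>K[OF cK]] K[OF sK] K[OF kK]
        by (subst ip_add_left) (auto simp only: ip_scale_left intro!: L2_on_scale)
      finally show ?thesis by (simp add: 1 2)
    qed
    then have "nrm halfline k = 0" by (simp add: ip_self)
    then have "AE t in halfline. k t = 0" using nrm_eq_0_iff[OF K[OF kK]] by simp
    then have "AE t in lborel. 0 < t \<longrightarrow> k t = 0" unfolding AE_halfline_iff .
    then show ?thesis
    proof eventually_elim
      fix t assume k0: "0 < t \<longrightarrow> k t = 0"
      have "p = q" if "1 * p + (-1) * q = 0" for p q :: complex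
        using that by simp
      from this[of "\<Gamma> (\<lambda>u. a * f u + b * g u) t" "a * \<Gamma> f t + b * \<Gamma> g t"] k0
      show "0 < t \<longrightarrow> \<Gamma> (\<lambda>u. a * f u + b * g u) t = a * \<Gamma> f t + b * \<Gamma> g t"
        unfolding k_def by blast
    qed
  qed
  have rep: "has_hankel_integral h f g (L2_inner (\<Gamma> f) g)" if f: "f \<in> K" and g: "g \<in> K" for f g
    unfolding has_hankel_integral_def
  proof (rule tendsto_at_right_sequentially)
    fix S :: "nat \<Rightarrow> real" assume S: "\<And>n. 0 < S n" "\<And>n. S n < 1" "S \<longlonglongrightarrow> 0"
    have [measurable]: "real_laplace f \<in> borel_measurable borel" "real_laplace g \<in> borel_measurable borel"
      using K f g by measurable
    have "(\<lambda>n. \<integral>s. of_real (cutoff (S n) s) * (real_laplace f s * cnj (real_laplace g s)) \<partial>m) \<longlonglongrightarrow>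
        (\<integral>s. real_laplace f s * cnj (real_laplace g s) \<partial>m)"
    proof (rule integral_dominated_convergence[where w = "\<lambda>s. cmod (real_laplace f s * cnj (real_laplace g s))"])
      show "integrable m (\<lambda>s. cmod (real_laplace f s * cnj (real_laplace g s)))"
        using integrable_ip[OF RL[OF f] RL[OF g]] by (rule integrable_norm)
      show "AE s in m. (\<lambda>n. of_real (cutoff (S n) s) * (real_laplace f s * cnj (real_laplace g s))) \<longlonglongrightarrow>
          real_laplace f s * cnj (real_laplace g s)"
        using pos
      proof eventually_elim
        fix s :: real assume "0 < s"
        from tendsto_cutoff[OF this S(1,3)]
        have "(\<lambda>n. of_real (cutoff (S n) s) * (real_laplace f s * cnj (real_laplace g s))) \<longlonglongrightarrow>
            of_real 1 * (real_laplace f s * cnj (real_laplace g s))"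
          by (intro tendsto_intros)
        then show "(\<lambda>n. of_real (cutoff (S n) s) * (real_laplace f s * cnj (real_laplace g s))) \<longlonglongrightarrow>
            real_laplace f s * cnj (real_laplace g s)" by simp
      qed
      show "AE s in m. norm (of_real (cutoff (S n) s) * (real_laplace f s * cnj (real_laplace g s))) \<le>
          cmod (real_laplace f s * cnj (real_laplace g s))" for n
        using pos
        by eventually_elim (use cutoff_bounds(1,2)[OF S(1,2)[of n]] in
            \<open>simp add: norm_mult mult_left_le_one_le del: complex_mod_cnj\<close>)
    qed measurable
    moreover have "(\<integral>s. real_laplace f s * cnj (real_laplace g s) \<partial>m) = L2_inner (\<Gamma> f) g"
    proof -
      have "(\<integral>s. real_laplace f s * cnj (real_laplace g s) \<partial>m) = cnj (B g f)"
        unfolding B_def by (subst ip_cnj[symmetric]) (simp add: ip_def)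
      also have "\<dots> = L2_inner (\<Gamma> f) g"
        by (simp add: \<Gamma>[OF f g] L2_inner_eq_ip ip_cnj[of halfline g])
      finally show ?thesis .
    qed
    ultimately show "(\<lambda>n. regularized_hankel_integral (S n) h f g) \<longlonglongrightarrow> L2_inner (\<Gamma> f) g"
      using regularized_hankel_eq(2)[OF K[OF f] K[OF g] S(1,2)] by simp
  qed simp
  have "bounded_operator_on K \<Gamma>"
    unfolding bounded_operator_on_def L2_norm_eq_nrm using \<Gamma>K lin bound by blast
  with rep show ?thesis
    unfolding truncated_hankel_bounded_def by blast
qed

definition poisson_test :: "(complex \<Rightarrow> complex) \<Rightarrow> real \<Rightarrow> real \<Rightarrow> bool"
  where "poisson_test \<theta> c w \<longleftrightarrow>
    (\<integral>\<^sup>+s. ennreal (w / (w + s)\<^sup>2) \<partial>m) \<le> ennreal c / ennreal (1 - cmod (\<theta> (of_real w)))"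

text \<open>Test the embedding on the reproducing kernel at \<open>w\<close>: its Laplace transform is at least
  \<open>(1 - \<bar>\<theta> w\<bar>) / (s + w)\<close> in modulus, and its squared norm is at most \<open>(1 - \<bar>\<theta> w\<bar>) / w\<close>. The
  constant \<open>C + 1\<close> is positive also for \<open>C = 0\<close>.\<close>

lemma poisson_test_if_embeds:
  assumes \<theta>: "inner_function \<theta>" and emb: "embeds (model_L2 \<theta>) C" and w: "0 < w"
  shows "poisson_test \<theta> (C + 1) w"
proof -
  define W where "W = complex_of_real w"
  have W: "0 < Re W" using w by (simp add: W_def)
  define r where "r = cmod (\<theta> W)"
  have r1: "r \<le> 1" "0 \<le> r" unfolding r_def using inner_function_le_one[OF \<theta> W] by auto
  have C: "0 \<le> C" using emb by (simp add: embeds_def)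
  show ?thesis
  proof (cases "r = 1")
    case True
    then show ?thesis using C
      by (simp add: poisson_test_def r_def W_def ennreal_divide_zero top.extremum)
  next
    case False
    then have e: "0 < 1 - r" using r1 by simp
    obtain k where k: "\<And>w. 0 < w \<Longrightarrow> k w \<in> model_L2 \<theta>"
      "\<And>w s. 0 < w \<Longrightarrow> 0 < Re s \<Longrightarrow> laplace (k w) s = (1 - cnj (\<theta> (of_real w)) * \<theta> s) / (s + of_real w)"
      "\<And>w. 0 < w \<Longrightarrow> (nrm halfline (k w))\<^sup>2 = (1 - (cmod (\<theta> (of_real w)))\<^sup>2) / (2 * w)"
      using reproducing_kernel_family[OF \<theta>] by metis
    define \<kappa> where "\<kappa> = k w"
    have \<kappa>: "\<kappa> \<in> model_L2 \<theta>" "\<And>s. 0 < Re s \<Longrightarrow> laplace \<kappa> s = (1 - cnj (\<theta> W) * \<theta> s) / (s + W)"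
      and nrm2: "(nrm halfline \<kappa>)\<^sup>2 = (1 - r\<^sup>2) / (2 * w)"
      using k[OF w] by (simp_all add: \<kappa>_def W_def r_def)
    have "(\<integral>\<^sup>+s. ennreal ((1 - r)\<^sup>2 / w) * ennreal (w / (w + s)\<^sup>2) \<partial>m) \<le>
        (\<integral>\<^sup>+s. ennreal ((cmod (real_laplace \<kappa> s))\<^sup>2) \<partial>m)"
    proof (intro nn_integral_mono_AE eventually_mono[OF pos])
      fix s :: real assume s: "0 < s"
      have ths: "cmod (\<theta> (of_real s)) \<le> 1" using s by (intro inner_function_le_one[OF \<theta>]) simp
      have "1 - r \<le> 1 - r * cmod (\<theta> (of_real s))"
        using ths r1 by (simp add: mult_left_le)
      also have "\<dots> \<le> cmod (1 - cnj (\<theta> W) * \<theta> (of_real s))"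
        using norm_triangle_ineq2[of 1 "cnj (\<theta> W) * \<theta> (of_real s)"] by (simp add: norm_mult r_def)
      finally have n: "1 - r \<le> cmod (1 - cnj (\<theta> W) * \<theta> (of_real s))" .
      have "ennreal ((1 - r)\<^sup>2 / w) * ennreal (w / (w + s)\<^sup>2) = ennreal ((1 - r)\<^sup>2 / (w + s)\<^sup>2)"
        using w by (simp flip: ennreal_mult)
      also have "\<dots> \<le> ennreal ((cmod (1 - cnj (\<theta> W) * \<theta> (of_real s)))\<^sup>2 / (w + s)\<^sup>2)"
        using n e by (intro ennreal_leI divide_right_mono power_mono) auto
      also have "(cmod (1 - cnj (\<theta> W) * \<theta> (of_real s)))\<^sup>2 / (w + s)\<^sup>2 = (cmod (real_laplace \<kappa> s))\<^sup>2"
      proof -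
        have "cmod (of_real s + W) = w + s" unfolding W_def of_real_add[symmetric] norm_of_real using s w by simp
        then show ?thesis
          using s by (simp add: real_laplace_pos \<kappa>(2) norm_divide power_divide)
      qed
      finally show "ennreal ((1 - r)\<^sup>2 / w) * ennreal (w / (w + s)\<^sup>2) \<le> ennreal ((cmod (real_laplace \<kappa> s))\<^sup>2)" .
    qed
    also have "\<dots> \<le> ennreal (C * ((1 - r\<^sup>2) / (2 * w)))"
      using emb \<kappa>(1) nrm2 by (auto simp: embeds_def)
    also have "\<dots> \<le> ennreal ((C + 1) * ((1 - r) / w))"
    proof (rule ennreal_leI)
      have "(1 - r\<^sup>2) \<le> (1 - r) * 2"
        using e r1 mult_left_mono[of "1 + r" 2 "1 - r"] by (simp add: power2_eq_square algebra_simps)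
      then have "(1 - r\<^sup>2) / (2 * w) \<le> ((1 - r) * 2) / (2 * w)" using w by (intro divide_right_mono) auto
      also have "((1 - r) * 2) / (2 * w) = (1 - r) / w" by (rule nonzero_mult_divide_mult_cancel_right2) simp
      finally have "(1 - r\<^sup>2) / (2 * w) \<le> (1 - r) / w" .
      then have "C * ((1 - r\<^sup>2) / (2 * w)) \<le> C * ((1 - r) / w)" using C by (rule mult_left_mono)
      also have "\<dots> \<le> (C + 1) * ((1 - r) / w)" using e w by (intro mult_right_mono) auto
      finally show "C * ((1 - r\<^sup>2) / (2 * w)) \<le> (C + 1) * ((1 - r) / w)" .
    qed
    finally have "ennreal ((1 - r)\<^sup>2 / w) * (\<integral>\<^sup>+s. ennreal (w / (w + s)\<^sup>2) \<partial>m) \<le> ennreal ((C + 1) * ((1 - r) / w))"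
      by (subst nn_integral_cmult[symmetric]) auto
    then have "ennreal (w / (1 - r)\<^sup>2) * (ennreal ((1 - r)\<^sup>2 / w) * (\<integral>\<^sup>+s. ennreal (w / (w + s)\<^sup>2) \<partial>m)) \<le>
        ennreal (w / (1 - r)\<^sup>2) * ennreal ((C + 1) * ((1 - r) / w))"
      by (intro mult_left_mono) auto
    moreover have "ennreal (w / (1 - r)\<^sup>2) * ennreal ((1 - r)\<^sup>2 / w) = 1"
      using w e by (simp flip: ennreal_mult)
    moreover have "ennreal (w / (1 - r)\<^sup>2) * ennreal ((C + 1) * ((1 - r) / w)) = ennreal ((C + 1) / (1 - r))"
      using w e C by (simp add: power2_eq_square flip: ennreal_mult)
    ultimately have "(\<integral>\<^sup>+s. ennreal (w / (w + s)\<^sup>2) \<partial>m) \<le> ennreal ((C + 1) / (1 - r))"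
      by (simp add: mult.assoc[symmetric])
    also have "ennreal ((C + 1) / (1 - r)) = ennreal (C + 1) / ennreal (1 - r)"
      using e C by (intro divide_ennreal[symmetric]) auto
    finally show ?thesis
      by (simp only: poisson_test_def r_def W_def)
  qed
qed

text \<open>On a bounded interval away from \<open>0\<close> the measure is finite and the embedding is bounded for trivial
  reasons, so that its adjoint exists by the Riesz theorem. The composite of the embedding with its adjoint has
  the integral kernel \<open>(1 - cnj (\<theta> t) * \<theta> s) / (s + t)\<close>, and the Schur test bounds it independently of the
  interval.\<close>

lemma embeds_truncated:
  assumes \<theta>: "inner_function \<theta>" and less: "\<And>s. 0 < s \<Longrightarrow> cmod (\<theta> (of_real s)) < 1"
    and c: "0 < c" and test: "\<And>w. 0 < w \<Longrightarrow> poisson_test \<theta> c w"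
    and ab: "0 < a" "a < b" and f: "f \<in> model_L2 \<theta>"
  shows "(\<integral>\<^sup>+s. ennreal ((cmod (real_laplace f s))\<^sup>2) * indicator {a<..<b} s \<partial>m) \<le> ennreal (768 * c * (nrm halfline f)\<^sup>2)"
proof -
  obtain k where k: "\<And>w. 0 < w \<Longrightarrow> k w \<in> model_L2 \<theta>"
      "\<And>w s. 0 < w \<Longrightarrow> 0 < Re s \<Longrightarrow> laplace (k w) s = (1 - cnj (\<theta> (of_real w)) * \<theta> s) / (s + of_real w)"
      "\<And>w f. 0 < w \<Longrightarrow> f \<in> model_L2 \<theta> \<Longrightarrow> ip halfline f (k w) = laplace f (of_real w)"
      "\<And>w. 0 < w \<Longrightarrow> (nrm halfline (k w))\<^sup>2 = (1 - (cmod (\<theta> (of_real w)))\<^sup>2) / (2 * w)"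
    using reproducing_kernel_family[OF \<theta>] by metis
  have KL: "g \<in> L2_on halfline" if "g \<in> model_L2 \<theta>" for g using that by (rule model_L2_subset)
  define u where "u s = indicator {0<..} s *\<^sub>R \<theta> (of_real s)" for s :: real
  have u_pos: "u s = \<theta> (of_real s)" if "0 < s" for s using that by (simp add: u_def)
  have \<theta>_cont: "continuous_on {0<..} (\<lambda>s. \<theta> (of_real s))"
    by (rule continuous_on_compose2[OF holomorphic_on_imp_continuous_on[OF inner_functionD(1)[OF \<theta>]]])
       (auto intro!: continuous_intros)
  define m' where "m' = density m (\<lambda>s. indicator {a<..<b} s)"
  have [measurable_cong]: "sets m' = sets borel" by (simp add: m'_def sets_m)
  have nn: "(\<integral>\<^sup>+s. g s \<partial>m') = (\<integral>\<^sup>+s. g s * indicator {a<..<b} s \<partial>m)" if [measurable]: "g \<in> borel_measurable borel" for g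
    unfolding m'_def by (subst nn_integral_density) (auto simp: mult.commute)
  have supp: "AE s in m'. a < s \<and> s < b"
    unfolding m'_def by (subst AE_density) (auto simp: indicator_def)
  have supp_pos: "AE s in m'. 0 < s" using supp by eventually_elim (use ab in simp)
  interpret pm: pick_function u
  proof
    show "u \<in> borel_measurable borel"
      unfolding u_def[abs_def] by (rule borel_measurable_continuous_on_indicator[OF _ \<theta>_cont]) simp
    show "continuous_on {0<..} u"
      using \<theta>_cont by (rule continuous_on_eq) (simp add: u_pos)
    show "cmod (u s) < 1" if "0 < s" for s using less[OF that] by (simp add: u_pos that)
    show "4 * s * t * (cmod (1 - cnj (u t) * u s))\<^sup>2 \<le> (s + t)\<^sup>2 * ((1 - (cmod (u s))\<^sup>2) * (1 - (cmod (u t))\<^sup>2))"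
      if st: "0 < s" "0 < t" for s t
    proof -
      have "cmod (complex_of_real s + complex_of_real t) = s + t"
        unfolding of_real_add[symmetric] norm_of_real using st by simp
      then have "cmod (1 - cnj (u t) * u s) / (s + t) = cmod (ip halfline (k t) (k s))"
        using st by (subst k(3)) (auto simp: k(1,2) u_pos norm_divide)
      also have "\<dots> \<le> nrm halfline (k t) * nrm halfline (k s)"
        by (intro cmod_ip_le KL k st)
      finally have "(cmod (1 - cnj (u t) * u s) / (s + t))\<^sup>2 \<le> (nrm halfline (k t) * nrm halfline (k s))\<^sup>2"
        using st by (intro power_mono) auto
      also have "\<dots> = ((1 - (cmod (u t))\<^sup>2) / (2 * t)) * ((1 - (cmod (u s))\<^sup>2) / (2 * s))"
        using st by (simp add: power_mult_distrib k(4) u_pos)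
      finally have "(cmod (1 - cnj (u t) * u s))\<^sup>2 / (s + t)\<^sup>2 \<le>
          ((1 - (cmod (u s))\<^sup>2) * (1 - (cmod (u t))\<^sup>2)) / (4 * s * t)"
        by (simp add: power_divide mult_ac)
      moreover have "0 < (s + t)\<^sup>2" using st by (intro zero_less_power) simp
      ultimately show ?thesis
        using st by (simp add: pos_divide_le_eq pos_le_divide_eq mult_ac)
    qed
  qed
  interpret pm: pick_measure u m' a "2 * c"
  proof
    show "sets m' = sets borel" by (simp add: m'_def sets_m)
    show "0 < a" "0 \<le> 2 * c" using ab c by auto
    show "AE s in m'. a < s" using supp by eventually_elim simp
    show "(\<integral>\<^sup>+s. ennreal (w / (w + s)\<^sup>2) \<partial>m') \<le> ennreal (2 * c / pm.E w)" if w: "0 < w" for w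
    proof -
      define r where "r = cmod (\<theta> (of_real w))"
      have r: "r < 1" "0 \<le> r" using less[OF w] by (auto simp: r_def)
      have "(\<integral>\<^sup>+s. ennreal (w / (w + s)\<^sup>2) \<partial>m') \<le> (\<integral>\<^sup>+s. ennreal (w / (w + s)\<^sup>2) \<partial>m)"
        by (subst nn) (auto intro!: nn_integral_mono simp: indicator_def)
      also have "\<dots> \<le> ennreal c / ennreal (1 - r)"
        using test[OF w] by (simp add: poisson_test_def r_def)
      also have "\<dots> = ennreal (c / (1 - r))"
        using r c by (simp add: divide_ennreal)
      \<comment> \<open>the locale uses \<open>1 - \<bar>\<theta>\<bar>\<^sup>2\<close> in place of \<open>1 - \<bar>\<theta>\<bar>\<close>, whence the factor \<open>2\<close>\<close>
      also have "\<dots> \<le> ennreal (2 * c / (1 - r\<^sup>2))"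
      proof (rule ennreal_leI)
        have e: "1 - r\<^sup>2 = (1 - r) * (1 + r)" by (simp add: power2_eq_square algebra_simps)
        have "c / (1 - r) = c * (1 + r) / (1 - r\<^sup>2)" unfolding e using r by simp
        also have "\<dots> \<le> 2 * c / (1 - r\<^sup>2)"
          using r c mult_left_mono[of "1 + r" 2 c] by (intro divide_right_mono) (auto simp: power_le_one)
        finally show "c / (1 - r) \<le> 2 * c / (1 - r\<^sup>2)" .
      qed
      also have "1 - r\<^sup>2 = pm.E w"
        using w by (simp add: pm.E_def u_pos r_def)
      finally show ?thesis .
    qed
  qed
  have fin: "emeasure m' (space m') < \<infinity>"
  proof -
    have "space m' = UNIV" using sets_eq_imp_space_eq[OF \<open>sets m' = sets borel\<close>] by simp
    then have "emeasure m' (space m') = emeasure m {a<..<b}"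
      using nn[of "\<lambda>_. 1"] by (simp add: sets_m)
    also have "\<dots> \<le> emeasure m {..b}" by (rule emeasure_mono) (auto simp: sets_m)
    also have "\<dots> < \<infinity>" by (rule emeasure_atMost_finite)
    finally show ?thesis .
  qed
  interpret fm: finite_measure m' using fin by (intro finite_measureI) simp
  have RL: "real_laplace g \<in> L2_on m'" and Rle: "nrm m' (real_laplace g) \<le> sqrt (measure m' (space m') / a) * nrm halfline g"
    if g: "g \<in> model_L2 \<theta>" for g
  proof -
    have [measurable]: "real_laplace g \<in> borel_measurable borel" using KL[OF g] by measurable
    have "(\<integral>\<^sup>+s. ennreal ((cmod (real_laplace g s))\<^sup>2) \<partial>m') \<le> (\<integral>\<^sup>+s. ennreal ((nrm halfline g)\<^sup>2 / a) \<partial>m')"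
    proof (intro nn_integral_mono_AE eventually_mono[OF supp] ennreal_leI)
      fix s assume s: "a < s \<and> s < b"
      then have s0: "0 < s" using ab by simp
      have "(cmod (real_laplace g s))\<^sup>2 \<le> (nrm halfline g / sqrt s)\<^sup>2"
        by (intro power_mono cmod_real_laplace_le KL g s0) simp
      also have "\<dots> = (nrm halfline g)\<^sup>2 / s" using s0 by (simp add: power_divide)
      also have "\<dots> \<le> (nrm halfline g)\<^sup>2 / a" using s ab by (intro divide_left_mono) auto
      finally show "(cmod (real_laplace g s))\<^sup>2 \<le> (nrm halfline g)\<^sup>2 / a" .
    qed
    also have "\<dots> = ennreal ((measure m' (space m') / a) * (nrm halfline g)\<^sup>2)"
      using ab by (simp add: fm.emeasure_eq_measure mult_ac flip: ennreal_mult)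
    finally have le: "(\<integral>\<^sup>+s. ennreal ((cmod (real_laplace g s))\<^sup>2) \<partial>m') \<le> ennreal ((measure m' (space m') / a) * (nrm halfline g)\<^sup>2)" .
    show "real_laplace g \<in> L2_on m'"
      by (rule L2_on_if_nn_integral_le(1)[OF _ le]) (use ab in auto)
    have "(nrm m' (real_laplace g))\<^sup>2 \<le> (measure m' (space m') / a) * (nrm halfline g)\<^sup>2"
      by (rule L2_on_if_nn_integral_le(2)[OF _ le]) (use ab in auto)
    then have "nrm m' (real_laplace g) \<le> sqrt ((measure m' (space m') / a) * (nrm halfline g)\<^sup>2)" by (rule real_le_rsqrt)
    then show "nrm m' (real_laplace g) \<le> sqrt (measure m' (space m') / a) * nrm halfline g"
      by (simp only: real_sqrt_mult real_sqrt_abs abs_of_nonneg[OF nrm_nonneg])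
  qed
  define \<Lambda> where "\<Lambda> g = ip m' (real_laplace g) (real_laplace f)" for g
  have "\<exists>v\<in>model_L2 \<theta>. \<forall>g\<in>model_L2 \<theta>. \<Lambda> g = ip halfline g v"
  proof (rule riesz_representation[OF closed_subspace_model_L2])
    show "\<Lambda> (\<lambda>x. p * g x + q * g' x) = p * \<Lambda> g + q * \<Lambda> g'" if "g \<in> model_L2 \<theta>" "g' \<in> model_L2 \<theta>" for g g' p q
    proof -
      have "real_laplace (\<lambda>x. p * g x + q * g' x) = (\<lambda>s. p * real_laplace g s + q * real_laplace g' s)"
        using that KL by (auto simp: real_laplace_linear)
      then show ?thesis
        unfolding \<Lambda>_def using RL that f by (simp add: ip_add_left L2_on_scale ip_scale_left)
    qed
    show "cmod (\<Lambda> g) \<le> (sqrt (measure m' (space m') / a) * nrm m' (real_laplace f)) * nrm halfline g" if g: "g \<in> model_L2 \<theta>" for g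
    proof -
      have "cmod (\<Lambda> g) \<le> nrm m' (real_laplace g) * nrm m' (real_laplace f)"
        unfolding \<Lambda>_def by (intro cmod_ip_le RL g f)
      also have "\<dots> \<le> (sqrt (measure m' (space m') / a) * nrm halfline g) * nrm m' (real_laplace f)"
        by (intro mult_right_mono Rle g) simp
      finally show ?thesis by (simp add: mult_ac)
    qed
  qed
  \<comment> \<open>\<open>v\<close> is the image of \<open>real_laplace f\<close> under the adjoint of the embedding\<close>
  then obtain v where v: "v \<in> model_L2 \<theta>" and \<Lambda>v: "\<And>g. g \<in> model_L2 \<theta> \<Longrightarrow> \<Lambda> g = ip halfline g v" by blast
  have [measurable]: "real_laplace f \<in> borel_measurable borel" "real_laplace v \<in> borel_measurable borel"
    using KL f v by measurable
  define F where "F s = cmod (real_laplace f s)" for s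
  have [measurable]: "F \<in> borel_measurable borel" unfolding F_def[abs_def] by measurable
  define I where "I = (nrm m' (real_laplace f))\<^sup>2"
  have I_nn: "(\<integral>\<^sup>+s. ennreal ((F s)\<^sup>2) \<partial>m') = ennreal I"
    unfolding F_def I_def by (rule nn_integral_L2[OF RL[OF f]])
  have norm_le: "ennreal (cmod (ip m' g g')) \<le> (\<integral>\<^sup>+s. ennreal (cmod (g s) * cmod (g' s)) \<partial>m')"
    if "g \<in> L2_on m'" "g' \<in> L2_on m'" for g g'
    using integral_norm_bound_ennreal[OF integrable_ip[OF that]] by (simp add: ip_def norm_mult)
  have rl_v: "ennreal (cmod (real_laplace v t)) \<le> (\<integral>\<^sup>+s. ennreal (pm.d t s / (s + t) * F s) \<partial>m')" if t: "0 < t" for t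
  proof -
    have "cmod (real_laplace v t) = cmod (ip halfline v (k t))"
      using t v by (simp add: real_laplace_pos k)
    also have "\<dots> = cmod (\<Lambda> (k t))"
      by (subst ip_cnj) (simp add: \<Lambda>v[OF k(1)[OF t]])
    finally have "ennreal (cmod (real_laplace v t)) \<le> (\<integral>\<^sup>+s. ennreal (cmod (real_laplace (k t) s) * cmod (real_laplace f s)) \<partial>m')"
      using norm_le[OF RL[OF k(1)[OF t]] RL[OF f]] by (simp add: \<Lambda>_def)
    also have "\<dots> = (\<integral>\<^sup>+s. ennreal (pm.d t s / (s + t) * F s) \<partial>m')"
    proof (intro nn_integral_cong_AE eventually_mono[OF supp_pos])
      fix s :: real assume s: "0 < s"
      have "cmod (complex_of_real s + complex_of_real t) = s + t"
        unfolding of_real_add[symmetric] norm_of_real using s t by simp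
      then show "ennreal (cmod (real_laplace (k t) s) * cmod (real_laplace f s)) = ennreal (pm.d t s / (s + t) * F s)"
        using s t by (simp add: real_laplace_pos k(2) norm_divide pm.d_def u_pos F_def)
    qed
    finally show ?thesis .
  qed
  have "ennreal ((nrm halfline v)\<^sup>2) = ennreal (cmod (\<Lambda> v))"
    unfolding \<Lambda>v[OF v] ip_self by (simp add: norm_power)
  also have "\<dots> \<le> (\<integral>\<^sup>+t. ennreal (cmod (real_laplace v t) * F t) \<partial>m')"
    unfolding \<Lambda>_def F_def by (rule norm_le[OF RL[OF v] RL[OF f]])
  also have "\<dots> \<le> (\<integral>\<^sup>+t. \<integral>\<^sup>+s. ennreal (F t * F s * (pm.d t s / (s + t))) \<partial>m' \<partial>m')"
  proof (intro nn_integral_mono_AE eventually_mono[OF supp_pos])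
    fix t :: real assume t: "0 < t"
    have "ennreal (cmod (real_laplace v t) * F t) = ennreal (F t) * ennreal (cmod (real_laplace v t))"
      by (simp add: F_def mult.commute flip: ennreal_mult)
    also have "\<dots> \<le> ennreal (F t) * (\<integral>\<^sup>+s. ennreal (pm.d t s / (s + t) * F s) \<partial>m')"
      by (intro mult_left_mono rl_v t) simp
    also have "\<dots> = (\<integral>\<^sup>+s. ennreal (F t) * ennreal (pm.d t s / (s + t) * F s) \<partial>m')"
    proof (rule nn_integral_cmult[symmetric])
      have [measurable]: "(\<lambda>s. pm.d t s) \<in> borel_measurable borel"
        unfolding pm.d_commute[of t] by measurable
      show "(\<lambda>s. ennreal (pm.d t s / (s + t) * F s)) \<in> borel_measurable m'" by measurable
    qed
    also have "\<dots> = (\<integral>\<^sup>+s. ennreal (F t * F s * (pm.d t s / (s + t))) \<partial>m')"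
    proof (intro nn_integral_cong_AE eventually_mono[OF supp_pos])
      fix s :: real assume "0 < s"
      then have "0 \<le> pm.d t s / (s + t) * F s" using t by (simp add: F_def)
      then show "ennreal (F t) * ennreal (pm.d t s / (s + t) * F s) = ennreal (F t * F s * (pm.d t s / (s + t)))"
        by (subst ennreal_mult[symmetric]) (auto simp: F_def mult_ac)
    qed
    finally show "ennreal (cmod (real_laplace v t) * F t) \<le> (\<integral>\<^sup>+s. ennreal (F t * F s * (pm.d t s / (s + t))) \<partial>m')" .
  qed
  also have "\<dots> \<le> ennreal (768 * c) * (\<integral>\<^sup>+s. ennreal ((F s)\<^sup>2) \<partial>m')"
  proof (rule schur_test[where p = "\<lambda>s. sqrt (pm.\<phi> s)"])
    show "sigma_finite_measure m'" by (rule fm.sigma_finite_measure_axioms)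
    show "sets m' = sets borel" by (simp add: m'_def sets_m)
    show "(\<lambda>(s, t). pm.d s t / (t + s)) \<in> borel_measurable (borel \<Otimes>\<^sub>M borel)" by measurable
    show "AE s in m'. 0 < sqrt (pm.\<phi> s)"
      using supp_pos by eventually_elim (simp add: pm.\<phi>_pos)
    show "AE s in m'. AE t in m'. 0 \<le> pm.d s t / (t + s)"
      by (intro eventually_mono[OF supp_pos]) simp
    show "pm.d s t / (t + s) = pm.d t s / (s + t)" for s t
      by (simp add: pm.d_commute[of s] add.commute)
    show "AE s in m'. (\<integral>\<^sup>+t. ennreal (pm.d s t / (t + s) * sqrt (pm.\<phi> t)) \<partial>m') \<le> ennreal (768 * c * sqrt (pm.\<phi> s))"
    proof (intro eventually_mono[OF supp_pos])
      fix s :: real assume s: "0 < s"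
      have b0: "0 < b" using ab by simp
      have "AE s in m'. s < b" using supp by eventually_elim simp
      from pm.schur_row[OF b0 this s]
      show "(\<integral>\<^sup>+t. ennreal (pm.d s t / (t + s) * sqrt (pm.\<phi> t)) \<partial>m') \<le> ennreal (768 * c * sqrt (pm.\<phi> s))"
        by (simp add: pm.d_commute[of s] add.commute)
    qed
  qed (use c in \<open>auto simp: F_def\<close>)
  also have "\<dots> = ennreal (768 * c * I)"
    unfolding I_nn using c by (simp add: I_def flip: ennreal_mult)
  finally have v_le: "(nrm halfline v)\<^sup>2 \<le> 768 * c * I"
    using c by (simp add: I_def)
  \<comment> \<open>\<open>I \<le> \<parallel>f\<parallel> * \<parallel>v\<parallel>\<close> and \<open>\<parallel>v\<parallel>\<^sup>2 \<le> 768 * c * I\<close>\<close>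
  have "I = cmod (\<Lambda> f)" unfolding \<Lambda>_def ip_self I_def by (simp add: norm_power)
  also have "\<dots> \<le> nrm halfline f * nrm halfline v"
    unfolding \<Lambda>v[OF f] by (intro cmod_ip_le KL f v)
  finally have "I\<^sup>2 \<le> (nrm halfline f * nrm halfline v)\<^sup>2"
    by (intro power_mono) (auto simp: I_def)
  also have "\<dots> \<le> (nrm halfline f)\<^sup>2 * (768 * c * I)"
    unfolding power_mult_distrib by (intro mult_left_mono v_le) simp
  finally have I2: "I * I \<le> (768 * c * (nrm halfline f)\<^sup>2) * I"
    by (simp add: power2_eq_square mult_ac)
  have "I \<le> 768 * c * (nrm halfline f)\<^sup>2"
  proof (cases "I = 0")
    case False
    then have "0 < I" by (simp add: I_def less_le)
    with I2 show ?thesis by simp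
  qed (use c in simp)
  then have "(\<integral>\<^sup>+s. ennreal ((F s)\<^sup>2) \<partial>m') \<le> ennreal (768 * c * (nrm halfline f)\<^sup>2)"
    unfolding I_nn by (rule ennreal_leI)
  then show ?thesis
    by (subst (asm) nn) (auto simp: F_def)
qed

text \<open>Exhaust the half-line by the intervals \<open>(1 / n, n)\<close>. If \<open>\<bar>\<theta>\<bar> = 1\<close> at one point, all Laplace transforms vanish.\<close>

theorem embeds_if_poisson_test:
  assumes \<theta>: "inner_function \<theta>" and c: "0 < c" and test: "\<And>w. 0 < w \<Longrightarrow> poisson_test \<theta> c w"
  shows "embeds (model_L2 \<theta>) (768 * c)"
  unfolding embeds_def
proof (intro conjI ballI)
  show "0 \<le> 768 * c" using c by simp
  fix f assume f: "f \<in> model_L2 \<theta>"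
  have fL: "f \<in> L2_on halfline" using f by (rule model_L2_subset)
  have [measurable]: "real_laplace f \<in> borel_measurable borel" using fL by measurable
  show "(\<integral>\<^sup>+s. ennreal ((cmod (real_laplace f s))\<^sup>2) \<partial>m) \<le> ennreal (768 * c * (nrm halfline f)\<^sup>2)"
  proof (cases "\<forall>s>0. cmod (\<theta> (of_real s)) < 1")
    case True
    show ?thesis
    proof (rule L2_fatou)
      fix n :: nat
      define a b where "a = inverse (real (Suc (Suc n)))" and "b = real (Suc (Suc n))"
      have ab: "0 < a" "a < b"
        using less_1_mult[of b b] by (auto simp: a_def b_def inverse_eq_divide divide_less_eq)
      have "(cmod (indicator {a<..<b} s *\<^sub>R real_laplace f s))\<^sup>2 = (cmod (real_laplace f s))\<^sup>2 * indicator {a<..<b} s" for s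
        by (simp add: indicator_def)
      then have "(\<integral>\<^sup>+s. ennreal ((cmod (indicator {a<..<b} s *\<^sub>R real_laplace f s))\<^sup>2) \<partial>m) =
          (\<integral>\<^sup>+s. ennreal ((cmod (real_laplace f s))\<^sup>2) * indicator {a<..<b} s \<partial>m)"
        by (intro nn_integral_cong) (simp add: indicator_def)
      also have "\<dots> \<le> ennreal (768 * c * (nrm halfline f)\<^sup>2)"
        using True by (intro embeds_truncated[OF \<theta> _ c test ab f]) auto
      finally show "(\<integral>\<^sup>+s. ennreal ((cmod (indicator {inverse (real (Suc (Suc n)))<..<real (Suc (Suc n))} s *\<^sub>R real_laplace f s))\<^sup>2) \<partial>m)
          \<le> ennreal (768 * c * (nrm halfline f)\<^sup>2)"
        by (simp only: a_def b_def)
      show "(\<lambda>s. indicator {inverse (real (Suc (Suc n)))<..<real (Suc (Suc n))} s *\<^sub>R real_laplace f s) \<in> borel_measurable m"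
        by measurable
    next
      show "AE s in m. (\<lambda>n. indicator {inverse (real (Suc (Suc n)))<..<real (Suc (Suc n))} s *\<^sub>R real_laplace f s) \<longlonglongrightarrow> real_laplace f s"
        using pos
      proof eventually_elim
        fix s :: real assume s: "0 < s"
        obtain n1 :: nat where n1: "s < real n1" using reals_Archimedean2 by blast
        obtain n2 :: nat where n2: "inverse s < real n2" using reals_Archimedean2 by blast
        have "\<forall>\<^sub>F n in sequentially. indicator {inverse (real (Suc (Suc n)))<..<real (Suc (Suc n))} s *\<^sub>R real_laplace f s = real_laplace f s"
          using eventually_ge_at_top[of n1] eventually_ge_at_top[of n2]
        proof eventually_elim
          case (elim n)
          have "s < real (Suc (Suc n))" using n1 elim by simp
          moreover have "inverse (real (Suc (Suc n))) < inverse (inverse s)"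
            using n2 elim s by (intro less_imp_inverse_less) auto
          ultimately show ?case by simp
        qed
        then show "(\<lambda>n. indicator {inverse (real (Suc (Suc n)))<..<real (Suc (Suc n))} s *\<^sub>R real_laplace f s) \<longlonglongrightarrow> real_laplace f s"
          by (rule tendsto_eventually)
      qed
    qed measurable
  next
    case False
    then obtain t where t: "0 < t" "\<not> cmod (\<theta> (of_real t)) < 1" by blast
    then have t1: "cmod (\<theta> (of_real t)) = 1"
      using inner_function_le_one[OF \<theta>, of "of_real t"] by simp
    have zero: "real_laplace f s = 0" if s: "0 < s" for s
      using reproducing_kernels_vanish(2)[OF \<theta> t(1) t1 s f] s by (simp add: real_laplace_pos)
    have "(\<integral>\<^sup>+s. ennreal ((cmod (real_laplace f s))\<^sup>2) \<partial>m) = (\<integral>\<^sup>+s. 0 \<partial>m)"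
      by (intro nn_integral_cong_AE eventually_mono[OF pos]) (simp add: zero)
    then show ?thesis by simp
  qed
qed

theorem truncated_hankel_bounded_iff:
  assumes \<theta>: "inner_function \<theta>"
  shows "truncated_hankel_bounded h (model_L2 \<theta>) \<longleftrightarrow> (\<exists>c>0. \<forall>w>0. poisson_test \<theta> c w)"
proof
  assume "truncated_hankel_bounded h (model_L2 \<theta>)"
  then obtain C where C: "embeds (model_L2 \<theta>) C"
    using embeds_if_truncated_hankel_bounded[of "model_L2 \<theta>"] model_L2_subset by blast
  then have "0 < C + 1" by (simp add: embeds_def)
  with poisson_test_if_embeds[OF \<theta> C] show "\<exists>c>0. \<forall>w>0. poisson_test \<theta> c w" by blast
next
  assume "\<exists>c>0. \<forall>w>0. poisson_test \<theta> c w"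
  then obtain c where "0 < c" "\<And>w. 0 < w \<Longrightarrow> poisson_test \<theta> c w" by blast
  from embeds_if_poisson_test[OF \<theta> this]
  show "truncated_hankel_bounded h (model_L2 \<theta>)"
    by (rule truncated_hankel_bounded_if_embeds[OF closed_subspace_model_L2])
qed

end

section \<open>Boundary decay away from the spectrum\<close>

lemma hedge_le:
  assumes ab: "a \<le> b" and le: "\<And>x. a \<le> x \<Longrightarrow> x \<le> b \<Longrightarrow> cmod (g (Complex x y)) \<le> M"
  shows "cmod (hedge g a b y) \<le> M * (b - a)"
proof -
  have M: "0 \<le> M" using le[of a] ab norm_ge_zero order_trans by blast
  have "cmod (hedge g a b y) \<le> (LBINT x. norm (indicator {a..b} x *\<^sub>R g (Complex x y)))"
    unfolding hedge_def set_lebesgue_integral_def by (rule integral_norm_bound)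
  also have "\<dots> \<le> (LBINT x. M * indicator {a..b} x)"
  proof (rule Bochner_Integration.integral_mono')
    show "integrable lborel (\<lambda>x. M * indicator {a..b} x)"
      by (intro integrable_mult_right integrable_real_indicator) (auto simp: emeasure_lborel_Icc_eq)
  qed (use le M in \<open>auto simp: indicator_def\<close>)
  also have "\<dots> = M * (b - a)" using ab by simp
  finally show ?thesis .
qed

lemma vedge_le_integral:
  assumes K: "integrable lborel K" and le: "\<And>y. c \<le> y \<Longrightarrow> y \<le> d \<Longrightarrow> cmod (g (Complex x y)) \<le> K y" and K0: "\<And>y. 0 \<le> K y"
  shows "cmod (vedge g x c d) \<le> (LBINT y. indicator {c..d} y * K y)"
proof -
  have "cmod (vedge g x c d) \<le> (LBINT y. norm (indicator {c..d} y *\<^sub>R g (Complex x y)))"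
    unfolding vedge_def set_lebesgue_integral_def by (rule integral_norm_bound)
  also have "\<dots> \<le> (LBINT y. indicator {c..d} y * K y)"
  proof (rule Bochner_Integration.integral_mono')
    show "integrable lborel (\<lambda>y. indicator {c..d} y * K y)"
      using integrable_mult_indicator[OF _ K, of "{c..d}"] by simp
  qed (use le K0 in \<open>auto simp: indicator_def\<close>)
  finally show ?thesis .
qed

lemma vedge_le:
  assumes cd: "c \<le> d" and le: "\<And>y. c \<le> y \<Longrightarrow> y \<le> d \<Longrightarrow> cmod (g (Complex x y)) \<le> M"
  shows "cmod (vedge g x c d) \<le> M * (d - c)"
proof -
  have M: "0 \<le> M" using le[of c] cd norm_ge_zero order_trans by blast
  have "cmod (vedge g x c d) \<le> (LBINT y. norm (indicator {c..d} y *\<^sub>R g (Complex x y)))"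
    unfolding vedge_def set_lebesgue_integral_def by (rule integral_norm_bound)
  also have "\<dots> \<le> (LBINT y. M * indicator {c..d} y)"
  proof (rule Bochner_Integration.integral_mono')
    show "integrable lborel (\<lambda>y. M * indicator {c..d} y)"
      by (intro integrable_mult_right integrable_real_indicator) (auto simp: emeasure_lborel_Icc_eq)
  qed (use le M in \<open>auto simp: indicator_def\<close>)
  also have "\<dots> = M * (d - c)" using cd by simp
  finally show ?thesis .
qed

lemma vedge_combine:
  assumes "c \<le> d" "d \<le> e" and g: "continuous_on ((\<lambda>y. Complex x y) ` {c..e}) g"
  shows "vedge g x c e = vedge g x c d + vedge g x d e"
proof -
  have ct: "continuous_on {c..e} (\<lambda>y. g (Complex x y))"
    by (rule continuous_on_compose2[OF g]) (auto intro!: continuous_intros)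
  have eq: "vedge g x p q = integral {p..q} (\<lambda>y. g (Complex x y))" if "c \<le> p" "q \<le> e" for p q
  proof -
    have "set_integrable lborel {p..q} (\<lambda>y. g (Complex x y))"
      using ct that by (intro borel_integrable_atLeastAtMost' continuous_on_subset[OF ct]) auto
    then show ?thesis unfolding vedge_def by (rule set_borel_integral_eq_integral)
  qed
  have "(\<lambda>y. g (Complex x y)) integrable_on {c..e}" using ct by (rule integrable_continuous_real)
  then show ?thesis
    using assms(1,2) by (simp add: eq Henstock_Kurzweil_Integration.integral_combine)
qed

text \<open>Dominated convergence on the lines \<open>Re z = S k\<close>, as \<open>\<bar>\<theta>\<bar>\<close> is at least \<open>\<delta>\<close> on the support of the weight \<open>K\<close>.\<close>

lemma inner_inverse_powers_tendsto:
  assumes \<theta>: "inner_function \<theta>" and S: "\<And>k. 0 < S k" "S \<longlonglongrightarrow> 0"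
    and K: "integrable lborel K" "\<And>y. 0 \<le> K y" and \<delta>: "0 < \<delta>"
    and low: "\<And>k y. K y \<noteq> 0 \<Longrightarrow> \<delta> \<le> cmod (\<theta> (Complex (S k) y))"
  shows "integrable lborel (\<lambda>y. (1 / cmod (\<theta> (Complex (S k) y))) ^ n * K y)"
    and "(\<lambda>k. LBINT y. (1 / cmod (\<theta> (Complex (S k) y))) ^ n * K y) \<longlonglongrightarrow> integral\<^sup>L lborel K"
proof -
  have [measurable]: "K \<in> borel_measurable borel" using K(1) by auto
  have [measurable]: "(\<lambda>y. \<theta> (Complex (S k) y)) \<in> borel_measurable borel" for k
    using measurable_on_line[OF inner_functionD(1)[OF \<theta>] S(1)[of k]] by (simp add: on_line_def[abs_def])
  have le: "norm ((1 / cmod (\<theta> (Complex (S k) y))) ^ n * K y) \<le> (1 / \<delta>) ^ n * K y" for k y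
  proof (cases "K y = 0")
    case False
    then have "1 / cmod (\<theta> (Complex (S k) y)) \<le> 1 / \<delta>"
      using low[OF False, of k] \<delta> by (intro frac_le) auto
    then have "(1 / cmod (\<theta> (Complex (S k) y))) ^ n \<le> (1 / \<delta>) ^ n"
      by (intro power_mono) auto
    then show ?thesis using K(2)[of y] by (simp add: abs_mult mult_right_mono del: power_one_over)
  qed simp
  have dom: "integrable lborel (\<lambda>y. (1 / \<delta>) ^ n * K y)" using K(1) by simp
  show "integrable lborel (\<lambda>y. (1 / cmod (\<theta> (Complex (S k) y))) ^ n * K y)"
    by (rule Bochner_Integration.integrable_bound[OF dom])
       (measurable, use le[of k] in \<open>auto intro!: AE_I2 intro: order_trans[OF _ abs_ge_self]\<close>)
  show "(\<lambda>k. LBINT y. (1 / cmod (\<theta> (Complex (S k) y))) ^ n * K y) \<longlonglongrightarrow> integral\<^sup>L lborel K"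
  proof (rule integral_dominated_convergence[OF _ _ dom])
    show "AE y in lborel. (\<lambda>k. (1 / cmod (\<theta> (Complex (S k) y))) ^ n * K y) \<longlonglongrightarrow> K y"
      using inner_function_seq_tendsto[OF \<theta> S]
    proof eventually_elim
      fix y assume "(\<lambda>k. cmod (\<theta> (Complex (S k) y))) \<longlonglongrightarrow> 1"
      then have "(\<lambda>k. (1 / cmod (\<theta> (Complex (S k) y))) ^ n * K y) \<longlonglongrightarrow> (1 / 1) ^ n * K y"
        by (intro tendsto_intros) auto
      then show "(\<lambda>k. (1 / cmod (\<theta> (Complex (S k) y))) ^ n * K y) \<longlonglongrightarrow> K y" by simp
    qed
    show "AE y in lborel. norm ((1 / cmod (\<theta> (Complex (S k) y))) ^ n * K y) \<le> (1 / \<delta>) ^ n * K y" for k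
      using le by (intro AE_I2)
  qed measurable
qed

text \<open>Near a boundary point outside the spectrum, \<open>log (1 / \<bar>\<theta>\<bar>)\<close> is a bounded harmonic function on a
  rectangle with boundary values \<open>0\<close> on the imaginary axis. It is dominated by the harmonic polynomial
  \<open>y\<^sup>2 - x\<^sup>2 + 2 a x\<close>, a multiple of which majorises it on the other three sides. Equivalently \<open>\<bar>g\<bar> \<le> 1\<close>
  on these sides, and the left side is moved to the imaginary axis in Cauchy's formula for \<open>g\<^sup>n\<close>.\<close>

lemma inner_defect_linear_at_zero:
  assumes \<theta>: "inner_function \<theta>" and r: "0 < r" and \<delta>: "0 < \<delta>"
    and low: "\<And>z. 0 < Re z \<Longrightarrow> cmod z < r \<Longrightarrow> \<delta> \<le> cmod (\<theta> z)"
  shows "\<exists>L>0. \<forall>w>0. 1 - cmod (\<theta> (of_real w)) \<le> L * w"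
proof -
  define a where "a = r / 4"
  have a: "0 < a" using r by (simp add: a_def)
  have \<delta>1: "\<delta> \<le> 1"
    using low[of "of_real a"] inner_function_le_one[OF \<theta>, of "of_real a"] a r by (simp add: a_def)
  define A where "A = ln (1 / \<delta>) / a\<^sup>2"
  have A: "0 \<le> A" "A * a\<^sup>2 = ln (1 / \<delta>)"
    using \<delta> \<delta>1 a by (auto simp: A_def)
  have in_ball: "cmod z < r" if "\<bar>Re z\<bar> \<le> a" "\<bar>Im z\<bar> \<le> a" for z
    using cmod_le[of z] that a by (simp add: a_def)
  have hol: "\<theta> holomorphic_on Cplus" by (rule inner_functionD(1)[OF \<theta>])
  define g where "g z = exp (of_real A * (z\<^sup>2 - 2 * of_real a * z)) / \<theta> z" for z
  have cmod_g: "cmod (g z) = exp (- (A * ((Im z)\<^sup>2 - (Re z)\<^sup>2 + 2 * a * Re z))) / cmod (\<theta> z)" for z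
    by (simp add: g_def norm_divide power2_eq_square algebra_simps)
  have \<theta>0: "\<theta> z \<noteq> 0" if "0 < Re z" "Re z \<le> a" "\<bar>Im z\<bar> \<le> a" for z
    using low[OF that(1) in_ball] that \<delta> by auto
  have g_le: "cmod (g z) \<le> 1 / cmod (\<theta> z)" if "0 < Re z" "Re z \<le> a" for z
  proof -
    have "(Re z)\<^sup>2 \<le> 2 * a * Re z"
      using that a by (simp add: power2_eq_square mult_right_mono)
    then have "0 \<le> (Im z)\<^sup>2 - (Re z)\<^sup>2 + 2 * a * Re z"
      using zero_le_power2[of "Im z"] by linarith
    then have "0 \<le> A * ((Im z)\<^sup>2 - (Re z)\<^sup>2 + 2 * a * Re z)"
      using A by (intro mult_nonneg_nonneg)
    then show ?thesis unfolding cmod_g by (intro divide_right_mono) auto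
  qed
  have g_le1: "cmod (g z) \<le> 1" if z: "0 < Re z" "Re z \<le> a" "\<bar>Im z\<bar> \<le> a" and side: "\<bar>Im z\<bar> = a \<or> Re z = a" for z
  proof -
    have "a\<^sup>2 \<le> (Im z)\<^sup>2 - (Re z)\<^sup>2 + 2 * a * Re z"
      using side
    proof
      assume "\<bar>Im z\<bar> = a"
      then have "(Im z)\<^sup>2 = a\<^sup>2" by (metis power2_abs)
      moreover have "(Re z)\<^sup>2 \<le> 2 * a * Re z"
        using z a by (simp add: power2_eq_square mult_right_mono)
      ultimately show ?thesis by simp
    next
      assume "Re z = a"
      then show ?thesis by (simp add: power2_eq_square)
    qed
    then have "ln (1 / \<delta>) \<le> A * ((Im z)\<^sup>2 - (Re z)\<^sup>2 + 2 * a * Re z)"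
      unfolding A(2)[symmetric] using A(1) by (rule mult_left_mono)
    then have "exp (- (A * ((Im z)\<^sup>2 - (Re z)\<^sup>2 + 2 * a * Re z))) \<le> exp (- ln (1 / \<delta>))"
      by simp
    also have "\<dots> = \<delta>" using \<delta> by (simp add: ln_div)
    also have "\<dots> \<le> cmod (\<theta> z)" using low[OF z(1) in_ball] z by auto
    finally have "exp (- (A * ((Im z)\<^sup>2 - (Re z)\<^sup>2 + 2 * a * Re z))) \<le> cmod (\<theta> z)" .
    then show ?thesis
      unfolding cmod_g using \<theta>0[OF z(1-3)] by simp
  qed
  have main: "1 - cmod (\<theta> (of_real w)) \<le> 2 * a * A * w" if w: "0 < w" "w < a" for w
  proof -
    define S where "S k = (w / 2) * inverse (real (Suc k))" for k
    have S: "0 < S k" "S k \<le> w / 2" for k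
      using w by (auto simp: S_def intro!: mult_left_le simp: inverse_le_1_iff)
    have "S \<longlonglongrightarrow> (w / 2) * 0"
      unfolding S_def by (intro tendsto_intros LIMSEQ_inverse_real_of_nat)
    then have S0: "S \<longlonglongrightarrow> 0" by simp
    define K where "K y = (2 / w) * indicator {-a..a} y" for y :: real
    have K: "integrable lborel K" "0 \<le> K y" for y
    proof -
      show "integrable lborel K"
        unfolding K_def
        by (intro integrable_mult_right integrable_real_indicator) (auto simp: emeasure_lborel_Icc_eq)
      show "0 \<le> K y" using w by (simp add: K_def)
    qed
    have K_low: "\<delta> \<le> cmod (\<theta> (Complex (S k) y))" if "K y \<noteq> 0" for k y
    proof (rule low)
      show "cmod (Complex (S k) y) < r"
        using that S[of k] w by (intro in_ball) (auto simp: K_def indicator_def split: if_splits)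
    qed (use S in simp)
    have "cmod (g (of_real w)) ^ n \<le> (2 + 2 * a / (a - w) + integral\<^sup>L lborel K) / (2 * pi)" for n
    proof -
      define G where "G z = g z ^ n / (z - of_real w)" for z
      have le: "2 * pi * cmod (g (of_real w)) ^ n \<le>
          2 + 2 * a / (a - w) + (LBINT y. (1 / cmod (\<theta> (Complex (S k) y))) ^ n * K y)" for k
      proof -
        note Sk = S[of k]
        have ne: "\<theta> z \<noteq> 0" if "S k \<le> Re z" "Re z \<le> a" "- a \<le> Im z" "Im z \<le> a" for z
          using that Sk by (intro \<theta>0) auto
        have "hedge G (S k) a (- a) + \<i> * vedge G a (- a) a - hedge G (S k) a a - \<i> * vedge G (S k) (- a) a =
            2 * pi * \<i> * g (of_real w) ^ n"
          unfolding G_def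
        proof (rule rectangle_cauchy_formula)
          show "(\<lambda>z. g z ^ n) holomorphic_on {z. Re z \<in> {S k..a} \<and> Im z \<in> {- a..a}}"
            unfolding g_def using Sk(1)
            by (intro holomorphic_intros holomorphic_on_subset[OF hol]) (auto dest: ne)
        qed (use Sk w a in auto)
        note cauchy = this
        have "cmod (2 * pi * \<i> * g (of_real w) ^ n) \<le>
            cmod (hedge G (S k) a (- a)) + cmod (vedge G a (- a) a) + cmod (hedge G (S k) a a) + cmod (vedge G (S k) (- a) a)"
        proof -
          have "cmod (p + \<i> * q - r - \<i> * s) \<le> cmod p + cmod q + cmod r + cmod s" for p q r s
            using norm_triangle_ineq4[of "p + \<i> * q - r" "\<i> * s"] norm_triangle_ineq4[of "p + \<i> * q" r]
              norm_triangle_ineq[of p "\<i> * q"] by (simp add: norm_mult)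
          from this[of "hedge G (S k) a (- a)" "vedge G a (- a) a" "hedge G (S k) a a" "vedge G (S k) (- a) a"]
          show ?thesis unfolding cauchy .
        qed
        moreover have "cmod (2 * pi * \<i> * g (of_real w) ^ n) = 2 * pi * cmod (g (of_real w)) ^ n"
          by (simp add: norm_mult norm_power)
        moreover have h: "cmod (hedge G (S k) a y) \<le> 1" if y: "\<bar>y\<bar> = a" for y
        proof -
          have "cmod (hedge G (S k) a y) \<le> (1 / a) * (a - S k)"
          proof (rule hedge_le)
            fix x assume x: "S k \<le> x" "x \<le> a"
            have "cmod (g (Complex x y)) \<le> 1" using Sk x y by (intro g_le1) auto
            moreover have "a \<le> cmod (Complex x y - of_real w)"
              using abs_Im_le_cmod[of "Complex x y - of_real w"] y by simp
            ultimately show "cmod (G (Complex x y)) \<le> 1 / a"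
              unfolding G_def norm_divide norm_power using a by (intro frac_le power_le_one) auto
          qed (use Sk w in simp)
          also have "\<dots> \<le> 1" using a Sk by (simp add: field_simps)
          finally show ?thesis .
        qed
        moreover have "cmod (vedge G a (- a) a) \<le> 2 * a / (a - w)"
        proof -
          have "cmod (vedge G a (- a) a) \<le> (1 / (a - w)) * (a - (- a))"
          proof (rule vedge_le)
            fix y assume y: "- a \<le> y" "y \<le> a"
            have "cmod (g (Complex a y)) \<le> 1" using a y by (intro g_le1) auto
            moreover have "a - w \<le> cmod (Complex a y - of_real w)"
              using abs_Re_le_cmod[of "Complex a y - of_real w"] by simp
            ultimately show "cmod (G (Complex a y)) \<le> 1 / (a - w)"
              unfolding G_def norm_divide norm_power using w by (intro frac_le power_le_one) auto
          qed (use a in simp)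
          then show ?thesis by simp
        qed
        moreover have "cmod (vedge G (S k) (- a) a) \<le> (LBINT y. (1 / cmod (\<theta> (Complex (S k) y))) ^ n * K y)"
        proof -
          have "cmod (vedge G (S k) (- a) a) \<le>
              (LBINT y. indicator {- a..a} y * ((1 / cmod (\<theta> (Complex (S k) y))) ^ n * K y))"
          proof (rule vedge_le_integral[OF inner_inverse_powers_tendsto(1)[OF \<theta> S(1) S0 K \<delta> K_low]])
            fix y assume y: "- a \<le> y" "y \<le> a"
            have "cmod (g (Complex (S k) y)) \<le> 1 / cmod (\<theta> (Complex (S k) y))" using Sk w y by (intro g_le) auto
            moreover have "w / 2 \<le> cmod (Complex (S k) y - of_real w)"
              using abs_Re_le_cmod[of "Complex (S k) y - of_real w"] Sk by simp
            ultimately have "cmod (G (Complex (S k) y)) \<le> (1 / cmod (\<theta> (Complex (S k) y))) ^ n / (w / 2)"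
              unfolding G_def norm_divide norm_power using w by (intro frac_le power_mono) auto
            then show "cmod (G (Complex (S k) y)) \<le> (1 / cmod (\<theta> (Complex (S k) y))) ^ n * K y"
              using y by (simp add: K_def)
          qed (use K in auto)
          also have "\<dots> = (LBINT y. (1 / cmod (\<theta> (Complex (S k) y))) ^ n * K y)"
            by (intro Bochner_Integration.integral_cong refl) (auto simp: K_def indicator_def)
          finally show ?thesis .
        qed
        moreover have "cmod (hedge G (S k) a a) \<le> 1" "cmod (hedge G (S k) a (- a)) \<le> 1"
          using a by (intro h; simp)+
        ultimately show ?thesis by linarith
      qed
      have "(\<lambda>k. 2 + 2 * a / (a - w) + (LBINT y. (1 / cmod (\<theta> (Complex (S k) y))) ^ n * K y)) \<longlonglongrightarrow>
          2 + 2 * a / (a - w) + integral\<^sup>L lborel K"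
        by (intro tendsto_intros inner_inverse_powers_tendsto(2)[OF \<theta> S(1) S0 K \<delta> K_low])
      then have "2 * pi * cmod (g (of_real w)) ^ n \<le> 2 + 2 * a / (a - w) + integral\<^sup>L lborel K"
        by (rule LIMSEQ_le_const) (use le in blast)
      then show ?thesis by (simp add: field_simps)
    qed
    then have "cmod (g (of_real w)) \<le> 1" by (rule le_one_if_powers_bounded)
    then have "exp (- (A * (2 * a * w - w\<^sup>2))) \<le> cmod (\<theta> (of_real w))"
      unfolding cmod_g using \<theta>0[of "of_real w"] w a by (simp add: algebra_simps)
    moreover have "1 - A * (2 * a * w - w\<^sup>2) \<le> exp (- (A * (2 * a * w - w\<^sup>2)))"
      using exp_ge_add_one_self[of "- (A * (2 * a * w - w\<^sup>2))"] by simp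
    moreover have "A * (2 * a * w - w\<^sup>2) \<le> A * (2 * a * w)"
      using A(1) by (intro mult_left_mono) auto
    ultimately show ?thesis by (simp add: mult_ac)
  qed
  define L where "L = 2 * a * A + 1 / a"
  have "1 - cmod (\<theta> (of_real w)) \<le> L * w" if w: "0 < w" for w
  proof (cases "w < a")
    case True
    have "2 * a * A * w \<le> L * w" using w a by (intro mult_right_mono) (auto simp: L_def)
    with main[OF w True] show ?thesis by simp
  next
    case False
    have "1 \<le> (1 / a) * w" using False a by simp
    also have "\<dots> \<le> L * w" using w a A by (intro mult_right_mono) (auto simp: L_def)
    finally have "1 \<le> L * w" .
    moreover have "1 - cmod (\<theta> (of_real w)) \<le> 1" by simp
    ultimately show ?thesis by linarith
  qed
  moreover have "0 < L" using a A by (simp add: L_def add_nonneg_pos)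
  ultimately show ?thesis by blast
qed

text \<open>At infinity the comparison function is the corresponding one for \<open>1 / z\<close>, on the half-plane without the
  rectangle \<open>[0, R] \<times> [- R, R]\<close>: with \<open>1 / z = x' - \<i> y'\<close>, the function \<open>p\<close> is \<open>y'\<^sup>2 - x'\<^sup>2 + (4 / R) x'\<close>. The region is
  cut into three rectangles, one to the right of the line \<open>Re z = R\<close> and two to its left; the outer sides
  contribute nothing in the limit.\<close>

lemma inner_defect_at_infinity:
  assumes \<theta>: "inner_function \<theta>" and R: "0 < R" and \<delta>: "0 < \<delta>"
    and low: "\<And>z. 0 < Re z \<Longrightarrow> R \<le> cmod z \<Longrightarrow> \<delta> \<le> cmod (\<theta> z)"
  shows "\<exists>L>0. \<forall>w>0. (1 - cmod (\<theta> (of_real w))) * w \<le> L"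
proof -
  have \<delta>1: "\<delta> \<le> 1"
    using low[of "of_real R"] inner_function_le_one[OF \<theta>, of "of_real R"] R by simp
  define A where "A = 4 * R\<^sup>2 * ln (1 / \<delta>)"
  have A: "0 \<le> A" "A * (1 / (4 * R\<^sup>2)) = ln (1 / \<delta>)"
    using \<delta> \<delta>1 R by (auto simp: A_def)
  have hol: "\<theta> holomorphic_on Cplus" by (rule inner_functionD(1)[OF \<theta>])
  define B where "B = 1 / \<delta>"
  have B: "1 \<le> B" using \<delta> \<delta>1 by (simp add: B_def)
  define g where "g z = exp (of_real A * (1 / z\<^sup>2 - of_real (4 / R) * (1 / z))) / \<theta> z" for z
  define p where "p z = 4 * Re z / (R * (cmod z)\<^sup>2) + ((Im z)\<^sup>2 - (Re z)\<^sup>2) / ((cmod z)\<^sup>2)\<^sup>2" for z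
  have cmod_g: "cmod (g z) = exp (- (A * p z)) / cmod (\<theta> z)" if "z \<noteq> 0" for z
  proof -
    have 1: "Re (1 / z) = Re z / (cmod z)\<^sup>2"
      by (simp add: Re_divide cmod_power2)
    have "Re (1 / z\<^sup>2) = Re (z\<^sup>2) / (cmod (z\<^sup>2))\<^sup>2"
      by (simp add: Re_divide cmod_power2)
    also have "\<dots> = ((Re z)\<^sup>2 - (Im z)\<^sup>2) / ((cmod z)\<^sup>2)\<^sup>2"
      by (simp only: norm_power Re_power2)
    finally have 2: "Re (1 / z\<^sup>2) = ((Re z)\<^sup>2 - (Im z)\<^sup>2) / ((cmod z)\<^sup>2)\<^sup>2" .
    have "Re (of_real A * (1 / z\<^sup>2 - of_real (4 / R) * (1 / z))) = A * (Re (1 / z\<^sup>2) - 4 / R * Re (1 / z))"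
    proof -
      have "Re (of_real A * (u - of_real c * v)) = A * (Re u - c * Re v)" for u v c
        by simp
      then show ?thesis .
    qed
    also have "\<dots> = - (A * p z)"
      unfolding 1 2 p_def by (simp add: algebra_simps diff_divide_distrib)
    finally show ?thesis
      by (simp add: g_def norm_divide)
  qed
  have p_nonneg: "0 \<le> p z" if z: "0 < Re z" "R \<le> cmod z" for z
  proof -
    define D where "D = (cmod z)\<^sup>2"
    have D: "0 < D" "0 < cmod z" using z R by (auto simp: D_def)
    have "(Re z)\<^sup>2 * R \<le> Re z * (cmod z * R)"
      using z R complex_Re_le_cmod[of z] by (simp add: power2_eq_square mult_mono)
    also have "\<dots> \<le> Re z * (cmod z * cmod z)"
      using z R by (intro mult_left_mono) auto
    also have "\<dots> = Re z * D" by (simp add: D_def power2_eq_square)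
    finally have "(Re z)\<^sup>2 * R \<le> Re z * D" .
    then have "(Re z)\<^sup>2 / D\<^sup>2 \<le> Re z / (R * D)"
      using D R by (simp add: pos_divide_le_eq pos_le_divide_eq power2_eq_square mult_ac)
    also have "\<dots> \<le> 4 * Re z / (R * D)"
      using z R D by (intro divide_right_mono) auto
    finally have "(Re z)\<^sup>2 / D\<^sup>2 \<le> 4 * Re z / (R * D)" .
    moreover have "0 \<le> (Im z)\<^sup>2 / D\<^sup>2" by simp
    ultimately show ?thesis
      unfolding p_def D_def[symmetric] diff_divide_distrib by linarith
  qed
  have p_hole: "1 / (4 * R\<^sup>2) \<le> p z" if z: "0 < Re z" "Re z \<le> R" "\<bar>Im z\<bar> \<le> R" and side: "\<bar>Im z\<bar> = R \<or> Re z = R" for z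
  proof -
    define D where "D = (cmod z)\<^sup>2"
    have sq: "(Re z)\<^sup>2 \<le> R\<^sup>2" "(Im z)\<^sup>2 \<le> R\<^sup>2"
      using z by (auto simp: abs_le_square_iff[symmetric])
    have Deq: "D = (Re z)\<^sup>2 + (Im z)\<^sup>2" by (simp add: D_def cmod_power2)
    have D2: "D \<le> 2 * R\<^sup>2" using sq Deq by simp
    have DR: "R\<^sup>2 \<le> D"
    proof -
      have "(Im z)\<^sup>2 = R\<^sup>2 \<or> (Re z)\<^sup>2 = R\<^sup>2" using side by (metis power2_abs)
      then show ?thesis unfolding Deq by auto
    qed
    have R2: "0 < R\<^sup>2" using R by simp
    then have D0: "0 < D" using DR by linarith
    show ?thesis
      using side
    proof
      assume "\<bar>Im z\<bar> = R"
      then have Im: "(Im z)\<^sup>2 = R\<^sup>2" by (metis power2_abs)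
      have "D\<^sup>2 \<le> (2 * R\<^sup>2)\<^sup>2" using D2 D0 by (intro power_mono) auto
      then have "(R\<^sup>2 - (Re z)\<^sup>2) / (2 * R\<^sup>2)\<^sup>2 \<le> (R\<^sup>2 - (Re z)\<^sup>2) / D\<^sup>2"
        using sq D0 R by (intro divide_left_mono) auto
      moreover have "4 * Re z / (R * (2 * R\<^sup>2)) \<le> 4 * Re z / (R * D)"
        using D2 D0 R z by (intro divide_left_mono mult_left_mono) auto
      moreover have "1 / (4 * R\<^sup>2) \<le> 4 * Re z / (R * (2 * R\<^sup>2)) + (R\<^sup>2 - (Re z)\<^sup>2) / (2 * R\<^sup>2)\<^sup>2"
      proof -
        have "Re z * Re z \<le> 8 * (Re z * R)"
          using z R mult_left_mono[of "Re z" R "Re z"] by simp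
        then have "R * R \<le> 8 * (Re z * R) + (R * R - Re z * Re z)" by simp
        then have "(R * R) / (4 * (R * R * (R * R))) \<le> (8 * (Re z * R) + (R * R - Re z * Re z)) / (4 * (R * R * (R * R)))"
          by (intro divide_right_mono) auto
        moreover have "(R * R) / (4 * (R * R * (R * R))) = 1 / (4 * R\<^sup>2)"
          using R by (simp add: power2_eq_square)
        moreover have "(8 * (Re z * R) + (R * R - Re z * Re z)) / (4 * (R * R * (R * R))) =
            4 * Re z / (R * (2 * R\<^sup>2)) + (R\<^sup>2 - (Re z)\<^sup>2) / (2 * R\<^sup>2)\<^sup>2"
          using R by (simp add: add_divide_distrib power2_eq_square mult_ac)
        ultimately show ?thesis by simp
      qed
      ultimately show ?thesis
        unfolding p_def D_def[symmetric] Im by linarith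
    next
      assume Re: "Re z = R"
      have "R\<^sup>2 / D\<^sup>2 \<le> D / D\<^sup>2" using DR by (intro divide_right_mono) auto
      also have "\<dots> = 1 / D" using D0 by (simp add: power2_eq_square)
      finally have 1: "R\<^sup>2 / D\<^sup>2 \<le> 1 / D" .
      have "1 / (4 * R\<^sup>2) \<le> 1 / D" using D2 D0 R2 by (intro divide_left_mono) auto
      moreover have "4 * R / (R * D) = 4 * (1 / D)" using R by simp
      moreover have "0 < 1 / D" using D0 by simp
      moreover have "0 \<le> (Im z)\<^sup>2 / D\<^sup>2" by simp
      moreover have "x \<le> q + (i - r)" if "x \<le> y" "q = 4 * y" "0 < y" "0 \<le> i" "r \<le> y" for x y q i r :: real
        using that by linarith
      ultimately show ?thesis
        using 1 unfolding p_def D_def[symmetric] Re diff_divide_distrib by blast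
    qed
  qed
  have \<theta>0: "\<theta> z \<noteq> 0" if "0 < Re z" "R \<le> cmod z" for z
    using low[OF that] \<delta> by auto
  have z0: "z \<noteq> 0" if "0 < Re z" for z using that by auto
  have g_le: "cmod (g z) \<le> 1 / cmod (\<theta> z)" if z: "0 < Re z" "R \<le> cmod z" for z
    unfolding cmod_g[OF z0[OF z(1)]] using p_nonneg[OF z] A(1) by (intro divide_right_mono) auto
  have g_leB: "cmod (g z) \<le> B" if z: "0 < Re z" "R \<le> cmod z" for z
  proof -
    have "1 / cmod (\<theta> z) \<le> B" unfolding B_def using low[OF z] \<delta> by (intro frac_le) auto
    with g_le[OF z] show ?thesis by simp
  qed
  have side_le: "R \<le> cmod z" if "\<bar>Im z\<bar> \<ge> R \<or> Re z \<ge> R" for z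
    using that abs_Im_le_cmod[of z] complex_Re_le_cmod[of z] by linarith
  have g_le1: "cmod (g z) \<le> 1" if z: "0 < Re z" "Re z \<le> R" "\<bar>Im z\<bar> \<le> R" and side: "\<bar>Im z\<bar> = R \<or> Re z = R" for z
  proof -
    have zR: "R \<le> cmod z" using side by (intro side_le) auto
    have "ln (1 / \<delta>) \<le> A * p z"
      unfolding A(2)[symmetric] using p_hole[OF z side] A(1) by (rule mult_left_mono)
    then have "exp (- (A * p z)) \<le> exp (- ln (1 / \<delta>))" by simp
    also have "\<dots> = \<delta>" using \<delta> by (simp add: ln_div)
    also have "\<dots> \<le> cmod (\<theta> z)" by (rule low[OF z(1) zR])
    finally show ?thesis
      unfolding cmod_g[OF z0[OF z(1)]] using \<theta>0[OF z(1) zR] by simp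
  qed
  have g_hol: "g holomorphic_on {z. 0 < Re z \<and> R \<le> cmod z}"
    unfolding g_def
    by (intro holomorphic_intros holomorphic_on_subset[OF hol]) (use R in \<open>auto dest: \<theta>0\<close>)
  have main: "(1 - cmod (\<theta> (of_real w))) * w \<le> A * (4 / R)" if w: "R < w" for w
  proof -
    have w0: "0 < w" using w R by simp
    define S where "S k = (R / 2) * inverse (real (Suc k))" for k
    have S: "0 < S k" "S k < R" for k
    proof -
      show "0 < S k" using R by (simp add: S_def)
      have "S k \<le> R / 2" using R by (auto simp: S_def intro!: mult_left_le simp: inverse_le_1_iff)
      then show "S k < R" using R by simp
    qed
    have "S \<longlonglongrightarrow> (R / 2) * 0"
      unfolding S_def by (intro tendsto_intros LIMSEQ_inverse_real_of_nat)
    then have S0: "S \<longlonglongrightarrow> 0" by simp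
    define d where "d y = cmod (on_line (\<lambda>z. 1 / (z - (-1))) 0 y) * cmod (on_line (\<lambda>z. 1 / (z - of_real (w - R))) 0 y)" for y
    define K where "K y = indicator {y. R \<le> \<bar>y\<bar>} y * d y" for y
    have d_int: "integrable lborel d"
      unfolding d_def using w by (intro integrable_cmod_mult L2_on_pole) auto
    have K: "integrable lborel K" "0 \<le> K y" for y
    proof -
      have "closed {y::real. R \<le> \<bar>y\<bar>}" by (intro closed_Collect_le continuous_intros)
      then have "integrable lborel (\<lambda>y. indicator {y. R \<le> \<bar>y\<bar>} y *\<^sub>R d y)"
        by (intro integrable_mult_indicator d_int) auto
      then show "integrable lborel K" by (simp add: K_def[abs_def])
      show "0 \<le> K y" by (simp add: K_def d_def)
    qed
    have K_low: "\<delta> \<le> cmod (\<theta> (Complex (S k) y))" if "K y \<noteq> 0" for k y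
      using that S[of k] by (intro low side_le) (auto simp: K_def indicator_def split: if_splits)
    have "cmod (g (of_real w)) ^ n \<le> (2 * R / (w - R) + 2 + integral\<^sup>L lborel K) * (w + 1) / (2 * pi)" for n
    proof -
      \<comment> \<open>the factor \<open>1 / (z + 1)\<close> makes the integrals over the outer sides tend to \<open>0\<close>\<close>
      define F where "F z = g z ^ n / (z + 1)" for z
      define G where "G z = F z / (z - of_real w)" for z
      have le: "2 * pi * (cmod (g (of_real w)) ^ n / (w + 1)) \<le>
          2 * R / (w - R) + 2 + (LBINT y. (1 / cmod (\<theta> (Complex (S k) y))) ^ n * K y)" for k
      proof -
        note Sk = S[of k]
        define J where "J = (LBINT y. (1 / cmod (\<theta> (Complex (S k) y))) ^ n * K y)"
        have J_int: "integrable lborel (\<lambda>y. (1 / cmod (\<theta> (Complex (S k) y))) ^ n * K y)"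
          by (rule inner_inverse_powers_tendsto(1)[OF \<theta> S(1) S0 K \<delta> K_low])
        have z1: "z + 1 \<noteq> 0" if "0 < Re z" for z :: complex
          using that by (auto simp: complex_eq_iff)
        have F_hol: "F holomorphic_on {z. 0 < Re z \<and> R \<le> cmod z}"
          unfolding F_def by (intro holomorphic_intros g_hol) (auto dest: z1)
        have G_hol: "G holomorphic_on T" if "\<And>z. z \<in> T \<Longrightarrow> 0 < Re z \<and> R \<le> cmod z \<and> Re z \<le> R" for T
          unfolding G_def using that w
          by (intro holomorphic_intros holomorphic_on_subset[OF F_hol]) force+
        have z1_le: "1 \<le> cmod (z + 1)" if "0 < Re z" for z
          using complex_Re_le_cmod[of "z + 1"] that by simp
        have G_le1: "cmod (G z) \<le> 1 / e" if "0 < Re z" "cmod (g z) \<le> 1" "0 < e" "e \<le> cmod (z - of_real w)" for z e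
        proof -
          have "cmod (F z) \<le> 1 / 1"
            unfolding F_def norm_divide norm_power using that z1_le[of z] by (intro frac_le power_le_one) auto
          then show ?thesis unfolding G_def norm_divide using that by (intro frac_le) auto
        qed
        have total: "2 * pi * (cmod (g (of_real w)) ^ n / (w + 1)) \<le>
            2 * R / (w - R) + 2 + J + (2 * B ^ n / X + 2 * B ^ n / (X - w))" if X: "w < X" for X
        proof -
          have X0: "0 < X" "R < X" using X w w0 by auto
          have right: "hedge G R X (- X) + \<i> * vedge G X (- X) X - hedge G R X X - \<i> * vedge G R (- X) X =
              2 * pi * \<i> * F (of_real w)"
            unfolding G_def using R X w
            by (intro rectangle_cauchy_formula holomorphic_on_subset[OF F_hol]) (auto intro!: side_le)
          have top: "hedge G (S k) R R + \<i> * vedge G R R X - hedge G (S k) R X - \<i> * vedge G (S k) R X = 0"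
            using Sk X0 by (intro rectangle_cauchy_theorem G_hol) (auto intro!: side_le)
          have bot: "hedge G (S k) R (- X) + \<i> * vedge G R (- X) (- R) - hedge G (S k) R (- R) - \<i> * vedge G (S k) (- X) (- R) = 0"
            using Sk X0 by (intro rectangle_cauchy_theorem G_hol) (auto intro!: side_le)
          have contR: "continuous_on ((\<lambda>y. Complex R y) ` {- X..X}) G"
            using R by (intro holomorphic_on_imp_continuous_on G_hol) (auto intro!: side_le)
          have "vedge G R (- X) X = vedge G R (- X) (- R) + vedge G R (- R) X"
            using R X0 by (intro vedge_combine contR) auto
          also have "vedge G R (- R) X = vedge G R (- R) R + vedge G R R X"
            using R X0 by (intro vedge_combine continuous_on_subset[OF contR]) auto
          finally have comb: "vedge G R (- X) X = vedge G R (- X) (- R) + (vedge G R (- R) R + vedge G R R X)" .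
          define E where "E = (hedge G R X (- X) + hedge G (S k) R (- X)) - (hedge G R X X + hedge G (S k) R X) + \<i> * vedge G X (- X) X"
          define I where "I = hedge G (S k) R R - hedge G (S k) R (- R) - \<i> * vedge G R (- R) R"
          define V where "V = \<i> * (vedge G (S k) R X + vedge G (S k) (- X) (- R))"
          have "2 * pi * \<i> * F (of_real w) = E + I - V"
            unfolding right[symmetric] comb E_def I_def V_def using top bot by (simp add: algebra_simps)
          then have "cmod (2 * pi * \<i> * F (of_real w)) \<le> cmod E + cmod I + cmod V"
            using norm_triangle_ineq4[of "E + I" V] norm_triangle_ineq[of E I] by simp
          moreover have "cmod (2 * pi * \<i> * F (of_real w)) = 2 * pi * (cmod (g (of_real w)) ^ n / (w + 1))"
          proof -
            have "cmod (complex_of_real w + 1) = w + 1"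
              using w0 by (metis norm_of_real of_real_1 of_real_add abs_of_pos add_pos_pos zero_less_one)
            then show ?thesis by (simp add: F_def norm_mult norm_divide norm_power)
          qed
          moreover have "cmod I \<le> 2 + 2 * R / (w - R)"
          proof -
            have h: "cmod (hedge G (S k) R y) \<le> 1" if y: "\<bar>y\<bar> = R" for y
            proof -
              have "cmod (hedge G (S k) R y) \<le> (1 / R) * (R - S k)"
              proof (rule hedge_le)
                fix x assume x: "S k \<le> x" "x \<le> R"
                show "cmod (G (Complex x y)) \<le> 1 / R"
                  using Sk x y R abs_Im_le_cmod[of "Complex x y - of_real w"] by (intro G_le1 g_le1) auto
              qed (use Sk in simp)
              also have "\<dots> \<le> 1" using R Sk by (simp add: field_simps)
              finally show ?thesis .
            qed
            have "cmod (vedge G R (- R) R) \<le> (1 / (w - R)) * (R - (- R))"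
            proof (rule vedge_le)
              fix y assume y: "- R \<le> y" "y \<le> R"
              show "cmod (G (Complex R y)) \<le> 1 / (w - R)"
                using R y w abs_Re_le_cmod[of "Complex R y - of_real w"] by (intro G_le1 g_le1) auto
            qed (use R in simp)
            then have "cmod (vedge G R (- R) R) \<le> 2 * R / (w - R)" by simp
            moreover have "cmod I \<le> (cmod (hedge G (S k) R R) + cmod (hedge G (S k) R (- R))) + cmod (\<i> * vedge G R (- R) R)"
              unfolding I_def by (rule order_trans[OF norm_triangle_ineq4 add_right_mono[OF norm_triangle_ineq4]])
            moreover have "cmod (\<i> * vedge G R (- R) R) = cmod (vedge G R (- R) R)"
              by (simp add: norm_mult)
            ultimately show ?thesis using h[of R] h[of "- R"] R by simp
          qed
          moreover have "cmod E \<le> 2 * B ^ n / X + 2 * B ^ n / (X - w)"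
          proof -
            have GB: "cmod (G z) \<le> B ^ n / (e1 * e2)"
              if "0 < Re z" "R \<le> cmod z" "0 < e1" "0 < e2" "e1 \<le> cmod (z + 1)" "e2 \<le> cmod (z - of_real w)" for z e1 e2
            proof -
              have "e1 * e2 \<le> cmod (z + 1) * cmod (z - of_real w)"
                by (rule mult_mono) (use that(3-6) in simp_all)
              moreover have "cmod (g z) ^ n \<le> B ^ n"
                by (rule power_mono[OF g_leB[OF that(1,2)]]) simp
              moreover have "0 \<le> B ^ n" "0 < e1 * e2" using B that(3,4) by simp_all
              ultimately show ?thesis
                unfolding G_def F_def divide_divide_eq_left norm_divide norm_power norm_mult by (intro frac_le)
            qed
            have hX: "cmod (hedge G x1 x2 y) \<le> B ^ n / (X * X) * (x2 - x1)" if "0 < x1" "x1 \<le> x2" "\<bar>y\<bar> = X" for x1 x2 y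
            proof (rule hedge_le)
              fix x assume x: "x1 \<le> x" "x \<le> x2"
              show "cmod (G (Complex x y)) \<le> B ^ n / (X * X)"
                using x that X0 abs_Im_le_cmod[of "Complex x y - of_real w"] abs_Im_le_cmod[of "Complex x y + 1"]
                by (intro GB side_le) auto
            qed (use that in simp)
            have pair: "cmod (hedge G R X y + hedge G (S k) R y) \<le> B ^ n / X" if y: "\<bar>y\<bar> = X" for y
            proof -
              have "cmod (hedge G R X y + hedge G (S k) R y) \<le> B ^ n / (X * X) * (X - R) + B ^ n / (X * X) * (R - S k)"
                using hX[of R X y] hX[of "S k" R y] R Sk X0 y by (intro norm_triangle_le add_mono) auto
              also have "\<dots> = B ^ n / (X * X) * (X - S k)" unfolding distrib_left[symmetric] by simp
              also have "\<dots> \<le> B ^ n / (X * X) * X"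
                using Sk B X0 by (intro mult_left_mono divide_nonneg_nonneg) auto
              also have "\<dots> = B ^ n / X" using X0 by simp
              finally show ?thesis .
            qed
            have "cmod (vedge G X (- X) X) \<le> B ^ n / (X * (X - w)) * (X - (- X))"
            proof (rule vedge_le)
              fix y assume y: "- X \<le> y" "y \<le> X"
              show "cmod (G (Complex X y)) \<le> B ^ n / (X * (X - w))"
                using y X0 X abs_Re_le_cmod[of "Complex X y - of_real w"] abs_Re_le_cmod[of "Complex X y + 1"]
                by (intro GB side_le) auto
            qed (use X0 in simp)
            also have "\<dots> = 2 * B ^ n / (X - w)"
            proof -
              have "B ^ n / (X * (X - w)) * (X - (- X)) = X * (2 * B ^ n) / (X * (X - w))" by simp
              also have "\<dots> = 2 * B ^ n / (X - w)" using X0 by (intro nonzero_mult_divide_mult_cancel_left) simp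
              finally show ?thesis .
            qed
            finally have v: "cmod (vedge G X (- X) X) \<le> 2 * B ^ n / (X - w)" .
            have "cmod E \<le> (cmod (hedge G R X (- X) + hedge G (S k) R (- X)) + cmod (hedge G R X X + hedge G (S k) R X)) + cmod (\<i> * vedge G X (- X) X)"
              unfolding E_def by (rule order_trans[OF norm_triangle_ineq add_right_mono[OF norm_triangle_ineq4]])
            moreover have "cmod (\<i> * vedge G X (- X) X) = cmod (vedge G X (- X) X)"
              by (simp add: norm_mult)
            ultimately show ?thesis using pair[of X] pair[of "- X"] X0 v by simp
          qed
          moreover have "cmod V \<le> J"
          proof -
            have GK: "cmod (G (Complex (S k) y)) \<le> (1 / cmod (\<theta> (Complex (S k) y))) ^ n * K y" if y: "R \<le> \<bar>y\<bar>" for y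
            proof -
              define z where "z = Complex (S k) y"
              have "cmod (g z) \<le> 1 / cmod (\<theta> z)" using Sk y by (intro g_le side_le) (auto simp: z_def)
              moreover have "cmod (Complex 1 y) \<le> cmod (z + 1)"
                using Sk by (intro cmod_mono) (auto simp: z_def)
              moreover have "cmod (Complex (w - R) (- y)) \<le> cmod (z - of_real w)"
                using Sk w by (intro cmod_mono) (auto simp: z_def)
              moreover have "0 < cmod (Complex 1 y)" "0 < cmod (Complex (w - R) (- y))"
                using w by (auto simp: complex_eq_iff)
              ultimately have "cmod (Complex 1 y) * cmod (Complex (w - R) (- y)) \<le> cmod (z + 1) * cmod (z - of_real w)"
                and "cmod (g z) ^ n \<le> (1 / cmod (\<theta> z)) ^ n"
                and "0 < cmod (Complex 1 y) * cmod (Complex (w - R) (- y))"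
                by (intro mult_mono power_mono mult_pos_pos; simp)+
              moreover have "0 \<le> (1 / cmod (\<theta> z)) ^ n" by simp
              ultimately have "cmod (G z) \<le> (1 / cmod (\<theta> z)) ^ n / (cmod (Complex 1 y) * cmod (Complex (w - R) (- y)))"
                unfolding G_def F_def divide_divide_eq_left norm_divide norm_power norm_mult by (intro frac_le)
              moreover have "d y = 1 / (cmod (Complex 1 y) * cmod (Complex (w - R) (- y)))"
              proof -
                have "Complex 0 y - (-1) = Complex 1 y" by (simp add: complex_eq_iff)
                moreover have "Complex 0 y - of_real (w - R) = - Complex (w - R) (- y)" by (simp add: complex_eq_iff)
                ultimately show ?thesis
                  unfolding d_def on_line_def by (simp only: norm_divide norm_one norm_minus_cancel times_divide_times_eq mult_1)
              qed
              ultimately show ?thesis using y by (simp add: K_def z_def)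
            qed
            have "cmod (vedge G (S k) R X) \<le> (LBINT y. indicator {R..X} y * ((1 / cmod (\<theta> (Complex (S k) y))) ^ n * K y))"
              using GK R K(2) by (intro vedge_le_integral J_int) auto
            moreover have "cmod (vedge G (S k) (- X) (- R)) \<le>
                (LBINT y. indicator {- X..- R} y * ((1 / cmod (\<theta> (Complex (S k) y))) ^ n * K y))"
              using GK R K(2) by (intro vedge_le_integral J_int) auto
            ultimately have "cmod V \<le> (LBINT y. indicator {R..X} y * ((1 / cmod (\<theta> (Complex (S k) y))) ^ n * K y)) +
                (LBINT y. indicator {- X..- R} y * ((1 / cmod (\<theta> (Complex (S k) y))) ^ n * K y))"
              unfolding V_def norm_mult by (simp add: norm_triangle_le)
            also have "\<dots> = (LBINT y. indicator {R..X} y * ((1 / cmod (\<theta> (Complex (S k) y))) ^ n * K y) +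
                indicator {- X..- R} y * ((1 / cmod (\<theta> (Complex (S k) y))) ^ n * K y))"
              using integrable_mult_indicator[OF _ J_int, of "{R..X}"] integrable_mult_indicator[OF _ J_int, of "{- X..- R}"]
              by (intro Bochner_Integration.integral_add[symmetric]) auto
            also have "\<dots> \<le> J"
              unfolding J_def
            proof (rule Bochner_Integration.integral_mono'[OF J_int])
              fix y
              have "0 \<le> (1 / cmod (\<theta> (Complex (S k) y))) ^ n * K y" using K(2)[of y] by simp
              then show "indicator {R..X} y * ((1 / cmod (\<theta> (Complex (S k) y))) ^ n * K y) +
                indicator {- X..- R} y * ((1 / cmod (\<theta> (Complex (S k) y))) ^ n * K y) \<le> (1 / cmod (\<theta> (Complex (S k) y))) ^ n * K y"
                using R by (auto simp: indicator_def)
            qed (use K(2) in simp)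
            finally show ?thesis .
          qed
          ultimately show ?thesis by linarith
        qed
        have lim: "((\<lambda>X. 2 * R / (w - R) + 2 + J + (2 * B ^ n / X + 2 * B ^ n / (X - w))) \<longlongrightarrow> 2 * R / (w - R) + 2 + J + (0 + 0)) at_top"
        proof (intro tendsto_intros)
          show "((\<lambda>X. 2 * B ^ n / X) \<longlongrightarrow> 0) at_top"
            by (intro tendsto_divide_0[OF tendsto_const] filterlim_at_top_imp_at_infinity filterlim_ident)
          have "filterlim (\<lambda>X. X - w) at_top at_top"
            using filterlim_tendsto_add_at_top[OF tendsto_const[of "- w"] filterlim_ident] by simp
          then show "((\<lambda>X. 2 * B ^ n / (X - w)) \<longlongrightarrow> 0) at_top"
            by (intro tendsto_divide_0[OF tendsto_const] filterlim_at_top_imp_at_infinity)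
        qed
        have "2 * pi * (cmod (g (of_real w)) ^ n / (w + 1)) \<le> 2 * R / (w - R) + 2 + J + (0 + 0)"
          by (rule tendsto_lowerbound[OF lim eventually_mono[OF eventually_gt_at_top[of w] total]]) simp_all
        then show ?thesis by (simp add: J_def)
      qed
      have "(\<lambda>k. 2 * R / (w - R) + 2 + (LBINT y. (1 / cmod (\<theta> (Complex (S k) y))) ^ n * K y)) \<longlonglongrightarrow>
          2 * R / (w - R) + 2 + integral\<^sup>L lborel K"
        by (intro tendsto_intros inner_inverse_powers_tendsto(2)[OF \<theta> S(1) S0 K \<delta> K_low])
      then have "2 * pi * (cmod (g (of_real w)) ^ n / (w + 1)) \<le> 2 * R / (w - R) + 2 + integral\<^sup>L lborel K"
        by (rule LIMSEQ_le_const) (use le in blast)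
      then show ?thesis using w0 by (simp add: field_simps)
    qed
    then have g1: "cmod (g (of_real w)) \<le> 1" by (rule le_one_if_powers_bounded)
    have "exp (- (A * p (of_real w))) \<le> cmod (\<theta> (of_real w))"
      using g1 \<theta>0[of "of_real w"] w w0 by (subst (asm) cmod_g) auto
    moreover have "1 - A * p (of_real w) \<le> exp (- (A * p (of_real w)))"
      using exp_ge_add_one_self[of "- (A * p (of_real w))"] by simp
    moreover have "A * p (of_real w) \<le> A * (4 / (R * w))"
    proof (rule mult_left_mono[OF _ A(1)])
      have "4 * w / (R * w\<^sup>2) = 4 / (R * w)" using w0 by (simp add: power2_eq_square)
      moreover have "0 \<le> w\<^sup>2 / (w\<^sup>2)\<^sup>2" by simp
      ultimately show "p (of_real w) \<le> 4 / (R * w)" by (simp add: p_def)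
    qed
    ultimately have "1 - cmod (\<theta> (of_real w)) \<le> A * (4 / (R * w))" by linarith
    then have "(1 - cmod (\<theta> (of_real w))) * w \<le> A * (4 / (R * w)) * w"
      using w0 by (intro mult_right_mono) auto
    also have "\<dots> = A * (4 / R)" using w0 by simp
    finally show ?thesis .
  qed
  define L where "L = A * (4 / R) + R"
  have "(1 - cmod (\<theta> (of_real w))) * w \<le> L" if w: "0 < w" for w
  proof (cases "R < w")
    case True
    then show ?thesis using main[OF True] R by (simp add: L_def)
  next
    case False
    have "(1 - cmod (\<theta> (of_real w))) * w \<le> 1 * w"
      using w by (intro mult_right_mono) auto
    also have "\<dots> \<le> L" using False A R by (simp add: L_def add_increasing)
    finally show ?thesis .
  qed
  moreover have "0 < L" using A R by (simp add: L_def add_nonneg_pos)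
  ultimately show ?thesis by blast
qed

section \<open>Restricting the test to the spectral range\<close>

lemma eventually_gt_if_Liminf_nonzero:
  fixes f :: "'a \<Rightarrow> complex"
  assumes "Liminf F (\<lambda>z. ereal (cmod (f z))) \<noteq> 0"
  shows "\<exists>\<delta>>0. eventually (\<lambda>z. \<delta> < cmod (f z)) F"
proof -
  have "0 \<le> Liminf F (\<lambda>z. ereal (cmod (f z)))"
    by (rule Liminf_bounded) simp
  with assms have "0 < Liminf F (\<lambda>z. ereal (cmod (f z)))" by (simp add: less_le)
  then obtain \<delta> where \<delta>: "0 < ereal \<delta>" "ereal \<delta> < Liminf F (\<lambda>z. ereal (cmod (f z)))"
    using ereal_dense2 by blast
  from less_LiminfD[OF \<delta>(2)] \<delta>(1) show ?thesis by auto
qed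

lemma lower_bound_off_spectrum:
  assumes \<theta>: "inner_function \<theta>" and \<zeta>: "\<zeta> \<in> closure Cplus" "\<zeta> \<notin> finite_spectrum \<theta>"
  shows "\<exists>r>0. \<exists>\<delta>>0. \<forall>z. 0 < Re z \<longrightarrow> dist z \<zeta> < r \<longrightarrow> \<delta> \<le> cmod (\<theta> z)"
proof -
  have "Liminf (at \<zeta> within Cplus) (\<lambda>z. ereal (cmod (\<theta> z))) \<noteq> 0"
    using \<zeta> by (simp add: finite_spectrum_def)
  then obtain \<delta> where \<delta>: "0 < \<delta>" and ev: "\<forall>\<^sub>F z in at \<zeta> within Cplus. \<delta> < cmod (\<theta> z)"
    using eventually_gt_if_Liminf_nonzero by blast
  then obtain r where r: "0 < r" "\<And>z. z \<in> Cplus \<Longrightarrow> z \<noteq> \<zeta> \<Longrightarrow> dist z \<zeta> < r \<Longrightarrow> \<delta> < cmod (\<theta> z)"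
    unfolding eventually_at by blast
  \<comment> \<open>the limit inferior ignores the value at \<open>\<zeta>\<close> itself, which matters for interior points and follows by continuity\<close>
  have "\<delta> \<le> cmod (\<theta> \<zeta>)" if "0 < Re \<zeta>"
  proof (rule tendsto_lowerbound)
    have "isCont \<theta> \<zeta>"
      using holomorphic_on_imp_continuous_on[OF inner_functionD(1)[OF \<theta>]] open_Cplus that
      by (simp add: continuous_on_eq_continuous_at)
    then show "((\<lambda>z. cmod (\<theta> z)) \<longlongrightarrow> cmod (\<theta> \<zeta>)) (at \<zeta> within Cplus)"
      by (intro tendsto_norm) (auto simp: isCont_def intro: tendsto_mono[OF at_le[OF subset_UNIV]])
    show "\<forall>\<^sub>F z in at \<zeta> within Cplus. \<delta> \<le> cmod (\<theta> z)"
      using ev by eventually_elim simp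
    show "at \<zeta> within Cplus \<noteq> bot"
      using at_within_open[of \<zeta> Cplus] open_Cplus that by simp
  qed
  then have "\<delta> \<le> cmod (\<theta> z)" if "0 < Re z" "dist z \<zeta> < r" for z
    using r(2)[of z] that by (cases "z = \<zeta>") (auto intro: less_imp_le)
  with r(1) \<delta> show ?thesis by blast
qed

lemma lower_bound_at_infinity:
  assumes "\<not> infinity_in_spectrum \<theta>"
  shows "\<exists>R>0. \<exists>\<delta>>0. \<forall>z. 0 < Re z \<longrightarrow> R \<le> cmod z \<longrightarrow> \<delta> \<le> cmod (\<theta> z)"
proof -
  obtain \<delta> where \<delta>: "0 < \<delta>" and ev: "\<forall>\<^sub>F z in inf at_infinity (principal Cplus). \<delta> < cmod (\<theta> z)"
    using assms eventually_gt_if_Liminf_nonzero unfolding infinity_in_spectrum_def by blast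
  then obtain b where b: "\<And>z. b \<le> cmod z \<Longrightarrow> z \<in> Cplus \<Longrightarrow> \<delta> < cmod (\<theta> z)"
    unfolding eventually_inf_principal eventually_at_infinity by blast
  have "\<delta> \<le> cmod (\<theta> z)" if "0 < Re z" "max b 1 \<le> cmod z" for z
    using b[of z] that by simp
  moreover have "0 < max b 1" by simp
  ultimately show ?thesis using \<delta> by blast
qed

text \<open>By compactness of the closed half-plane with \<open>\<infinity>\<close>, an empty spectrum means that \<open>\<bar>\<theta>\<bar>\<close> is bounded below. Then
  \<open>1 / \<theta>\<close> is inner as well.\<close>

lemma unimodular_if_spectrum_empty:
  assumes \<theta>: "inner_function \<theta>" and fin: "finite_spectrum \<theta> = {}" and inf: "\<not> infinity_in_spectrum \<theta>"
    and s: "0 < Re s"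
  shows "cmod (\<theta> s) = 1"
proof -
  obtain R \<delta>0 where R: "0 < R" "0 < \<delta>0" "\<And>z. 0 < Re z \<Longrightarrow> R \<le> cmod z \<Longrightarrow> \<delta>0 \<le> cmod (\<theta> z)"
    using lower_bound_at_infinity[OF inf] by blast
  have "\<exists>\<delta>>0. \<forall>z. 0 < Re z \<longrightarrow> \<delta> \<le> cmod (\<theta> z)"
  proof (rule ccontr)
    assume neg: "\<not> ?thesis"
    have "\<forall>n. \<exists>z. 0 < Re z \<and> cmod (\<theta> z) < min \<delta>0 (inverse (real (Suc n)))"
    proof
      fix n
      have "0 < min \<delta>0 (inverse (real (Suc n)))" using R(2) by simp
      then show "\<exists>z. 0 < Re z \<and> cmod (\<theta> z) < min \<delta>0 (inverse (real (Suc n)))"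
        using neg not_le by blast
    qed
    then obtain z where z: "\<And>n. 0 < Re (z n)" "\<And>n. cmod (\<theta> (z n)) < min \<delta>0 (inverse (real (Suc n)))"
      by metis
    have "compact (closure Cplus \<inter> cball 0 R)" by (intro closed_Int_compact) auto
    moreover have "z n \<in> closure Cplus \<inter> cball 0 R" for n
    proof -
      have "cmod (z n) < R"
        using R(3)[OF z(1)[of n]] z(2)[of n] by (meson min_less_iff_conj not_le)
      then show ?thesis using z(1)[of n] closure_subset[of Cplus] by auto
    qed
    ultimately obtain \<zeta> q where \<zeta>: "\<zeta> \<in> closure Cplus" and q: "strict_mono q" "(z \<circ> q) \<longlonglongrightarrow> \<zeta>"
      unfolding compact_def by blast
    obtain r \<delta> where r: "0 < r" "0 < \<delta>" "\<And>z. 0 < Re z \<Longrightarrow> dist z \<zeta> < r \<Longrightarrow> \<delta> \<le> cmod (\<theta> z)"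
      using lower_bound_off_spectrum[OF \<theta> \<zeta>] fin by blast
    have "\<forall>\<^sub>F n in sequentially. dist ((z \<circ> q) n) \<zeta> < r"
      using q(2) r(1) by (rule tendstoD)
    moreover have "\<forall>\<^sub>F n in sequentially. inverse (real (Suc n)) < \<delta>"
      using LIMSEQ_inverse_real_of_nat r(2) by (rule order_tendstoD)
    ultimately have "\<forall>\<^sub>F n in sequentially. False"
    proof eventually_elim
      case (elim n)
      have "inverse (real (Suc (q n))) \<le> inverse (real (Suc n))"
        using seq_suble[OF q(1), of n] by (intro le_imp_inverse_le) auto
      moreover have "\<delta> \<le> cmod (\<theta> (z (q n)))"
        using elim(1) z(1) by (intro r(3)) simp_all
      moreover have "cmod (\<theta> (z (q n))) < inverse (real (Suc (q n)))"
        using z(2)[of "q n"] by (simp only: min_less_iff_conj)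
      ultimately show ?case
        using elim(2) by linarith
    qed
    then show False by simp
  qed
  then obtain \<delta> where \<delta>: "0 < \<delta>" "\<And>z. 0 < Re z \<Longrightarrow> \<delta> \<le> cmod (\<theta> z)" by blast
  have ne: "\<theta> z \<noteq> 0" if "0 < Re z" for z using \<delta>(2)[OF that] \<delta>(1) by auto
  have "inner_function (\<lambda>z. 1 / \<theta> z)"
    unfolding inner_function_def
  proof (intro conjI)
    show "(\<lambda>z. 1 / \<theta> z) holomorphic_on Cplus"
      by (intro holomorphic_intros inner_functionD(1)[OF \<theta>]) (simp add: ne)
    have "cmod (1 / \<theta> z) \<le> 1 / \<delta>" if "0 < Re z" for z
      using \<delta>(2)[OF that] \<delta>(1) by (simp add: norm_divide frac_le)
    then show "bounded ((\<lambda>z. 1 / \<theta> z) ` Cplus)"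
      unfolding bounded_iff by (intro exI[of _ "1 / \<delta>"]) auto
    have "AE y in lborel. \<exists>\<zeta>. ((\<lambda>x. \<theta> (Complex x y)) \<longlongrightarrow> \<zeta>) (at_right 0) \<and> cmod \<zeta> = 1"
      using \<theta> by (simp add: inner_function_def)
    then show "AE y in lborel. \<exists>\<zeta>. ((\<lambda>x. 1 / \<theta> (Complex x y)) \<longlongrightarrow> \<zeta>) (at_right 0) \<and> cmod \<zeta> = 1"
    proof eventually_elim
      fix y assume "\<exists>\<zeta>. ((\<lambda>x. \<theta> (Complex x y)) \<longlongrightarrow> \<zeta>) (at_right 0) \<and> cmod \<zeta> = 1"
      then obtain \<zeta> where \<zeta>: "((\<lambda>x. \<theta> (Complex x y)) \<longlongrightarrow> \<zeta>) (at_right 0)" "cmod \<zeta> = 1" by blast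
      have "((\<lambda>x. 1 / \<theta> (Complex x y)) \<longlongrightarrow> 1 / \<zeta>) (at_right 0)"
        using \<zeta> by (intro tendsto_intros) auto
      then show "\<exists>\<zeta>. ((\<lambda>x. 1 / \<theta> (Complex x y)) \<longlongrightarrow> \<zeta>) (at_right 0) \<and> cmod \<zeta> = 1"
        using \<zeta>(2) by (intro exI[of _ "1 / \<zeta>"]) (simp add: norm_divide)
    qed
  qed
  from inner_function_le_one[OF this s] have "1 \<le> cmod (\<theta> s)"
    using ne[OF s] by (simp add: norm_divide divide_le_eq_1)
  with inner_function_le_one[OF \<theta> s] show ?thesis by simp
qed

context laplace_measure
begin

text \<open>The right-hand side is \<open>c / 0 = \<infinity>\<close>.\<close>

lemma poisson_test_unimodular: "0 < c \<Longrightarrow> cmod (\<theta> (of_real w)) = 1 \<Longrightarrow> poisson_test \<theta> c w"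
  by (simp add: poisson_test_def ennreal_divide_zero top.extremum)

lemma poisson_test_mono: "poisson_test \<theta> c w \<Longrightarrow> c \<le> c' \<Longrightarrow> poisson_test \<theta> c' w"
  unfolding poisson_test_def by (erule order_trans) (intro divide_right_mono_ennreal ennreal_leI)

text \<open>Passing from \<open>v\<close> to \<open>w\<close> multiplies the Poisson integral by at most \<open>M\<close>, and \<open>1 - \<bar>\<theta> w\<bar>\<close> is small enough to
  compensate for \<open>M\<close>.\<close>

lemma poisson_test_transfer:
  assumes test: "poisson_test \<theta> c v" and c: "0 < c" and v: "0 < v" "cmod (\<theta> (of_real v)) < 1"
    and w: "0 < w" "cmod (\<theta> (of_real w)) \<le> 1" and M: "0 \<le> M" and L: "0 < L"
    and kernel: "\<And>s. 0 < s \<Longrightarrow> w / (w + s)\<^sup>2 \<le> M * (v / (v + s)\<^sup>2)"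
    and defect: "M * (1 - cmod (\<theta> (of_real w))) \<le> L"
  shows "poisson_test \<theta> (L * c / (1 - cmod (\<theta> (of_real v)))) w"
proof -
  define e where "e = 1 - cmod (\<theta> (of_real v))"
  have e: "0 < e" using v by (simp add: e_def)
  show ?thesis
  proof (cases "cmod (\<theta> (of_real w)) = 1")
    case True
    then show ?thesis using L c e by (intro poisson_test_unimodular) (auto simp: e_def)
  next
    case False
    define x where "x = 1 - cmod (\<theta> (of_real w))"
    have x: "0 < x" using w False by (simp add: x_def)
    have "(\<integral>\<^sup>+s. ennreal (w / (w + s)\<^sup>2) \<partial>m) \<le> (\<integral>\<^sup>+s. ennreal M * ennreal (v / (v + s)\<^sup>2) \<partial>m)"
    proof (intro nn_integral_mono_AE eventually_mono[OF pos])
      fix s :: real assume "0 < s"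
      then have "ennreal (w / (w + s)\<^sup>2) \<le> ennreal (M * (v / (v + s)\<^sup>2))"
        by (intro ennreal_leI kernel)
      then show "ennreal (w / (w + s)\<^sup>2) \<le> ennreal M * ennreal (v / (v + s)\<^sup>2)"
        using ennreal_mult[OF M, of "v / (v + s)\<^sup>2"] v by simp
    qed
    also have "\<dots> = ennreal M * (\<integral>\<^sup>+s. ennreal (v / (v + s)\<^sup>2) \<partial>m)"
      by (rule nn_integral_cmult) measurable
    also have "\<dots> \<le> ennreal M * (ennreal c / ennreal e)"
      using test by (intro mult_left_mono) (auto simp: poisson_test_def e_def)
    also have "\<dots> = ennreal (M * (c / e))"
      using ennreal_mult[OF M, of "c / e"] c e by (simp add: divide_ennreal)
    also have "\<dots> \<le> ennreal ((L * c / e) / x)"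
    proof (rule ennreal_leI)
      have "M \<le> L / x" using defect x by (simp add: x_def pos_le_divide_eq)
      then have "M * (c / e) \<le> L / x * (c / e)" using c e by (intro mult_right_mono) auto
      then show "M * (c / e) \<le> (L * c / e) / x" by (simp add: mult_ac)
    qed
    also have "\<dots> = ennreal (L * c / e) / ennreal x"
      using L c e x by (intro divide_ennreal[symmetric]) auto
    finally show ?thesis by (simp only: poisson_test_def e_def x_def)
  qed
qed

text \<open>The test at the single point \<open>v\<close> implies it at all points outside the range \<open>P\<close> with a common constant.\<close>

lemma poisson_test_everywhere:
  assumes \<theta>: "inner_function \<theta>" and c: "0 < c" and v: "0 < v" "poisson_test \<theta> c v" and L: "0 < L"
    and in_range: "\<And>w. 0 < w \<Longrightarrow> P w \<Longrightarrow> poisson_test \<theta> c w"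
    and transfer: "\<And>w. 0 < w \<Longrightarrow> \<not> P w \<Longrightarrow> \<exists>M\<ge>0. (\<forall>s>0. w / (w + s)\<^sup>2 \<le> M * (v / (v + s)\<^sup>2)) \<and>
        M * (1 - cmod (\<theta> (of_real w))) \<le> L"
  shows "\<exists>c>0. \<forall>w>0. poisson_test \<theta> c w"
proof (cases "cmod (\<theta> (of_real v)) = 1")
  case True
  have "poisson_test \<theta> 1 w" if "0 < w" for w
    by (rule poisson_test_unimodular) (auto intro: reproducing_kernels_vanish(1)[OF \<theta> v(1) True that])
  then show ?thesis by (intro exI[of _ 1]) auto
next
  case False
  have le1: "cmod (\<theta> (of_real w)) \<le> 1" if "0 < w" for w
    using that by (intro inner_function_le_one[OF \<theta>]) simp
  have lt: "cmod (\<theta> (of_real v)) < 1" using le1[OF v(1)] False by simp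
  define c' where "c' = max c (L * c / (1 - cmod (\<theta> (of_real v))))"
  have "poisson_test \<theta> c' w" if w: "0 < w" for w
  proof (cases "P w")
    case True
    then show ?thesis
      using in_range[OF w] by (rule_tac poisson_test_mono[of \<theta> c]) (auto simp: c'_def)
  next
    case False
    then obtain M where M: "0 \<le> M" "\<forall>s>0. w / (w + s)\<^sup>2 \<le> M * (v / (v + s)\<^sup>2)"
        "M * (1 - cmod (\<theta> (of_real w))) \<le> L"
      using transfer[OF w] by blast
    have "poisson_test \<theta> (L * c / (1 - cmod (\<theta> (of_real v)))) w"
      using M(2) by (intro poisson_test_transfer[OF v(2) c v(1) lt w le1[OF w] M(1) L _ M(3)]) blast
    then show ?thesis
      unfolding c'_def by (rule poisson_test_mono) (rule max.cobounded2)
  qed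
  moreover have "0 < c'" using c by (simp add: c'_def less_max_iff_disj)
  ultimately show ?thesis by blast
qed

text \<open>Transfer from \<open>v = 1\<close> with \<open>M = 1 / w\<close>, against \<open>1 - \<bar>\<theta> w\<bar> \<le> L * w\<close>.\<close>

lemma poisson_test_away_from_zero:
  assumes \<theta>: "inner_function \<theta>" and z: "0 \<notin> finite_spectrum \<theta>" and c: "0 < c"
    and test: "\<And>w. 1 \<le> w \<Longrightarrow> poisson_test \<theta> c w"
  shows "\<exists>c>0. \<forall>w>0. poisson_test \<theta> c w"
proof -
  have "0 \<in> closure Cplus"
  proof -
    have "(\<lambda>n. complex_of_real (inverse (real (Suc n)))) \<longlonglongrightarrow> of_real 0"
      by (intro tendsto_of_real LIMSEQ_inverse_real_of_nat)
    then show ?thesis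
      unfolding closure_sequential by (intro exI[of _ "\<lambda>n. complex_of_real (inverse (real (Suc n)))"]) auto
  qed
  from lower_bound_off_spectrum[OF \<theta> this z]
  obtain r \<delta> where "0 < r" "0 < \<delta>" "\<And>z. 0 < Re z \<Longrightarrow> cmod z < r \<Longrightarrow> \<delta> \<le> cmod (\<theta> z)" by auto
  from inner_defect_linear_at_zero[OF \<theta> this]
  obtain L where L: "0 < L" "\<And>w. 0 < w \<Longrightarrow> 1 - cmod (\<theta> (of_real w)) \<le> L * w" by blast
  show ?thesis
  proof (rule poisson_test_everywhere[OF \<theta> c _ _ L(1), where v = 1 and P = "\<lambda>w. 1 \<le> w"])
    fix w :: real assume w: "0 < w" "\<not> 1 \<le> w"
    have "w / (w + s)\<^sup>2 \<le> 1 / w * (1 / (1 + s)\<^sup>2)" if s: "0 < s" for s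
    proof -
      have "w * (1 + s) \<le> w + s" using w s by (simp add: distrib_left mult_left_le_one_le)
      then have "(w * (1 + s))\<^sup>2 \<le> (w + s)\<^sup>2" using w s by (intro power_mono) auto
      moreover have "0 < (w * (1 + s))\<^sup>2" using w s by (intro zero_less_power mult_pos_pos) auto
      ultimately have "w / (w + s)\<^sup>2 \<le> w / (w * (1 + s))\<^sup>2" using w by (intro frac_le) auto
      also have "\<dots> = 1 / w * (1 / (1 + s)\<^sup>2)" using w by (simp add: power_mult_distrib power2_eq_square)
      finally show ?thesis .
    qed
    moreover have "1 / w * (1 - cmod (\<theta> (of_real w))) \<le> L"
      using L(2)[OF w(1)] w by (simp add: pos_divide_le_eq)
    ultimately show "\<exists>M\<ge>0. (\<forall>s>0. w / (w + s)\<^sup>2 \<le> M * (1 / (1 + s)\<^sup>2)) \<and> M * (1 - cmod (\<theta> (of_real w))) \<le> L"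
      using w by (intro exI[of _ "1 / w"]) auto
  qed (use test in auto)
qed

text \<open>Transfer from \<open>v\<close> with \<open>M = w / v\<close>, against \<open>1 - \<bar>\<theta> w\<bar> \<le> L / w\<close>.\<close>

lemma poisson_test_away_from_infinity:
  assumes \<theta>: "inner_function \<theta>" and inf: "\<not> infinity_in_spectrum \<theta>" and c: "0 < c" and v: "0 < v"
    and test: "\<And>w. 0 < w \<Longrightarrow> w \<le> v \<Longrightarrow> poisson_test \<theta> c w"
  shows "\<exists>c>0. \<forall>w>0. poisson_test \<theta> c w"
proof -
  obtain R \<delta> where "0 < R" "0 < \<delta>" "\<And>z. 0 < Re z \<Longrightarrow> R \<le> cmod z \<Longrightarrow> \<delta> \<le> cmod (\<theta> z)"
    using lower_bound_at_infinity[OF inf] by blast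
  from inner_defect_at_infinity[OF \<theta> this]
  obtain L where L: "0 < L" "\<And>w. 0 < w \<Longrightarrow> (1 - cmod (\<theta> (of_real w))) * w \<le> L" by blast
  have Lv: "0 < L / v" using L v by simp
  show ?thesis
  proof (rule poisson_test_everywhere[OF \<theta> c v _ Lv, where P = "\<lambda>w. w \<le> v"])
    fix w assume w: "0 < w" "\<not> w \<le> v"
    have "w / (w + s)\<^sup>2 \<le> w / v * (v / (v + s)\<^sup>2)" if s: "0 < s" for s
    proof -
      have "(v + s)\<^sup>2 \<le> (w + s)\<^sup>2" using w v s by (intro power_mono) auto
      moreover have "0 < (v + s)\<^sup>2" using v s by (intro zero_less_power) auto
      ultimately have "w / (w + s)\<^sup>2 \<le> w / (v + s)\<^sup>2" using w by (intro frac_le) auto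
      then show ?thesis using v by simp
    qed
    moreover have "w / v * (1 - cmod (\<theta> (of_real w))) \<le> L / v"
      using divide_right_mono[OF L(2)[OF w(1)], of v] v by (simp add: mult.commute)
    ultimately show "\<exists>M\<ge>0. (\<forall>s>0. w / (w + s)\<^sup>2 \<le> M * (v / (v + s)\<^sup>2)) \<and> M * (1 - cmod (\<theta> (of_real w))) \<le> L / v"
      using w v by (intro exI[of _ "w / v"]) auto
  qed (use test v in auto)
qed

end

lemma laplace_measure_distr:
  assumes sets: "sets \<mu> = sets (restrict_space borel {0<..})" and h: "is_laplace_of_measure h \<mu>"
  shows "laplace_measure (distr \<mu> borel (\<lambda>s. s)) h"
    and "0 < w \<Longrightarrow> test_condition \<mu> \<theta> c w \<longleftrightarrow> laplace_measure.poisson_test (distr \<mu> borel (\<lambda>s. s)) \<theta> c w"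
proof -
  have id [measurable]: "(\<lambda>s. s) \<in> measurable \<mu> borel"
    unfolding measurable_cong_sets[OF sets refl] by (intro measurable_restrict_space1) simp
  have space: "space \<mu> = {0<..}"
    using sets_eq_imp_space_eq[OF sets] by (simp add: space_restrict_space)
  show lm: "laplace_measure (distr \<mu> borel (\<lambda>s. s)) h"
  proof
    show "AE s in distr \<mu> borel (\<lambda>s. s). 0 < s"
      by (subst AE_distr_iff) (auto intro!: AE_I2 simp: space)
    show "has_bochner_integral (distr \<mu> borel (\<lambda>s. s)) (\<lambda>s. exp (- (s * t))) (h t)" if "0 < t" for t
    proof (rule has_bochner_integral_distr[OF _ id])
      show "has_bochner_integral \<mu> (\<lambda>s. exp (- (s * t))) (h t)"
        using h that by (simp add: is_laplace_of_measure_def)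
    qed measurable
  qed simp
  show "test_condition \<mu> \<theta> c w \<longleftrightarrow> laplace_measure.poisson_test (distr \<mu> borel (\<lambda>s. s)) \<theta> c w" if "0 < w"
    unfolding test_condition_def laplace_measure.poisson_test_def[OF lm]
    by (simp add: nn_integral_distr)
qed

theorem theorem4p4:
  fixes \<mu> :: "real measure" and h :: "real \<Rightarrow> real" and \<theta> :: "complex \<Rightarrow> complex"
    and K :: "(real \<Rightarrow> complex) set"
  assumes "sets \<mu> = sets (restrict_space borel {0<..})"
    and "is_laplace_of_measure h \<mu>"
    and "inner_function \<theta>"
    and "K = inverse_laplace_image (model_space \<theta>)"
  shows "(truncated_hankel_bounded h K \<longleftrightarrow> (\<exists>c>0. \<forall>w>0. test_condition \<mu> \<theta> c w)) \<and>
    (0 \<notin> finite_spectrum \<theta> \<longrightarrow>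
      (truncated_hankel_bounded h K \<longleftrightarrow>
        (\<exists>c>0. \<forall>w>0. min ((INF z\<in>finite_spectrum \<theta>. ereal (dist 0 z)) / 2) 1 \<le> ereal w \<longrightarrow>
           test_condition \<mu> \<theta> c w))) \<and>
    (\<not> infinity_in_spectrum \<theta> \<and> finite_spectrum \<theta> \<noteq> {0} \<longrightarrow>
      (truncated_hankel_bounded h K \<longleftrightarrow>
        (\<exists>c>0. \<forall>w>0. ereal w \<le> 2 * (SUP z\<in>finite_spectrum \<theta>. ereal (cmod z)) \<longrightarrow>
           test_condition \<mu> \<theta> c w)))"
proof -
  define m where "m = distr \<mu> borel (\<lambda>s. s)"
  interpret laplace_measure m h
    unfolding m_def by (rule laplace_measure_distr(1)[OF assms(1,2)])
  have test_iff: "test_condition \<mu> \<theta> c w \<longleftrightarrow> poisson_test \<theta> c w" if "0 < w" for c w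
    using laplace_measure_distr(2)[OF assms(1,2) that] by (simp add: m_def)
  have bounded_iff: "truncated_hankel_bounded h K \<longleftrightarrow> (\<exists>c>0. \<forall>w>0. test_condition \<mu> \<theta> c w)"
    unfolding assms(4) inverse_laplace_image_model_space[OF assms(3)] truncated_hankel_bounded_iff[OF assms(3)]
    using test_iff by auto
  have zero: "(\<exists>c>0. \<forall>w>0. test_condition \<mu> \<theta> c w) \<longleftrightarrow>
      (\<exists>c>0. \<forall>w>0. min ((INF z\<in>finite_spectrum \<theta>. ereal (dist 0 z)) / 2) 1 \<le> ereal w \<longrightarrow> test_condition \<mu> \<theta> c w)"
    if z: "0 \<notin> finite_spectrum \<theta>"
  proof
    assume "\<exists>c>0. \<forall>w>0. min ((INF z\<in>finite_spectrum \<theta>. ereal (dist 0 z)) / 2) 1 \<le> ereal w \<longrightarrow> test_condition \<mu> \<theta> c w"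
    then obtain c where c: "0 < c"
      "\<And>w. 0 < w \<Longrightarrow> min ((INF z\<in>finite_spectrum \<theta>. ereal (dist 0 z)) / 2) 1 \<le> ereal w \<Longrightarrow> test_condition \<mu> \<theta> c w"
      by blast
    \<comment> \<open>whatever the spectrum, the prescribed range contains \<open>w \<ge> 1\<close>\<close>
    have "poisson_test \<theta> c w" if w: "1 \<le> w" for w
      using c(2)[of w] w test_iff[of w c] by (simp add: min.coboundedI2)
    from poisson_test_away_from_zero[OF assms(3) z c(1) this]
    show "\<exists>c>0. \<forall>w>0. test_condition \<mu> \<theta> c w" using test_iff by auto
  qed blast
  have infinity: "(\<exists>c>0. \<forall>w>0. test_condition \<mu> \<theta> c w) \<longleftrightarrow>
      (\<exists>c>0. \<forall>w>0. ereal w \<le> 2 * (SUP z\<in>finite_spectrum \<theta>. ereal (cmod z)) \<longrightarrow> test_condition \<mu> \<theta> c w)"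
    if inf: "\<not> infinity_in_spectrum \<theta>" and ne0: "finite_spectrum \<theta> \<noteq> {0}"
  proof
    assume "\<exists>c>0. \<forall>w>0. ereal w \<le> 2 * (SUP z\<in>finite_spectrum \<theta>. ereal (cmod z)) \<longrightarrow> test_condition \<mu> \<theta> c w"
    then obtain c where c: "0 < c"
      "\<And>w. 0 < w \<Longrightarrow> ereal w \<le> 2 * (SUP z\<in>finite_spectrum \<theta>. ereal (cmod z)) \<Longrightarrow> test_condition \<mu> \<theta> c w"
      by blast
    show "\<exists>c>0. \<forall>w>0. test_condition \<mu> \<theta> c w"
    proof (cases "finite_spectrum \<theta> = {}")
      case True
      have "test_condition \<mu> \<theta> 1 w" if "0 < w" for w
        unfolding test_iff[OF that] using that
        by (intro poisson_test_unimodular unimodular_if_spectrum_empty[OF assms(3) True inf]) auto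
      then show ?thesis by (intro exI[of _ 1]) auto
    next
      case False
      \<comment> \<open>a nonzero spectral point \<open>z\<close> puts the interval \<open>(0, \<bar>z\<bar>]\<close> into the prescribed range\<close>
      with ne0 obtain z where z: "z \<in> finite_spectrum \<theta>" "z \<noteq> 0" by blast
      define X where "X = (SUP z\<in>finite_spectrum \<theta>. ereal (cmod z))"
      have zX: "ereal (cmod z) \<le> X" unfolding X_def using z(1) by (rule SUP_upper)
      have "X \<le> 2 * X"
      proof (cases X)
        case (real r)
        with zX have "0 \<le> r" by (auto intro: order_trans[OF norm_ge_zero])
        with real show ?thesis by simp
      qed (use zX in auto)
      have "poisson_test \<theta> c w" if w: "0 < w" "w \<le> cmod z" for w
      proof -
        have "ereal w \<le> ereal (cmod z)" using w by simp
        also note zX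
        also note \<open>X \<le> 2 * X\<close>
        finally show ?thesis using c(2)[OF w(1)] test_iff[OF w(1)] by (simp add: X_def)
      qed
      then have "\<exists>c>0. \<forall>w>0. poisson_test \<theta> c w"
        using z(2) by (intro poisson_test_away_from_infinity[OF assms(3) inf c(1), of "cmod z"]) simp_all
      then show ?thesis using test_iff by auto
    qed
  qed blast
  show ?thesis using bounded_iff zero infinity by blast
qed

end
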